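(* Let $N,a>0$, and for $h\in(0,1)$ put $\Omega_h=\sqrt{1-h^2}$ and $$\varphi_{0,h}(z)=\frac{1}{\sqrt{\pi h}}e^{-\frac{|z|^2}{2h}},\qquad \varphi_{1,h}(z)=\frac{1}{\sqrt{\pi h}}\frac{z}{\sqrt h}e^{-\frac{|z|^2}{2h}}.$$ Set $\kappa_\infty=\frac{5}{32}$ and $\kappa_0=\frac12$. Consider the problem of minimizing $E_h$ over $\{u\in\mathcal{E}_h:M(u)=1\}$. (i) If $h>\sqrt{\kappa_0\frac{Na\Omega_h^2}{4\pi}}$, then $\varphi_{0,h}$ is the unique global minimizer, up to phase and space rotations. This bound is optimal, in the sense that $\varphi_{0,h}$ is not a local minimizer when $h<\sqrt{\kappa_0\frac{Na\Omega_h^2}{4\pi}}$. Moreover $E_h(\varphi_{0,h})=\frac{Na\Omega_h^2}{4\pi h}+h$. (ii) If $h<\sqrt{\kappa_\infty\frac{Na\Omega_h^2}{4\pi}}$, then any minimizer (local or global) has infinitely many zeros in $\mathbb{C}$. (iii) There exists $\kappa_1\in(\kappa_\infty,\kappa_0)$ such that, for any $h\in(0,1)$ satisfying $$\sqrt{\kappa_1\frac{Na\Omega_h^2}{4\pi}}<h<\sqrt{\kappa_0\frac{Na\Omega_h^2}{4\pi}},$$ the function $\varphi_{1,h}$ is the unique global minimizer, up to phase and space rotations. Moreover $E_h(\varphi_{1,h})=\frac{Na\Omega_h^2}{8\pi h}+2h$.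
   Context: $L$ denotes Lebesgue measure on $\mathbb{C}$. For $h\in(0,1)$, $\mathcal{E}_h=\{u(z)=e^{-\frac{|z|^2}{2h}}f(z): f\text{ entire holomorphic on }\mathbb{C}\}\cap L^2(\mathbb{C})$, $E_h(u)=\int_{\mathbb{C}}\left(|z|^2|u(z)|^2+\frac{Na\Omega_h^2}{2}|u(z)|^4\right)dL(z)$ (possibly $+\infty$), and $M(u)=\int_{\mathbb{C}}|u|^2\,dL$. A global minimizer is a $u\in\mathcal{E}_h$ with $M(u)=1$ and $E_h(u)\le E_h(v)$ for all $v\in\mathcal{E}_h$ with $M(v)=1$. A local minimizer is a $u\in\mathcal{E}_h$ with $\int(1+|z|^2)|u|^2\,dL<\infty$ and $M(u)=1$ for which there is $\delta>0$ such that $E_h(u)\le E_h(v)$ for all $v\in\mathcal{E}_h$ with $M(v)=1$ and $\int_{\mathbb{C}}(1+|z|^2)|u-v|^2\,dL<\delta^2$. Phase rotations are the maps $u(z)\mapsto e^{i\gamma}u(z)$, $\gamma\in\mathbb{R}$; space rotations are the maps $u(z)\mapsto u(e^{i\theta}z)$, $\theta\in\mathbb{R}$. *)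

theory Defs
  imports "HOL-Complex_Analysis.Complex_Analysis"
begin

definition L2 :: "(complex \<Rightarrow> complex) set" where
  "L2 = {u. u \<in> borel_measurable lborel \<and> integrable lborel (\<lambda>z. (cmod (u z))\<^sup>2)}"

text \<open>Elements are genuine functions, not classes modulo null sets; as they are continuous,
  this makes no difference.\<close>

definition LLL_space :: "real \<Rightarrow> (complex \<Rightarrow> complex) set" where
  "LLL_space h =
     {u. \<exists>f. f holomorphic_on UNIV \<and>
             u = (\<lambda>z. of_real (exp (- (cmod z)\<^sup>2 / (2 * h))) * f z)} \<inter> L2"

definition Omega :: "real \<Rightarrow> real" where
  "Omega h = sqrt (1 - h\<^sup>2)"

text \<open>Mass, energy and squared weighted norm are extended nonnegative integrals, because the
  energy and the weighted norm may be infinite on the space above (a Bochner integral would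
  then be 0).  For \<open>0 < h < 1\<close> and \<open>N, a > 0\<close> the integrand of the energy is nonnegative,
  so \<^const>\<open>ennreal\<close> does not truncate.\<close>

definition mass :: "(complex \<Rightarrow> complex) \<Rightarrow> ennreal" where
  "mass u = (\<integral>\<^sup>+ z. ennreal ((cmod (u z))\<^sup>2) \<partial>lborel)"

definition energy :: "real \<Rightarrow> real \<Rightarrow> real \<Rightarrow> (complex \<Rightarrow> complex) \<Rightarrow> ennreal" where
  "energy N a h u =
     (\<integral>\<^sup>+ z. ennreal ((cmod z)\<^sup>2 * (cmod (u z))\<^sup>2 + N * a * (Omega h)\<^sup>2 / 2 * (cmod (u z)) ^ 4)
        \<partial>lborel)"

definition weighted_norm_sq :: "(complex \<Rightarrow> complex) \<Rightarrow> ennreal" where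
  "weighted_norm_sq u = (\<integral>\<^sup>+ z. ennreal ((1 + (cmod z)\<^sup>2) * (cmod (u z))\<^sup>2) \<partial>lborel)"

definition global_minimizer :: "real \<Rightarrow> real \<Rightarrow> real \<Rightarrow> (complex \<Rightarrow> complex) \<Rightarrow> bool" where
  "global_minimizer N a h u \<longleftrightarrow>
     u \<in> LLL_space h \<and> mass u = 1 \<and>
     (\<forall>v\<in>LLL_space h. mass v = 1 \<longrightarrow> energy N a h u \<le> energy N a h v)"

definition local_minimizer :: "real \<Rightarrow> real \<Rightarrow> real \<Rightarrow> (complex \<Rightarrow> complex) \<Rightarrow> bool" where
  "local_minimizer N a h u \<longleftrightarrow>
     u \<in> LLL_space h \<and> weighted_norm_sq u < \<infinity> \<and> mass u = 1 \<and>
     (\<exists>\<delta>>0. \<forall>v\<in>LLL_space h.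
        mass v = 1 \<and> weighted_norm_sq (\<lambda>z. u z - v z) < ennreal (\<delta>\<^sup>2) \<longrightarrow>
        energy N a h u \<le> energy N a h v)"

definition rotation_equivalent :: "(complex \<Rightarrow> complex) \<Rightarrow> (complex \<Rightarrow> complex) \<Rightarrow> bool" where
  "rotation_equivalent u w \<longleftrightarrow>
     (\<exists>\<gamma> \<theta> :: real. \<forall>z. u z = exp (\<i> * of_real \<gamma>) * w (exp (\<i> * of_real \<theta>) * z))"

definition unique_global_minimizer ::
    "real \<Rightarrow> real \<Rightarrow> real \<Rightarrow> (complex \<Rightarrow> complex) \<Rightarrow> bool" where
  "unique_global_minimizer N a h w \<longleftrightarrow>
     global_minimizer N a h w \<and>
     (\<forall>u. global_minimizer N a h u \<longrightarrow> rotation_equivalent u w)"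

definition phi0 :: "real \<Rightarrow> complex \<Rightarrow> complex" where
  "phi0 h z = of_real (1 / sqrt (pi * h)) * of_real (exp (- (cmod z)\<^sup>2 / (2 * h)))"

definition phi1 :: "real \<Rightarrow> complex \<Rightarrow> complex" where
  "phi1 h z = of_real (1 / sqrt (pi * h)) * (z / of_real (sqrt h)) *
     of_real (exp (- (cmod z)\<^sup>2 / (2 * h)))"

definition kappa_inf :: real where "kappa_inf = 5 / 32"

definition kappa_0 :: real where "kappa_0 = 1 / 2"

end

theory Submission
  imports Defs "HOL-Probability.Probability" "HOL-Real_Asymp.Real_Asymp"
    "HOL-Computational_Algebra.Fundamental_Theorem_Algebra"
begin

text \<open>In the orthonormal basis of normalized monomials a state of mass \<open>1\<close> becomes a unit vector \<open>c\<close>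
  of \<open>\<ell>\<^sup>2\<close>, and its energy is \<open>h (1 + P c + \<tau> Q c)\<close> with \<open>\<tau> = N a \<Omega>\<^sub>h\<^sup>2 / (4 \<pi> h\<^sup>2)\<close>, where \<open>P\<close> is the
  number operator and \<open>Q\<close> the squared norm of the Cauchy product with binomial weights.  The
  thresholds are \<open>\<tau> = 2\<close> and \<open>\<tau> = 32 / 5\<close>.

  The central inequality is \<open>P / 2 + Q \<ge> 1\<close>: for fixed \<open>z\<close>, the function \<open>w \<mapsto> f (z + w) f (z - w)\<close> is
  even, so its Taylor series has a gap at order \<open>1\<close>; integrating the resulting spectral gap over \<open>z\<close>
  gives the inequality.  It settles \<open>\<tau> < 2\<close>.  Equality forces
  \<open>f (z + w) f (z - w) = f z\<^sup>2 + g z w\<^sup>2\<close>, hence \<open>f z = \<gamma> exp (\<beta> z)\<close> or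
  \<open>f z = \<gamma> (z - \<zeta>) exp (\<beta> z)\<close>.  With the Hessian at \<open>\<phi>\<^sub>1\<close> and a compactness argument this yields
  \<open>P - 1 \<le> K (P / 2 + Q - 1)\<close> for some \<open>K\<close>, which makes \<open>\<phi>\<^sub>1\<close> optimal for \<open>\<tau>\<close> slightly above \<open>2\<close>.

  If a local minimizer has finitely many zeros, Hadamard's argument gives
  \<open>f z = p z exp (\<alpha> z\<^sup>2 / 2 + \<beta> z)\<close> with a polynomial \<open>p\<close>.  Bootstrapping the decay of \<open>c\<close> through the
  Euler-Lagrange equation yields \<open>\<alpha> = 0\<close>, comparing coefficients then leaves only monomials, and
  these are unstable for \<open>\<tau> > 32 / 5\<close>.\<close>

section \<open>Gaussian integrals of entire functions\<close>

text \<open>With \<open>defect\<close> = P / 2 + Q - 1 the energy satisfies P + \<tau> Q = \<tau> +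
  (1 - \<tau> / 2) P + \<tau> \<open>defect\<close>. At \<tau> = 2 the middle term drops out and the
  minimizers are exactly the zeros of \<open>defect\<close>: besides the ground state, a continuous
  family (z - \<zeta>) exp (\<beta> z) with centre of mass 0, along which P runs from 0 to 1 and
  which ends in \<phi>_1. This family is the obstacle above \<tau> = 2: even near \<phi>_1 no bound
  can control the distance to it by \<open>defect\<close>. What remains true is the one-sided
  estimate on P - 1, since P falls below 1 along the family; it is also what the energy identity
  asks for, because large P is now rewarded. Its constant comes from compactness, so the third
  threshold of the theorem is not explicit. The centre of mass appears because integrating the gap
  inequality produces the variance of the density rather than its second moment. The value 32 / 5 is
  where mode 5 destabilizes \<phi>_1; every other monomial is unstable before that.\<close>

lemma borel_measurable_Complex [measurable (raw)]:
  assumes "f \<in> borel_measurable M" "g \<in> borel_measurable M"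
  shows "(\<lambda>x. Complex (f x) (g x)) \<in> borel_measurable M"
  unfolding Complex_eq using assms by measurable

text \<open>\<open>lborel\<close> on a Euclidean space is pinned down by the volumes of boxes, and
  boxes in the plane are rectangles. The product form gives access to Tonelli in the real and
  imaginary parts.\<close>

lemma lborel_complex:
  "(lborel :: complex measure) = distr (lborel \<Otimes>\<^sub>M lborel) borel (\<lambda>(x, y). Complex x y)"
proof (rule lborel_eqI)
  fix l u :: complex
  assume lu: "\<And>b. b \<in> Basis \<Longrightarrow> l \<bullet> b \<le> u \<bullet> b"
  have "Re l \<le> Re u" "Im l \<le> Im u" using lu[of 1] lu[of \<i>] by (auto simp: Basis_complex_def)
  have *: "(\<lambda>(x, y). Complex x y) -` box l u \<inter> space (lborel \<Otimes>\<^sub>M lborel) = box (Re l) (Re u) \<times> box (Im l) (Im u)"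
    by (auto simp: box_def Basis_complex_def space_pair_measure)
  show "emeasure (distr (lborel \<Otimes>\<^sub>M lborel) borel (\<lambda>(x, y). Complex x y)) (box l u) = ennreal (\<Prod>b\<in>Basis. (u - l) \<bullet> b)"
    using \<open>Re l \<le> Re u\<close> \<open>Im l \<le> Im u\<close>
    apply (subst emeasure_distr)
      apply (simp_all add: * lborel.emeasure_pair_measure_Times Basis_complex_def split_beta)
    by (simp add: ennreal_mult)
qed simp

lemma nn_integral_complex:
  fixes g :: "complex \<Rightarrow> ennreal"
  assumes [measurable]: "g \<in> borel_measurable borel"
  shows "(\<integral>\<^sup>+ z. g z \<partial>lborel) = (\<integral>\<^sup>+ x. \<integral>\<^sup>+ y. g (Complex x y) \<partial>lborel \<partial>lborel)"
  by (subst lborel_complex, subst nn_integral_distr)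
     (auto simp: lborel.nn_integral_fst[symmetric] split_beta)

lemma nn_integral_complex':
  fixes g :: "complex \<Rightarrow> ennreal"
  assumes [measurable]: "g \<in> borel_measurable borel"
  shows "(\<integral>\<^sup>+ z. g z \<partial>lborel) = (\<integral>\<^sup>+ y. \<integral>\<^sup>+ x. g (Complex x y) \<partial>lborel \<partial>lborel)"
proof -
  have "(\<integral>\<^sup>+ y. \<integral>\<^sup>+ x. g (Complex x y) \<partial>lborel \<partial>lborel) = (\<integral>\<^sup>+ x. \<integral>\<^sup>+ y. g (Complex x y) \<partial>lborel \<partial>lborel)"
    by (rule lborel_pair.Fubini') (simp add: split_beta)
  then show ?thesis by (simp add: nn_integral_complex)
qed

lemma nn_integral_translate:
  fixes g :: "'a::euclidean_space \<Rightarrow> ennreal"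
  assumes [measurable]: "g \<in> borel_measurable borel"
  shows "(\<integral>\<^sup>+ x. g (c + x) \<partial>lborel) = (\<integral>\<^sup>+ x. g x \<partial>lborel)"
  by (subst (2) lborel_distr_plus[of c, symmetric]) (simp add: nn_integral_distr)

text \<open>On each horizontal line a shear is a translation by a constant, so invariance of the
  inner integral suffices.\<close>

lemma nn_integral_shear1:
  fixes g :: "complex \<Rightarrow> ennreal"
  assumes [measurable]: "g \<in> borel_measurable borel"
  shows "(\<integral>\<^sup>+ z. g (Complex (a * Im z + Re z) (Im z)) \<partial>lborel) = (\<integral>\<^sup>+ z. g z \<partial>lborel)"
  by (simp add: nn_integral_complex' nn_integral_translate[where g = "\<lambda>x. g (Complex x _)"])

lemma nn_integral_shear2:
  fixes g :: "complex \<Rightarrow> ennreal"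
  assumes [measurable]: "g \<in> borel_measurable borel"
  shows "(\<integral>\<^sup>+ z. g (Complex (Re z) (b * Re z + Im z)) \<partial>lborel) = (\<integral>\<^sup>+ z. g z \<partial>lborel)"
  by (simp add: nn_integral_complex nn_integral_translate[where g = "\<lambda>x. g (Complex _ x)"])

text \<open>A rotation is a product of three shears.\<close>

lemma nn_integral_rotate:
  fixes g :: "complex \<Rightarrow> ennreal"
  assumes [measurable]: "g \<in> borel_measurable borel" and t: "- pi < t" "t < pi"
  shows "(\<integral>\<^sup>+ z. g (cis t * z) \<partial>lborel) = (\<integral>\<^sup>+ z. g z \<partial>lborel)"
proof -
  \<comment> \<open>The two horizontal shears use \<open>- tan (t / 2)\<close> and the vertical one
    between them uses \<open>sin t\<close>; the bounds on \<open>t\<close> keep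
    \<open>cos (t / 2)\<close> away from 0.\<close>
  define a where "a = - tan (t / 2)"
  have c: "cos (t/2) \<noteq> 0" using t cos_gt_zero_pi[of "t/2"] by auto
  have s: "sin t = 2 * sin (t/2) * cos (t/2)" using sin_double[of "t/2"] by simp
  have cc: "cos t = 1 - 2 * (sin (t/2))\<^sup>2" using cos_double_sin[of "t/2"] by simp
  have e1: "1 + a * sin t = cos t" unfolding a_def tan_def s cc using c by (simp add: field_simps power2_eq_square)
  have e2: "a * (1 + cos t) = - sin t" 
  proof -
    have "1 + cos t = 2 * (cos (t/2))\<^sup>2" using cos_double_cos[of "t/2"] by simp
    then show ?thesis unfolding a_def tan_def s using c by (simp add: field_simps power2_eq_square)
  qed
  define g1 where "g1 z = g (Complex (a * Im z + Re z) (Im z))" for z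
  define g2 where "g2 z = g1 (Complex (Re z) (sin t * Re z + Im z))" for z
  define g3 where "g3 z = g2 (Complex (a * Im z + Re z) (Im z))" for z
  have [measurable]: "g1 \<in> borel_measurable borel" unfolding g1_def by measurable
  have [measurable]: "g2 \<in> borel_measurable borel" unfolding g2_def by measurable
  have "g3 z = g (cis t * z)" for z
  proof -
    have "a * (sin t * (a * Im z + Re z) + Im z) + (a * Im z + Re z)
      = (1 + a * sin t) * Re z + a * (1 + (1 + a * sin t)) * Im z" by (simp add: algebra_simps)
    also have "\<dots> = cos t * Re z - sin t * Im z" unfolding e1 e2 by simp
    finally have 1: "a * (sin t * (a * Im z + Re z) + Im z) + (a * Im z + Re z) = cos t * Re z - sin t * Im z" .
    have "sin t * (a * Im z + Re z) + Im z = (1 + a * sin t) * Im z + sin t * Re z" by (simp add: algebra_simps)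
    then have 2: "sin t * (a * Im z + Re z) + Im z = cos t * Im z + sin t * Re z" unfolding e1 .
    have "Complex (cos t * Re z - sin t * Im z) (cos t * Im z + sin t * Re z) = cis t * z"
      by (simp add: complex_eq_iff)
    then show ?thesis unfolding g3_def g2_def g1_def using 1 2 by simp
  qed
  then have "(\<integral>\<^sup>+ z. g (cis t * z) \<partial>lborel) = (\<integral>\<^sup>+ z. g3 z \<partial>lborel)" by simp
  also have "\<dots> = (\<integral>\<^sup>+ z. g z \<partial>lborel)"
    unfolding g3_def by (subst nn_integral_shear1, simp, unfold g2_def, subst nn_integral_shear2, simp)
      (unfold g1_def, subst nn_integral_shear1, auto)
  finally show ?thesis .
qed

text \<open>The disc of squared radius \<open>b\<close> has area \<open>pi * b\<close>, which is
  linear in \<open>b\<close>; hence the squared modulus has constant density. This takes the place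
  of polar coordinates.\<close>

lemma distr_cmod_sq:
  "distr (lborel :: complex measure) borel (\<lambda>z. (cmod z)\<^sup>2) = density lborel (\<lambda>s. ennreal pi * indicator {0..} s)"
proof (rule measure_eqI_generator_eq[where E = "range atMost" and \<Omega> = UNIV and A = "\<lambda>n. {..real n}"])
  show "Int_stable (range (atMost :: real \<Rightarrow> real set))" by (auto simp: Int_stable_def)
  fix X :: "real set" assume "X \<in> range atMost"
  then obtain b where X: "X = {..b}" by auto
  have 1: "emeasure (distr (lborel :: complex measure) borel (\<lambda>z. (cmod z)\<^sup>2)) X = emeasure lborel {z. (cmod z)\<^sup>2 \<le> b}"
    unfolding X by (subst emeasure_distr) (auto simp: vimage_def)
  have 2: "emeasure (density lborel (\<lambda>s. ennreal pi * indicator {0..} s)) X = ennreal pi * emeasure lborel ({0..b})"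
  proof -
    have "emeasure (density lborel (\<lambda>s. ennreal pi * indicator {0..} s)) X = (\<integral>\<^sup>+ s. ennreal pi * indicator {0..b} s \<partial>lborel)"
      unfolding X by (subst emeasure_density) (auto intro!: nn_integral_cong simp: indicator_def)
    then show ?thesis by (simp add: nn_integral_cmult)
  qed
  show "emeasure (distr (lborel :: complex measure) borel (\<lambda>z. (cmod z)\<^sup>2)) X = emeasure (density lborel (\<lambda>s. ennreal pi * indicator {0..} s)) X"
  proof (cases "b \<ge> 0")
    case True
    have "{z. (cmod z)\<^sup>2 \<le> b} = cball 0 (sqrt b)"
      using True by (auto simp: real_le_rsqrt) (metis norm_ge_zero power_mono real_sqrt_pow2)
    then show ?thesis unfolding 1 2 using True
      by (simp add: emeasure_cball unit_ball_vol_2 ennreal_mult[symmetric])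
  next
    case False
    then have "{z. (cmod z)\<^sup>2 \<le> b} = {}" "{0..b} = {}" by (auto simp: not_le intro: less_le_trans)
    then show ?thesis unfolding 1 2 by simp
  qed
next
  show "(\<Union>n. {..real n}) = UNIV" using real_arch_simple by auto
  show "emeasure (distr (lborel :: complex measure) borel (\<lambda>z. (cmod z)\<^sup>2)) {..real n} \<noteq> \<infinity>" for n
  proof -
    have "{z. (cmod z)\<^sup>2 \<le> real n} = cball 0 (sqrt (real n))"
      by (auto simp: real_le_rsqrt) (metis norm_ge_zero of_nat_0_le_iff power_mono real_sqrt_pow2)
    then show ?thesis by (subst emeasure_distr) (auto simp: vimage_def emeasure_cball)
  qed
qed (auto simp: borel_eq_atMost)

lemma nn_integral_radial:
  fixes g :: "real \<Rightarrow> ennreal"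
  assumes [measurable]: "g \<in> borel_measurable borel"
  shows "(\<integral>\<^sup>+ z. g ((cmod z)\<^sup>2) \<partial>lborel) = ennreal pi * (\<integral>\<^sup>+ s. g s * indicator {0..} s \<partial>lborel)"
proof -
  have "(\<integral>\<^sup>+ z. g ((cmod z)\<^sup>2) \<partial>lborel) = (\<integral>\<^sup>+ s. g s \<partial>distr (lborel :: complex measure) borel (\<lambda>z. (cmod z)\<^sup>2))"
    by (simp add: nn_integral_distr)
  also have "\<dots> = (\<integral>\<^sup>+ s. ennreal pi * (g s * indicator {0..} s) \<partial>lborel)"
    unfolding distr_cmod_sq by (subst nn_integral_density) (auto simp: mult_ac)
  finally show ?thesis by (simp add: nn_integral_cmult)
qed

lemma nn_integral_gaussian_moment:
  assumes "t > 0"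
  shows "(\<integral>\<^sup>+ z. ennreal ((cmod z) ^ (2 * n) * exp (- t * (cmod z)\<^sup>2)) \<partial>lborel) = ennreal (pi * fact n / t ^ (n + 1))"
proof -
  have "(\<integral>\<^sup>+ z. ennreal ((cmod z) ^ (2 * n) * exp (- t * (cmod z)\<^sup>2)) \<partial>lborel)
     = ennreal pi * (\<integral>\<^sup>+ s. ennreal (s ^ n * exp (- t * s)) * indicator {0..} s \<partial>lborel)"
    by (subst nn_integral_radial[symmetric]) (auto simp: power_mult)
  also have "(\<integral>\<^sup>+ s. ennreal (s ^ n * exp (- t * s)) * indicator {0..} s \<partial>lborel) 
     = ennreal (1 / t) * (\<integral>\<^sup>+ s. ennreal ((s/t) ^ n * exp (- s)) * indicator {0..} s \<partial>lborel)"
    using assms by (subst nn_integral_real_affine[where c = "1/t" and t = 0])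
      (auto intro!: arg_cong2[where f = "(*)"] nn_integral_cong simp: indicator_def zero_le_divide_iff)
  also have "(\<integral>\<^sup>+ s. ennreal ((s/t) ^ n * exp (- s)) * indicator {0..} s \<partial>lborel)
     = (\<integral>\<^sup>+ s. ennreal (1 / t ^ n) * (ennreal (s ^ n * exp (- s)) * indicator {0..} s) \<partial>lborel)"
    using assms by (intro nn_integral_cong) (auto simp: indicator_def power_divide ennreal_mult[symmetric])
  also have "\<dots> = ennreal (1 / t ^ n) * ennreal (fact n)"
    by (simp add: nn_integral_cmult nn_intergal_power_times_exp_Ici)
  finally show ?thesis using assms by (simp add: ennreal_mult[symmetric] mult.assoc)
qed

section \<open>Parseval on circles and for Gaussian weights\<close>

lemma circle_orthogonality:
  fixes k :: int
  shows "((\<lambda>\<theta>. cis (of_int k * \<theta>)) has_integral (if k = 0 then 2 * pi else 0)) {-pi..pi}"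
proof (cases "k = 0")
  case False
  have "((\<lambda>\<theta>. cis (of_int k * \<theta>)) has_integral (cis (of_int k * pi) / (\<i> * of_int k) - cis (of_int k * (-pi)) / (\<i> * of_int k))) {-pi..pi}"
  proof (rule fundamental_theorem_of_calculus)
    fix x assume "x \<in> {-pi..pi}"
    show "((\<lambda>x. cis (real_of_int k * x) / (\<i> * of_int k)) has_vector_derivative cis (real_of_int k * x)) (at x within {- pi..pi})"
    proof -
      have "((\<lambda>z. exp (\<i> * of_int k * z) / (\<i> * of_int k)) has_field_derivative exp (\<i> * of_int k * of_real x)) (at (of_real x))"
        using False by (auto intro!: derivative_eq_intros)
      from has_vector_derivative_real_field[OF this] show ?thesis
        by (simp add: cis_conv_exp mult.assoc)
    qed
  qed auto
  moreover have "cis (of_int k * pi) = cis (of_int k * (-pi))"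
    using sin_npi_int[of k] by (simp add: complex_eq_iff mult.commute)
  ultimately show ?thesis using False by simp
qed (use has_integral_const_real[of "1::complex" "-pi" pi] in \<open>simp add: scaleR_conv_of_real\<close>)

lemma circle_parseval_poly:
  fixes b :: "nat \<Rightarrow> complex"
  shows "((\<lambda>\<theta>. (cmod (\<Sum>n<N. b n * cis (real n * \<theta>)))\<^sup>2) has_integral (2 * pi * (\<Sum>n<N. (cmod (b n))\<^sup>2))) {-pi..pi}"
proof -
  let ?s = "\<lambda>\<theta>. \<Sum>n<N. b n * cis (real n * \<theta>)"
  have "((\<lambda>\<theta>. \<Sum>m<N. \<Sum>n<N. (b m * cnj (b n)) * cis (of_int (int m - int n) * \<theta>)) has_integral
     (\<Sum>m<N. \<Sum>n<N. (b m * cnj (b n)) * (if int m - int n = 0 then 2 * pi else 0))) {-pi..pi}"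
    by (intro has_integral_sum has_integral_mult_right circle_orthogonality) auto
  also have "(\<lambda>\<theta>. \<Sum>m<N. \<Sum>n<N. (b m * cnj (b n)) * cis (of_int (int m - int n) * \<theta>)) = (\<lambda>\<theta>. of_real ((cmod (?s \<theta>))\<^sup>2))"
    unfolding complex_norm_square
    by (auto simp: fun_eq_iff sum_product cis_mult cis_cnj algebra_simps intro!: sum.cong)
  also have "(\<Sum>m<N. \<Sum>n<N. (b m * cnj (b n)) * (if int m - int n = 0 then 2 * pi else 0)) = of_real (2 * pi * (\<Sum>n<N. (cmod (b n))\<^sup>2))"
  proof -
    have "(\<Sum>n<N. (b m * cnj (b n)) * (if int m - int n = 0 then 2 * pi else 0)) = of_real (2 * pi * (cmod (b m))\<^sup>2)" if "m < N" for m
    proof -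
      have "(\<Sum>n<N. (b m * cnj (b n)) * (if int m - int n = 0 then 2 * pi else 0)) = (\<Sum>n<N. if n = m then (b m * cnj (b m)) * of_real (2 * pi) else 0)"
        by (intro sum.cong) auto
      then show ?thesis using that by (simp add: complex_norm_square[symmetric])
    qed
    then show ?thesis by (simp add: sum_distrib_left)
  qed
  finally have "((\<lambda>\<theta>. Re (of_real ((cmod (?s \<theta>))\<^sup>2))) has_integral Re (of_real (2 * pi * (\<Sum>n<N. (cmod (b n))\<^sup>2)))) {-pi..pi}"
    by (rule has_integral_Re)
  then show ?thesis by simp
qed

lemma circle_parseval:
  fixes a :: "nat \<Rightarrow> complex"
  assumes f: "\<And>z. (\<lambda>n. a n * z ^ n) sums f z"
  shows "(\<integral>\<^sup>+ \<theta>. ennreal ((cmod (f (cis \<theta> * z)))\<^sup>2) * indicator {-pi..pi} \<theta> \<partial>lborel)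
    = ennreal (2 * pi) * (\<Sum>n. ennreal ((cmod (a n))\<^sup>2 * cmod z ^ (2 * n)))"
proof -
  define b where "b n = a n * z ^ n" for n
  define s where "s N \<theta> = (\<Sum>n<N. b n * cis (real n * \<theta>))" for N \<theta>
  have sm: "summable (\<lambda>n. cmod (b n))"
  proof -
    \<comment> \<open>Convergence at a point of larger modulus gives absolute convergence at
      \<open>z\<close>, and thus the constant bound \<open>B\<close> for dominated
      convergence.\<close>
    have "summable (\<lambda>n. a n * of_real (cmod z + 1) ^ n)" using f sums_summable by blast
    from powser_insidea[OF this, of z] show ?thesis unfolding b_def by (simp add: norm_mult norm_power)
  qed
  have conv: "(\<lambda>N. s N \<theta>) \<longlonglongrightarrow> f (cis \<theta> * z)" for \<theta>
  proof -
    have "b n * cis (real n * \<theta>) = a n * (cis \<theta> * z) ^ n" for n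
      unfolding b_def by (simp add: power_mult_distrib Complex.DeMoivre)
    then show ?thesis using f[of "cis \<theta> * z"] unfolding s_def sums_def by simp
  qed
  have i: "((\<lambda>\<theta>. (cmod (s N \<theta>))\<^sup>2) has_integral (2 * pi * (\<Sum>n<N. (cmod (b n))\<^sup>2))) {-pi..pi}" for N
    unfolding s_def by (rule circle_parseval_poly)
  define B where "B = (\<Sum>n. cmod (b n))"
  have bd: "cmod (s N \<theta>) \<le> B" for N \<theta>
  proof -
    have "cmod (s N \<theta>) \<le> (\<Sum>n<N. cmod (b n))" unfolding s_def by (rule sum_norm_le) (simp add: norm_mult)
    also have "\<dots> \<le> B" unfolding B_def using sm by (rule sum_le_suminf) auto
    finally show ?thesis .
  qed
  have dc: "(\<lambda>\<theta>. (cmod (f (cis \<theta> * z)))\<^sup>2) integrable_on {-pi..pi}"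
    "(\<lambda>N. integral {-pi..pi} (\<lambda>\<theta>. (cmod (s N \<theta>))\<^sup>2)) \<longlonglongrightarrow> integral {-pi..pi} (\<lambda>\<theta>. (cmod (f (cis \<theta> * z)))\<^sup>2)"
  proof -
    have 1: "(\<lambda>\<theta>. (cmod (s N \<theta>))\<^sup>2) integrable_on {-pi..pi}" for N using i by blast
    have 2: "(\<lambda>_. B\<^sup>2) integrable_on {-pi..pi}" by (rule integrable_const_ivl)
    have 3: "norm ((cmod (s N \<theta>))\<^sup>2) \<le> B\<^sup>2" for N \<theta> using power_mono[OF bd norm_ge_zero] by simp
    have 4: "(\<lambda>N. (cmod (s N \<theta>))\<^sup>2) \<longlonglongrightarrow> (cmod (f (cis \<theta> * z)))\<^sup>2" for \<theta>
      by (intro tendsto_power tendsto_norm conv)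
    show "(\<lambda>\<theta>. (cmod (f (cis \<theta> * z)))\<^sup>2) integrable_on {-pi..pi}"
      by (rule dominated_convergence(1)[OF 1 2 3 4])
    show "(\<lambda>N. integral {-pi..pi} (\<lambda>\<theta>. (cmod (s N \<theta>))\<^sup>2)) \<longlonglongrightarrow> integral {-pi..pi} (\<lambda>\<theta>. (cmod (f (cis \<theta> * z)))\<^sup>2)"
      by (rule dominated_convergence(2)[OF 1 2 3 4])
  qed
  have sq: "summable (\<lambda>n. (cmod (b n))\<^sup>2)"
  proof (rule summable_comparison_test_ev[OF _ sm])
    have "\<forall>\<^sub>F n in sequentially. cmod (b n) < 1" using summable_LIMSEQ_zero[OF sm] by (rule order_tendstoD) simp
    then show "\<forall>\<^sub>F n in sequentially. norm ((cmod (b n))\<^sup>2) \<le> cmod (b n)"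
      by eventually_elim (simp add: power2_eq_square mult_left_le)
  qed
  have "(\<lambda>N. integral {-pi..pi} (\<lambda>\<theta>. (cmod (s N \<theta>))\<^sup>2)) \<longlonglongrightarrow> 2 * pi * (\<Sum>n. (cmod (b n))\<^sup>2)"
    unfolding integral_unique[OF i] by (intro tendsto_intros summable_LIMSEQ sq)
  then have "integral {-pi..pi} (\<lambda>\<theta>. (cmod (f (cis \<theta> * z)))\<^sup>2) = 2 * pi * (\<Sum>n. (cmod (b n))\<^sup>2)"
    using dc(2) LIMSEQ_unique by blast
  then have "((\<lambda>\<theta>. (cmod (f (cis \<theta> * z)))\<^sup>2) has_integral (2 * pi * (\<Sum>n. (cmod (b n))\<^sup>2))) {-pi..pi}"
    using dc(1) by (metis integrable_integral)
  from nn_integral_has_integral_lebesgue'[OF _ this]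
  have "(\<integral>\<^sup>+ \<theta>. ennreal ((cmod (f (cis \<theta> * z)))\<^sup>2) * indicator {-pi..pi} \<theta> \<partial>lborel) = ennreal (2 * pi * (\<Sum>n. (cmod (b n))\<^sup>2))"
    by simp
  also have "\<dots> = ennreal (2 * pi) * (\<Sum>n. ennreal ((cmod (b n))\<^sup>2))"
  proof -
    have "(\<Sum>n. ennreal ((cmod (b n))\<^sup>2)) = ennreal (\<Sum>n. (cmod (b n))\<^sup>2)"
      by (rule suminf_ennreal2[OF _ sq]) simp
    then show ?thesis by (simp add: ennreal_mult suminf_nonneg sq)
  qed
  also have "(\<lambda>n. ennreal ((cmod (b n))\<^sup>2)) = (\<lambda>n. ennreal ((cmod (a n))\<^sup>2 * cmod z ^ (2 * n)))"
    unfolding b_def norm_mult norm_power power_mult_distrib power_mult[symmetric] by (simp only: mult.commute)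
  finally show ?thesis .
qed

lemma power_series_entire:
  fixes a :: "nat \<Rightarrow> complex"
  assumes f: "\<And>z. (\<lambda>n. a n * z ^ n) sums f z"
  shows "f holomorphic_on UNIV"
proof -
  have "f holomorphic_on ball 0 r" for r
    by (rule power_series_holomorphic[where a = a]) (use f in simp)
  then have "f holomorphic_on (\<Union>r\<in>UNIV. ball 0 r)"
    by (subst holomorphic_on_UN_open) auto
  moreover have "(\<Union>r\<in>UNIV. ball (0::complex) r) = UNIV" using gt_ex by auto
  ultimately show ?thesis by simp
qed

text \<open>Orthogonality of the monomials is obtained by averaging over all rotations: Tonelli puts
  the angular integral inside, where \<open>circle_parseval\<close> applies, and the remaining
  radial integrals are Gaussian moments. Since everything is an \<open>ennreal\<close>, the identity
  also holds when both sides are infinite, and later it turns finite integrals into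
  summability.\<close>

theorem nn_integral_parseval:
  fixes a :: "nat \<Rightarrow> complex"
  assumes f: "\<And>z. (\<lambda>n. a n * z ^ n) sums f z" and t: "t > 0"
  shows "(\<integral>\<^sup>+ z. ennreal (cmod z ^ (2 * j) * (cmod (f z))\<^sup>2 * exp (- t * (cmod z)\<^sup>2)) \<partial>lborel)
    = (\<Sum>n. ennreal (pi * fact (n + j) / t ^ (n + j + 1) * (cmod (a n))\<^sup>2))"
proof -
  have "f holomorphic_on UNIV" by (rule power_series_entire[OF f])
  then have fc: "continuous_on UNIV f" by (rule holomorphic_on_imp_continuous_on)
  then have [measurable]: "f \<in> borel_measurable borel" by (rule borel_measurable_continuous_onI)
  let ?w = "\<lambda>z::complex. cmod z ^ (2 * j) * exp (- t * (cmod z)\<^sup>2)"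
  let ?F = "\<lambda>z. ennreal (?w z * (cmod (f z))\<^sup>2)"
  have [measurable]: "(\<lambda>\<theta>. cis \<theta>) \<in> borel_measurable borel"
    by (intro borel_measurable_continuous_onI continuous_intros)
  have "ennreal (2 * pi) * (\<integral>\<^sup>+ z. ?F z \<partial>lborel) = (\<integral>\<^sup>+ \<theta>. (\<integral>\<^sup>+ z. ?F z \<partial>lborel) * indicator {-pi..pi} \<theta> \<partial>lborel)"
    by (subst nn_integral_cmult) (auto simp: mult.commute)
  also have "\<dots> = (\<integral>\<^sup>+ \<theta>. (\<integral>\<^sup>+ z. ?F (cis \<theta> * z) * indicator {-pi..pi} \<theta> \<partial>lborel) \<partial>lborel)"
  proof (rule nn_integral_cong_AE)
    \<comment> \<open>\<open>nn_integral_rotate\<close> excludes the end points, which form a null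
      set.\<close>
    have "AE \<theta> in lborel. \<theta> \<noteq> pi \<and> \<theta> \<noteq> - pi" 
      using AE_lborel_singleton[of pi] AE_lborel_singleton[of "- pi"] by auto
    then show "AE \<theta> in lborel. (\<integral>\<^sup>+ z. ?F z \<partial>lborel) * indicator {-pi..pi} \<theta> = (\<integral>\<^sup>+ z. ?F (cis \<theta> * z) * indicator {-pi..pi} \<theta> \<partial>lborel)"
    proof eventually_elim
      case (elim \<theta>)
      show ?case
      proof (cases "\<theta> \<in> {-pi..pi}")
        case True
        then show ?thesis using nn_integral_rotate[of ?F \<theta>] elim by simp
      qed simp
    qed
  qed
  also have "\<dots> = (\<integral>\<^sup>+ z. (\<integral>\<^sup>+ \<theta>. ?F (cis \<theta> * z) * indicator {-pi..pi} \<theta> \<partial>lborel) \<partial>lborel)"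
    by (rule lborel_pair.Fubini') (simp add: split_beta)
  also have "\<dots> = (\<integral>\<^sup>+ z. ennreal (?w z) * (ennreal (2 * pi) * (\<Sum>n. ennreal ((cmod (a n))\<^sup>2 * cmod z ^ (2 * n)))) \<partial>lborel)"
    by (subst circle_parseval[OF f, symmetric], subst nn_integral_cmult[symmetric])
       (auto simp: norm_mult ennreal_mult mult.assoc)
  also have "\<dots> = (\<integral>\<^sup>+ z. ennreal (2 * pi) * (\<Sum>n. ennreal ((cmod (a n))\<^sup>2) * ennreal (cmod z ^ (2 * (n + j)) * exp (- t * (cmod z)\<^sup>2))) \<partial>lborel)"
  proof (rule nn_integral_cong)
    fix z :: complex
    have "ennreal ((cmod (a n))\<^sup>2) * ennreal (cmod z ^ (2 * (n + j)) * exp (- t * (cmod z)\<^sup>2))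
      = ennreal (?w z) * ennreal ((cmod (a n))\<^sup>2 * cmod z ^ (2 * n))" for n
      by (subst (1 2) ennreal_mult[symmetric]) (auto simp: power_add distrib_left)
    then show "ennreal (?w z) * (ennreal (2 * pi) * (\<Sum>n. ennreal ((cmod (a n))\<^sup>2 * cmod z ^ (2 * n))))
      = ennreal (2 * pi) * (\<Sum>n. ennreal ((cmod (a n))\<^sup>2) * ennreal (cmod z ^ (2 * (n + j)) * exp (- t * (cmod z)\<^sup>2)))"
      by (simp only: ennreal_suminf_cmult mult.left_commute)
  qed
  also have "\<dots> = ennreal (2 * pi) * (\<Sum>n. ennreal ((cmod (a n))\<^sup>2) * ennreal (pi * fact (n + j) / t ^ (n + j + 1)))"
    by (simp only: nn_integral_gaussian_moment[OF t, symmetric])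
       (simp add: nn_integral_cmult nn_integral_suminf)
  finally have "(\<integral>\<^sup>+ z. ?F z \<partial>lborel) = (\<Sum>n. ennreal ((cmod (a n))\<^sup>2) * ennreal (pi * fact (n + j) / t ^ (n + j + 1)))"
    by (subst (asm) ennreal_mult_cancel_left) auto
  also have "\<dots> = (\<Sum>n. ennreal (pi * fact (n + j) / t ^ (n + j + 1) * (cmod (a n))\<^sup>2))"
    using t by (subst ennreal_mult[symmetric]) (auto simp: mult.commute)
  finally show ?thesis by (simp add: mult_ac)
qed

section \<open>Coefficient sequences\<close>

definition l2 :: "(nat \<Rightarrow> complex) \<Rightarrow> bool" where
  "l2 c \<longleftrightarrow> summable (\<lambda>n. (cmod (c n))\<^sup>2)"

text \<open>The normalized monomial of degree \<open>n\<close> has second moment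
  \<open>h * (n + 1)\<close>, so this is finiteness of the potential energy; the weight
  \<open>n + 1\<close> instead of \<open>n\<close> includes the mass.\<close>

definition h1 :: "(nat \<Rightarrow> complex) \<Rightarrow> bool" where
  "h1 c \<longleftrightarrow> summable (\<lambda>n. real (n + 1) * (cmod (c n))\<^sup>2)"

definition msum :: "(nat \<Rightarrow> complex) \<Rightarrow> real" where
  "msum c = (\<Sum>n. (cmod (c n))\<^sup>2)"

definition psum :: "(nat \<Rightarrow> complex) \<Rightarrow> real" where
  "psum c = (\<Sum>n. real n * (cmod (c n))\<^sup>2)"

text \<open>The squares form the symmetric binomial distribution on \<open>0..k\<close>; that they
  sum to 1 is what makes \<open>bil\<close> bounded on \<open>l2\<close>.\<close>

definition wt :: "nat \<Rightarrow> nat \<Rightarrow> real" where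
  "wt k m = sqrt (real (k choose m) / 2 ^ k)"

definition bil :: "(nat \<Rightarrow> complex) \<Rightarrow> (nat \<Rightarrow> complex) \<Rightarrow> nat \<Rightarrow> complex" where
  "bil c d k = (\<Sum>m\<le>k. of_real (wt k m) * c m * d (k - m))"

definition qsum :: "(nat \<Rightarrow> complex) \<Rightarrow> real" where
  "qsum c = (\<Sum>k. (cmod (bil c c k))\<^sup>2)"

lemma wt_nonneg [simp]: "0 \<le> wt k m" by (simp add: wt_def)

lemma wt_sq: "(wt k m)\<^sup>2 = real (k choose m) / 2 ^ k"
  by (simp add: wt_def)

lemma sum_wt_sq: "(\<Sum>m\<le>k. (wt k m)\<^sup>2) = 1"
proof -
  have "(\<Sum>m\<le>k. real (k choose m)) = 2 ^ k"
    using choose_row_sum[of k] by (metis of_nat_numeral of_nat_power of_nat_sum)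
  then show ?thesis by (simp add: wt_sq sum_divide_distrib[symmetric])
qed

lemma wt_sym: "m \<le> k \<Longrightarrow> wt k (k - m) = wt k m"
  by (simp add: wt_def binomial_symmetric[symmetric])

lemma wt_le_1: "wt k m \<le> 1"
proof (cases "m \<le> k")
  case True
  have "(wt k m)\<^sup>2 \<le> (\<Sum>m\<le>k. (wt k m)\<^sup>2)" using True by (intro member_le_sum) auto
  then show ?thesis unfolding sum_wt_sq using abs_square_le_1[of "wt k m"] by simp
qed (simp add: wt_def binomial_eq_0)

lemma h1_imp_l2:
  assumes "h1 c"
  shows "l2 c"
  unfolding l2_def
proof (rule summable_comparison_test')
  show "summable (\<lambda>n. real (n + 1) * (cmod (c n))\<^sup>2)" using assms by (simp add: h1_def)
qed (simp add: distrib_right)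

lemma h1_summable_n:
  assumes "h1 c"
  shows "summable (\<lambda>n. real n * (cmod (c n))\<^sup>2)"
proof (rule summable_comparison_test')
  show "summable (\<lambda>n. real (n + 1) * (cmod (c n))\<^sup>2)" using assms by (simp add: h1_def)
qed (simp add: distrib_right)

lemma h1I: "l2 c \<Longrightarrow> summable (\<lambda>n. real n * (cmod (c n))\<^sup>2) \<Longrightarrow> h1 c"
  using summable_add[of "\<lambda>n. real n * (cmod (c n))\<^sup>2" "\<lambda>n. (cmod (c n))\<^sup>2"]
  unfolding h1_def l2_def by (simp add: distrib_right add.commute)

text \<open>Cauchy-Schwarz against the weights, whose squares sum to 1. The right side is a Cauchy
  product of two summable sequences, so summing over \<open>k\<close> gives a bound by the product
  of the masses.\<close>

lemma bil_sq_le: "(cmod (bil c d k))\<^sup>2 \<le> (\<Sum>m\<le>k. (cmod (c m))\<^sup>2 * (cmod (d (k - m)))\<^sup>2)"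
proof -
  have "cmod (bil c d k) \<le> (\<Sum>m\<le>k. wt k m * (cmod (c m) * cmod (d (k - m))))"
    unfolding bil_def by (rule sum_norm_le) (simp add: norm_mult)
  then have "(cmod (bil c d k))\<^sup>2 \<le> (\<Sum>m\<le>k. wt k m * (cmod (c m) * cmod (d (k - m))))\<^sup>2"
    by (rule power_mono) simp
  also have "\<dots> \<le> (\<Sum>m\<le>k. (wt k m)\<^sup>2) * (\<Sum>m\<le>k. (cmod (c m) * cmod (d (k - m)))\<^sup>2)"
    by (rule Cauchy_Schwarz_ineq_sum)
  finally show ?thesis by (simp add: sum_wt_sq power_mult_distrib)
qed

lemma
  assumes "l2 c" "l2 d"
  shows summable_bil: "summable (\<lambda>k. (cmod (bil c d k))\<^sup>2)"
    and suminf_bil_le: "(\<Sum>k. (cmod (bil c d k))\<^sup>2) \<le> msum c * msum d"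
proof -
  have s: "(\<lambda>k. \<Sum>m\<le>k. (cmod (c m))\<^sup>2 * (cmod (d (k - m)))\<^sup>2) sums (msum c * msum d)"
    unfolding msum_def using assms unfolding l2_def by (intro Cauchy_product_sums) auto
  show 1: "summable (\<lambda>k. (cmod (bil c d k))\<^sup>2)"
    using sums_summable[OF s] by (rule summable_comparison_test'[where N = 0]) (auto simp: bil_sq_le)
  show "(\<Sum>k. (cmod (bil c d k))\<^sup>2) \<le> msum c * msum d"
    using suminf_le[OF bil_sq_le 1 sums_summable[OF s]] sums_unique[OF s] by simp
qed

lemma bil_sym: "bil c d k = bil d c k"
  unfolding bil_def
  by (rule sum.reindex_bij_witness[where i = "\<lambda>m. k - m" and j = "\<lambda>m. k - m"]) (auto simp: wt_sym)

lemma bil_add: "bil (\<lambda>n. c n + d n) e k = bil c e k + bil d e k"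
  unfolding bil_def by (simp add: sum.distrib algebra_simps)

lemma bil_cmult: "bil (\<lambda>n. x * c n) e k = x * bil c e k"
  unfolding bil_def by (simp add: sum_distrib_left algebra_simps)

lemma bil_diag_add:
  "bil (\<lambda>n. c n + d n) (\<lambda>n. c n + d n) k = bil c c k + 2 * bil c d k + bil d d k"
  unfolding bil_add bil_sym[of c "\<lambda>n. c n + d n"] bil_sym[of d "\<lambda>n. c n + d n"] bil_sym[of d c] by simp

lemma msum_nonneg: "l2 c \<Longrightarrow> 0 \<le> msum c" 
  unfolding msum_def l2_def by (intro suminf_nonneg) auto

text \<open>The weight \<open>sqrt (k choose m)\<close> makes \<^const>\<open>bil\<close> the Cauchy product of the Taylor
  coefficients.\<close>

lemma bil_eq_cauchy:
  assumes h: "h > 0" and c: "\<And>n. c n = of_real (sqrt (pi * fact n * h ^ (n + 1))) * a n"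
  shows "bil c c k = of_real (pi * h * sqrt (fact k * (h / 2) ^ k)) * (\<Sum>m\<le>k. a m * a (k - m))"
proof -
  have "wt k m * (sqrt (pi * fact m * h ^ (m + 1)) * sqrt (pi * fact (k - m) * h ^ (k - m + 1))) = pi * h * sqrt (fact k * (h / 2) ^ k)" if "m \<le> k" for m
  proof -
    have b: "real (k choose m) = fact k / (fact m * fact (k - m))" by (rule binomial_fact[OF that])
    have hp: "h ^ (m + 1) * h ^ (k - m + 1) = h ^ k * h\<^sup>2" 
      using that by (simp add: power_add[symmetric] power2_eq_square)
    have "wt k m * (sqrt (pi * fact m * h ^ (m + 1)) * sqrt (pi * fact (k - m) * h ^ (k - m + 1)))
       = sqrt (fact k / (fact m * fact (k - m)) / 2 ^ k * ((pi * fact m * h ^ (m + 1)) * (pi * fact (k - m) * h ^ (k - m + 1))))"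
      unfolding wt_def b by (simp add: real_sqrt_mult real_sqrt_divide)
    also have "fact k / (fact m * fact (k - m)) / 2 ^ k * ((pi * fact m * h ^ (m + 1)) * (pi * fact (k - m) * h ^ (k - m + 1)))
      = fact k / 2 ^ k * pi\<^sup>2 * (h ^ (m + 1) * h ^ (k - m + 1))"
      by (simp add: field_simps power2_eq_square)
    also have "\<dots> = (pi * h)\<^sup>2 * (fact k * (h / 2) ^ k)"
      unfolding hp by (simp add: power_divide power_mult_distrib)
    finally show ?thesis using h by (simp add: real_sqrt_mult)
  qed
  then have "of_real (wt k m) * c m * c (k - m) = of_real (pi * h * sqrt (fact k * (h / 2) ^ k)) * (a m * a (k - m))" if "m \<le> k" for m
  proof -
    assume *: "\<And>m. m \<le> k \<Longrightarrow> wt k m * (sqrt (pi * fact m * h ^ (m + 1)) * sqrt (pi * fact (k - m) * h ^ (k - m + 1))) = pi * h * sqrt (fact k * (h / 2) ^ k)"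
    have "of_real (wt k m) * c m * c (k - m) = of_real (wt k m * (sqrt (pi * fact m * h ^ (m + 1)) * sqrt (pi * fact (k - m) * h ^ (k - m + 1)))) * (a m * a (k - m))"
      unfolding c by (simp only: of_real_mult mult_ac)
    then show ?thesis unfolding *[OF that] .
  qed
  then show ?thesis unfolding bil_def sum_distrib_left by (intro sum.cong) auto
qed

section \<open>Integrals of a state in terms of its coefficients\<close>

lemma power_series_square:
  fixes a :: "nat \<Rightarrow> complex"
  assumes f: "\<And>z. (\<lambda>n. a n * z ^ n) sums f z"
  shows "(\<lambda>k. (\<Sum>m\<le>k. a m * a (k - m)) * z ^ k) sums (f z)\<^sup>2"
proof -
  have "summable (\<lambda>n. a n * of_real (cmod z + 1) ^ n)" using f sums_summable by blast
  from powser_insidea[OF this, of z] have s: "summable (\<lambda>n. norm (a n * z ^ n))" by simp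
  have "(\<lambda>k. \<Sum>m\<le>k. (a m * z ^ m) * (a (k - m) * z ^ (k - m))) sums ((\<Sum>n. a n * z ^ n) * (\<Sum>n. a n * z ^ n))"
    by (rule Cauchy_product_sums[OF s s])
  moreover have "(\<Sum>m\<le>k. (a m * z ^ m) * (a (k - m) * z ^ (k - m))) = (\<Sum>m\<le>k. a m * a (k - m)) * z ^ k" for k
    unfolding sum_distrib_right by (intro sum.cong) (auto simp: mult_ac power_add[symmetric])
  ultimately show ?thesis using sums_unique[OF f[of z]] by (simp add: power2_eq_square)
qed

text \<open>All three are Parseval. For the quartic integral it is applied to the square of
  \<open>f\<close> with a Gaussian of twice the rate, which is the origin of the powers of 2 in
  \<open>wt\<close>.\<close>

lemma fock_integrals:
  assumes f: "\<And>z. (\<lambda>n. a n * z ^ n) sums f z" and h: "h > 0"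
    and c: "\<And>n. c n = of_real (sqrt (pi * fact n * h ^ (n + 1))) * a n"
  shows fock_mass: "(\<integral>\<^sup>+ z. ennreal ((cmod (f z))\<^sup>2 * exp (- (cmod z)\<^sup>2 / h)) \<partial>lborel) = (\<Sum>n. ennreal ((cmod (c n))\<^sup>2))"
    and fock_moment: "(\<integral>\<^sup>+ z. ennreal ((cmod z)\<^sup>2 * (cmod (f z))\<^sup>2 * exp (- (cmod z)\<^sup>2 / h)) \<partial>lborel) = (\<Sum>n. ennreal (h * (real (n + 1) * (cmod (c n))\<^sup>2)))"
    and fock_quartic: "(\<integral>\<^sup>+ z. ennreal ((cmod (f z)) ^ 4 * exp (- 2 * (cmod z)\<^sup>2 / h)) \<partial>lborel) = (\<Sum>k. ennreal (1 / (2 * pi * h) * (cmod (bil c c k))\<^sup>2))"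
proof -
  have cc: "(cmod (c n))\<^sup>2 = pi * fact n * h ^ (n + 1) * (cmod (a n))\<^sup>2" for n
    using h unfolding c by (simp add: norm_mult power_mult_distrib abs_mult)
  have 1: "pi * fact (n + 0) / (1 / h) ^ (n + 0 + 1) * (cmod (a n))\<^sup>2 = (cmod (c n))\<^sup>2" for n
    unfolding cc using h by (simp add: power_divide)
  have "(\<integral>\<^sup>+ z. ennreal ((cmod (f z))\<^sup>2 * exp (- (cmod z)\<^sup>2 / h)) \<partial>lborel)
    = (\<integral>\<^sup>+ z. ennreal (cmod z ^ (2 * 0) * (cmod (f z))\<^sup>2 * exp (- (1 / h) * (cmod z)\<^sup>2)) \<partial>lborel)"
    by simp
  also have "\<dots> = (\<Sum>n. ennreal ((cmod (c n))\<^sup>2))"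
    unfolding 1[symmetric] by (rule nn_integral_parseval[OF f]) (use h in simp)
  finally show "(\<integral>\<^sup>+ z. ennreal ((cmod (f z))\<^sup>2 * exp (- (cmod z)\<^sup>2 / h)) \<partial>lborel) = (\<Sum>n. ennreal ((cmod (c n))\<^sup>2))" .
  have 2: "pi * fact (n + 1) / (1 / h) ^ (n + 1 + 1) * (cmod (a n))\<^sup>2 = h * (real (n + 1) * (cmod (c n))\<^sup>2)" for n
    unfolding cc using h by (simp add: power_divide)
  have "(\<integral>\<^sup>+ z. ennreal ((cmod z)\<^sup>2 * (cmod (f z))\<^sup>2 * exp (- (cmod z)\<^sup>2 / h)) \<partial>lborel)
    = (\<integral>\<^sup>+ z. ennreal (cmod z ^ (2 * 1) * (cmod (f z))\<^sup>2 * exp (- (1 / h) * (cmod z)\<^sup>2)) \<partial>lborel)"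
    by simp
  also have "\<dots> = (\<Sum>n. ennreal (h * (real (n + 1) * (cmod (c n))\<^sup>2)))"
    unfolding 2[symmetric] by (rule nn_integral_parseval[OF f]) (use h in simp)
  finally show "(\<integral>\<^sup>+ z. ennreal ((cmod z)\<^sup>2 * (cmod (f z))\<^sup>2 * exp (- (cmod z)\<^sup>2 / h)) \<partial>lborel) = (\<Sum>n. ennreal (h * (real (n + 1) * (cmod (c n))\<^sup>2)))" .
  have 3: "pi * fact (k + 0) / (2 / h) ^ (k + 0 + 1) * (cmod (\<Sum>m\<le>k. a m * a (k - m)))\<^sup>2 = 1 / (2 * pi * h) * (cmod (bil c c k))\<^sup>2" for k
  proof -
    have "(cmod (bil c c k))\<^sup>2 = (pi * h)\<^sup>2 * (fact k * (h / 2) ^ k) * (cmod (\<Sum>m\<le>k. a m * a (k - m)))\<^sup>2"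
      using h unfolding bil_eq_cauchy[OF h c] norm_mult norm_of_real power_mult_distrib power2_abs by simp
    then show ?thesis using h by (simp add: power_divide power2_eq_square)
  qed
  have "(\<integral>\<^sup>+ z. ennreal ((cmod (f z)) ^ 4 * exp (- 2 * (cmod z)\<^sup>2 / h)) \<partial>lborel)
    = (\<integral>\<^sup>+ z. ennreal (cmod z ^ (2 * 0) * (cmod ((f z)\<^sup>2))\<^sup>2 * exp (- (2 / h) * (cmod z)\<^sup>2)) \<partial>lborel)"
    by (simp add: norm_power)
  also have "\<dots> = (\<Sum>k. ennreal (1 / (2 * pi * h) * (cmod (bil c c k))\<^sup>2))"
    unfolding 3[symmetric] by (rule nn_integral_parseval[OF power_series_square[OF f]]) (use h in simp)
  finally show "(\<integral>\<^sup>+ z. ennreal ((cmod (f z)) ^ 4 * exp (- 2 * (cmod z)\<^sup>2 / h)) \<partial>lborel) = (\<Sum>k. ennreal (1 / (2 * pi * h) * (cmod (bil c c k))\<^sup>2))" .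
qed

text \<open>The term is the geometric mean of \<open>(2 * x\<^sup>2) ^ n / fact n\<close> and
  \<open>(1 / 2) ^ n\<close>, both of which are summable.\<close>

lemma summable_power_div_sqrt_fact: 
  fixes x :: real
  assumes "x \<ge> 0"
  shows "summable (\<lambda>n. x ^ n / sqrt (fact n))"
proof -
  have "summable (\<lambda>n. (2 * x\<^sup>2) ^ n / fact n)"
    using summable_exp[of "2 * x\<^sup>2"] by (simp only: divide_inverse_commute)
  then have "summable (\<lambda>n. ((2 * x\<^sup>2) ^ n / fact n + (1 / 2) ^ n) / 2)"
    by (intro summable_divide summable_add summable_geometric) auto
  then show ?thesis
  proof (rule summable_comparison_test'[where N = 0])
    fix n
    have "(x ^ n / sqrt (fact n)) = sqrt (((2 * x\<^sup>2) ^ n / fact n) * (1 / 2) ^ n)"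
    proof -
      have "(2 * x\<^sup>2) ^ n / fact n * (1 / 2) ^ n = (x ^ n)\<^sup>2 / fact n"
        by (simp add: power_mult_distrib power_divide power_mult[symmetric] mult.commute)
      then show ?thesis using assms by (simp add: real_sqrt_divide)
    qed
    also have "\<dots> \<le> ((2 * x\<^sup>2) ^ n / fact n + (1 / 2) ^ n) / 2"
      by (rule arith_geo_mean_sqrt) auto
    finally show "norm (x ^ n / sqrt (fact n)) \<le> ((2 * x\<^sup>2) ^ n / fact n + (1 / 2) ^ n) / 2"
      using assms by simp
  qed
qed

lemma l2_bounded:
  assumes "l2 c"
  obtains C where "C > 0" "\<And>n. cmod (c n) \<le> C"
proof -
  have "(cmod (c n))\<^sup>2 \<le> msum c" for n
    using sum_le_suminf[of "\<lambda>n. (cmod (c n))\<^sup>2" "{n}"] assms unfolding msum_def l2_def by simp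
  then have "cmod (c n) \<le> sqrt (msum c)" for n by (simp add: real_le_rsqrt)
  then have "cmod (c n) \<le> sqrt (msum c) + 1" for n by (simp add: add_increasing2)
  moreover have "sqrt (msum c) + 1 > 0" using msum_nonneg[OF assms] by (simp add: add_nonneg_pos)
  ultimately show ?thesis using that by blast
qed

lemma l2_power_series:
  assumes c: "l2 c" and h: "h > 0"
    and a: "\<And>n. a n = c n / of_real (sqrt (pi * fact n * h ^ (n + 1)))"
  shows "(\<lambda>n. a n * z ^ n) sums (\<Sum>n. a n * z ^ n)"
proof -
  obtain C where C: "C > 0" "\<And>n. cmod (c n) \<le> C" by (rule l2_bounded[OF c]) blast
  have "summable (\<lambda>n. C / sqrt (pi * h) * ((cmod z / sqrt h) ^ n / sqrt (fact n)))"
    using h by (intro summable_mult summable_power_div_sqrt_fact) auto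
  then have "summable (\<lambda>n. a n * z ^ n)"
  proof (rule summable_comparison_test'[where N = 0])
    fix n
    have "norm (a n * z ^ n) = cmod (c n) * (cmod z ^ n / sqrt (pi * fact n * h ^ (n + 1)))"
      using h unfolding a by (simp add: norm_mult norm_divide norm_power)
    also have "\<dots> \<le> C * (cmod z ^ n / sqrt (pi * fact n * h ^ (n + 1)))"
      using C h by (intro mult_right_mono) auto
    also have "\<dots> = C / sqrt (pi * h) * ((cmod z / sqrt h) ^ n / sqrt (fact n))"
      using h by (simp add: real_sqrt_mult real_sqrt_power power_divide)
    finally show "norm (a n * z ^ n) \<le> C / sqrt (pi * h) * ((cmod z / sqrt h) ^ n / sqrt (fact n))" .
  qed
  then show ?thesis by (rule summable_sums)
qed

section \<open>The inequality for the even product\<close>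

lemma nn_integral_affine:
  fixes g :: "'a::euclidean_space \<Rightarrow> ennreal"
  assumes [measurable]: "g \<in> borel_measurable borel" and "c \<noteq> 0"
  shows "(\<integral>\<^sup>+ x. g x \<partial>lborel) = ennreal (\<bar>c\<bar> ^ DIM('a)) * (\<integral>\<^sup>+ x. g (t + c *\<^sub>R x) \<partial>lborel)"
  by (subst lborel_affine[OF assms(2), of t]) (simp add: nn_integral_density nn_integral_distr nn_integral_cmult ennreal_power)

text \<open>The substitution \<open>x = z + w\<close>, \<open>y = z - w\<close> has real Jacobian 4,
  since a complex scaling by 2 counts twice. With one variable fixed it is a translation, then that
  scaling, so Tonelli replaces a change of variables in four dimensions.\<close>

lemma nn_integral_sum_difference:
  fixes F :: "complex \<Rightarrow> complex \<Rightarrow> ennreal"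
  assumes [measurable]: "case_prod F \<in> borel_measurable (borel \<Otimes>\<^sub>M borel)"
  shows "(\<integral>\<^sup>+ x. \<integral>\<^sup>+ y. F x y \<partial>lborel \<partial>lborel) = 4 * (\<integral>\<^sup>+ z. \<integral>\<^sup>+ w. F (z + w) (z - w) \<partial>lborel \<partial>lborel)"
proof -
  have m [measurable]: "(\<lambda>x. F (u x) (v x)) \<in> borel_measurable M" if [measurable]: "u \<in> borel_measurable M" "v \<in> borel_measurable M" for u v M
    using measurable_compose[OF measurable_Pair[OF that] assms] by simp
  have "(\<integral>\<^sup>+ z. \<integral>\<^sup>+ w. F (z + w) (z - w) \<partial>lborel \<partial>lborel) = (\<integral>\<^sup>+ w. \<integral>\<^sup>+ z. F (z + w) (z - w) \<partial>lborel \<partial>lborel)"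
    by (rule lborel_pair.Fubini') (simp add: split_beta)
  also have "\<dots> = (\<integral>\<^sup>+ w. \<integral>\<^sup>+ z. F (w + z + w) (w + z - w) \<partial>lborel \<partial>lborel)"
    by (subst nn_integral_translate[where g = "\<lambda>z. F (z + _) (z - _)"]) auto
  also have "\<dots> = (\<integral>\<^sup>+ w. \<integral>\<^sup>+ z. F (z + 2 *\<^sub>R w) z \<partial>lborel \<partial>lborel)"
    by (simp add: scaleR_2 algebra_simps)
  also have "\<dots> = (\<integral>\<^sup>+ z. \<integral>\<^sup>+ w. F (z + 2 *\<^sub>R w) z \<partial>lborel \<partial>lborel)"
    by (rule lborel_pair.Fubini') (simp add: split_beta)
  finally have "4 * (\<integral>\<^sup>+ z. \<integral>\<^sup>+ w. F (z + w) (z - w) \<partial>lborel \<partial>lborel) = (\<integral>\<^sup>+ z. 4 * (\<integral>\<^sup>+ w. F (z + 2 *\<^sub>R w) z \<partial>lborel) \<partial>lborel)"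
    by (simp add: nn_integral_cmult)
  also have "\<dots> = (\<integral>\<^sup>+ z. \<integral>\<^sup>+ x. F x z \<partial>lborel \<partial>lborel)"
    by (intro nn_integral_cong, subst (2) nn_integral_affine[where c = 2 and t = "_ :: complex"]) auto
  also have "\<dots> = (\<integral>\<^sup>+ x. \<integral>\<^sup>+ y. F x y \<partial>lborel \<partial>lborel)"
    by (rule lborel_pair.Fubini') (simp add: split_beta)
  finally show ?thesis ..
qed

lemma power_series_has_fps_expansion:
  fixes a :: "nat \<Rightarrow> complex"
  assumes "\<And>z. (\<lambda>n. a n * z ^ n) sums f z"
  shows "f has_fps_expansion Abs_fps a"
  by (rule has_fps_expansionI) (use assms in simp)

lemma power_series_unique:
  fixes a b :: "nat \<Rightarrow> complex"
  assumes "\<And>z. (\<lambda>n. a n * z ^ n) sums f z" "\<And>z. (\<lambda>n. b n * z ^ n) sums f z"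
  shows "a n = b n"
  using fps_expansion_unique_complex[OF power_series_has_fps_expansion[OF assms(1)] power_series_has_fps_expansion[OF assms(2)]]
  by (metis fps_nth_Abs_fps)

text \<open>Serves to read off the equality case term by term; finiteness allows the common sum to
  be cancelled.\<close>

lemma suminf_ennreal_eq_imp_eq:
  fixes x y :: "nat \<Rightarrow> ennreal"
  assumes le: "\<And>n. x n \<le> y n" and eq: "(\<Sum>n. x n) = (\<Sum>n. y n)" and fin: "(\<Sum>n. x n) < \<infinity>"
  shows "x n = y n"
proof -
  have d: "y n = x n + (y n - x n)" for n using le by (simp add: diff_add_cancel_ennreal add.commute[of _ "_ - _"])
  have "(\<Sum>n. y n) = (\<Sum>n. x n) + (\<Sum>n. y n - x n)"
    by (subst suminf_add) (use d in auto)
  then have "(\<Sum>n. x n) + (\<Sum>n. y n - x n) = (\<Sum>n. x n) + 0" using eq by simp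
  then have "(\<Sum>n. y n - x n) = 0" using fin by (subst (asm) ennreal_add_left_cancel) auto
  then have "y n - x n = 0" by (simp add: suminf_eq_zero_iff)
  then show ?thesis using d[of n] by simp
qed

lemma nn_integral_eq_imp_AE_eq:
  assumes [measurable]: "f \<in> borel_measurable M" "g \<in> borel_measurable M"
    and le: "\<And>x. f x \<le> g x" and eq: "integral\<^sup>N M f = integral\<^sup>N M g" and fin: "integral\<^sup>N M f < \<infinity>"
  shows "AE x in M. f x = g x"
proof -
  have d: "g x = f x + (g x - f x)" for x using le by (simp add: diff_add_cancel_ennreal add.commute[of _ "_ - _"])
  have "integral\<^sup>N M g = integral\<^sup>N M f + (\<integral>\<^sup>+ x. g x - f x \<partial>M)"
    by (subst nn_integral_add[symmetric]) (use d in auto)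
  then have "integral\<^sup>N M f + (\<integral>\<^sup>+ x. g x - f x \<partial>M) = integral\<^sup>N M f + 0" using eq by simp
  then have "(\<integral>\<^sup>+ x. g x - f x \<partial>M) = 0" using fin by (subst (asm) ennreal_add_left_cancel) auto
  then have "AE x in M. g x - f x = 0" by (subst (asm) nn_integral_0_iff_AE) auto
  then show ?thesis by eventually_elim (use d in \<open>metis add.right_neutral\<close>)
qed

text \<open>Taylor coefficients of odd order vanish, so the smallest nonzero order after \<open>0\<close> is \<open>2\<close>.\<close>

lemma even_entire_gap:
  fixes b :: "nat \<Rightarrow> complex"
  assumes g: "\<And>w. (\<lambda>n. b n * w ^ n) sums g w" and ev: "\<And>w. g (- w) = g w"
  defines "I0 \<equiv> (\<integral>\<^sup>+ w. ennreal ((cmod (g w))\<^sup>2 * exp (- 2 * (cmod w)\<^sup>2)) \<partial>lborel)"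
    and "I1 \<equiv> (\<integral>\<^sup>+ w. ennreal (2 * (cmod w)\<^sup>2 * (cmod (g w))\<^sup>2 * exp (- 2 * (cmod w)\<^sup>2)) \<partial>lborel)"
  shows even_entire_gap_le: "3 * I0 \<le> I1 + ennreal (pi * (cmod (g 0))\<^sup>2)"
    and even_entire_gap_eq: "3 * I0 = I1 + ennreal (pi * (cmod (g 0))\<^sup>2) \<Longrightarrow> I0 < \<infinity> \<Longrightarrow> g w = g 0 + (g 1 - g 0) * w\<^sup>2"
proof -
  \<comment> \<open>The contribution of order \<open>n\<close> to \<open>I0\<close>. The factor
    \<open>2 * |w|^2\<close> in \<open>I1\<close> multiplies it by \<open>n + 1\<close>, and
    \<open>n + 1 >= 3\<close> holds for every even \<open>n\<close> except 0, where
    \<open>pi * |g 0|^2 = 2 * A 0\<close> makes up the difference.\<close>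
  define A where "A n = pi * fact n / 2 ^ (n + 1) * (cmod (b n))\<^sup>2" for n
  have A0: "A n \<ge> 0" for n by (simp add: A_def)
  have odd0: "b n = 0" if "odd n" for n
  proof -
    have "(\<lambda>n. ((-1) ^ n * b n) * w ^ n) sums g w" for w
      using g[of "- w"] by (simp add: ev power_minus[of w] mult_ac)
    then have "(-1) ^ n * b n = b n" using power_series_unique[of "\<lambda>n. (-1) ^ n * b n" g b n] g by blast
    then show ?thesis using that by simp
  qed
  have g0: "g 0 = b 0" using g[of 0] sums_unique2[OF powser_sums_zero[of b] g[of 0]] by simp
  have I0: "I0 = (\<Sum>n. ennreal (A n))"
  proof -
    have "I0 = (\<integral>\<^sup>+ w. ennreal (cmod w ^ (2 * 0) * (cmod (g w))\<^sup>2 * exp (- 2 * (cmod w)\<^sup>2)) \<partial>lborel)"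
      unfolding I0_def by simp
    also have "\<dots> = (\<Sum>n. ennreal (pi * fact (n + 0) / 2 ^ (n + 0 + 1) * (cmod (b n))\<^sup>2))"
      by (rule nn_integral_parseval[OF g]) simp
    finally show ?thesis by (simp only: A_def add_0_right)
  qed
  have "I1 = 2 * (\<integral>\<^sup>+ w. ennreal (cmod w ^ (2 * 1) * (cmod (g w))\<^sup>2 * exp (- 2 * (cmod w)\<^sup>2)) \<partial>lborel)"
  proof -
    have "continuous_on UNIV g"
      using power_series_entire[OF g] by (rule holomorphic_on_imp_continuous_on)
    then have [measurable]: "g \<in> borel_measurable borel" by (rule borel_measurable_continuous_onI)
    show ?thesis unfolding I1_def
      by (subst nn_integral_cmult[symmetric], simp) (auto intro!: nn_integral_cong simp: ennreal_mult' mult.assoc)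
  qed
  also have "\<dots> = (\<Sum>n. ennreal (real (n + 1) * A n))"
  proof -
    have "2 * ennreal (pi * fact (n + 1) / 2 ^ (n + 1 + 1) * (cmod (b n))\<^sup>2) = ennreal (real (n + 1) * A n)" for n
    proof -
      have "2 * (pi * fact (n + 1) / 2 ^ (n + 1 + 1) * (cmod (b n))\<^sup>2) = real (n + 1) * A n"
        by (simp add: A_def field_simps)
      then show ?thesis by (metis ennreal_mult' ennreal_numeral zero_le_numeral)
    qed
    then show ?thesis by (simp only: nn_integral_parseval[OF g zero_less_numeral] ennreal_suminf_cmult[symmetric])
  qed
  finally have I1: "I1 = (\<Sum>n. ennreal (real (n + 1) * A n))" .
  have d: "ennreal (pi * (cmod (g 0))\<^sup>2) = (\<Sum>n. if n = 0 then ennreal (2 * A 0) else 0)"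
    by (subst suminf_finite[of "{0}"]) (auto simp: A_def g0)
  have R: "I1 + ennreal (pi * (cmod (g 0))\<^sup>2) = (\<Sum>n. ennreal (real (n + 1) * A n) + (if n = 0 then ennreal (2 * A 0) else 0))"
    unfolding I1 d by (rule suminf_add) auto
  have L: "3 * I0 = (\<Sum>n. ennreal (3 * A n))"
    unfolding I0 ennreal_suminf_cmult[symmetric] by (simp add: ennreal_mult')
  have le: "ennreal (3 * A n) \<le> ennreal (real (n + 1) * A n) + (if n = 0 then ennreal (2 * A 0) else 0)" for n
  proof -
    consider "n = 0" | "odd n" | "n \<ge> 2" by (metis less_2_cases odd_one One_nat_def not_less)
    then show ?thesis
    proof cases
      case 1 then show ?thesis using A0[of 0] by (simp add: ennreal_plus[symmetric] del: ennreal_plus)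
    next
      case 2 then show ?thesis by (simp add: A_def odd0)
    next
      case 3 then show ?thesis using mult_right_mono[OF _ A0[of n], of 3 "real (n + 1)"] by (simp add: ennreal_leI)
    qed
  qed
  show "3 * I0 \<le> I1 + ennreal (pi * (cmod (g 0))\<^sup>2)"
    unfolding L R by (intro suminf_le le) auto
  assume eq: "3 * I0 = I1 + ennreal (pi * (cmod (g 0))\<^sup>2)" and fin: "I0 < \<infinity>"
  have eqn: "ennreal (3 * A n) = ennreal (real (n + 1) * A n) + (if n = 0 then ennreal (2 * A 0) else 0)" for n
    using le eq[unfolded L R] 
  proof (rule suminf_ennreal_eq_imp_eq)
    show "(\<Sum>n. ennreal (3 * A n)) < \<infinity>" unfolding L[symmetric] using fin by (simp add: ennreal_mult_less_top)
  qed
  \<comment> \<open>At even orders beyond 2 the factor \<open>n + 1\<close> exceeds 3 strictly, so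
    equality forces the coefficient to vanish.\<close>
  have b0: "b n = 0" if "n \<noteq> 0" "n \<noteq> 2" for n
  proof (cases "odd n")
    case False
    then have "n \<ge> 3" using that by presburger
    then have "3 * A n = real (n + 1) * A n" using eqn[of n] A0[of n] by simp
    then have "A n = 0" using \<open>n \<ge> 3\<close> by simp
    then show ?thesis by (simp add: A_def)
  qed (rule odd0)
  have gw: "g w = b 0 + b 2 * w\<^sup>2" for w
  proof -
    have "(\<lambda>n. b n * w ^ n) sums (\<Sum>n\<in>{0,2}. b n * w ^ n)" by (rule sums_finite) (auto simp: b0)
    then show ?thesis using g[of w] sums_unique2 by fastforce
  qed
  show "g w = g 0 + (g 1 - g 0) * w\<^sup>2" unfolding gw[of w] gw[of 0] gw[of 1] by simp
qed

text \<open>The centre of mass: at scale 1 this is the integral of \<open>z\<close> against the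
  density \<open>|f z|^2 * exp (- |z|^2)\<close>.\<close>

definition dsum :: "(nat \<Rightarrow> complex) \<Rightarrow> complex" where
  "dsum c = (\<Sum>n. of_real (sqrt (real (n + 1))) * c n * cnj (c (n + 1)))"

lemma dsum_summable:
  assumes "h1 c"
  shows "summable (\<lambda>n. of_real (sqrt (real (n + 1))) * c n * cnj (c (n + 1)))"
proof (rule summable_comparison_test')
  have "summable (\<lambda>n. real (Suc n) * (cmod (c (Suc n)))\<^sup>2)"
    using h1_summable_n[OF assms] by (subst summable_Suc_iff)
  then show "summable (\<lambda>n. ((cmod (c n))\<^sup>2 + real (Suc n) * (cmod (c (Suc n)))\<^sup>2) / 2)"
    using h1_imp_l2[OF assms] unfolding l2_def by (intro summable_divide summable_add)
  fix n
  have "cmod (c n) * (sqrt (real (Suc n)) * cmod (c (Suc n))) \<le> ((cmod (c n))\<^sup>2 + (sqrt (real (Suc n)) * cmod (c (Suc n)))\<^sup>2) / 2"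
    using sum_squares_bound[of "cmod (c n)" "sqrt (real (Suc n)) * cmod (c (Suc n))"] by simp
  then show "cmod (of_real (sqrt (real (n + 1))) * c n * cnj (c (n + 1))) \<le> ((cmod (c n))\<^sup>2 + real (Suc n) * (cmod (c (Suc n)))\<^sup>2) / 2"
    by (simp add: norm_mult power_mult_distrib mult_ac)
qed

text \<open>This is the mass formula applied to \<open>(z - y) * f z\<close>, whose Taylor
  coefficients are the \<open>b\<close> and whose normalized coefficients are the \<open>e\<close>
  of the proof.\<close>

lemma nn_second_moment_about:
  fixes a c :: "nat \<Rightarrow> complex"
  assumes f: "\<And>z. (\<lambda>n. a n * z ^ n) sums f z"
    and c: "\<And>n. c n = of_real (sqrt (pi * fact n)) * a n" and h1: "h1 c"
  shows "(\<integral>\<^sup>+ x. ennreal ((cmod (x - y))\<^sup>2 * ((cmod (f x))\<^sup>2 * exp (- (cmod x)\<^sup>2))) \<partial>lborel)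
     = ennreal (msum c + psum c + (cmod y)\<^sup>2 * msum c - 2 * Re (cnj y * dsum c))"
proof -
  define b where "b n = (case n of 0 \<Rightarrow> 0 | Suc m \<Rightarrow> a m) - y * a n" for n
  define e where "e n = (case n of 0 \<Rightarrow> 0 | Suc m \<Rightarrow> of_real (sqrt (real n)) * c m) - y * c n" for n
  have eb: "e n = of_real (sqrt (pi * fact n * 1 ^ (n + 1))) * b n" for n
  proof (cases n)
    case (Suc m)
    have "sqrt (real (Suc m)) * sqrt (pi * fact m) = sqrt (pi * fact (Suc m))"
      by (simp add: real_sqrt_mult[symmetric])
    then have "of_real (sqrt (real (Suc m))) * c m = of_real (sqrt (pi * fact (Suc m))) * a m"
      unfolding c by (metis mult.assoc of_real_mult)
    then show ?thesis unfolding Suc e_def b_def nat.case right_diff_distrib c[of "Suc m"] by (simp add: mult_ac)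
  qed (simp add: e_def b_def c)
  have bf: "(\<lambda>n. b n * z ^ n) sums ((z - y) * f z)" for z
  proof -
    have "(\<lambda>n. z * (a n * z ^ n)) sums (z * f z)" using f by (rule sums_mult)
    then have "(\<lambda>n. (case Suc n of 0 \<Rightarrow> 0 | Suc m \<Rightarrow> a m) * z ^ Suc n) sums (z * f z)" by (simp add: mult_ac)
    then have "(\<lambda>n. (case n of 0 \<Rightarrow> 0 | Suc m \<Rightarrow> a m) * z ^ n) sums (z * f z)"
      by (subst (asm) sums_Suc_iff) simp
    from sums_diff[OF this sums_mult[OF f[of z], of y]] show ?thesis
      by (simp add: b_def algebra_simps)
  qed
  have sq: "(cmod (e (Suc n)))\<^sup>2 = real (n + 1) * (cmod (c n))\<^sup>2 + (cmod y)\<^sup>2 * (cmod (c (Suc n)))\<^sup>2 - 2 * Re (cnj y * (of_real (sqrt (real (n + 1))) * c n * cnj (c (n + 1))))" for n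
  proof -
    have n: "(cmod (u - v))\<^sup>2 = (cmod u)\<^sup>2 + (cmod v)\<^sup>2 - 2 * Re (u * cnj v)" for u v
      unfolding cmod_power2 by (simp add: power2_eq_square algebra_simps)
    show ?thesis unfolding e_def nat.case n by (simp add: norm_mult power_mult_distrib algebra_simps)
  qed
  have l: "l2 c" using h1 by (rule h1_imp_l2)
  have s1: "(\<lambda>n. real (n + 1) * (cmod (c n))\<^sup>2) sums (msum c + psum c)"
  proof -
    have "(\<lambda>n. (cmod (c n))\<^sup>2 + real n * (cmod (c n))\<^sup>2) sums (msum c + psum c)"
      unfolding msum_def psum_def using l h1_summable_n[OF h1] unfolding l2_def by (intro sums_add summable_sums)
    then show ?thesis by (simp add: distrib_right add.commute)
  qed
  have s2: "(\<lambda>n. (cmod y)\<^sup>2 * (cmod (c (Suc n)))\<^sup>2) sums ((cmod y)\<^sup>2 * msum c - (cmod y)\<^sup>2 * (cmod (c 0))\<^sup>2)"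
  proof -
    have "(\<lambda>n. (cmod y)\<^sup>2 * (cmod (c n))\<^sup>2) sums ((cmod y)\<^sup>2 * msum c)"
      unfolding msum_def using l unfolding l2_def by (intro sums_mult summable_sums)
    then show ?thesis by (subst sums_Suc_iff) simp
  qed
  have s3: "(\<lambda>n. 2 * Re (cnj y * (of_real (sqrt (real (n + 1))) * c n * cnj (c (n + 1))))) sums (2 * Re (cnj y * dsum c))"
    unfolding dsum_def by (intro sums_mult sums_Re summable_sums dsum_summable h1)
  have "(\<lambda>n. (cmod (e (Suc n)))\<^sup>2) sums (msum c + psum c + ((cmod y)\<^sup>2 * msum c - (cmod y)\<^sup>2 * (cmod (c 0))\<^sup>2) - 2 * Re (cnj y * dsum c))"
    unfolding sq by (intro sums_diff sums_add s1 s2 s3)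
  then have es: "(\<lambda>n. (cmod (e n))\<^sup>2) sums (msum c + psum c + (cmod y)\<^sup>2 * msum c - 2 * Re (cnj y * dsum c))"
    by (subst (asm) sums_Suc_iff) (simp add: e_def norm_mult power_mult_distrib add_diff_eq diff_diff_eq add.assoc add_ac)
  have "(\<integral>\<^sup>+ x. ennreal ((cmod (x - y))\<^sup>2 * ((cmod (f x))\<^sup>2 * exp (- (cmod x)\<^sup>2))) \<partial>lborel)
     = (\<integral>\<^sup>+ x. ennreal ((cmod ((x - y) * f x))\<^sup>2 * exp (- (cmod x)\<^sup>2 / 1)) \<partial>lborel)"
    by (simp add: norm_mult power_mult_distrib mult.assoc)
  also have "\<dots> = (\<Sum>n. ennreal ((cmod (e n))\<^sup>2))"
    by (rule fock_mass[OF bf _ eb]) simp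
  also have "\<dots> = ennreal (\<Sum>n. (cmod (e n))\<^sup>2)"
    by (rule suminf_ennreal2) (use sums_summable[OF es] in auto)
  finally show ?thesis unfolding sums_unique[OF es, symmetric] .
qed

text \<open>The scale is fixed to \<open>h = 1\<close>, which loses nothing because
  \<open>psum\<close> and \<open>qsum\<close> of a coefficient sequence do not involve
  \<open>h\<close>. The function \<open>\<rho>\<close> is a probability density on the
  plane.\<close>

locale fock_state =
  fixes a c :: "nat \<Rightarrow> complex" and f :: "complex \<Rightarrow> complex" and \<rho> :: "complex \<Rightarrow> real"
  assumes f: "\<And>z. (\<lambda>n. a n * z ^ n) sums f z"
    and c: "\<And>n. c n = of_real (sqrt (pi * fact n)) * a n" and h1: "h1 c" and m1: "msum c = 1"
    and rho: "\<And>z. \<rho> z = (cmod (f z))\<^sup>2 * exp (- (cmod z)\<^sup>2)"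
begin

lemma rho_nonneg: "\<rho> z \<ge> 0" by (simp add: rho)

lemma f_cont: "continuous_on A f"
  using holomorphic_on_imp_continuous_on[OF power_series_entire[OF f]] continuous_on_subset by blast

lemma f_meas [measurable]: "f \<in> borel_measurable borel"
  by (rule borel_measurable_continuous_onI) (rule f_cont)

lemma rho_meas [measurable]: "\<rho> \<in> borel_measurable borel"
proof -
  have "\<rho> = (\<lambda>z. (cmod (f z))\<^sup>2 * exp (- (cmod z)\<^sup>2))" by (rule ext) (rule rho)
  then show ?thesis by simp
qed

lemma c': "c n = of_real (sqrt (pi * fact n * 1 ^ (n + 1))) * a n" by (simp add: c)

lemma rho_mass: "(\<integral>\<^sup>+ z. ennreal (\<rho> z) \<partial>lborel) = 1"
proof -
  have "(\<integral>\<^sup>+ z. ennreal (\<rho> z) \<partial>lborel) = (\<Sum>n. ennreal ((cmod (c n))\<^sup>2))"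
  proof -
    have "(\<integral>\<^sup>+ z. ennreal (\<rho> z) \<partial>lborel) = (\<integral>\<^sup>+ z. ennreal ((cmod (f z))\<^sup>2 * exp (- (cmod z)\<^sup>2 / 1)) \<partial>lborel)"
      by (simp add: rho)
    also have "\<dots> = (\<Sum>n. ennreal ((cmod (c n))\<^sup>2))" by (rule fock_mass[OF f _ c']) simp
    finally show ?thesis .
  qed
  also have "\<dots> = ennreal (msum c)"
    unfolding msum_def using h1_imp_l2[OF h1] unfolding l2_def by (intro suminf_ennreal2) auto
  finally show ?thesis by (simp add: m1)
qed

lemma rho_quartic: "(\<integral>\<^sup>+ z. ennreal ((\<rho> z)\<^sup>2) \<partial>lborel) = ennreal (qsum c / (2 * pi))"
proof -
  have "(\<rho> z)\<^sup>2 = (cmod (f z)) ^ 4 * exp (- 2 * (cmod z)\<^sup>2 / 1)" for z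
    by (simp add: rho power_mult_distrib power_mult[symmetric] exp_double[symmetric])
  then have "(\<integral>\<^sup>+ z. ennreal ((\<rho> z)\<^sup>2) \<partial>lborel) = (\<Sum>k. ennreal (1 / (2 * pi * 1) * (cmod (bil c c k))\<^sup>2))"
    using fock_quartic[OF f zero_less_one c'] by (simp only:)
  also have "\<dots> = ennreal (\<Sum>k. 1 / (2 * pi * 1) * (cmod (bil c c k))\<^sup>2)"
    using summable_bil[OF h1_imp_l2[OF h1] h1_imp_l2[OF h1]] by (intro suminf_ennreal2 summable_mult) auto
  also have "(\<Sum>k. 1 / (2 * pi * 1) * (cmod (bil c c k))\<^sup>2) = qsum c / (2 * pi)"
    unfolding qsum_def using summable_bil[OF h1_imp_l2[OF h1] h1_imp_l2[OF h1]] by (subst suminf_mult) auto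
  finally show ?thesis .
qed

lemma second_moment: 
  "(\<integral>\<^sup>+ x. ennreal ((cmod (x - y))\<^sup>2 * \<rho> x) \<partial>lborel) = ennreal (1 + psum c + (cmod y)\<^sup>2 - 2 * Re (cnj y * dsum c))"
  using nn_second_moment_about[OF f c h1, of y] by (simp only: rho m1 mult_1_right)

lemma psum_nonneg: "psum c \<ge> 0"
  unfolding psum_def by (intro suminf_nonneg h1_summable_n h1) auto

text \<open>The double integral is twice the variance of \<open>\<rho>\<close>, and
  \<open>dsum_le\<close> says that the variance is nonnegative. To stay clear of subtraction in
  \<open>ennreal\<close>, the integral of \<open>E\<close> is computed after adding the squared
  modulus of the centre, when \<open>second_moment\<close> about the centre applies once
  more.\<close>

lemma pair_moment:
  "(\<integral>\<^sup>+ y. \<integral>\<^sup>+ x. ennreal ((cmod (x - y))\<^sup>2 * \<rho> x * \<rho> y) \<partial>lborel \<partial>lborel) = ennreal (2 * (1 + psum c) - 2 * (cmod (dsum c))\<^sup>2)"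
  and dsum_le: "(cmod (dsum c))\<^sup>2 \<le> 1 + psum c"
proof -
  let ?D = "dsum c"
  define E where "E y = 1 + psum c + (cmod y)\<^sup>2 - 2 * Re (cnj y * ?D)" for y
  have sq: "(cmod (y - ?D))\<^sup>2 = (cmod y)\<^sup>2 + (cmod ?D)\<^sup>2 - 2 * Re (cnj y * ?D)" for y
    unfolding cmod_power2 by (simp add: power2_eq_square algebra_simps)
  have E: "E y + (cmod ?D)\<^sup>2 = (1 + psum c) + (cmod (y - ?D))\<^sup>2" for y
    unfolding E_def sq by simp
  have ED: "E ?D = 1 + psum c - (cmod ?D)\<^sup>2"
    unfolding E_def cmod_power2 by (simp add: power2_eq_square)
  \<comment> \<open>\<open>second_moment\<close> alone does not give this, because
    \<open>ennreal\<close> maps negative numbers to 0: a negative value would mean a vanishing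
    integral, hence \<open>\<rho> = 0\<close> almost everywhere.\<close>
  have E0: "E y \<ge> 0" for y
  proof (rule ccontr)
    assume neg: "\<not> E y \<ge> 0"
    then have "(\<integral>\<^sup>+ x. ennreal ((cmod (x - y))\<^sup>2 * \<rho> x) \<partial>lborel) = 0"
      unfolding second_moment using neg by (simp add: E_def ennreal_neg)
    then have "AE x in lborel. ennreal ((cmod (x - y))\<^sup>2 * \<rho> x) = 0"
      by (subst (asm) nn_integral_0_iff_AE) auto
    then have "AE x in lborel. ennreal (\<rho> x) = 0"
      using AE_lborel_singleton[of y] 
      by eventually_elim (auto simp: ennreal_eq_0_iff mult_le_0_iff rho_nonneg)
    then have "(\<integral>\<^sup>+ z. ennreal (\<rho> z) \<partial>lborel) = 0" by (subst nn_integral_0_iff_AE) auto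
    then show False using rho_mass by simp
  qed
  show le: "(cmod (dsum c))\<^sup>2 \<le> 1 + psum c" using E0[of ?D] ED by simp
  have [measurable]: "E \<in> borel_measurable borel" unfolding E_def
    by (intro borel_measurable_continuous_onI continuous_intros)
  have "(\<integral>\<^sup>+ y. ennreal (E y * \<rho> y) \<partial>lborel) + ennreal ((cmod ?D)\<^sup>2) 
     = (\<integral>\<^sup>+ y. ennreal (E y * \<rho> y) \<partial>lborel) + (\<integral>\<^sup>+ y. ennreal ((cmod ?D)\<^sup>2) * ennreal (\<rho> y) \<partial>lborel)"
    by (simp add: nn_integral_cmult rho_mass)
  also have "\<dots> = (\<integral>\<^sup>+ y. ennreal ((E y + (cmod ?D)\<^sup>2) * \<rho> y) \<partial>lborel)"
    by (subst nn_integral_add[symmetric]) (auto intro!: nn_integral_cong simp: distrib_right ennreal_mult[symmetric] ennreal_plus[symmetric] E0 rho_nonneg simp del: ennreal_plus)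
  also have "\<dots> = (\<integral>\<^sup>+ y. ennreal (1 + psum c) * ennreal (\<rho> y) + ennreal ((cmod (y - ?D))\<^sup>2 * \<rho> y) \<partial>lborel)"
    unfolding E by (intro nn_integral_cong) (auto simp: distrib_right ennreal_mult[symmetric] ennreal_plus[symmetric] psum_nonneg rho_nonneg simp del: ennreal_plus)
  also have "\<dots> = ennreal (1 + psum c) + ennreal (E ?D)"
    unfolding E_def second_moment[symmetric] by (subst nn_integral_add) (auto simp: nn_integral_cmult rho_mass)
  also have "\<dots> = ennreal (2 * (1 + psum c) - 2 * (cmod ?D)\<^sup>2) + ennreal ((cmod ?D)\<^sup>2)"
    unfolding ED using le psum_nonneg by (subst (1 2) ennreal_plus[symmetric]) auto
  finally have main: "(\<integral>\<^sup>+ y. ennreal (E y * \<rho> y) \<partial>lborel) = ennreal (2 * (1 + psum c) - 2 * (cmod ?D)\<^sup>2)"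
    by (simp add: add.commute[of _ "ennreal ((cmod ?D)\<^sup>2)"] ennreal_add_left_cancel)
  have "(\<integral>\<^sup>+ x. ennreal ((cmod (x - y))\<^sup>2 * \<rho> x * \<rho> y) \<partial>lborel) = ennreal (E y * \<rho> y)" for y
  proof -
    have "(\<integral>\<^sup>+ x. ennreal ((cmod (x - y))\<^sup>2 * \<rho> x * \<rho> y) \<partial>lborel) = (\<integral>\<^sup>+ x. ennreal ((cmod (x - y))\<^sup>2 * \<rho> x) * ennreal (\<rho> y) \<partial>lborel)"
      by (simp add: ennreal_mult rho_nonneg)
    also have "\<dots> = ennreal (E y) * ennreal (\<rho> y)"
      by (subst nn_integral_multc) (auto simp: second_moment E_def)
    finally show ?thesis by (simp add: ennreal_mult E0 rho_nonneg)
  qed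
  then show "(\<integral>\<^sup>+ y. \<integral>\<^sup>+ x. ennreal ((cmod (x - y))\<^sup>2 * \<rho> x * \<rho> y) \<partial>lborel \<partial>lborel) = ennreal (2 * (1 + psum c) - 2 * (cmod (dsum c))\<^sup>2)"
    using main by simp
qed

text \<open>By the parallelogram law the two Gaussian factors separate into a function of
  \<open>z\<close> and a function of \<open>w\<close>. For fixed \<open>z\<close> what remains is
  the weight of \<open>even_entire_gap\<close> for an even function of \<open>w\<close>.\<close>

lemma parallelogram_exp: "\<rho> (z + w) * \<rho> (z - w) = exp (- 2 * (cmod z)\<^sup>2) * ((cmod (f (z + w) * f (z - w)))\<^sup>2 * exp (- 2 * (cmod w)\<^sup>2))"
proof -
  have "(cmod (z + w))\<^sup>2 + (cmod (z - w))\<^sup>2 = 2 * (cmod z)\<^sup>2 + 2 * (cmod w)\<^sup>2"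
    unfolding cmod_power2 by (simp add: power2_eq_square algebra_simps)
  then have "exp (- (cmod (z + w))\<^sup>2) * exp (- (cmod (z - w))\<^sup>2) = exp (- 2 * (cmod z)\<^sup>2) * exp (- 2 * (cmod w)\<^sup>2)"
    unfolding exp_add[symmetric] by simp
  then show ?thesis by (simp add: rho norm_mult power_mult_distrib mult_ac)
qed

text \<open>\<open>lhs\<close> and \<open>rhs\<close> are the two sides of
  \<open>even_entire_gap_le\<close> for \<open>w \<mapsto> f (z + w) * f (z - w)\<close>, times the
  Gaussian in \<open>z\<close>.\<close>

definition lhs :: "complex \<Rightarrow> ennreal" where
  "lhs z = ennreal (exp (- 2 * (cmod z)\<^sup>2)) * (3 * (\<integral>\<^sup>+ w. ennreal ((cmod (f (z + w) * f (z - w)))\<^sup>2 * exp (- 2 * (cmod w)\<^sup>2)) \<partial>lborel))"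

definition rhs :: "complex \<Rightarrow> ennreal" where
  "rhs z = ennreal (exp (- 2 * (cmod z)\<^sup>2)) * ((\<integral>\<^sup>+ w. ennreal (2 * (cmod w)\<^sup>2 * (cmod (f (z + w) * f (z - w)))\<^sup>2 * exp (- 2 * (cmod w)\<^sup>2)) \<partial>lborel) + ennreal (pi * (cmod (f (z + 0) * f (z - 0)))\<^sup>2))"

lemma lhs_eq: "lhs z = 3 * (\<integral>\<^sup>+ w. ennreal (\<rho> (z + w) * \<rho> (z - w)) \<partial>lborel)"
proof -
  have "(\<integral>\<^sup>+ w. ennreal (\<rho> (z + w) * \<rho> (z - w)) \<partial>lborel) =
    (\<integral>\<^sup>+ w. ennreal (exp (- 2 * (cmod z)\<^sup>2)) * ennreal ((cmod (f (z + w) * f (z - w)))\<^sup>2 * exp (- 2 * (cmod w)\<^sup>2)) \<partial>lborel)"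
    by (intro nn_integral_cong) (simp only: parallelogram_exp ennreal_mult[symmetric] exp_ge_zero zero_le_power2 mult_nonneg_nonneg)
  also have "\<dots> = ennreal (exp (- 2 * (cmod z)\<^sup>2)) * (\<integral>\<^sup>+ w. ennreal ((cmod (f (z + w) * f (z - w)))\<^sup>2 * exp (- 2 * (cmod w)\<^sup>2)) \<partial>lborel)"
    by (rule nn_integral_cmult) measurable
  finally show ?thesis unfolding lhs_def by (simp only: mult.left_commute)
qed

lemma rhs_eq: "rhs z = (\<integral>\<^sup>+ w. ennreal ((cmod ((z + w) - (z - w)))\<^sup>2 * \<rho> (z + w) * \<rho> (z - w)) \<partial>lborel) * ennreal (1/2) + ennreal pi * ennreal ((\<rho> z)\<^sup>2)"
proof -
  have 1: "(cmod ((z + w) - (z - w)))\<^sup>2 * \<rho> (z + w) * \<rho> (z - w) * (1/2) =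
    exp (- 2 * (cmod z)\<^sup>2) * (2 * (cmod w)\<^sup>2 * (cmod (f (z + w) * f (z - w)))\<^sup>2 * exp (- 2 * (cmod w)\<^sup>2))" for w
  proof -
    have "(z + w) - (z - w) = 2 * w" by simp
    then have "(cmod ((z + w) - (z - w)))\<^sup>2 = 4 * (cmod w)\<^sup>2" by (simp add: norm_mult power_mult_distrib)
    then show ?thesis using parallelogram_exp[of z w] by (simp add: mult_ac)
  qed
  have "(\<integral>\<^sup>+ w. ennreal ((cmod ((z + w) - (z - w)))\<^sup>2 * \<rho> (z + w) * \<rho> (z - w)) \<partial>lborel) * ennreal (1/2)
    = (\<integral>\<^sup>+ w. ennreal ((cmod ((z + w) - (z - w)))\<^sup>2 * \<rho> (z + w) * \<rho> (z - w)) * ennreal (1/2) \<partial>lborel)"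
    by (subst nn_integral_multc) auto
  also have "\<dots> = (\<integral>\<^sup>+ w. ennreal (exp (- 2 * (cmod z)\<^sup>2)) * ennreal (2 * (cmod w)\<^sup>2 * (cmod (f (z + w) * f (z - w)))\<^sup>2 * exp (- 2 * (cmod w)\<^sup>2)) \<partial>lborel)"
    using 1 by (intro nn_integral_cong) (simp only: ennreal_mult[symmetric] rho_nonneg zero_le_power2 mult_nonneg_nonneg exp_ge_zero zero_le_numeral zero_le_divide_1_iff)
  also have "\<dots> = ennreal (exp (- 2 * (cmod z)\<^sup>2)) * (\<integral>\<^sup>+ w. ennreal (2 * (cmod w)\<^sup>2 * (cmod (f (z + w) * f (z - w)))\<^sup>2 * exp (- 2 * (cmod w)\<^sup>2)) \<partial>lborel)"
    by (subst nn_integral_cmult) auto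
  finally have 2: "(\<integral>\<^sup>+ w. ennreal ((cmod ((z + w) - (z - w)))\<^sup>2 * \<rho> (z + w) * \<rho> (z - w)) \<partial>lborel) * ennreal (1/2) = \<dots>" .
  have "pi * (\<rho> z)\<^sup>2 = exp (- 2 * (cmod z)\<^sup>2) * (pi * (cmod (f (z + 0) * f (z - 0)))\<^sup>2)"
    using parallelogram_exp[of z 0] by (simp add: power2_eq_square)
  then have 3: "ennreal pi * ennreal ((\<rho> z)\<^sup>2) = ennreal (exp (- 2 * (cmod z)\<^sup>2)) * ennreal (pi * (cmod (f (z + 0) * f (z - 0)))\<^sup>2)"
    by (simp only: ennreal_mult[symmetric] exp_ge_zero zero_le_power2 mult_nonneg_nonneg pi_ge_zero)
  show ?thesis unfolding rhs_def distrib_left 2 3 ..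
qed

lemma lhs_meas [measurable]: "lhs \<in> borel_measurable borel"
proof -
  have "lhs = (\<lambda>z. 3 * (\<integral>\<^sup>+ w. ennreal (\<rho> (z + w) * \<rho> (z - w)) \<partial>lborel))" by (rule ext) (rule lhs_eq)
  then show ?thesis by simp
qed

lemma rhs_meas [measurable]: "rhs \<in> borel_measurable borel"
proof -
  have "rhs = (\<lambda>z. (\<integral>\<^sup>+ w. ennreal ((cmod ((z + w) - (z - w)))\<^sup>2 * \<rho> (z + w) * \<rho> (z - w)) \<partial>lborel) * ennreal (1/2) + ennreal pi * ennreal ((\<rho> z)\<^sup>2))"
    by (rule ext) (rule rhs_eq)
  then show ?thesis by simp
qed

lemma lhs_integral: "4 * (\<integral>\<^sup>+ z. lhs z \<partial>lborel) = 3"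
proof -
  have "(\<integral>\<^sup>+ x. \<integral>\<^sup>+ y. ennreal (\<rho> x * \<rho> y) \<partial>lborel \<partial>lborel) = 1"
    by (simp add: ennreal_mult rho_nonneg nn_integral_cmult rho_mass)
  then have "4 * (\<integral>\<^sup>+ z. \<integral>\<^sup>+ w. ennreal (\<rho> (z + w) * \<rho> (z - w)) \<partial>lborel \<partial>lborel) = 1"
    by (subst (asm) nn_integral_sum_difference) auto
  then have "3 * (4 * (\<integral>\<^sup>+ z. \<integral>\<^sup>+ w. ennreal (\<rho> (z + w) * \<rho> (z - w)) \<partial>lborel \<partial>lborel)) = 3" by simp
  then show ?thesis unfolding lhs_eq by (subst nn_integral_cmult) (auto simp: mult.left_commute)
qed

lemma rhs_integral: "4 * (\<integral>\<^sup>+ z. rhs z \<partial>lborel) = ennreal ((1 + psum c) - (cmod (dsum c))\<^sup>2 + 2 * qsum c)"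
proof -
  have q0: "qsum c \<ge> 0" unfolding qsum_def 
    using summable_bil[OF h1_imp_l2[OF h1] h1_imp_l2[OF h1]] by (intro suminf_nonneg) auto
  have "(\<integral>\<^sup>+ x. \<integral>\<^sup>+ y. ennreal ((cmod (x - y))\<^sup>2 * \<rho> x * \<rho> y) \<partial>lborel \<partial>lborel) = ennreal (2 * (1 + psum c) - 2 * (cmod (dsum c))\<^sup>2)"
    unfolding pair_moment[symmetric] by (rule lborel_pair.Fubini') simp
  then have 1: "4 * (\<integral>\<^sup>+ z. \<integral>\<^sup>+ w. ennreal ((cmod ((z + w) - (z - w)))\<^sup>2 * \<rho> (z + w) * \<rho> (z - w)) \<partial>lborel \<partial>lborel) = ennreal (2 * (1 + psum c) - 2 * (cmod (dsum c))\<^sup>2)"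
    by (subst (asm) nn_integral_sum_difference) auto
  \<comment> \<open>Half of the pair moment is the variance \<open>1 + psum c - |dsum c|^2\<close>;
    the quartic integral \<open>qsum c / (2 * pi)\<close> times \<open>4 * pi\<close> is
    \<open>2 * qsum c\<close>.\<close>
  have "4 * (\<integral>\<^sup>+ z. rhs z \<partial>lborel) = 4 * (\<integral>\<^sup>+ z. \<integral>\<^sup>+ w. ennreal ((cmod ((z + w) - (z - w)))\<^sup>2 * \<rho> (z + w) * \<rho> (z - w)) \<partial>lborel \<partial>lborel) * ennreal (1/2) + 4 * (ennreal pi * ennreal (qsum c / (2 * pi)))"
    unfolding rhs_eq by (subst nn_integral_add, simp, simp) (simp add: nn_integral_multc nn_integral_cmult rho_quartic distrib_left mult.assoc)
  also have "\<dots> = ennreal ((2 * (1 + psum c) - 2 * (cmod (dsum c))\<^sup>2) * (1/2)) + ennreal (4 * (pi * (qsum c / (2 * pi))))"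
    unfolding 1
  proof (rule arg_cong2[where f = "(+)"])
    show "ennreal (2 * (1 + psum c) - 2 * (cmod (dsum c))\<^sup>2) * ennreal (1/2) = ennreal ((2 * (1 + psum c) - 2 * (cmod (dsum c))\<^sup>2) * (1/2))"
      using dsum_le by (intro ennreal_mult[symmetric]) auto
    have "4 * (ennreal pi * ennreal (qsum c / (2 * pi))) = ennreal 4 * ennreal (pi * (qsum c / (2 * pi)))"
      using q0 by (simp only: ennreal_mult[of pi "qsum c / (2 * pi)"] pi_ge_zero ennreal_numeral divide_nonneg_nonneg zero_le_numeral mult_nonneg_nonneg)
    also have "\<dots> = ennreal (4 * (pi * (qsum c / (2 * pi))))"
      using q0 by (intro ennreal_mult[symmetric]) auto
    finally show "4 * (ennreal pi * ennreal (qsum c / (2 * pi))) = ennreal (4 * (pi * (qsum c / (2 * pi))))" .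
  qed
  also have "\<dots> = ennreal ((1 + psum c) - (cmod (dsum c))\<^sup>2 + 2 * qsum c)"
  proof -
    have "0 \<le> (2 * (1 + psum c) - 2 * (cmod (dsum c))\<^sup>2) * (1/2)" "0 \<le> 4 * (pi * (qsum c / (2 * pi)))"
      using dsum_le q0 by auto
    moreover have "(2 * (1 + psum c) - 2 * (cmod (dsum c))\<^sup>2) * (1/2) + 4 * (pi * (qsum c / (2 * pi))) = (1 + psum c) - (cmod (dsum c))\<^sup>2 + 2 * qsum c"
      by (simp add: diff_divide_distrib)
    ultimately show ?thesis by (simp only: ennreal_plus[symmetric])
  qed
  finally show ?thesis .
qed

lemma shifted_product_series: "(\<lambda>n. (deriv ^^ n) (\<lambda>w. f (z + w) * f (z - w)) 0 / fact n * w ^ n) sums (f (z + w) * f (z - w))"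
proof -
  have fh: "f holomorphic_on UNIV" by (rule power_series_entire[OF f])
  have "(\<lambda>w. f (z + w) * f (z - w)) holomorphic_on UNIV"
  proof (rule holomorphic_on_mult)
    have 1: "(\<lambda>w. z + w) holomorphic_on UNIV" "(\<lambda>w. z - w) holomorphic_on UNIV" by (intro holomorphic_intros)+
    show "(\<lambda>w. f (z + w)) holomorphic_on UNIV"
      using holomorphic_on_compose[OF 1(1) holomorphic_on_subset[OF fh subset_UNIV]] by (simp only: o_def)
    show "(\<lambda>w. f (z - w)) holomorphic_on UNIV"
      using holomorphic_on_compose[OF 1(2) holomorphic_on_subset[OF fh subset_UNIV]] by (simp only: o_def)
  qed
  then have "(\<lambda>w. f (z + w) * f (z - w)) holomorphic_on ball 0 (cmod w + 1)"
    by (rule holomorphic_on_subset) simp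
  from holomorphic_power_series[OF this, of w] show ?thesis by simp
qed

lemma lhs_le_rhs: "lhs z \<le> rhs z"
  unfolding lhs_def rhs_def
proof (rule mult_left_mono)
  have "f (z + - w) * f (z - - w) = f (z + w) * f (z - w)" for w by simp
  then show "3 * (\<integral>\<^sup>+ w. ennreal ((cmod (f (z + w) * f (z - w)))\<^sup>2 * exp (- 2 * (cmod w)\<^sup>2)) \<partial>lborel)
    \<le> (\<integral>\<^sup>+ w. ennreal (2 * (cmod w)\<^sup>2 * (cmod (f (z + w) * f (z - w)))\<^sup>2 * exp (- 2 * (cmod w)\<^sup>2)) \<partial>lborel) + ennreal (pi * (cmod (f (z + 0) * f (z - 0)))\<^sup>2)"
    by (rule even_entire_gap_le[OF shifted_product_series])
qed simp

text \<open>Integrated over \<open>z\<close>, the gap inequality reads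
  \<open>3 <= 1 + psum c - |dsum c|^2 + 2 * qsum c\<close>. The centre of mass is a bonus term, and
  it pins down \<open>\<beta>\<close> in the equality case.\<close>

lemma psum_qsum_ge: "psum c / 2 + qsum c \<ge> 1 + (cmod (dsum c))\<^sup>2 / 2"
proof -
  have "4 * (\<integral>\<^sup>+ z. lhs z \<partial>lborel) \<le> 4 * (\<integral>\<^sup>+ z. rhs z \<partial>lborel)"
    by (intro mult_left_mono nn_integral_mono lhs_le_rhs) auto
  then have "ennreal 3 \<le> ennreal ((1 + psum c) - (cmod (dsum c))\<^sup>2 + 2 * qsum c)"
    unfolding lhs_integral rhs_integral by simp
  then show ?thesis by (simp add: ennreal_le_iff2)
qed

text \<open>Equality leaves no room for the centre of mass and forces \<open>lhs = rhs\<close>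
  almost everywhere, hence equality in the gap at almost every \<open>z\<close>. Both sides of the
  resulting formula are continuous in \<open>z\<close>, so the set where they differ is open and
  null, that is, empty.\<close>

lemma equality_case:
  assumes eq: "psum c / 2 + qsum c = 1"
  shows "dsum c = 0" and "f (z + w) * f (z - w) = (f z)\<^sup>2 + (f (z + 1) * f (z - 1) - (f z)\<^sup>2) * w\<^sup>2"
proof -
  show D: "dsum c = 0" using psum_qsum_ge eq by simp
  have "4 * (\<integral>\<^sup>+ z. lhs z \<partial>lborel) = 4 * (\<integral>\<^sup>+ z. rhs z \<partial>lborel)"
    unfolding lhs_integral rhs_integral using eq D by (simp add: field_simps)
  then have I: "(\<integral>\<^sup>+ z. lhs z \<partial>lborel) = (\<integral>\<^sup>+ z. rhs z \<partial>lborel)"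
    by (subst (asm) ennreal_mult_cancel_left) auto
  have fin: "(\<integral>\<^sup>+ z. lhs z \<partial>lborel) < \<infinity>"
  proof (rule ccontr)
    assume "\<not> ?thesis" then show False using lhs_integral by (simp add: not_less top_unique ennreal_mult_top)
  qed
  have "AE z in lborel. lhs z = rhs z"
    by (rule nn_integral_eq_imp_AE_eq) (use lhs_le_rhs I fin in auto)
  moreover have "AE z in lborel. lhs z \<noteq> \<infinity>"
    by (rule nn_integral_noteq_infinite) (use fin in auto)
  ultimately have AE: "AE z in lborel. \<forall>w. f (z + w) * f (z - w) = (f z)\<^sup>2 + (f (z + 1) * f (z - 1) - (f z)\<^sup>2) * w\<^sup>2"
  proof eventually_elim
    case (elim z)
    let ?e = "ennreal (exp (- 2 * (cmod z)\<^sup>2))"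
    have e: "?e \<noteq> 0" "?e \<noteq> \<top>" by auto
    let ?I = "\<integral>\<^sup>+ w. ennreal ((cmod (f (z + w) * f (z - w)))\<^sup>2 * exp (- 2 * (cmod w)\<^sup>2)) \<partial>lborel"
    have 1: "3 * ?I = (\<integral>\<^sup>+ w. ennreal (2 * (cmod w)\<^sup>2 * (cmod (f (z + w) * f (z - w)))\<^sup>2 * exp (- 2 * (cmod w)\<^sup>2)) \<partial>lborel) + ennreal (pi * (cmod (f (z + 0) * f (z - 0)))\<^sup>2)"
      using elim(1) e unfolding lhs_def rhs_def by (subst (asm) ennreal_mult_cancel_left) auto
    have "?I \<noteq> \<top>"
    proof
      assume "?I = \<top>" then show False using elim(2) e unfolding lhs_def by (simp add: ennreal_mult_top)
    qed
    then have 2: "?I < \<infinity>" by (simp add: less_top)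
    have G: "f (z + w) * f (z - w) = f (z + 0) * f (z - 0) + (f (z + 1) * f (z - 1) - f (z + 0) * f (z - 0)) * w\<^sup>2" for w
      by (rule even_entire_gap_eq[OF shifted_product_series _ 1 2]) simp
    have z0: "f (z + 0) * f (z - 0) = (f z)\<^sup>2" by (simp add: power2_eq_square)
    show ?case by (rule allI) (rule G[unfolded z0])
  qed
  have eqs: "F z = G z" if "AE z in lborel. F z = G z" "continuous_on UNIV F" "continuous_on UNIV G" for F G :: "complex \<Rightarrow> complex" and z
  proof -
    have "open {z. F z \<noteq> G z}" by (rule open_Collect_neq[OF that(2,3)])
    then have "{z \<in> space lborel. \<not> (F z = G z)} \<in> sets lborel" by simp
    from AE_iff_null[OF this] that(1) have "{z. F z \<noteq> G z} \<in> null_sets lborel" by simp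
    then have "negligible {z. F z \<noteq> G z}" using negligible_iff_null_sets null_sets_completionI by blast
    then have "{z. F z \<noteq> G z} = {}" using open_not_negligible[OF \<open>open {z. F z \<noteq> G z}\<close>] by blast
    then show ?thesis by blast
  qed
  show "f (z + w) * f (z - w) = (f z)\<^sup>2 + (f (z + 1) * f (z - 1) - (f z)\<^sup>2) * w\<^sup>2"
    by (rule eqs[where F = "\<lambda>z. f (z + w) * f (z - w)" and G = "\<lambda>z. (f z)\<^sup>2 + (f (z + 1) * f (z - 1) - (f z)\<^sup>2) * w\<^sup>2"])
      (rule eventually_mono[OF AE], erule spec, (intro continuous_intros continuous_on_compose2[OF f_cont[of UNIV]]; simp)+)
qed

end

section \<open>The equality case\<close>

text \<open>Midpoint and half difference turn the hypothesis into
  \<open>h (x + y) * h 0 = h x * h y\<close>; its derivative in \<open>y\<close> at 0 is a linear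
  differential equation with constant coefficient.\<close>

lemma multiplicative_entire:
  fixes h :: "complex \<Rightarrow> complex"
  assumes hol: "h holomorphic_on UNIV" and nz: "\<And>z. h z \<noteq> 0"
    and mult: "\<And>z w. h (z + w) * h (z - w) = (h z)\<^sup>2"
  obtains \<beta> where "\<And>z. h z = h 0 * exp (\<beta> * z)"
proof -
  have add: "h (x + y) * h 0 = h x * h y" for x y
  proof -
    have "(x + y) / 2 + (x + y) / 2 = x + y" "(x + y) / 2 + (x - y) / 2 = x" "(x + y) / 2 - (x - y) / 2 = y"
      by (simp_all add: field_simps)
    then show ?thesis using mult[of "(x + y) / 2" "(x + y) / 2"] mult[of "(x + y) / 2" "(x - y) / 2"] by simp
  qed
  define \<beta> where "\<beta> = deriv h 0 / h 0"
  have d: "(h has_field_derivative deriv h z) (at z)" for z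
    using hol by (meson holomorphic_derivI open_UNIV UNIV_I)
  have dh: "deriv h z = \<beta> * h z" for z
  proof -
    have "((\<lambda>y. h (z + y) * h 0) has_field_derivative deriv h z * h 0) (at 0)"
    proof -
      have 1: "(h has_field_derivative deriv h z) (at (z + 0))" using d by simp
      have 2: "((\<lambda>y. z + y) has_field_derivative 1) (at 0)" by (auto intro!: derivative_eq_intros)
      show ?thesis using DERIV_cmult_right[OF DERIV_chain2[OF 1 2], of "h 0"] by (simp only: mult_1_right)
    qed
    moreover have "((\<lambda>y. h z * h y) has_field_derivative h z * deriv h 0) (at 0)"
      using d[of 0] by (rule DERIV_cmult)
    ultimately have "deriv h z * h 0 = h z * deriv h 0"
      using DERIV_unique unfolding add by blast
    then show ?thesis using nz[of 0] by (simp add: \<beta>_def field_simps)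
  qed
  have "((\<lambda>z. h z * exp (- \<beta> * z)) has_field_derivative 0) (at z)" for z
    using d[of z] unfolding dh by (auto intro!: derivative_eq_intros simp: algebra_simps)
  then obtain k where k: "\<And>z. h z * exp (- \<beta> * z) = k"
    using has_field_derivative_zero_constant[of UNIV "\<lambda>z. h z * exp (- \<beta> * z)"] by auto
  have "h z = h 0 * exp (\<beta> * z)" for z
    using k[of z] k[of 0] by (simp add: exp_minus field_simps)
  then show ?thesis using that by blast
qed

text \<open>Zeros of \<open>f\<close> are isolated, so a small nonzero \<open>w\<close> moves both
  factors off the zero set.\<close>

lemma product_zero_entire:
  fixes f :: "complex \<Rightarrow> complex"
  assumes hol: "f holomorphic_on UNIV" and nz: "f p \<noteq> 0"
  shows "\<exists>w. f (z + w) * f (z - w) \<noteq> 0"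
proof (rule ccontr)
  assume "\<not> ?thesis"
  then have 0: "f (z + w) * f (z - w) = 0" for w by blast
  obtain e where e: "e > 0" "\<And>w. w \<in> ball z e - {z} \<Longrightarrow> f w \<noteq> 0"
  proof (cases "f z = 0")
    case True
    obtain r where "0 < r" "ball z r \<subseteq> UNIV" "\<And>w. w \<in> ball z r - {z} \<Longrightarrow> f w \<noteq> 0"
      by (rule isolated_zeros[OF hol open_UNIV connected_UNIV UNIV_I True UNIV_I nz]) blast
    then show ?thesis using that by blast
  next
    case False
    have "continuous_on UNIV f" using hol by (rule holomorphic_on_imp_continuous_on)
    then have "open {w. f w \<noteq> 0}" by (intro open_Collect_neq continuous_intros)
    then obtain r where "r > 0" "ball z r \<subseteq> {w. f w \<noteq> 0}" using False unfolding open_contains_ball by blast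
    then show ?thesis using that by blast
  qed
  have "z + of_real (e/2) \<in> ball z e - {z}" "z - of_real (e/2) \<in> ball z e - {z}"
    using e(1) by (auto simp: dist_norm)
  then show False using e(2) 0[of "of_real (e/2)"] unfolding mult_eq_0_iff by blast
qed

text \<open>A zero \<open>\<zeta>\<close> of \<open>f\<close> determines the coefficient \<open>g\<close>: put \<open>z + w = \<zeta>\<close>.\<close>

lemma quadratic_product_classification:
  fixes f g :: "complex \<Rightarrow> complex"
  assumes hol: "f holomorphic_on UNIV" and nz: "f p \<noteq> 0"
    and eq: "\<And>z w. f (z + w) * f (z - w) = (f z)\<^sup>2 + g z * w\<^sup>2"
  obtains (exponential) \<gamma> \<beta> where "\<And>z. f z = \<gamma> * exp (\<beta> * z)"
    | (linear) \<gamma> \<beta> \<zeta> where "\<And>z. f z = \<gamma> * (z - \<zeta>) * exp (\<beta> * z)"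
proof (cases "\<exists>\<zeta>. f \<zeta> = 0")
  case False
  have g0: "g z = 0" for z
  proof (rule ccontr)
    assume g: "g z \<noteq> 0"
    \<comment> \<open>If \<open>g z\<close> is nonzero, this \<open>w\<close> makes the right side
      of \<open>eq\<close> vanish and so produces a zero of \<open>f\<close>.\<close>
    define w where "w = csqrt (- (f z)\<^sup>2 / g z)"
    have "f (z + w) * f (z - w) = 0" unfolding eq w_def using g by simp
    then show False using False by auto
  qed
  obtain \<beta> where "\<And>z. f z = f 0 * exp (\<beta> * z)"
    using multiplicative_entire[OF hol] False eq g0 by (metis add.right_neutral mult_zero_left)
  then show ?thesis by (rule exponential)
next
  case True
  then obtain \<zeta> where \<zeta>: "f \<zeta> = 0" by blast
  have g: "(f z)\<^sup>2 + g z * (\<zeta> - z)\<^sup>2 = 0" for z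
    using eq[of z "\<zeta> - z"] \<zeta> by simp
  have z1: "f z \<noteq> 0" if "z \<noteq> \<zeta>" for z
  proof
    assume "f z = 0"
    then have "g z = 0" using g[of z] that by simp
    then show False using product_zero_entire[OF hol nz, of z] eq[of z] \<open>f z = 0\<close> by simp
  qed
  obtain h where h: "h holomorphic_on UNIV" "\<And>z. f z = (z - \<zeta>) * h z"
  proof
    show "(\<lambda>z. if z = \<zeta> then deriv f \<zeta> else (f z - f \<zeta>) / (z - \<zeta>)) holomorphic_on UNIV"
      by (rule pole_theorem_open_0[where g = f and a = \<zeta>])
         (use hol in \<open>auto simp: \<zeta>\<close>)
  qed (auto simp: \<zeta>)
  \<comment> \<open>Since \<open>g z * (\<zeta> - z)^2 = - (f z)^2\<close>, the right side of
    \<open>eq\<close> is \<open>(f z)^2\<close> times \<open>1 - w^2 / (z - \<zeta>)^2\<close>. The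
    linear factors contribute the same, so the quotient \<open>h\<close> satisfies the equation of
    \<open>multiplicative_entire\<close>.\<close>
  have hm: "h (z + w) * h (z - w) = (h z)\<^sup>2" if "z \<noteq> \<zeta>" "z + w \<noteq> \<zeta>" "z - w \<noteq> \<zeta>" for z w
  proof -
    have "((z + w - \<zeta>) * (z - w - \<zeta>)) * (h (z + w) * h (z - w)) * (z - \<zeta>)\<^sup>2 = (f (z + w) * f (z - w)) * (z - \<zeta>)\<^sup>2"
      unfolding h(2) by (simp add: mult_ac)
    also have "\<dots> = (f z)\<^sup>2 * (z - \<zeta>)\<^sup>2 + (g z * (\<zeta> - z)\<^sup>2) * w\<^sup>2"
      unfolding eq by (simp add: power2_commute[of \<zeta> z] algebra_simps)
    also have "g z * (\<zeta> - z)\<^sup>2 = - (f z)\<^sup>2" using g[of z] by (simp add: eq_neg_iff_add_eq_0 add.commute)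
    also have "(f z)\<^sup>2 * (z - \<zeta>)\<^sup>2 + - (f z)\<^sup>2 * w\<^sup>2 = ((z + w - \<zeta>) * (z - w - \<zeta>)) * (h z)\<^sup>2 * (z - \<zeta>)\<^sup>2"
      unfolding h(2) by (simp add: algebra_simps power2_eq_square)
    finally show ?thesis using that by simp
  qed
  have hc: "continuous_on A h" for A using h(1) holomorphic_on_imp_continuous_on continuous_on_subset by blast
  have dense: "F x = G x" if "finite S" "\<And>z. z \<notin> S \<Longrightarrow> F z = G z" "continuous_on UNIV F" "continuous_on UNIV G" for S and F G :: "complex \<Rightarrow> complex" and x
  proof -
    have "open {z. F z \<noteq> G z}" by (rule open_Collect_neq[OF that(3,4)])
    moreover have "finite {z. F z \<noteq> G z}" by (rule finite_subset[OF _ that(1)]) (use that(2) in blast)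
    ultimately have "{z. F z \<noteq> G z} = {}" using finite_imp_not_open by blast
    then show ?thesis by blast
  qed
  have hm': "h (z + w) * h (z - w) = (h z)\<^sup>2" for z w
  proof (rule dense[where S = "{\<zeta>, \<zeta> - w, \<zeta> + w}" and F = "\<lambda>z. h (z + w) * h (z - w)" and G = "\<lambda>z. (h z)\<^sup>2"])
    show "h (z + w) * h (z - w) = (h z)\<^sup>2" if "z \<notin> {\<zeta>, \<zeta> - w, \<zeta> + w}" for z
      by (rule hm) (use that in auto)
  qed (simp, (intro continuous_intros continuous_on_compose2[OF hc[of UNIV]]; simp)+)
  have hnz: "h z \<noteq> 0" for z
  proof
    assume "h z = 0"
    have "f q \<noteq> 0 \<Longrightarrow> h q \<noteq> 0" for q using h(2)[of q] by auto
    then have "h p \<noteq> 0" using nz by blast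
    from product_zero_entire[OF h(1) this, of z] show False using hm'[of z] \<open>h z = 0\<close> by simp
  qed
  obtain \<beta> where "\<And>z. h z = h 0 * exp (\<beta> * z)" using multiplicative_entire[OF h(1) hnz hm'] by blast
  then have "f z = h 0 * (z - \<zeta>) * exp (\<beta> * z)" for z unfolding h(2)[of z] by (metis mult.assoc mult.commute)
  then show ?thesis by (rule linear)
qed

text \<open>Below \<open>a n\<close> are the Taylor coefficients of \<open>\<gamma> (z - \<zeta>) exp (\<beta> z)\<close>.\<close>

context fock_state
begin

lemma linear_exp_state:
  assumes lin: "\<And>z. f z = \<gamma> * (z - \<zeta>) * exp (\<beta> * z)"
  defines "e \<equiv> cnj \<beta> - \<zeta>" and "W \<equiv> pi * (cmod \<gamma>)\<^sup>2 * exp ((cmod \<beta>)\<^sup>2)"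
  shows linear_exp_mass: "W * (1 + (cmod e)\<^sup>2) = 1"
    and linear_exp_dsum: "cnj (dsum c) = \<beta> + W * cnj e"
    and linear_exp_psum: "psum c = (cmod \<beta>)\<^sup>2 + 2 * Re (cnj \<beta> * W * cnj e) + W"
proof -
  define E where "E n = \<beta> ^ n / fact n" for n
  have Es: "(\<lambda>n. E n * z ^ n) sums exp (\<beta> * z)" for z
    using exp_converges[of "\<beta> * z"] unfolding E_def
    by (simp add: scaleR_conv_of_real power_mult_distrib divide_inverse mult_ac)
  have fs: "(\<lambda>n. \<gamma> * ((case n of 0 \<Rightarrow> 0 | Suc m \<Rightarrow> E m) - \<zeta> * E n) * z ^ n) sums f z" for z
  proof -
    have "(\<lambda>n. z * (E n * z ^ n)) sums (z * exp (\<beta> * z))" by (rule sums_mult) (rule Es)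
    then have "(\<lambda>n. (case Suc n of 0 \<Rightarrow> 0 | Suc m \<Rightarrow> E m) * z ^ Suc n) sums (z * exp (\<beta> * z))" by (simp add: mult_ac)
    then have "(\<lambda>n. (case n of 0 \<Rightarrow> 0 | Suc m \<Rightarrow> E m) * z ^ n) sums (z * exp (\<beta> * z))"
      by (subst (asm) sums_Suc_iff) simp
    from sums_mult[OF sums_diff[OF this sums_mult[OF Es[of z], of \<zeta>]], of \<gamma>] show ?thesis
      unfolding lin by (simp add: algebra_simps)
  qed
  have a: "a n = \<gamma> * ((case n of 0 \<Rightarrow> 0 | Suc m \<Rightarrow> E m) - \<zeta> * E n)" for n
    by (rule power_series_unique[OF f fs])
  have ES: "of_nat (Suc n) * E (Suc n) = \<beta> * E n" for n
    unfolding E_def by (simp add: field_simps del: of_nat_Suc)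
  have Ef: "fact n * E n = \<beta> ^ n" for n by (simp add: E_def)
  \<comment> \<open>Coefficient form of \<open>f' = \<beta> f + \<gamma> exp (\<beta> z)\<close>. It
    reduces the moments to the mass and to pairings with the exponential.\<close>
  have aS: "of_nat (Suc n) * a (Suc n) = \<beta> * a n + \<gamma> * E n" for n
  proof -
    have "of_nat (Suc n) * a (Suc n) = \<gamma> * (of_nat (Suc n) * E n - \<zeta> * (of_nat (Suc n) * E (Suc n)))"
      unfolding a nat.case by (simp only: right_diff_distrib mult_ac)
    also have "\<dots> = \<gamma> * ((of_nat n * E n + E n) - \<zeta> * (\<beta> * E n))" unfolding ES by (simp add: algebra_simps)
    also have "of_nat n * E n = \<beta> * (case n of 0 \<Rightarrow> 0 | Suc m \<Rightarrow> E m)" using ES by (cases n) (auto simp del: of_nat_Suc)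
    finally show ?thesis unfolding a by (simp add: algebra_simps)
  qed
  let ?s = "exp ((cmod \<beta>)\<^sup>2)"
  have es: "exp (\<beta> * cnj \<beta>) = of_real ?s" unfolding complex_norm_square[symmetric] exp_of_real ..
  have fb: "f (cnj \<beta>) = \<gamma> * e * of_real ?s" unfolding lin e_def es ..
  have W: "of_real W = of_real pi * \<gamma> * cnj \<gamma> * of_real ?s" unfolding W_def of_real_mult complex_norm_square by simp
  \<comment> \<open>The exponential is the reproducing kernel: pairing it with \<open>f\<close>
    evaluates \<open>f\<close> at \<open>cnj \<beta>\<close>.\<close>
  have s0: "(\<lambda>n. \<beta> ^ n * cnj (a n)) sums cnj (f (cnj \<beta>))"
    using f[of "cnj \<beta>"] sums_cnj[of "\<lambda>n. a n * cnj \<beta> ^ n" "f (cnj \<beta>)"] by (simp add: mult.commute)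
  have sb: "(\<lambda>n. of_real pi * \<gamma> * (\<beta> ^ n * cnj (a n))) sums (W * cnj e)"
    using sums_mult[OF s0, of "of_real pi * \<gamma>"] unfolding fb W by (simp add: mult_ac)
  have cc: "of_real ((cmod (c n))\<^sup>2) = of_real pi * fact n * (a n * cnj (a n))" for n
  proof -
    have "(cmod (c n))\<^sup>2 = pi * fact n * (cmod (a n))\<^sup>2"
      unfolding c by (simp add: norm_mult power_mult_distrib)
    then show ?thesis by (simp only: of_real_mult complex_norm_square of_real_fact)
  qed
  have ms: "(\<lambda>n. of_real ((cmod (c n))\<^sup>2)) sums (1 :: complex)"
    using h1_imp_l2[OF h1] m1 unfolding l2_def msum_def by (metis of_real_1 sums_of_real summable_sums)
  have dterm: "cnj (of_real (sqrt (real (n + 1))) * c n * cnj (c (n + 1))) = \<beta> * of_real ((cmod (c n))\<^sup>2) + of_real pi * \<gamma> * (\<beta> ^ n * cnj (a n))" for n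
  proof -
    have r: "sqrt (real (n + 1)) * sqrt (pi * fact n) * sqrt (pi * fact (n + 1)) = pi * fact n * real (n + 1)"
    proof -
      have "pi * fact (n + 1) = real (n + 1) * (pi * fact n)" by simp
      then have "sqrt (pi * fact (n + 1)) = sqrt (real (n + 1)) * sqrt (pi * fact n)" by (simp only: real_sqrt_mult)
      then have "sqrt (real (n + 1)) * sqrt (pi * fact n) * sqrt (pi * fact (n + 1)) = (sqrt (real (n + 1)))\<^sup>2 * (sqrt (pi * fact n))\<^sup>2"
        by (simp only: power2_eq_square mult_ac)
      then show ?thesis by (simp add: mult.commute)
    qed
    have "cnj (of_real (sqrt (real (n + 1))) * c n * cnj (c (n + 1))) = of_real (sqrt (real (n + 1)) * sqrt (pi * fact n) * sqrt (pi * fact (n + 1))) * (cnj (a n) * a (n + 1))"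
      unfolding c by (simp add: mult_ac)
    also have "\<dots> = of_real pi * fact n * cnj (a n) * (of_nat (Suc n) * a (Suc n))"
      unfolding r by (simp add: mult_ac)
    also have "\<dots> = \<beta> * (of_real pi * fact n * (a n * cnj (a n))) + of_real pi * \<gamma> * ((fact n * E n) * cnj (a n))"
      unfolding aS by (simp add: algebra_simps)
    finally show ?thesis unfolding cc Ef .
  qed
  have "(\<lambda>n. cnj (of_real (sqrt (real (n + 1))) * c n * cnj (c (n + 1)))) sums (\<beta> * 1 + W * cnj e)"
    unfolding dterm by (intro sums_add sums_mult ms sb)
  moreover have "(\<lambda>n. cnj (of_real (sqrt (real (n + 1))) * c n * cnj (c (n + 1)))) sums cnj (dsum c)"
    unfolding dsum_def sums_cnj by (intro summable_sums dsum_summable h1)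
  ultimately show "cnj (dsum c) = \<beta> + W * cnj e" using sums_unique2 by fastforce
  have pterm: "real (Suc n) * (cmod (c (Suc n)))\<^sup>2 = (cmod \<beta>)\<^sup>2 * (cmod (c n))\<^sup>2 + 2 * Re (cnj \<beta> * (of_real pi * \<gamma> * (\<beta> ^ n * cnj (a n)))) + pi * (cmod \<gamma>)\<^sup>2 * (((cmod \<beta>)\<^sup>2) ^ n / fact n)" for n
  proof -
    have cn: "(cmod (c n))\<^sup>2 = pi * fact n * (cmod (a n))\<^sup>2" for n
      unfolding c by (simp add: norm_mult power_mult_distrib)
    have "real (Suc n) * (cmod (c (Suc n)))\<^sup>2 = pi * fact n * (cmod (of_nat (Suc n) * a (Suc n)))\<^sup>2"
      unfolding cn norm_mult norm_of_nat by (simp add: power2_eq_square)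
    also have "\<dots> = pi * fact n * ((cmod (\<beta> * a n))\<^sup>2 + (cmod (\<gamma> * E n))\<^sup>2 + 2 * Re (cnj (\<beta> * a n) * (\<gamma> * E n)))"
      unfolding aS cmod_power2 by (simp add: power2_eq_square algebra_simps)
    also have "\<dots> = (cmod \<beta>)\<^sup>2 * (pi * fact n * (cmod (a n))\<^sup>2) + pi * (cmod \<gamma>)\<^sup>2 * (fact n * (cmod (E n))\<^sup>2) + 2 * (pi * fact n * Re (cnj (\<beta> * a n) * (\<gamma> * E n)))"
      by (simp add: norm_mult power_mult_distrib algebra_simps)
    also have "fact n * (cmod (E n))\<^sup>2 = ((cmod \<beta>)\<^sup>2) ^ n / fact n"
      by (simp add: E_def norm_divide norm_power power_divide power2_eq_square power_mult_distrib)
    also have "pi * fact n * Re (cnj (\<beta> * a n) * (\<gamma> * E n)) = Re (of_real (pi * fact n) * (cnj (\<beta> * a n) * (\<gamma> * E n)))"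
    proof -
      have "r * Re x = Re (of_real r * x)" for r x by simp
      then show ?thesis .
    qed
    also have "of_real (pi * fact n) * (cnj (\<beta> * a n) * (\<gamma> * E n)) = cnj \<beta> * (of_real pi * \<gamma> * ((fact n * E n) * cnj (a n)))"
      by (simp add: mult_ac)
    finally show ?thesis unfolding cn Ef by simp
  qed
  have "(\<lambda>n. (cmod \<beta>)\<^sup>2 * (cmod (c n))\<^sup>2 + 2 * Re (cnj \<beta> * (of_real pi * \<gamma> * (\<beta> ^ n * cnj (a n)))) + pi * (cmod \<gamma>)\<^sup>2 * (((cmod \<beta>)\<^sup>2) ^ n / fact n))
     sums ((cmod \<beta>)\<^sup>2 * 1 + 2 * Re (cnj \<beta> * (W * cnj e)) + pi * (cmod \<gamma>)\<^sup>2 * ?s)"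
  proof (intro sums_add sums_mult sums_Re sb)
    show "(\<lambda>n. (cmod (c n))\<^sup>2) sums 1" using h1_imp_l2[OF h1] m1 unfolding l2_def msum_def by (metis summable_sums)
    show "(\<lambda>n. ((cmod \<beta>)\<^sup>2) ^ n / fact n) sums ?s" using exp_converges[of "(cmod \<beta>)\<^sup>2"] by (simp add: divide_inverse_commute)
  qed
  then have "(\<lambda>n. real (Suc n) * (cmod (c (Suc n)))\<^sup>2) sums ((cmod \<beta>)\<^sup>2 * 1 + 2 * Re (cnj \<beta> * (W * cnj e)) + pi * (cmod \<gamma>)\<^sup>2 * ?s)"
    unfolding pterm .
  then have "(\<lambda>n. real n * (cmod (c n))\<^sup>2) sums ((cmod \<beta>)\<^sup>2 * 1 + 2 * Re (cnj \<beta> * (W * cnj e)) + pi * (cmod \<gamma>)\<^sup>2 * ?s)"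
    by (subst (asm) sums_Suc_iff) simp
  then show "psum c = (cmod \<beta>)\<^sup>2 + 2 * Re (cnj \<beta> * W * cnj e) + W"
    unfolding psum_def by (simp add: sums_iff W_def mult.assoc)
  have mterm: "of_real ((cmod (c n))\<^sup>2) = of_real pi * \<gamma> * (of_nat n * (\<beta> ^ (n - 1) * cnj (a n))) - \<zeta> * (of_real pi * \<gamma> * (\<beta> ^ n * cnj (a n)))" for n
  proof -
    have "fact n * (case n of 0 \<Rightarrow> 0 | Suc m \<Rightarrow> E m) = of_nat n * \<beta> ^ (n - 1)"
      using Ef by (cases n) (auto simp: mult.assoc algebra_simps)
    moreover have "of_real ((cmod (c n))\<^sup>2) = of_real pi * \<gamma> * cnj (a n) * (fact n * (case n of 0 \<Rightarrow> 0 | Suc m \<Rightarrow> E m) - \<zeta> * (fact n * E n))"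
      unfolding cc by (subst (1) a) (simp add: algebra_simps)
    ultimately show ?thesis unfolding Ef by (simp add: algebra_simps)
  qed
  have sd: "(\<lambda>n. of_real pi * \<gamma> * (of_nat n * (\<beta> ^ (n - 1) * cnj (a n)))) sums (W * (1 + cnj \<beta> * cnj e))"
  proof -
    have "(\<lambda>n. ((cmod \<beta>)\<^sup>2) ^ n / fact n) sums ?s"
      using exp_converges[of "(cmod \<beta>)\<^sup>2"] by (simp add: divide_inverse_commute)
    then have "(\<lambda>n. complex_of_real (((cmod \<beta>)\<^sup>2) ^ n / fact n)) sums of_real ?s" by (simp only: sums_of_real_iff)
    then have "(\<lambda>n. cnj \<beta> * (of_real pi * \<gamma> * (\<beta> ^ n * cnj (a n))) + of_real pi * \<gamma> * cnj \<gamma> * complex_of_real (((cmod \<beta>)\<^sup>2) ^ n / fact n)) sums (cnj \<beta> * (W * cnj e) + of_real pi * \<gamma> * cnj \<gamma> * of_real ?s)"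
      by (intro sums_add sums_mult sb)
    moreover have "cnj \<beta> * (of_real pi * \<gamma> * (\<beta> ^ n * cnj (a n))) + of_real pi * \<gamma> * cnj \<gamma> * complex_of_real (((cmod \<beta>)\<^sup>2) ^ n / fact n)
      = of_real pi * \<gamma> * (of_nat (Suc n) * (\<beta> ^ (Suc n - 1) * cnj (a (Suc n))))" for n
    proof -
      have 1: "of_nat (Suc n) * cnj (a (Suc n)) = cnj \<beta> * cnj (a n) + cnj \<gamma> * cnj (E n)"
        using arg_cong[OF aS[of n], of cnj] by (simp del: of_nat_Suc)
      have 2: "complex_of_real (((cmod \<beta>)\<^sup>2) ^ n / fact n) = \<beta> ^ n * cnj (E n)"
      proof -
        have "complex_of_real (((cmod \<beta>)\<^sup>2) ^ n / fact n) = (complex_of_real ((cmod \<beta>)\<^sup>2)) ^ n / fact n"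
          by simp
        then show ?thesis unfolding complex_norm_square E_def by (simp add: power_mult_distrib)
      qed
      have "of_real pi * \<gamma> * (of_nat (Suc n) * (\<beta> ^ (Suc n - 1) * cnj (a (Suc n)))) = of_real pi * \<gamma> * (\<beta> ^ n * (of_nat (Suc n) * cnj (a (Suc n))))"
        by (simp add: mult_ac del: of_nat_Suc)
      then show ?thesis unfolding 1 2 by (simp add: algebra_simps)
    qed
    ultimately have "(\<lambda>n. of_real pi * \<gamma> * (of_nat (Suc n) * (\<beta> ^ (Suc n - 1) * cnj (a (Suc n))))) sums (cnj \<beta> * (W * cnj e) + of_real W)"
      unfolding W by (simp only:)
    then show ?thesis by (subst (asm) sums_Suc_iff) (simp add: algebra_simps)
  qed
  have "(\<lambda>n. of_real ((cmod (c n))\<^sup>2)) sums (W * (1 + cnj \<beta> * cnj e) - \<zeta> * (W * cnj e))"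
    unfolding mterm using sums_diff[OF sd sums_mult[OF sb, of \<zeta>]] by simp
  from sums_unique2[OF this ms] have "of_real W * (1 + e * cnj e) = 1"
    by (simp add: e_def algebra_simps)
  then have "of_real (W * (1 + (cmod e)\<^sup>2)) = (1 :: complex)"
    unfolding of_real_mult of_real_add complex_norm_square by simp
  then show "W * (1 + (cmod e)\<^sup>2) = 1" by (simp only: of_real_eq_1_iff)
qed

text \<open>A centre of mass at 0 reduces the exponential case to the ground state, which
  \<open>psum c \<ge> 1\<close> excludes. In the linear case it gives
  \<open>psum c = W - |\<beta>|^2\<close> with \<open>W \<le> 1\<close>, so
  \<open>psum c \<ge> 1\<close> forces \<open>\<beta> = 0\<close> and
  \<open>\<zeta> = 0\<close>.\<close>

lemma equality_case_phi1:
  assumes eq: "psum c / 2 + qsum c = 1" and p: "psum c \<ge> 1"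
  shows "cmod (c 1) = 1"
proof -
  have hol: "f holomorphic_on UNIV" by (rule power_series_entire[OF f])
  obtain p where nz: "f p \<noteq> 0"
  proof (rule ccontr)
    assume "\<not> thesis"
    then have "f z = 0" for z using that by blast
    then have "\<rho> z = 0" for z by (simp add: rho)
    then show False using rho_mass by simp
  qed
  note D = equality_case(1)[OF eq]
  have exp_sums: "(\<lambda>n. \<gamma> * \<beta> ^ n / fact n * z ^ n) sums (\<gamma> * exp (\<beta> * z))" for \<gamma> \<beta> z :: complex
  proof -
    have "\<gamma> * ((\<beta> * z) ^ n /\<^sub>R fact n) = \<gamma> * \<beta> ^ n / fact n * z ^ n" for n
      by (simp add: scaleR_conv_of_real power_mult_distrib field_simps)
    then show ?thesis using sums_mult[OF exp_converges[of "\<beta> * z"], of \<gamma>] by (simp only:)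
  qed
  have c1: "cmod (c 1) = 1" if a: "\<And>n. n \<noteq> 1 \<Longrightarrow> a n = 0"
  proof -
    have "msum c = (\<Sum>n\<in>{1}. (cmod (c n))\<^sup>2)"
      unfolding msum_def by (rule suminf_finite) (auto simp: c a)
    then have "(cmod (c 1))\<^sup>2 = 1" using m1 by simp
    then show ?thesis by (simp add: power2_eq_1_iff) (metis abs_norm_cancel abs_1 abs_minus power2_eq_iff)
  qed
  show ?thesis
  proof (cases rule: quadratic_product_classification[OF hol nz, of "\<lambda>z. f (z + 1) * f (z - 1) - (f z)\<^sup>2"])
    case 1
    show ?case by (rule equality_case(2)[OF eq])
  next
    case (2 \<gamma> \<beta>)
    have a: "a n = \<gamma> * \<beta> ^ n / fact n" for n
      by (rule power_series_unique[OF f]) (use exp_sums 2 in simp)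
    have "of_real (sqrt (real (n + 1))) * c n * cnj (c (n + 1)) = cnj \<beta> * of_real ((cmod (c n))\<^sup>2)" for n
    proof -
      have "pi * fact (n + 1) = real (n + 1) * (pi * fact n)" by simp
      then have "sqrt (pi * fact (n + 1)) = sqrt (real (n + 1)) * sqrt (pi * fact n)" by (simp only: real_sqrt_mult)
      then have "sqrt (real (n + 1)) * sqrt (pi * fact (n + 1)) = (sqrt (real (n + 1)))\<^sup>2 * sqrt (pi * fact n)"
        by (simp only: power2_eq_square mult_ac)
      then have f1: "sqrt (real (n + 1)) * sqrt (pi * fact (n + 1)) = real (n + 1) * sqrt (pi * fact n)" by simp
      have a1: "of_real (real (n + 1)) * a (n + 1) = \<beta> * a n"
        unfolding a by (simp add: field_simps del: of_nat_Suc)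
      have "of_real (sqrt (real (n + 1))) * c n * cnj (c (n + 1)) = of_real (sqrt (real (n + 1)) * sqrt (pi * fact (n + 1))) * c n * cnj (a (n + 1))"
        unfolding c[of "n + 1"] by (simp add: mult_ac)
      also have "\<dots> = c n * of_real (sqrt (pi * fact n)) * cnj (of_real (real (n + 1)) * a (n + 1))"
        unfolding f1 by (simp add: mult_ac)
      also have "\<dots> = cnj \<beta> * (c n * cnj (c n))"
        unfolding a1 c by (simp add: mult_ac)
      finally show ?thesis by (simp only: complex_norm_square)
    qed
    moreover have "(\<lambda>n. cnj \<beta> * of_real ((cmod (c n))\<^sup>2)) sums (cnj \<beta> * of_real 1)"
      using h1_imp_l2[OF h1] m1 unfolding l2_def msum_def by (intro sums_mult) (metis sums_of_real summable_sums)
    ultimately have "dsum c = cnj \<beta>" unfolding dsum_def by (simp add: sums_iff)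
    then have "\<beta> = 0" using D by simp
    then have "c n = 0" if "n \<noteq> 0" for n using that by (simp add: c a)
    then have "psum c = (\<Sum>n\<in>{0}. real n * (cmod (c n))\<^sup>2)" unfolding psum_def by (intro suminf_finite) auto
    then show ?thesis using p by simp
  next
    case (3 \<gamma> \<beta> \<zeta>)
    define e where "e = cnj \<beta> - \<zeta>"
    define W where "W = pi * (cmod \<gamma>)\<^sup>2 * exp ((cmod \<beta>)\<^sup>2)"
    have M: "W * (1 + (cmod e)\<^sup>2) = 1" and D': "cnj (dsum c) = \<beta> + W * cnj e"
      and P: "psum c = (cmod \<beta>)\<^sup>2 + 2 * Re (cnj \<beta> * W * cnj e) + W"
      using linear_exp_mass[OF 3] linear_exp_dsum[OF 3] linear_exp_psum[OF 3] unfolding e_def W_def by blast+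
    have W0: "W \<ge> 0" by (simp add: W_def)
    have We: "W * cnj e = - \<beta>" using D' D by (simp add: eq_neg_iff_add_eq_0 add.commute)
    have "cnj \<beta> * W * cnj e = - of_real ((cmod \<beta>)\<^sup>2)"
      unfolding complex_norm_square mult.assoc We by simp
    then have "Re (cnj \<beta> * W * cnj e) = - ((cmod \<beta>)\<^sup>2)" by simp
    then have PW: "psum c = W - (cmod \<beta>)\<^sup>2" using P by simp
    have "W + W * (cmod e)\<^sup>2 = 1" using M by (simp add: distrib_left)
    moreover have "W * (cmod e)\<^sup>2 \<ge> 0" "(cmod \<beta>)\<^sup>2 \<ge> 0" using W0 by simp_all
    ultimately have "W * (cmod e)\<^sup>2 = 0" "(cmod \<beta>)\<^sup>2 = 0" "W = 1" using PW p by linarith+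
    then have "\<beta> = 0" "\<zeta> = 0" unfolding e_def by auto
    then have fz: "f z = \<gamma> * z" for z using 3 by simp
    have "(\<lambda>n. (if n = 1 then \<gamma> else 0) * z ^ n) sums f z" for z
    proof -
      have "(\<lambda>n. (if n = 1 then \<gamma> else 0) * z ^ n) sums (\<Sum>n\<in>{1}. (if n = 1 then \<gamma> else 0) * z ^ n)"
        by (rule sums_finite) auto
      then show ?thesis by (simp add: fz)
    qed
    from power_series_unique[OF f this] show ?thesis by (intro c1) simp
  qed
qed

end

lemma fock_state_exists:
  assumes "h1 c" "msum c = 1"
  obtains a f \<rho> where "fock_state a c f \<rho>"
proof -
  define a where "a n = c n / of_real (sqrt (pi * fact n))" for n
  define f where "f z = (\<Sum>n. a n * z ^ n)" for z
  have "(\<lambda>n. a n * z ^ n) sums f z" for z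
    unfolding f_def by (rule l2_power_series[where h = 1 and c = c]) (use assms h1_imp_l2 in \<open>auto simp: a_def\<close>)
  then have "fock_state a c f (\<lambda>z. (cmod (f z))\<^sup>2 * exp (- (cmod z)\<^sup>2))"
    using assms by unfold_locales (auto simp: a_def)
  then show ?thesis by (rule that)
qed

definition defect :: "(nat \<Rightarrow> complex) \<Rightarrow> real" where
  "defect c = psum c / 2 + qsum c - 1"

lemma defect_nonneg:
  assumes "h1 c" "msum c = 1"
  shows "defect c \<ge> 0"
proof -
  obtain a f \<rho> where "fock_state a c f \<rho>" by (rule fock_state_exists[OF assms])
  then interpret fock_state a c f \<rho> .
  have "0 \<le> (cmod (dsum c))\<^sup>2 / 2" by simp
  then show ?thesis using psum_qsum_ge unfolding defect_def by linarith
qed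

lemma defect_zero_phi1:
  assumes "h1 c" "msum c = 1" "defect c = 0" "psum c \<ge> 1"
  shows "cmod (c 1) = 1"
proof -
  obtain a f \<rho> where "fock_state a c f \<rho>" by (rule fock_state_exists[OF assms(1,2)])
  then interpret fock_state a c f \<rho> .
  show ?thesis using equality_case_phi1 assms unfolding defect_def by simp
qed

section \<open>Stability of the first excited state\<close>

lemma cmod_add_sq: "(cmod (u + r))\<^sup>2 = (cmod u)\<^sup>2 + (cmod r)\<^sup>2 + 2 * Re (cnj u * r)"
  unfolding cmod_power2 by (simp add: power2_eq_square algebra_simps)

lemma Re_of_real_mult: "Re (of_real r * x) = r * Re x" by simp

lemma wt_1_sq: "(wt k 1)\<^sup>2 = real k / 2 ^ k"
  by (simp add: wt_sq)

text \<open>Young's inequality for the cross term. In the application \<open>L\<close> is linear and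
  \<open>R\<close> quadratic in the perturbation, so the loss \<open>|R|^2 / \<eta>\<close> is of
  fourth order and \<open>\<eta>\<close> can be a fixed small number.\<close>

lemma norm_add_sq_ge:
  fixes L R :: complex and \<eta> :: real
  assumes "\<eta> > 0"
  shows "(cmod (L + R))\<^sup>2 \<ge> (1 - \<eta>) * (cmod L)\<^sup>2 - (cmod R)\<^sup>2 / \<eta>"
proof -
  have "(cmod (L + R))\<^sup>2 = (cmod L)\<^sup>2 + (cmod R)\<^sup>2 + 2 * Re (L * cnj R)"
    unfolding cmod_power2 by (simp add: power2_eq_square algebra_simps)
  moreover have "\<bar>Re (L * cnj R)\<bar> \<le> cmod L * cmod R"
    using abs_Re_le_cmod[of "L * cnj R"] by (simp add: norm_mult)
  moreover have "2 * (cmod L * cmod R) \<le> \<eta> * (cmod L)\<^sup>2 + (cmod R)\<^sup>2 / \<eta>"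
  proof -
    have "0 \<le> (\<eta> * cmod L - cmod R)\<^sup>2 / \<eta>" using assms by simp
    also have "\<dots> = \<eta> * (cmod L)\<^sup>2 + (cmod R)\<^sup>2 / \<eta> - 2 * (cmod L * cmod R)"
      using assms by (simp add: power2_eq_square field_simps)
    finally show ?thesis by simp
  qed
  moreover have "(cmod R)\<^sup>2 \<ge> 0" by simp
  ultimately show ?thesis unfolding left_diff_distrib mult_1_left by linarith
qed

lemma linear_decay_weight: "real (n + 1) / 2 ^ (n + 1) \<le> 1 / 2"
proof (induction n)
  case (Suc n)
  have "real (Suc n + 1) / 2 ^ (Suc n + 1) \<le> real (n + 1) / 2 ^ (n + 1)"
    by (simp add: field_simps)
  then show ?case using Suc by simp
qed simp

text \<open>The Hessian of \<open>psum / 2 + qsum\<close> at \<open>\<phi>\<^sub>1\<close>: it degenerates only along translations and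
  the phase, and along translations \<open>psum\<close> decreases.\<close>

lemma defect_near_phi1:
  assumes h: "h1 c" and m: "msum c = 1" and near: "1 - (cmod (c 1))\<^sup>2 \<le> 1 / 10 ^ 6"
  shows "psum c - 1 \<le> 16 * defect c"
proof -
  define s where "s = (cmod (c 1))\<^sup>2"
  \<comment> \<open>The splitting \<open>c = s1 + d\<close> into the mode 1 part and a perturbation
    of mass \<open>e\<close>. Modes 0 and 2, with weights \<open>x\<close> and \<open>y\<close>, are
    kept apart because they couple to the square of mode 1.\<close>
  define d where "d n = (if n = 1 then 0 else c n)" for n
  define s1 where "s1 n = (if n = 1 then c 1 else 0)" for n :: nat
  define v where "v n = (cmod (d n))\<^sup>2" for n
  define e where "e = 1 - s"
  define x where "x = (cmod (c 0))\<^sup>2"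
  define y where "y = (cmod (c 2))\<^sup>2"
  define X where "X = Re (cnj ((c 1)\<^sup>2) * (c 0 * c 2))"
  \<comment> \<open>This is \<open>4 * (wt (n + 1) 1)^2\<close>, the factor by which
    \<open>2 * bil s1 d\<close> weighs mode \<open>n\<close>.\<close>
  define g where "g n = 4 * (real (n + 1) / 2 ^ (n + 1))" for n :: nat
  \<comment> \<open>The losses below are of order \<open>\<eta> * e\<close> and
    \<open>e^2 / \<eta>\<close>; with this value and \<open>e \<le> 1 / 10 ^ 6\<close> they sum to
    less than \<open>e / 100\<close>.\<close>
  define \<eta> :: real where "\<eta> = 1 / 1000"
  define z where "z n = (if n \<ge> 3 then real n - 1 else 0)" for n :: nat
  define Z where "Z = (\<Sum>n. z n * v n)"
  have l: "l2 c" using h by (rule h1_imp_l2)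
  have v0: "v n \<ge> 0" "v 1 = 0" "v (Suc 0) = 0" "v 0 = x" "v 2 = y" for n by (auto simp: v_def d_def x_def y_def)
  have cv: "(cmod (c n))\<^sup>2 = v n + (if n = 1 then s else 0)" for n by (simp add: v_def d_def s_def)
  have one: "(\<lambda>n::nat. if n = 1 then r else 0) sums (r::real)" for r using sums_single[of 1 "\<lambda>_. r"] by simp
  have sv: "v sums e"
  proof -
    have "(\<lambda>n. (cmod (c n))\<^sup>2) sums 1" using l m unfolding l2_def msum_def by (metis summable_sums)
    from sums_diff[OF this one[of s]] show ?thesis unfolding cv e_def by simp
  qed
  have snv: "(\<lambda>n. real n * v n) sums (psum c - s)"
  proof -
    have "(\<lambda>n. real n * (cmod (c n))\<^sup>2) sums psum c" unfolding psum_def using h1_summable_n[OF h] by (rule summable_sums)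
    from sums_diff[OF this one[of s]] have "(\<lambda>n. real n * (cmod (c n))\<^sup>2 - (if n = 1 then s else 0)) sums (psum c - s)" .
    moreover have "real n * (cmod (c n))\<^sup>2 - (if n = 1 then s else 0) = real n * v n" for n unfolding cv by (simp add: distrib_left)
    ultimately show ?thesis by simp
  qed
  have e: "0 \<le> e" "e \<le> 1 / 10 ^ 6" using sums_le[OF _ sums_zero sv] v0(1) near by (auto simp: e_def s_def)
  have vv: "v = (\<lambda>n. (cmod (d n))\<^sup>2)" by (rule ext) (simp add: v_def)
  have ld: "l2 d" unfolding l2_def vv[symmetric] using sums_summable[OF sv] .
  have md: "msum d = e" unfolding msum_def vv[symmetric] using sums_unique[OF sv] by simp
  have g: "0 \<le> g n" "g n \<le> 2" for n
  proof -
    show "0 \<le> g n" by (simp add: g_def)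
    show "g n \<le> 2" using linear_decay_weight[of n] unfolding g_def by linarith
  qed
  have sgv: "summable (\<lambda>n. g n * v n)"
    using sums_summable[OF sv] 
  proof (rule summable_comparison_test'[OF summable_mult[of v 2]])
    show "norm (g n * v n) \<le> 2 * v n" for n using g[of n] v0(1)[of n] by (simp add: mult_right_mono)
  qed
  define G where "G = (\<Sum>n. g n * v n)"
  have G: "0 \<le> G" "G \<le> 2 * e"
  proof -
    show "0 \<le> G" unfolding G_def using g v0 by (intro suminf_nonneg sgv) simp
    have "G \<le> (\<Sum>n. 2 * v n)" unfolding G_def
      using g v0 sums_summable[OF sv] by (intro suminf_le sgv summable_mult mult_right_mono) auto
    then show "G \<le> 2 * e" using suminf_mult[OF sums_summable[OF sv], of 2] sums_unique[OF sv] by simp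
  qed
  have zn: "summable (\<lambda>n. z n * v n)"
    using sums_summable[OF snv]
  proof (rule summable_comparison_test')
    show "norm (z n * v n) \<le> real n * v n" for n using v0(1)[of n] by (auto simp: z_def intro: mult_right_mono)
  qed
  have z0: "z n \<ge> 0" for n by (simp add: z_def)
  have Z: "0 \<le> Z" unfolding Z_def using z0 v0 by (intro suminf_nonneg zn) simp
  have zs: "(\<lambda>n. z n * v n) sums Z" unfolding Z_def by (rule summable_sums[OF zn])
  have at: "(\<lambda>n. if n = k then r else 0) sums (r::real)" for r and k :: nat using sums_single[of k "\<lambda>_. r"] by simp
  have P1: "psum c - 1 = y - x + Z"
  proof -
    have "(\<lambda>n. real n * v n - v n) sums (psum c - s - e)" by (intro sums_diff snv sv)
    moreover have "(\<lambda>n. (if n = 2 then y else 0) - (if n = 0 then x else 0) + z n * v n) sums (y - x + Z)"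
      by (intro sums_add sums_diff at zs)
    moreover have "real n * v n - v n = (if n = 2 then y else 0) - (if n = 0 then x else 0) + z n * v n" for n
    proof -
      consider "n = 0" | "n = 1" | "n = 2" | "n \<ge> 3" by linarith
      then show ?thesis by cases (auto simp: v0 z_def left_diff_distrib)
    qed
    ultimately have "psum c - s - e = y - x + Z" using sums_unique2 by simp
    then show ?thesis by (simp add: e_def)
  qed
  have E1: "e \<le> x + y + Z / 2"
  proof (rule sums_le[OF _ sv])
    show "(\<lambda>n. (if n = 0 then x else 0) + (if n = 2 then y else 0) + z n * v n / 2) sums (x + y + Z / 2)"
      by (intro sums_add at sums_divide zs)
    show "v n \<le> (if n = 0 then x else 0) + (if n = 2 then y else 0) + z n * v n / 2" for n
    proof -
      consider "n = 0" | "n = 1" | "n = 2" | "n \<ge> 3" by linarith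
      then show ?thesis
      proof cases
        case 4
        then have "1 * v n \<le> z n / 2 * v n" using v0(1)[of n] by (intro mult_right_mono) (auto simp: z_def)
        then show ?thesis using 4 by simp
      qed (use v0(1)[of 0] v0(1)[of 2] in \<open>auto simp: v0 z_def\<close>)
    qed
  qed
  \<comment> \<open>The diagonal part of the Hessian: \<open>n - 3 + 2 * g n\<close> is 1 at mode 0,
    2 at mode 2, and at least \<open>(n - 1) / 2\<close> from mode 3 on.\<close>
  have R1: "x + 2 * y + Z / 2 \<le> psum c - s - 3 * e + 2 * G"
  proof (rule sums_le)
    show "(\<lambda>n. (if n = 0 then x else 0) + (if n = 2 then 2 * y else 0) + z n * v n / 2) sums (x + 2 * y + Z / 2)"
      by (intro sums_add at sums_divide zs)
    show "(\<lambda>n. real n * v n - 3 * v n + 2 * (g n * v n)) sums (psum c - s - 3 * e + 2 * G)"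
      unfolding G_def by (intro sums_add sums_diff sums_mult snv sv summable_sums sgv)
    show "(if n = 0 then x else 0) + (if n = 2 then 2 * y else 0) + z n * v n / 2 \<le> real n * v n - 3 * v n + 2 * (g n * v n)" for n
    proof -
      consider "n = 0" | "n = 1" | "n = 2" | "n = 3" | "n = 4" | "n \<ge> 5" by linarith
      then show ?thesis
      proof cases
        case 6
        have "z n / 2 * v n \<le> (real n - 3 + 2 * g n) * v n"
          using v0(1)[of n] 6 g(1)[of n] by (intro mult_right_mono) (auto simp: z_def)
        then show ?thesis using 6 by (simp add: algebra_simps)
      qed (use v0 in \<open>auto simp: z_def g_def\<close>)
    qed
  qed
  have dc: "c n = s1 n + d n" for n by (simp add: s1_def d_def)
  have B: "bil c c k = bil s1 s1 k + 2 * bil s1 d k + bil d d k" for k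
    using bil_diag_add[of s1 d k] unfolding dc[symmetric] by simp
  have bs: "bil s1 w k = of_real (wt k 1) * c 1 * w (k - 1)" for w k
  proof (cases k)
    case 0 then show ?thesis by (simp add: bil_def s1_def wt_def)
  next
    case (Suc j)
    have "bil s1 w k = (\<Sum>m\<in>{1}. of_real (wt k m) * s1 m * w (k - m))"
      unfolding bil_def using Suc by (intro sum.mono_neutral_right) (auto simp: s1_def)
    then show ?thesis by (simp add: s1_def)
  qed
  define L where "L k = 2 * (of_real (wt k 1) * c 1 * d (k - 1))" for k
  have Lsq: "(cmod (L (Suc n)))\<^sup>2 = s * (g n * v n)" for n
  proof -
    have "(cmod (L (Suc n)))\<^sup>2 = 4 * (wt (Suc n) 1)\<^sup>2 * s * v n"
      by (simp add: L_def norm_mult power_mult_distrib s_def v_def del: One_nat_def)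
    then show ?thesis by (simp only: wt_1_sq g_def Suc_eq_plus1 mult_ac)
  qed
  have L0: "L 0 = 0" by (simp add: L_def wt_def)
  have Ls: "(\<lambda>k. (cmod (L k))\<^sup>2) sums (s * G)"
  proof -
    have "(\<lambda>n. (cmod (L (Suc n)))\<^sup>2) sums (s * G)"
      unfolding Lsq G_def by (intro sums_mult summable_sums sgv)
    then show ?thesis by (subst (asm) sums_Suc_iff) (simp add: L0)
  qed
  \<comment> \<open>At \<open>k = 2\<close>, the only index where \<open>bil s1 s1\<close> can be
    nonzero, the linear part vanishes and the square is expanded exactly; \<open>X\<close> is the
    coupling of modes 0 and 2 through mode 1.\<close>
  have lower: "(1 - \<eta>) * (cmod (L k))\<^sup>2 - (cmod (bil d d k))\<^sup>2 / \<eta> + (if k = 2 then s\<^sup>2 / 2 + sqrt 2 * X else 0) \<le> (cmod (bil c c k))\<^sup>2" for k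
  proof (cases "k = 2")
    case False
    then have "bil s1 s1 k = 0" unfolding bs by (cases "k = 0") (auto simp: s1_def wt_def)
    then have "bil c c k = L k + bil d d k" unfolding B bs L_def by simp
    then show ?thesis using norm_add_sq_ge[of \<eta> "L k" "bil d d k"] False by (simp add: \<eta>_def)
  next
    case True
    have L2: "L 2 = 0" by (simp add: L_def d_def)
    have w21: "wt 2 1 = 1 / sqrt 2" by (simp add: wt_def real_sqrt_divide)
    have w20: "wt 2 0 = 1 / 2" "wt 2 2 = 1 / 2" by (simp_all add: wt_def real_sqrt_divide)
    have "bil d d 2 = c 0 * c 2"
      by (simp add: bil_def numeral_2_eq_2 d_def) (simp add: w20[unfolded numeral_2_eq_2])
    then have b2: "bil c c 2 = of_real (1 / sqrt 2) * (c 1)\<^sup>2 + c 0 * c 2"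
      unfolding B bs w21 using L2 unfolding L_def w21 by (simp add: s1_def power2_eq_square)
    have "(cmod (bil c c 2))\<^sup>2 = (cmod (of_real (1 / sqrt 2) * (c 1)\<^sup>2))\<^sup>2 + (cmod (c 0 * c 2))\<^sup>2 + 2 * Re (cnj (of_real (1 / sqrt 2) * (c 1)\<^sup>2) * (c 0 * c 2))"
      unfolding b2 by (rule cmod_add_sq)
    also have "(cmod (of_real (1 / sqrt 2) * (c 1)\<^sup>2))\<^sup>2 = s\<^sup>2 / 2"
      by (simp add: norm_mult norm_divide norm_power s_def power_mult_distrib power_divide)
    also have "2 * Re (cnj (of_real (1 / sqrt 2) * (c 1)\<^sup>2) * (c 0 * c 2)) = sqrt 2 * X"
    proof -
      have "cnj (of_real (1 / sqrt 2) * (c 1)\<^sup>2) * (c 0 * c 2) = of_real (1 / sqrt 2) * (cnj ((c 1)\<^sup>2) * (c 0 * c 2))" by simp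
      then have "Re (cnj (of_real (1 / sqrt 2) * (c 1)\<^sup>2) * (c 0 * c 2)) = 1 / sqrt 2 * X"
        by (simp only: X_def Re_of_real_mult)
      then show ?thesis by (simp add: real_div_sqrt field_simps)
    qed
    finally have "(cmod (bil c c 2))\<^sup>2 = s\<^sup>2 / 2 + (cmod (c 0 * c 2))\<^sup>2 + sqrt 2 * X" .
    then show ?thesis using True L2 by (simp add: \<eta>_def add_increasing)
  qed
  have Q: "(1 - \<eta>) * (s * G) - (\<Sum>k. (cmod (bil d d k))\<^sup>2) / \<eta> + (s\<^sup>2 / 2 + sqrt 2 * X) \<le> qsum c"
    unfolding qsum_def
  proof (rule sums_le[OF lower])
    show "(\<lambda>k. (1 - \<eta>) * (cmod (L k))\<^sup>2 - (cmod (bil d d k))\<^sup>2 / \<eta> + (if k = 2 then s\<^sup>2 / 2 + sqrt 2 * X else 0)) sums ((1 - \<eta>) * (s * G) - (\<Sum>k. (cmod (bil d d k))\<^sup>2) / \<eta> + (s\<^sup>2 / 2 + sqrt 2 * X))"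
      by (intro sums_add sums_diff sums_mult sums_divide Ls at summable_sums summable_bil ld)
    show "(\<lambda>k. (cmod (bil c c k))\<^sup>2) sums (\<Sum>k. (cmod (bil c c k))\<^sup>2)" by (intro summable_sums summable_bil l)
  qed
  have Rd: "(\<Sum>k. (cmod (bil d d k))\<^sup>2) \<le> e * e" using suminf_bil_le[OF ld ld] md by simp
  \<comment> \<open>The Hessian on modes 0 and 2 is a perfect square. It is the squared modulus of
    the first two terms of \<open>dsum c\<close>, so the degenerate direction is the one that keeps
    the centre of mass at 0 to first order.\<close>
  define W where "W = (cmod (cnj (c 0) * c 1 + of_real (sqrt 2) * cnj (c 1) * c 2))\<^sup>2"
  have W: "W = s * (x + 2 * y) + 2 * sqrt 2 * X"
  proof -
    have n: "(cmod (u + r))\<^sup>2 = (cmod u)\<^sup>2 + (cmod r)\<^sup>2 + 2 * Re (cnj u * r)" for u r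
      unfolding cmod_power2 by (simp add: power2_eq_square algebra_simps)
    have "cnj (cnj (c 0) * c 1) * (of_real (sqrt 2) * cnj (c 1) * c 2) = of_real (sqrt 2) * (cnj ((c 1)\<^sup>2) * (c 0 * c 2))"
      by (simp add: power2_eq_square)
    then have "Re (cnj (cnj (c 0) * c 1) * (of_real (sqrt 2) * cnj (c 1) * c 2)) = sqrt 2 * X"
      by (simp only: X_def Re_of_real_mult)
    then show ?thesis unfolding W_def n by (simp add: norm_mult power_mult_distrib s_def x_def y_def algebra_simps)
  qed
  have W0: "W \<ge> 0" by (simp add: W_def)
  \<comment> \<open>Where \<open>W\<close> vanishes one has \<open>x = 2 * y\<close>. The factor
    3/4, chosen between 1/2 and 1, leads to \<open>y - x \<le> 3 * W - x / 4\<close>, whose negative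
    part absorbs the errors proportional to \<open>e\<close>.\<close>
  have yb: "s * y \<le> 3 / 2 * W + 3 / 4 * (s * x)"
  proof -
    have n: "(cmod (u - r))\<^sup>2 \<le> 3 * (cmod u)\<^sup>2 + 3 / 2 * (cmod r)\<^sup>2" for u r
    proof -
      have "0 \<le> (cmod (2 * u + r))\<^sup>2 / 2" by simp
      also have "\<dots> = 3 * (cmod u)\<^sup>2 + 3 / 2 * (cmod r)\<^sup>2 - (cmod (u - r))\<^sup>2"
        unfolding cmod_power2 by (simp add: power2_eq_square algebra_simps)
      finally show ?thesis by simp
    qed
    have "(cmod (of_real (sqrt 2) * cnj (c 1) * c 2))\<^sup>2 \<le> 3 * W + 3 / 2 * (cmod (cnj (c 0) * c 1))\<^sup>2"
      using n[of "cnj (c 0) * c 1 + of_real (sqrt 2) * cnj (c 1) * c 2" "cnj (c 0) * c 1"] unfolding W_def by simp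
    then show ?thesis by (simp add: norm_mult power_mult_distrib s_def x_def y_def algebra_simps)
  qed
  have x0: "x \<ge> 0" "y \<ge> 0" by (auto simp: x_def y_def)
  have s: "s = 1 - e" by (simp add: e_def)
  have sb: "s \<ge> 999 / 1000" using e s by simp
  have y3: "y \<le> 3 * W + 3 / 4 * x"
  proof -
    have "s * (y - 3 / 4 * x) \<le> 3 / 2 * W" using yb by (simp add: algebra_simps)
    moreover have "1 / 2 * u \<le> s * u" if "u \<ge> 0" for u using that sb by (intro mult_right_mono) auto
    ultimately show ?thesis using W0 by (cases "y - 3 / 4 * x \<ge> 0") fastforce+
  qed
  have ee: "e * e \<le> 1 / 10 ^ 6 * e" using e by (intro mult_right_mono) auto
  have sG: "(1 - \<eta>) * (s * G) \<ge> G - (\<eta> + e) * (2 * e)"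
  proof -
    have "(1 - \<eta>) * s \<ge> 1 - (\<eta> + e)" unfolding s using e by (simp add: \<eta>_def algebra_simps)
    then have "(1 - \<eta>) * s * G \<ge> (1 - (\<eta> + e)) * G" using G(1) by (rule mult_right_mono)
    moreover have "(\<eta> + e) * G \<le> (\<eta> + e) * (2 * e)" using G e by (intro mult_left_mono) (auto simp: \<eta>_def)
    ultimately show ?thesis by (simp add: algebra_simps)
  qed
  have s2: "s\<^sup>2 \<ge> 1 - 2 * e" unfolding s by (simp add: power2_eq_square algebra_simps)
  have Wx: "s * (x + 2 * y) \<le> x + 2 * y" using x0 s e by (simp add: mult_left_le_one_le)
  have D2: "2 * defect c = psum c + 2 * qsum c - 2" by (simp add: defect_def)
  have q2: "2 * qsum c \<ge> 2 * G - 2 * ((\<eta> + e) * (2 * e)) - 2000 * (e * e) + (1 - 2 * e) + 2 * sqrt 2 * X"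
    using Q sG Rd s2 by (simp add: \<eta>_def)
  have small: "2 * ((\<eta> + e) * (2 * e)) + 2000 * (e * e) \<le> 1 / 100 * e"
    using ee e by (simp add: \<eta>_def algebra_simps)
  have "2 * defect c \<ge> W + Z / 2 - 1 / 100 * e"
    using D2 q2 small R1 Wx W s by linarith
  then show ?thesis using P1 E1 y3 W0 Z x0 by linarith
qed

section \<open>Compactness away from the first excited state\<close>

lemma qsum_nonneg: "l2 c \<Longrightarrow> qsum c \<ge> 0"
  unfolding qsum_def by (intro suminf_nonneg summable_bil) auto

lemma psum_nonneg: "h1 c \<Longrightarrow> psum c \<ge> 0"
  unfolding psum_def by (intro suminf_nonneg h1_summable_n) auto

lemma bil_tendsto:
  assumes "\<And>n. (\<lambda>j. C j n) \<longlonglongrightarrow> l n"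
  shows "(\<lambda>j. bil (C j) (C j) k) \<longlonglongrightarrow> bil l l k"
  unfolding bil_def by (intro tendsto_intros assms)

lemma partial_sums_bounded:
  fixes u :: "nat \<Rightarrow> real"
  assumes "\<And>n. u n \<ge> 0" "\<And>N. (\<Sum>n<N. u n) \<le> B"
  shows "summable u" "suminf u \<le> B"
proof -
  show "summable u" by (rule summableI_nonneg_bounded) (use assms in auto)
  then show "suminf u \<le> B" by (rule suminf_le_const) (use assms in auto)
qed

text \<open>Away from \<open>\<phi>\<^sub>1\<close> the defect is bounded below, by compactness: the limit of a sequence with
  vanishing defect has defect \<open>0\<close> by Fatou and mass \<open>1\<close> because \<^const>\<open>psum\<close> controls the tails.\<close>

lemma defect_controls_psum:
  obtains K where "K > 0" "\<And>c. h1 c \<Longrightarrow> msum c = 1 \<Longrightarrow> psum c - 1 \<le> K * defect c"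
proof (rule ccontr)
  assume "\<not> thesis"
  \<comment> \<open>The offset 16 is the constant of \<open>defect_near_phi1\<close>, so no
    counterexample can lie near the first excited state.\<close>
  then have "\<forall>j. \<exists>c. h1 c \<and> msum c = 1 \<and> \<not> psum c - 1 \<le> (real j + 16) * defect c"
    using that by (metis add_nonneg_pos of_nat_0_le_iff zero_less_numeral)
  then obtain C where C: "\<And>j. h1 (C j)" "\<And>j. msum (C j) = 1" "\<And>j. psum (C j) - 1 > (real j + 16) * defect (C j)"
    by (metis not_less)
  have l2C: "l2 (C j)" for j using C(1) by (rule h1_imp_l2)
  have d0: "defect (C j) \<ge> 0" for j using C by (intro defect_nonneg)
  have P1: "psum (C j) > 1" for j using C(3)[of j] mult_nonneg_nonneg[OF _ d0[of j], of "real j + 16"] by simp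
  have far: "(cmod (C j 1))\<^sup>2 \<le> 1 - 1 / 10 ^ 6" for j
  proof (rule ccontr)
    assume "\<not> ?thesis"
    then have "psum (C j) - 1 \<le> 16 * defect (C j)" using C by (intro defect_near_phi1) auto
    also have "\<dots> \<le> (real j + 16) * defect (C j)" using d0 by (intro mult_right_mono) auto
    finally show False using C(3)[of j] by simp
  qed
  have P3: "psum (C j) \<le> 3" for j
  proof -
    have "16 * defect (C j) \<le> (real j + 16) * defect (C j)" using d0 by (intro mult_right_mono) auto
    moreover have "defect (C j) \<ge> psum (C j) / 2 - 1" using qsum_nonneg[OF l2C[of j]] unfolding defect_def by linarith
    ultimately show ?thesis using C(3)[of j] by linarith
  qed
  have dlim: "(\<lambda>j. defect (C j)) \<longlonglongrightarrow> 0"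
  proof (rule tendsto_sandwich[of "\<lambda>_. 0" _ _ "\<lambda>j. 2 / (real j + 16)"])
    show "\<forall>\<^sub>F j in sequentially. defect (C j) \<le> 2 / (real j + 16)"
    proof (intro always_eventually allI)
      fix j
      have "defect (C j) * (real j + 16) \<le> 2" using C(3)[of j] P3[of j] by (simp add: mult.commute)
      then show "defect (C j) \<le> 2 / (real j + 16)" by (simp add: pos_le_divide_eq)
    qed
    show "(\<lambda>j. 2 / (real j + 16)) \<longlonglongrightarrow> 0" by real_asymp
  qed (use d0 in auto)
  have w: "(\<Sum>n<N. (cmod (C j n))\<^sup>2) \<le> 1" for j N
    using sum_le_suminf[of "\<lambda>n. (cmod (C j n))\<^sup>2" "{..<N}"] l2C[of j] C(2)[of j] unfolding l2_def msum_def by simp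
  have bd: "cmod (C j n) \<le> 1" for j n
  proof -
    have "(cmod (C j n))\<^sup>2 \<le> (\<Sum>n<Suc n. (cmod (C j n))\<^sup>2)" by (rule member_le_sum) auto
    then have "(cmod (C j n))\<^sup>2 \<le> 1" using w order_trans by blast
    then show ?thesis by (simp add: power_le_one_iff abs_square_le_1)
  qed
  obtain r where r: "strict_mono r" "\<And>n. n \<in> UNIV \<Longrightarrow> \<exists>l. (\<lambda>j. C (r j) n) \<longlonglongrightarrow> l"
    by (rule function_convergent_subsequence[of UNIV C 1]) (use bd in auto)
  then obtain l where l: "\<And>n. (\<lambda>j. C (r j) n) \<longlonglongrightarrow> l n" by (metis UNIV_I)
  have dl: "(\<lambda>j. defect (C (r j))) \<longlonglongrightarrow> 0" using LIMSEQ_subseq_LIMSEQ[OF dlim r(1)] by (simp add: o_def)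
  have m1: "(\<Sum>n<N. (cmod (l n))\<^sup>2) \<le> 1" for N
    by (rule LIMSEQ_le_const2[of "\<lambda>j. \<Sum>n<N. (cmod (C (r j) n))\<^sup>2"]) (use w in \<open>auto intro!: tendsto_intros l\<close>)
  have Pp: "(\<Sum>n<N. real n * (cmod (C j n))\<^sup>2) \<le> psum (C j)" for j N
    unfolding psum_def by (rule sum_le_suminf) (use h1_summable_n[OF C(1)] in auto)
  have p3: "(\<Sum>n<N. real n * (cmod (l n))\<^sup>2) \<le> 3" for N
    by (rule LIMSEQ_le_const2[of "\<lambda>j. \<Sum>n<N. real n * (cmod (C (r j) n))\<^sup>2"])
      (use order_trans[OF Pp P3] in \<open>auto intro!: tendsto_intros l\<close>)
  have l2l: "l2 l" unfolding l2_def by (rule partial_sums_bounded(1)) (use m1 in auto)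
  have snl: "summable (\<lambda>n. real n * (cmod (l n))\<^sup>2)" by (rule partial_sums_bounded(1)) (use p3 in auto)
  have h1l: "h1 l" using l2l snl by (rule h1I)
  \<comment> \<open>The mass from index \<open>N + 1\<close> on is at most
    \<open>psum (C j) / (N + 1)\<close>, uniformly in \<open>j\<close>, so no mass escapes in the
    limit.\<close>
  have tail: "1 - 3 / real (Suc N) \<le> (\<Sum>n<Suc N. (cmod (C j n))\<^sup>2)" for j N
  proof -
    have "(\<Sum>n. (cmod (C j (n + Suc N)))\<^sup>2) \<le> (\<Sum>n. real (n + Suc N) * (cmod (C j (n + Suc N)))\<^sup>2 / real (Suc N))"
    proof (rule suminf_le)
      fix n
      have "real (Suc N) * (cmod (C j (n + Suc N)))\<^sup>2 \<le> real (n + Suc N) * (cmod (C j (n + Suc N)))\<^sup>2"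
        by (rule mult_right_mono) auto
      then show "(cmod (C j (n + Suc N)))\<^sup>2 \<le> real (n + Suc N) * (cmod (C j (n + Suc N)))\<^sup>2 / real (Suc N)"
        by (simp only: pos_le_divide_eq of_nat_0_less_iff zero_less_Suc mult.commute)
      show "summable (\<lambda>n. (cmod (C j (n + Suc N)))\<^sup>2)"
        using summable_ignore_initial_segment[OF l2C[of j, unfolded l2_def], of "Suc N"] .
      show "summable (\<lambda>n. real (n + Suc N) * (cmod (C j (n + Suc N)))\<^sup>2 / real (Suc N))"
        using summable_divide[OF summable_ignore_initial_segment[OF h1_summable_n[OF C(1)[of j]], of "Suc N"]] .
    qed
    also have "\<dots> = (\<Sum>n. real (n + Suc N) * (cmod (C j (n + Suc N)))\<^sup>2) / real (Suc N)"
      by (rule suminf_divide) (rule summable_ignore_initial_segment[OF h1_summable_n[OF C(1)[of j]], of "Suc N"])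
    also have "\<dots> \<le> 3 / real (Suc N)"
    proof (rule divide_right_mono)
      have "psum (C j) = (\<Sum>n. real (n + Suc N) * (cmod (C j (n + Suc N)))\<^sup>2) + (\<Sum>n<Suc N. real n * (cmod (C j n))\<^sup>2)"
        unfolding psum_def by (rule suminf_split_initial_segment) (rule h1_summable_n[OF C(1)])
      moreover have "(\<Sum>n<Suc N. real n * (cmod (C j n))\<^sup>2) \<ge> 0" by (intro sum_nonneg) auto
      ultimately show "(\<Sum>n. real (n + Suc N) * (cmod (C j (n + Suc N)))\<^sup>2) \<le> 3" using P3[of j] by linarith
    qed simp
    finally have "(\<Sum>n. (cmod (C j (n + Suc N)))\<^sup>2) \<le> 3 / real (Suc N)" .
    moreover have "msum (C j) = (\<Sum>n. (cmod (C j (n + Suc N)))\<^sup>2) + (\<Sum>n<Suc N. (cmod (C j n))\<^sup>2)"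
      unfolding msum_def by (rule suminf_split_initial_segment) (rule l2C[unfolded l2_def])
    ultimately show ?thesis using C(2)[of j] by linarith
  qed
  have "1 - 3 / real (Suc N) \<le> msum l" for N
  proof -
    have "1 - 3 / real (Suc N) \<le> (\<Sum>n<Suc N. (cmod (l n))\<^sup>2)"
    proof (rule LIMSEQ_le_const)
      show "(\<lambda>j. \<Sum>n<Suc N. (cmod (C (r j) n))\<^sup>2) \<longlonglongrightarrow> (\<Sum>n<Suc N. (cmod (l n))\<^sup>2)"
        by (intro tendsto_intros l)
      show "\<exists>M. \<forall>j\<ge>M. 1 - 3 / real (Suc N) \<le> (\<Sum>n<Suc N. (cmod (C (r j) n))\<^sup>2)" using tail by blast
    qed
    also have "\<dots> \<le> msum l" unfolding msum_def by (rule sum_le_suminf) (use l2l in \<open>auto simp: l2_def\<close>)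
    finally show ?thesis .
  qed
  moreover have "(\<lambda>N. 1 - 3 / real (Suc N)) \<longlonglongrightarrow> 1" by real_asymp
  ultimately have "1 \<le> msum l" using LIMSEQ_le_const2 by blast
  moreover have "msum l \<le> 1" unfolding msum_def by (rule partial_sums_bounded(2)) (use m1 in auto)
  ultimately have ml: "msum l = 1" by simp
  have Qp: "(\<Sum>k<N. (cmod (bil (C j) (C j) k))\<^sup>2) \<le> qsum (C j)" for j N
    unfolding qsum_def by (rule sum_le_suminf) (use summable_bil[OF l2C l2C] in auto)
  \<comment> \<open>\<open>psum\<close> is only lower semicontinuous, so a bound from below does not
    pass to the limit directly. It is first turned into \<open>qsum \<le> 1 / 2 + defect\<close>,
    which does pass, and \<open>defect l = 0\<close> then gives back
    \<open>psum l \<ge> 1\<close>.\<close>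
  have ql: "(\<Sum>k<N. (cmod (bil l l k))\<^sup>2) \<le> 1 / 2" for N
  proof (rule LIMSEQ_le)
    show "(\<lambda>j. \<Sum>k<N. (cmod (bil (C (r j)) (C (r j)) k))\<^sup>2) \<longlonglongrightarrow> (\<Sum>k<N. (cmod (bil l l k))\<^sup>2)"
      by (intro tendsto_intros bil_tendsto l)
    show "(\<lambda>j. 1 / 2 + defect (C (r j))) \<longlonglongrightarrow> 1 / 2" using tendsto_add[OF tendsto_const dl, of "1/2"] by simp
    have "(\<Sum>k<N. (cmod (bil (C j) (C j) k))\<^sup>2) \<le> 1 / 2 + defect (C j)" for j
      using Qp[of j N] P1[of j] unfolding defect_def by linarith
    then show "\<exists>M. \<forall>j\<ge>M. (\<Sum>k<N. (cmod (bil (C (r j)) (C (r j)) k))\<^sup>2) \<le> 1 / 2 + defect (C (r j))" by blast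
  qed
  have "(\<Sum>n<N. real n * (cmod (l n))\<^sup>2 / 2 + (cmod (bil l l n))\<^sup>2) \<le> 1" for N
  proof (rule LIMSEQ_le)
    show "(\<lambda>j. \<Sum>n<N. real n * (cmod (C (r j) n))\<^sup>2 / 2 + (cmod (bil (C (r j)) (C (r j)) n))\<^sup>2) \<longlonglongrightarrow> (\<Sum>n<N. real n * (cmod (l n))\<^sup>2 / 2 + (cmod (bil l l n))\<^sup>2)"
      by (intro tendsto_intros bil_tendsto l) simp
    show "(\<lambda>j. 1 + defect (C (r j))) \<longlonglongrightarrow> 1" using tendsto_add[OF tendsto_const dl, of 1] by simp
    have "(\<Sum>n<N. real n * (cmod (C j n))\<^sup>2 / 2 + (cmod (bil (C j) (C j) n))\<^sup>2) \<le> 1 + defect (C j)" for j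
      using Qp[of j N] Pp[of j N] unfolding defect_def sum.distrib sum_divide_distrib[symmetric] by linarith
    then show "\<exists>M. \<forall>j\<ge>M. (\<Sum>n<N. real n * (cmod (C (r j) n))\<^sup>2 / 2 + (cmod (bil (C (r j)) (C (r j)) n))\<^sup>2) \<le> 1 + defect (C (r j))" by blast
  qed
  then have "(\<Sum>n. real n * (cmod (l n))\<^sup>2 / 2 + (cmod (bil l l n))\<^sup>2) \<le> 1"
    by (intro partial_sums_bounded(2)) auto
  moreover have "(\<Sum>n. real n * (cmod (l n))\<^sup>2 / 2 + (cmod (bil l l n))\<^sup>2) = psum l / 2 + qsum l"
    unfolding psum_def qsum_def suminf_divide[OF snl, symmetric]
    by (rule suminf_add[symmetric]) (intro summable_divide snl summable_bil l2l)+
  ultimately have "defect l \<le> 0" by (simp add: defect_def)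
  then have dl0: "defect l = 0" using defect_nonneg[OF h1l ml] by simp
  have "qsum l \<le> 1 / 2" unfolding qsum_def by (rule partial_sums_bounded(2)) (use ql in auto)
  then have "psum l \<ge> 1" using dl0 by (simp add: defect_def)
  then have "cmod (l 1) = 1" by (rule defect_zero_phi1[OF h1l ml dl0])
  moreover have "(cmod (l 1))\<^sup>2 \<le> 1 - 1 / 10 ^ 6"
    by (rule LIMSEQ_le_const2[of "\<lambda>j. (cmod (C (r j) 1))\<^sup>2"]) (use far in \<open>auto intro!: tendsto_intros l[of "Suc 0"]\<close>)
  ultimately show False by simp
qed

section \<open>First and second variation\<close>

text \<open>Variations are taken along a real parameter, so the real part of the inner product is
  the bilinear form that appears.\<close>

definition rip :: "(nat \<Rightarrow> complex) \<Rightarrow> (nat \<Rightarrow> complex) \<Rightarrow> real" where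
  "rip x y = (\<Sum>n. Re (cnj (x n) * y n))"

lemma rip_summable:
  assumes "l2 x" "l2 y"
  shows "summable (\<lambda>n. Re (cnj (x n) * y n))"
proof (rule summable_comparison_test')
  show "summable (\<lambda>n. ((cmod (x n))\<^sup>2 + (cmod (y n))\<^sup>2) / 2)"
    using assms unfolding l2_def by (intro summable_divide summable_add)
  fix n
  have "\<bar>Re (cnj (x n) * y n)\<bar> \<le> cmod (x n) * cmod (y n)"
    using abs_Re_le_cmod[of "cnj (x n) * y n"] by (simp add: norm_mult)
  also have "\<dots> \<le> ((cmod (x n))\<^sup>2 + (cmod (y n))\<^sup>2) / 2"
    using sum_squares_bound[of "cmod (x n)" "cmod (y n)"] by simp
  finally show "norm (Re (cnj (x n) * y n)) \<le> ((cmod (x n))\<^sup>2 + (cmod (y n))\<^sup>2) / 2" by simp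
qed

lemma rip_self: "rip x x = (\<Sum>n. (cmod (x n))\<^sup>2)"
proof -
  have "Re (cnj z * z) = (cmod z)\<^sup>2" for z unfolding cmod_power2 by (simp add: power2_eq_square)
  then show ?thesis by (simp only: rip_def)
qed

lemma l2_add:
  assumes "l2 x" "l2 y"
  shows "l2 (\<lambda>n. x n + y n)"
proof -
  have "summable (\<lambda>n. (cmod (x n))\<^sup>2 + (cmod (y n))\<^sup>2 + 2 * Re (cnj (x n) * y n))"
    using assms unfolding l2_def by (intro summable_add summable_mult rip_summable) (auto simp: l2_def)
  moreover have "(cmod (x n + y n))\<^sup>2 = (cmod (x n))\<^sup>2 + (cmod (y n))\<^sup>2 + 2 * Re (cnj (x n) * y n)" for n
    unfolding cmod_power2 by (simp add: power2_eq_square algebra_simps)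
  ultimately show ?thesis unfolding l2_def by simp
qed

lemma l2_cmult: "l2 x \<Longrightarrow> l2 (\<lambda>n. r * x n)"
  unfolding l2_def norm_mult power_mult_distrib by (rule summable_mult)

lemma rip_add_left:
  assumes "l2 x" "l2 y" "l2 w"
  shows "rip (\<lambda>n. x n + y n) w = rip x w + rip y w"
proof -
  have "Re (cnj (x n + y n) * w n) = Re (cnj (x n) * w n) + Re (cnj (y n) * w n)" for n by (simp add: algebra_simps)
  then show ?thesis unfolding rip_def using assms by (simp only: suminf_add[OF rip_summable rip_summable])
qed

lemma rip_cmult_left:
  assumes "l2 x" "l2 w"
  shows "rip (\<lambda>n. of_real r * x n) w = r * rip x w"
proof -
  have "Re (cnj (of_real r * x n) * w n) = r * Re (cnj (x n) * w n)" for n by (simp add: algebra_simps)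
  then show ?thesis unfolding rip_def using assms by (simp only: suminf_mult[OF rip_summable])
qed

lemma rip_commute: "rip x y = rip y x"
  unfolding rip_def by (simp add: algebra_simps)

lemma rip_add_right: "l2 x \<Longrightarrow> l2 y \<Longrightarrow> l2 w \<Longrightarrow> rip w (\<lambda>n. x n + y n) = rip w x + rip w y"
  by (simp add: rip_commute[of w] rip_add_left)

lemma rip_cmult_right: "l2 x \<Longrightarrow> l2 w \<Longrightarrow> rip w (\<lambda>n. of_real r * x n) = r * rip w x"
  by (simp add: rip_commute[of w] rip_cmult_left)

lemma rip_expand:
  assumes x: "l2 x" and y: "l2 y"
  shows "rip (\<lambda>n. x n + of_real t * y n) (\<lambda>n. x n + of_real t * y n) = rip x x + 2 * t * rip x y + t\<^sup>2 * rip y y"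
  using assms l2_cmult[OF y]
  by (simp add: rip_add_left rip_add_right l2_add rip_cmult_left rip_cmult_right rip_commute[of y x] power2_eq_square algebra_simps)

text \<open>Square root of the number operator; with it mass, \<open>psum\<close> and
  \<open>qsum\<close> are all of the form \<open>rip x x\<close> and expand in the same way.\<close>

definition wsqrt :: "(nat \<Rightarrow> complex) \<Rightarrow> nat \<Rightarrow> complex" where
  "wsqrt c n = of_real (sqrt (real n)) * c n"

lemma wsqrt_sq: "(cmod (wsqrt c n))\<^sup>2 = real n * (cmod (c n))\<^sup>2"
  by (simp add: wsqrt_def norm_mult power_mult_distrib)

lemma wsqrt_l2: "h1 c \<Longrightarrow> l2 (wsqrt c)"
  unfolding l2_def wsqrt_sq by (rule h1_summable_n)

lemma msum_rip: "msum c = rip c c" by (simp add: msum_def rip_self)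
lemma psum_rip: "psum c = rip (wsqrt c) (wsqrt c)" by (simp add: psum_def rip_self wsqrt_sq)
lemma qsum_rip: "qsum c = rip (bil c c) (bil c c)" by (simp add: qsum_def rip_self)

lemma h1_add_cmult:
  assumes "h1 c" "h1 v"
  shows "h1 (\<lambda>n. c n + r * v n)"
proof (rule h1I)
  show "l2 (\<lambda>n. c n + r * v n)" using assms by (intro l2_add l2_cmult h1_imp_l2)
  have "l2 (\<lambda>n. wsqrt c n + r * wsqrt v n)" using assms by (intro l2_add l2_cmult wsqrt_l2)
  moreover have "(\<lambda>n. wsqrt c n + r * wsqrt v n) = wsqrt (\<lambda>n. c n + r * v n)"
    by (auto simp: wsqrt_def algebra_simps)
  ultimately have "l2 (wsqrt (\<lambda>n. c n + r * v n))" by (simp only:)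
  then show "summable (\<lambda>n. real n * (cmod (c n + r * v n))\<^sup>2)"
    unfolding l2_def wsqrt_sq .
qed

lemma h1_cmult: "h1 c \<Longrightarrow> h1 (\<lambda>n. r * c n)"
  unfolding h1_def norm_mult power_mult_distrib mult.left_commute[of _ "(cmod r)\<^sup>2"] by (rule summable_mult)

lemma l2_bil: "l2 c \<Longrightarrow> l2 d \<Longrightarrow> l2 (bil c d)"
  unfolding l2_def[of "bil c d"] by (rule summable_bil)

lemma msum_expand:
  "l2 c \<Longrightarrow> l2 v \<Longrightarrow> msum (\<lambda>n. c n + of_real t * v n) = msum c + 2 * t * rip c v + t\<^sup>2 * msum v"
  by (simp add: msum_rip rip_expand)

lemma psum_expand:
  assumes "h1 c" "h1 v"
  shows "psum (\<lambda>n. c n + of_real t * v n) = psum c + 2 * t * rip (wsqrt c) (wsqrt v) + t\<^sup>2 * psum v"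
proof -
  have "wsqrt (\<lambda>n. c n + of_real t * v n) = (\<lambda>n. wsqrt c n + of_real t * wsqrt v n)"
    by (auto simp: wsqrt_def algebra_simps)
  then show ?thesis using assms by (simp add: psum_rip rip_expand wsqrt_l2)
qed

lemma qsum_expand:
  assumes "l2 c" "l2 v"
  shows "qsum (\<lambda>n. c n + of_real t * v n) = qsum c + t * (4 * rip (bil c c) (bil c v))
     + t\<^sup>2 * (4 * rip (bil c v) (bil c v) + 2 * rip (bil c c) (bil v v))
     + t ^ 3 * (4 * rip (bil c v) (bil v v)) + t ^ 4 * qsum v"
proof -
  let ?B = "bil c c" and ?G = "bil c v" and ?H = "bil v v"
  have l: "l2 ?B" "l2 ?G" "l2 ?H" using assms by (auto intro: l2_bil)
  have e: "bil (\<lambda>n. c n + of_real t * v n) (\<lambda>n. c n + of_real t * v n) = (\<lambda>k. ?B k + of_real t * (of_real 2 * ?G k + of_real t * ?H k))"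
  proof
    fix k
    have "bil c (\<lambda>n. of_real t * v n) k = of_real t * ?G k" "bil v (\<lambda>n. of_real t * v n) k = of_real t * ?H k"
      using bil_cmult[of "of_real t" v c k] bil_cmult[of "of_real t" v v k]
      by (simp_all only: bil_sym[of c "\<lambda>n. of_real t * v n"] bil_sym[of c v] bil_sym[of v "\<lambda>n. of_real t * v n"])
    then show "bil (\<lambda>n. c n + of_real t * v n) (\<lambda>n. c n + of_real t * v n) k = ?B k + of_real t * (of_real 2 * ?G k + of_real t * ?H k)"
      unfolding bil_diag_add bil_cmult by (simp add: algebra_simps)
  qed
  have l': "l2 (\<lambda>k. of_real 2 * ?G k)" "l2 (\<lambda>k. of_real t * ?H k)" using l by (auto intro: l2_cmult)
  show ?thesis
    unfolding qsum_rip e rip_expand[OF l(1) l2_add[OF l']] rip_expand[OF l'(1) l(3)]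
      rip_add_right[OF l' l(1)] rip_cmult_right[OF l(2) l(1)] rip_cmult_right[OF l(3) l(1)]
      rip_cmult_left[OF l(2) l'(1)] rip_cmult_right[OF l(2) l(2)] rip_cmult_left[OF l(2) l(3)]
    by (simp add: power2_eq_square power3_eq_cube power4_eq_xxxx algebra_simps)
qed

text \<open>Here \<open>\<delta>\<close> bounds the squared distance. A global minimizer satisfies
  the condition with any value of it, so one notion covers both kinds.\<close>

definition lmin :: "real \<Rightarrow> (nat \<Rightarrow> complex) \<Rightarrow> bool" where
  "lmin \<tau> c \<longleftrightarrow> h1 c \<and> msum c = 1 \<and>
     (\<exists>\<delta>>0. \<forall>d. h1 d \<and> msum d = 1 \<and> (\<Sum>n. real (n + 1) * (cmod (c n - d n))\<^sup>2) < \<delta>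
        \<longrightarrow> psum c + \<tau> * qsum c \<le> psum d + \<tau> * qsum d)"

lemma psum_cmult: "h1 c \<Longrightarrow> psum (\<lambda>n. of_real r * c n) = r\<^sup>2 * psum c"
  unfolding psum_def by (subst suminf_mult[symmetric]) (auto simp: h1_summable_n norm_mult power_mult_distrib mult_ac)

lemma msum_cmult: "l2 c \<Longrightarrow> msum (\<lambda>n. of_real r * c n) = r\<^sup>2 * msum c"
  unfolding msum_def by (subst suminf_mult[symmetric]) (auto simp: l2_def norm_mult power_mult_distrib)

lemma qsum_cmult: "l2 c \<Longrightarrow> qsum (\<lambda>n. of_real r * c n) = r ^ 4 * qsum c"
proof -
  assume "l2 c"
  have "bil (\<lambda>n. of_real r * c n) (\<lambda>n. of_real r * c n) k = of_real (r\<^sup>2) * bil c c k" for k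
    by (simp add: bil_cmult bil_sym[of _ "\<lambda>n. of_real r * c n"] power2_eq_square)
  then show ?thesis unfolding qsum_def using summable_bil[OF \<open>l2 c\<close> \<open>l2 c\<close>]
    by (subst suminf_mult[symmetric]) (auto simp: norm_mult norm_power power_mult_distrib power_mult[symmetric])
qed

text \<open>A perturbation leaves the unit sphere. Scaling it back and clearing denominators, with
  \<open>psum\<close> homogeneous of degree 2 and \<open>qsum\<close> of degree 4, gives an
  inequality between polynomials in \<open>t\<close>.\<close>

lemma lmin_perturb:
  assumes min: "lmin \<tau> c" and v: "h1 v"
  shows "\<forall>\<^sub>F t in at 0. (psum c + \<tau> * qsum c) * (msum (\<lambda>n. c n + of_real t * v n))\<^sup>2
    \<le> psum (\<lambda>n. c n + of_real t * v n) * msum (\<lambda>n. c n + of_real t * v n) + \<tau> * qsum (\<lambda>n. c n + of_real t * v n)"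
proof -
  have c: "h1 c" "msum c = 1" using min by (auto simp: lmin_def)
  obtain \<delta> where \<delta>: "\<delta> > 0" "\<And>d. h1 d \<Longrightarrow> msum d = 1 \<Longrightarrow> (\<Sum>n. real (n + 1) * (cmod (c n - d n))\<^sup>2) < \<delta>
        \<Longrightarrow> psum c + \<tau> * qsum c \<le> psum d + \<tau> * qsum d"
    using min unfolding lmin_def by blast
  define V where "V t n = c n + of_real t * v n" for t :: real and n
  define m where "m t = 1 + 2 * t * rip c v + t\<^sup>2 * msum v" for t
  have mV: "msum (V t) = m t" for t unfolding V_def m_def using c v by (simp add: msum_expand h1_imp_l2)
  have hV: "h1 (V t)" for t unfolding V_def using c v by (intro h1_add_cmult)
  define \<sigma> where "\<sigma> t = 1 / sqrt (m t)" for t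
  define Hc where "Hc = (\<Sum>n. real (n + 1) * (cmod (c n))\<^sup>2)"
  define Hv where "Hv = (\<Sum>n. real (n + 1) * (cmod (v n))\<^sup>2)"
  have mlim: "(m \<longlongrightarrow> 1) (at 0)" unfolding m_def by (auto intro!: tendsto_eq_intros)
  have slim: "(\<sigma> \<longlongrightarrow> 1) (at 0)" unfolding \<sigma>_def using mlim by (auto intro!: tendsto_eq_intros)
  have "((\<lambda>t. 2 * (1 - \<sigma> t)\<^sup>2 * Hc + 2 * (\<sigma> t * t)\<^sup>2 * Hv) \<longlongrightarrow> 2 * (1 - 1)\<^sup>2 * Hc + 2 * (1 * 0)\<^sup>2 * Hv) (at 0)"
    by (intro tendsto_intros slim)
  then have "\<forall>\<^sub>F t in at 0. 2 * (1 - \<sigma> t)\<^sup>2 * Hc + 2 * (\<sigma> t * t)\<^sup>2 * Hv < \<delta>"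
    using \<delta>(1) by (intro order_tendstoD) simp
  moreover have "\<forall>\<^sub>F t in at 0. m t > 0" using mlim by (rule order_tendstoD) simp
  ultimately show ?thesis
  proof eventually_elim
    case (elim t)
    define d where "d n = of_real (\<sigma> t) * V t n" for n
    have s2: "(\<sigma> t)\<^sup>2 * m t = 1" using elim(2) by (simp add: \<sigma>_def power_divide)
    have d: "h1 d" "msum d = 1" unfolding d_def using hV h1_cmult h1_imp_l2 s2 mV by (auto simp: msum_cmult)
    have sc: "summable (\<lambda>n. real (n + 1) * (cmod (c n))\<^sup>2)" "summable (\<lambda>n. real (n + 1) * (cmod (v n))\<^sup>2)"
      using c v unfolding h1_def by auto
    have b: "real (n + 1) * (cmod (c n - d n))\<^sup>2 \<le> 2 * (1 - \<sigma> t)\<^sup>2 * (real (n + 1) * (cmod (c n))\<^sup>2) + 2 * (\<sigma> t * t)\<^sup>2 * (real (n + 1) * (cmod (v n))\<^sup>2)" for n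
    proof -
      have n: "(cmod (p - q))\<^sup>2 \<le> 2 * (cmod p)\<^sup>2 + 2 * (cmod q)\<^sup>2" for p q
      proof -
        have "0 \<le> (cmod (p + q))\<^sup>2" by simp
        also have "\<dots> = 2 * (cmod p)\<^sup>2 + 2 * (cmod q)\<^sup>2 - (cmod (p - q))\<^sup>2"
          unfolding cmod_power2 by (simp add: power2_eq_square algebra_simps)
        finally show ?thesis by simp
      qed
      have "c n - d n = of_real (1 - \<sigma> t) * c n - of_real (\<sigma> t * t) * v n"
        by (simp add: d_def V_def algebra_simps)
      then have "(cmod (c n - d n))\<^sup>2 \<le> 2 * (cmod (of_real (1 - \<sigma> t) * c n))\<^sup>2 + 2 * (cmod (of_real (\<sigma> t * t) * v n))\<^sup>2"
        using n by (simp only:)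
      also have "\<dots> = 2 * ((1 - \<sigma> t)\<^sup>2 * (cmod (c n))\<^sup>2) + 2 * ((\<sigma> t * t)\<^sup>2 * (cmod (v n))\<^sup>2)"
        by (simp only: norm_mult norm_of_real power_mult_distrib power2_abs)
      finally have "real (n + 1) * (cmod (c n - d n))\<^sup>2 \<le> real (n + 1) * (2 * ((1 - \<sigma> t)\<^sup>2 * (cmod (c n))\<^sup>2) + 2 * ((\<sigma> t * t)\<^sup>2 * (cmod (v n))\<^sup>2))"
        by (rule mult_left_mono) simp
      then show ?thesis by (simp only: distrib_left mult_ac)
    qed
    have sb: "summable (\<lambda>n. 2 * (1 - \<sigma> t)\<^sup>2 * (real (n + 1) * (cmod (c n))\<^sup>2) + 2 * (\<sigma> t * t)\<^sup>2 * (real (n + 1) * (cmod (v n))\<^sup>2))"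
      by (intro summable_add summable_mult sc)
    have sd: "summable (\<lambda>n. real (n + 1) * (cmod (c n - d n))\<^sup>2)"
      by (rule summable_comparison_test'[OF sb]) (use b in auto)
    have "(\<Sum>n. real (n + 1) * (cmod (c n - d n))\<^sup>2) \<le> (\<Sum>n. 2 * (1 - \<sigma> t)\<^sup>2 * (real (n + 1) * (cmod (c n))\<^sup>2) + 2 * (\<sigma> t * t)\<^sup>2 * (real (n + 1) * (cmod (v n))\<^sup>2))"
      by (rule suminf_le[OF b sd sb])
    also have "\<dots> = 2 * (1 - \<sigma> t)\<^sup>2 * Hc + 2 * (\<sigma> t * t)\<^sup>2 * Hv"
      unfolding Hc_def Hv_def by (subst suminf_add[symmetric]) (auto intro!: summable_mult sc simp only: suminf_mult[OF sc(1)] suminf_mult[OF sc(2)])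
    finally have "(\<Sum>n. real (n + 1) * (cmod (c n - d n))\<^sup>2) < \<delta>" using elim(1) by simp
    then have le: "psum c + \<tau> * qsum c \<le> psum d + \<tau> * qsum d" by (rule \<delta>(2)[OF d])
    have "psum d = (\<sigma> t)\<^sup>2 * psum (V t)" "qsum d = (\<sigma> t) ^ 4 * qsum (V t)"
      unfolding d_def using hV h1_imp_l2 by (auto simp: psum_cmult qsum_cmult)
    then have "(psum c + \<tau> * qsum c) * (m t)\<^sup>2 \<le> ((\<sigma> t)\<^sup>2 * psum (V t) + \<tau> * ((\<sigma> t) ^ 4 * qsum (V t))) * (m t)\<^sup>2"
      using le by (intro mult_right_mono) auto
    also have "\<dots> = ((\<sigma> t)\<^sup>2 * m t) * (psum (V t) * m t) + \<tau> * (((\<sigma> t)\<^sup>2 * m t)\<^sup>2 * qsum (V t))"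
      by (simp add: power2_eq_square power4_eq_xxxx algebra_simps)
    finally show ?case unfolding s2 mV V_def by (simp add: mV[unfolded V_def])
  qed
qed

lemma quartic_nonneg_near_0:
  fixes A B C D :: real
  assumes ev: "\<forall>\<^sub>F t in at 0. 0 \<le> A * t + B * t\<^sup>2 + C * t ^ 3 + D * t ^ 4"
  shows "A = 0" "B \<ge> 0"
proof -
  have l: "((\<lambda>t. A + B * t + C * t\<^sup>2 + D * t ^ 3) \<longlongrightarrow> A) (at_right 0)" "((\<lambda>t. A + B * t + C * t\<^sup>2 + D * t ^ 3) \<longlongrightarrow> A) (at_left 0)"
    by (auto intro!: tendsto_eq_intros)
  have f: "A * t + B * t\<^sup>2 + C * t ^ 3 + D * t ^ 4 = t * (A + B * t + C * t\<^sup>2 + D * t ^ 3)" for t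
    by (simp add: power2_eq_square power3_eq_cube power4_eq_xxxx algebra_simps)
  have r: "\<forall>\<^sub>F t in at_right 0. 0 \<le> A * t + B * t\<^sup>2 + C * t ^ 3 + D * t ^ 4"
    "\<forall>\<^sub>F t in at_left 0. 0 \<le> A * t + B * t\<^sup>2 + C * t ^ 3 + D * t ^ 4"
    using ev by (simp_all add: eventually_at_split)
  have "\<forall>\<^sub>F t in at_right 0. 0 \<le> A + B * t + C * t\<^sup>2 + D * t ^ 3"
    using r(1) eventually_at_right_less[of "0::real"] unfolding f
    by eventually_elim (simp add: zero_le_mult_iff)
  then have "0 \<le> A" using tendsto_lowerbound[OF l(1)] by simp
  have neg: "\<forall>\<^sub>F t in at_left (0::real). t < 0" by (simp add: eventually_at_filter)
  have "\<forall>\<^sub>F t in at_left 0. A + B * t + C * t\<^sup>2 + D * t ^ 3 \<le> 0"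
    using r(2) neg unfolding f
    by eventually_elim (simp add: zero_le_mult_iff)
  then have "A \<le> 0" using tendsto_upperbound[OF l(2)] by simp
  then show A: "A = 0" using \<open>0 \<le> A\<close> by simp
  have "((\<lambda>t. B + C * t + D * t\<^sup>2) \<longlongrightarrow> B) (at_right 0)" by (auto intro!: tendsto_eq_intros)
  moreover have "\<forall>\<^sub>F t in at_right 0. 0 \<le> B + C * t + D * t\<^sup>2"
    using r(1) eventually_at_right_less[of "0::real"]
  proof eventually_elim
    case (elim t)
    have "A * t + B * t\<^sup>2 + C * t ^ 3 + D * t ^ 4 = t\<^sup>2 * (B + C * t + D * t\<^sup>2)"
      by (simp add: A power2_eq_square power3_eq_cube power4_eq_xxxx algebra_simps)
    then show ?case using elim by (simp add: zero_le_mult_iff)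
  qed
  ultimately show "B \<ge> 0" using tendsto_lowerbound by fastforce
qed

text \<open>The first two coefficients of the polynomial inequality of \<open>lmin_perturb\<close>.
  The factor \<open>psum c + 2 * \<tau> * qsum c\<close> is the Lagrange multiplier; its 2 reflects
  that \<open>qsum\<close> has twice the degree of \<open>psum\<close>.\<close>

lemma lmin_variations:
  assumes min: "lmin \<tau> c" and v: "h1 v"
  shows lmin_first: "rip (wsqrt c) (wsqrt v) + 2 * \<tau> * rip (bil c c) (bil c v) = (psum c + 2 * \<tau> * qsum c) * rip c v"
    and lmin_second: "rip c v = 0 \<Longrightarrow> rip (wsqrt c) (wsqrt v) = 0 \<Longrightarrow>
      0 \<le> psum v - (psum c + 2 * \<tau> * qsum c) * msum v + \<tau> * (4 * rip (bil c v) (bil c v) + 2 * rip (bil c c) (bil v v))"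
proof -
  have c: "h1 c" "msum c = 1" using min by (auto simp: lmin_def)
  have l: "l2 c" "l2 v" using c v h1_imp_l2 by auto
  define p1 where "p1 = rip (wsqrt c) (wsqrt v)"
  define m1 where "m1 = rip c v"
  define b1 where "b1 = rip (bil c c) (bil c v)"
  define b2 where "b2 = 4 * rip (bil c v) (bil c v) + 2 * rip (bil c c) (bil v v)"
  define b3 where "b3 = 4 * rip (bil c v) (bil v v)"
  define P where "P = psum c"
  define Q where "Q = qsum c"
  define p2 where "p2 = psum v"
  define m2 where "m2 = msum v"
  define q4 where "q4 = qsum v"
  have "\<forall>\<^sub>F t in at 0. 0 \<le> (2 * p1 + 2 * P * m1 + 4 * \<tau> * b1 - 4 * (P + \<tau> * Q) * m1) * t
      + (p2 + 4 * p1 * m1 + P * m2 + \<tau> * b2 - (P + \<tau> * Q) * (2 * m2 + 4 * m1\<^sup>2)) * t\<^sup>2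
      + (2 * p2 * m1 + 2 * p1 * m2 + \<tau> * b3 - 4 * (P + \<tau> * Q) * m1 * m2) * t ^ 3
      + (p2 * m2 + \<tau> * q4 - (P + \<tau> * Q) * m2\<^sup>2) * t ^ 4"
    using lmin_perturb[OF min v]
  proof eventually_elim
    case (elim t)
    then have "0 \<le> (P + 2 * t * p1 + t\<^sup>2 * p2) * (1 + 2 * t * m1 + t\<^sup>2 * m2) + \<tau> * (Q + t * (4 * b1) + t\<^sup>2 * b2 + t ^ 3 * b3 + t ^ 4 * q4)
      - (P + \<tau> * Q) * (1 + 2 * t * m1 + t\<^sup>2 * m2)\<^sup>2"
      unfolding msum_expand[OF l] psum_expand[OF c(1) v] qsum_expand[OF l] c(2)
      unfolding p1_def[symmetric] m1_def[symmetric] b1_def[symmetric] b2_def[symmetric] b3_def[symmetric]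
        P_def[symmetric] Q_def[symmetric] p2_def[symmetric] m2_def[symmetric] q4_def[symmetric] by simp
    then show ?case by (simp add: power2_eq_square power3_eq_cube power4_eq_xxxx algebra_simps)
  qed
  note q = quartic_nonneg_near_0[OF this]
  show "p1 + 2 * \<tau> * b1 = (P + 2 * \<tau> * Q) * m1" using q(1) by (simp add: algebra_simps)
  assume "m1 = 0" "p1 = 0"
  then show "0 \<le> p2 - (P + 2 * \<tau> * Q) * m2 + \<tau> * b2" using q(2) by (simp add: algebra_simps)
qed

section \<open>Instability of monomials\<close>

definition single :: "nat \<Rightarrow> complex \<Rightarrow> nat \<Rightarrow> complex" where
  "single d \<gamma> n = (if n = d then \<gamma> else 0)"

lemma sums_at: "(\<lambda>n. if n = k then r n else 0) sums r k"
  using sums_single[of k r] by simp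

lemma bil_single: "bil (single d \<gamma>) v k = (if d \<le> k then of_real (wt k d) * \<gamma> * v (k - d) else 0)"
proof (cases "d \<le> k")
  case True
  have "bil (single d \<gamma>) v k = (\<Sum>m\<in>{d}. of_real (wt k m) * single d \<gamma> m * v (k - m))"
    unfolding bil_def using True by (intro sum.mono_neutral_right) (auto simp: single_def)
  then show ?thesis using True by (simp add: single_def)
next
  case False
  then show ?thesis unfolding bil_def by (auto simp: single_def intro!: sum.neutral)
qed

lemma h1_finite_support: "(\<And>n. n > N \<Longrightarrow> c n = 0) \<Longrightarrow> h1 c"
  unfolding h1_def by (rule summable_finite[of "{..N}"]) (auto simp: not_le)

lemma h1_single: "h1 (single d \<gamma>)"
  by (rule h1_finite_support[of d]) (auto simp: single_def)

lemma rip_single: "rip c (single n \<omega>) = Re (cnj (c n) * \<omega>)"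
proof -
  have "(\<lambda>m. Re (cnj (c m) * single n \<omega> m)) = (\<lambda>m. if m = n then Re (cnj (c m) * \<omega>) else 0)"
    by (auto simp: single_def)
  then show ?thesis unfolding rip_def using sums_at[of n "\<lambda>m. Re (cnj (c m) * \<omega>)"] by (simp add: sums_iff)
qed

lemma wsqrt_single: "wsqrt (single n \<omega>) = single n (of_real (sqrt (real n)) * \<omega>)"
  by (auto simp: wsqrt_def single_def)

section \<open>The Euler-Lagrange equation and the Hessian at a monomial\<close>

lemma euler_lagrange_summable:
  assumes "l2 c"
  shows "summable (\<lambda>m. of_real (wt (n + m) n) * cnj (c m) * bil c c (n + m))"
proof (rule summable_comparison_test')
  have "summable (\<lambda>m. (cmod (bil c c (m + n)))\<^sup>2)"
    using summable_ignore_initial_segment[OF summable_bil[OF assms assms], of n] .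
  then show "summable (\<lambda>m. ((cmod (c m))\<^sup>2 + (cmod (bil c c (m + n)))\<^sup>2) / 2)"
    using assms unfolding l2_def by (intro summable_divide summable_add)
  fix m
  have "norm (of_real (wt (n + m) n) * cnj (c m) * bil c c (n + m)) = wt (n + m) n * (cmod (c m) * cmod (bil c c (n + m)))"
    by (simp add: norm_mult)
  also have "\<dots> \<le> 1 * (cmod (c m) * cmod (bil c c (n + m)))"
    by (intro mult_right_mono wt_le_1) auto
  also have "\<dots> \<le> ((cmod (c m))\<^sup>2 + (cmod (bil c c (n + m)))\<^sup>2) / 2"
    using sum_squares_bound[of "cmod (c m)" "cmod (bil c c (n + m))"] by simp
  finally show "norm (of_real (wt (n + m) n) * cnj (c m) * bil c c (n + m)) \<le> ((cmod (c m))\<^sup>2 + (cmod (bil c c (m + n)))\<^sup>2) / 2"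
    by (simp add: add.commute)
qed

text \<open>The first variation along \<open>single n \<omega>\<close> is a real identity; since
  \<open>\<omega>\<close> is an arbitrary complex number, choosing it equal to the difference of
  both sides yields the complex equation.\<close>

lemma euler_lagrange:
  assumes min: "lmin \<tau> c"
  shows "of_real (psum c + 2 * \<tau> * qsum c - real n) * c n
    = of_real (2 * \<tau>) * (\<Sum>m. of_real (wt (n + m) n) * cnj (c m) * bil c c (n + m))"
proof -
  have c: "h1 c" "l2 c" using min h1_imp_l2 by (auto simp: lmin_def)
  define S where "S = (\<Sum>m. of_real (wt (n + m) n) * cnj (c m) * bil c c (n + m))"
  have S: "(\<lambda>m. of_real (wt (n + m) n) * cnj (c m) * bil c c (n + m)) sums S"
    unfolding S_def by (rule summable_sums[OF euler_lagrange_summable[OF c(2)]])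
  define mu where "mu = psum c + 2 * \<tau> * qsum c"
  have key: "Re (cnj (of_real (mu - real n) * c n - of_real (2 * \<tau>) * S) * \<omega>) = 0" for \<omega>
  proof -
    have "(\<lambda>m. Re (cnj (of_real (wt (n + m) n) * cnj (c m) * bil c c (n + m)) * \<omega>)) sums Re (cnj S * \<omega>)"
      by (intro sums_Re sums_mult2) (use S in \<open>simp only: sums_cnj\<close>)
    moreover have "Re (cnj (of_real (wt (n + m) n) * cnj (c m) * bil c c (n + m)) * \<omega>) = Re (cnj (bil c c (m + n)) * bil c (single n \<omega>) (m + n))" for m
      unfolding bil_sym[of c "single n \<omega>"] bil_single by (simp add: add.commute mult_ac)
    ultimately have "(\<lambda>m. Re (cnj (bil c c (m + n)) * bil c (single n \<omega>) (m + n))) sums Re (cnj S * \<omega>)" by simp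
    moreover have "(\<Sum>k<n. Re (cnj (bil c c k) * bil c (single n \<omega>) k)) = 0"
      unfolding bil_sym[of c "single n \<omega>"] bil_single by (intro sum.neutral) auto
    ultimately have "(\<lambda>k. Re (cnj (bil c c k) * bil c (single n \<omega>) k)) sums (Re (cnj S * \<omega>))"
      by (subst (asm) sums_iff_shift) simp
    then have r: "rip (bil c c) (bil c (single n \<omega>)) = Re (cnj S * \<omega>)" unfolding rip_def by (simp add: sums_iff)
    have w: "rip (wsqrt c) (wsqrt (single n \<omega>)) = real n * Re (cnj (c n) * \<omega>)"
    proof -
      have "cnj (wsqrt c n) * (of_real (sqrt (real n)) * \<omega>) = of_real (sqrt (real n) * sqrt (real n)) * (cnj (c n) * \<omega>)"
        by (simp only: wsqrt_def complex_cnj_mult complex_cnj_complex_of_real of_real_mult mult_ac)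
      then show ?thesis unfolding wsqrt_single rip_single by (simp only: real_sqrt_mult_self abs_of_nat Re_of_real_mult)
    qed
    have e: "real n * Re (cnj (c n) * \<omega>) + 2 * \<tau> * Re (cnj S * \<omega>) = mu * Re (cnj (c n) * \<omega>)"
      using lmin_first[OF min h1_single[of n \<omega>]] unfolding r w rip_single mu_def .
    have "cnj (of_real (mu - real n) * c n - of_real (2 * \<tau>) * S) * \<omega> = of_real (mu - real n) * (cnj (c n) * \<omega>) - of_real (2 * \<tau>) * (cnj S * \<omega>)"
      by (simp add: algebra_simps)
    then have "Re (cnj (of_real (mu - real n) * c n - of_real (2 * \<tau>) * S) * \<omega>) = (mu - real n) * Re (cnj (c n) * \<omega>) - 2 * \<tau> * Re (cnj S * \<omega>)"
      by (simp only: minus_complex.sel Re_of_real_mult)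
    then show ?thesis using e by (simp only: left_diff_distrib)
  qed
  let ?x = "of_real (mu - real n) * c n - of_real (2 * \<tau>) * S"
  have sq: "(cmod z)\<^sup>2 = Re (cnj z * z)" for z unfolding cmod_power2 by (simp add: power2_eq_square)
  have "(cmod ?x)\<^sup>2 = 0" using key[of ?x] sq[of ?x] by (simp only:)
  then have "?x = 0" by (simp only: zero_eq_power2 norm_eq_zero)
  then show ?thesis unfolding S_def mu_def by simp
qed

text \<open>The perturbation has real amplitudes relative to the phase \<open>\<gamma>\<close>, and
  \<open>w d = 0\<close> makes it orthogonal to the monomial. Since \<open>bil\<close> of the
  monomial with itself lives at index \<open>2 * d\<close> alone, the form is diagonal except for
  couplings of \<open>m\<close> with \<open>2 * d - m\<close>.\<close>

lemma second_variation_monomial: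
  fixes w :: "nat \<Rightarrow> real"
  assumes min: "lmin \<tau> (single d \<gamma>)" and \<gamma>: "cmod \<gamma> = 1" and wd: "w d = 0" and wN: "\<And>n. n > N \<Longrightarrow> w n = 0"
  shows "0 \<le> (\<Sum>n\<le>N. (real n - real d - 2 * \<tau> * (wt (2 * d) d)\<^sup>2 + 4 * \<tau> * (wt (n + d) d)\<^sup>2) * (w n)\<^sup>2)
     + 2 * \<tau> * wt (2 * d) d * (\<Sum>m\<le>2 * d. wt (2 * d) m * w m * w (2 * d - m))"
proof -
  define v where "v n = \<gamma> * of_real (w n)" for n
  let ?c = "single d \<gamma>"
  have v: "h1 v" by (rule h1_finite_support[of N]) (simp add: v_def wN)
  have vsq: "(cmod (v n))\<^sup>2 = (w n)\<^sup>2" for n by (simp add: v_def norm_mult \<gamma>)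
  have fin: "(\<Sum>n. u n * (w n)\<^sup>2) = (\<Sum>n\<le>N. u n * (w n)\<^sup>2)" "summable (\<lambda>n. u n * (w n)\<^sup>2)" for u
    using suminf_finite[of "{..N}" "\<lambda>n. u n * (w n)\<^sup>2"] summable_finite[of "{..N}" "\<lambda>n. u n * (w n)\<^sup>2"] wN by auto
  have ms: "msum v = (\<Sum>n\<le>N. 1 * (w n)\<^sup>2)" unfolding fin(1)[symmetric] by (simp add: msum_def vsq)
  have ps: "psum v = (\<Sum>n\<le>N. real n * (w n)\<^sup>2)" unfolding fin(1)[symmetric] by (simp add: psum_def vsq)
  have bcc: "bil ?c ?c k = (if k = 2 * d then of_real (wt (2 * d) d) * \<gamma>\<^sup>2 else 0)" for k
    unfolding bil_single by (auto simp: single_def power2_eq_square)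
  have pc: "psum ?c = real d"
  proof -
    have "(\<lambda>n. real n * (cmod (?c n))\<^sup>2) = (\<lambda>n. if n = d then real n else 0)" by (auto simp: single_def \<gamma>)
    then show ?thesis unfolding psum_def using sums_at[of d real] by (simp add: sums_iff)
  qed
  have qc: "qsum ?c = (wt (2 * d) d)\<^sup>2"
  proof -
    have "(\<lambda>k. (cmod (bil ?c ?c k))\<^sup>2) = (\<lambda>k. if k = 2 * d then (wt (2 * d) d)\<^sup>2 else 0)"
      by (auto simp: bcc norm_mult norm_power \<gamma> power_mult_distrib)
    then show ?thesis unfolding qsum_def using sums_at[of "2 * d" "\<lambda>_. (wt (2 * d) d)\<^sup>2"] by (simp add: sums_iff)
  qed
  have g: "rip (bil ?c v) (bil ?c v) = (\<Sum>n\<le>N. (wt (n + d) d)\<^sup>2 * (w n)\<^sup>2)"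
  proof -
    have "(\<lambda>n. (wt (n + d) d)\<^sup>2 * (w n)\<^sup>2) sums (\<Sum>n\<le>N. (wt (n + d) d)\<^sup>2 * (w n)\<^sup>2)"
      using fin[of "\<lambda>n. (wt (n + d) d)\<^sup>2"] by (simp add: sums_iff)
    moreover have "(wt (n + d) d)\<^sup>2 * (w n)\<^sup>2 = (cmod (bil ?c v (n + d)))\<^sup>2" for n
      by (simp add: bil_single norm_mult \<gamma> power_mult_distrib vsq)
    moreover have "(\<Sum>k<d. (cmod (bil ?c v k))\<^sup>2) = 0" by (intro sum.neutral) (auto simp: bil_single)
    ultimately have "(\<lambda>k. (cmod (bil ?c v k))\<^sup>2) sums (\<Sum>n\<le>N. (wt (n + d) d)\<^sup>2 * (w n)\<^sup>2)"
      by (simp add: sums_iff_shift[where n = d, of "\<lambda>k. (cmod (bil ?c v k))\<^sup>2"])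
    then show ?thesis unfolding rip_self by (simp add: sums_iff)
  qed
  have b: "rip (bil ?c ?c) (bil v v) = wt (2 * d) d * (\<Sum>m\<le>2 * d. wt (2 * d) m * w m * w (2 * d - m))"
  proof -
    have "bil v v (2 * d) = \<gamma>\<^sup>2 * of_real (\<Sum>m\<le>2 * d. wt (2 * d) m * w m * w (2 * d - m))"
      unfolding bil_def v_def of_real_sum sum_distrib_left by (intro sum.cong) (auto simp: power2_eq_square)
    moreover have "cnj (\<gamma>\<^sup>2) * \<gamma>\<^sup>2 = 1" using complex_norm_square[of "\<gamma>\<^sup>2"] \<gamma> by (simp add: norm_power mult.commute)
    ultimately have K: "cnj (of_real (wt (2 * d) d) * \<gamma>\<^sup>2) * bil v v (2 * d) = of_real (wt (2 * d) d * (\<Sum>m\<le>2 * d. wt (2 * d) m * w m * w (2 * d - m)))"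
      by (simp add: mult_ac)
    have "Re (cnj (bil ?c ?c k) * bil v v k) = (if k = 2 * d then wt (2 * d) d * (\<Sum>m\<le>2 * d. wt (2 * d) m * w m * w (2 * d - m)) else 0)" for k
    proof (cases "k = 2 * d")
      case True
      show ?thesis unfolding bcc True if_P[OF refl] K by simp
    qed (simp add: bcc)
    then show ?thesis unfolding rip_def
      using sums_at[of "2 * d" "\<lambda>_. wt (2 * d) d * (\<Sum>m\<le>2 * d. wt (2 * d) m * w m * w (2 * d - m))"] by (simp add: sums_iff)
  qed
  have o1: "rip ?c v = 0" unfolding rip_commute[of ?c] rip_single by (simp add: v_def wd)
  have o2: "rip (wsqrt ?c) (wsqrt v) = 0" unfolding wsqrt_single rip_commute[of "single d _"] rip_single by (simp add: wsqrt_def v_def wd)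
  have "0 \<le> psum v - (real d + 2 * \<tau> * (wt (2 * d) d)\<^sup>2) * msum v + \<tau> * (4 * rip (bil ?c v) (bil ?c v) + 2 * rip (bil ?c ?c) (bil v v))"
    using lmin_second[OF min v o1 o2] unfolding pc qc .
  also have "psum v - (real d + 2 * \<tau> * (wt (2 * d) d)\<^sup>2) * msum v + \<tau> * (4 * rip (bil ?c v) (bil ?c v) + 2 * rip (bil ?c ?c) (bil v v))
    = (\<Sum>n\<le>N. (real n - real d - 2 * \<tau> * (wt (2 * d) d)\<^sup>2 + 4 * \<tau> * (wt (n + d) d)\<^sup>2) * (w n)\<^sup>2)
     + 2 * \<tau> * wt (2 * d) d * (\<Sum>m\<le>2 * d. wt (2 * d) m * w m * w (2 * d - m))"
  proof -
    have "(\<Sum>n\<le>N. (real n - real d - 2 * \<tau> * (wt (2 * d) d)\<^sup>2 + 4 * \<tau> * (wt (n + d) d)\<^sup>2) * (w n)\<^sup>2)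
      = (\<Sum>n\<le>N. real n * (w n)\<^sup>2) - (real d + 2 * \<tau> * (wt (2 * d) d)\<^sup>2) * (\<Sum>n\<le>N. 1 * (w n)\<^sup>2) + 4 * \<tau> * (\<Sum>n\<le>N. (wt (n + d) d)\<^sup>2 * (w n)\<^sup>2)"
      unfolding sum_distrib_left sum_subtractf[symmetric] sum.distrib[symmetric]
      by (rule sum.cong) (auto simp: algebra_simps)
    then show ?thesis unfolding ps ms g b by (simp add: distrib_left)
  qed
  finally show ?thesis .
qed

text \<open>Mode 2 gives the value \<open>2 - \<tau>\<close>; mode 1 would give 1 for every
  \<open>\<tau>\<close>.\<close>

lemma phi0_unstable:
  assumes "\<tau> > 2" "cmod \<gamma> = 1"
  shows "\<not> lmin \<tau> (single 0 \<gamma>)"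
proof
  assume "lmin \<tau> (single 0 \<gamma>)"
  from second_variation_monomial[OF this assms(2), of "\<lambda>n. if n = 2 then 1 else 0" 2]
  have "0 \<le> 2 - 2 * \<tau> * (wt 0 0)\<^sup>2 + 4 * \<tau> * (wt 2 0)\<^sup>2"
    by (simp add: numeral_2_eq_2)
  then show False using assms by (simp add: wt_sq)
qed

text \<open>Mode 5 gives \<open>4 - 5 / 8 * \<tau>\<close>, the source of 32 / 5 and hence of
  \<open>kappa_inf\<close>. It lies above \<open>2 * d\<close>, so no coupling enters; mode 4 would
  become negative only beyond 8.\<close>

lemma phi1_unstable:
  assumes "\<tau> > 32 / 5" "cmod \<gamma> = 1"
  shows "\<not> lmin \<tau> (single 1 \<gamma>)"
proof
  assume "lmin \<tau> (single 1 \<gamma>)"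
  from second_variation_monomial[OF this assms(2), of "\<lambda>n. if n = 5 then 1 else 0" 5]
  have "0 \<le> 4 - 2 * \<tau> * (wt 2 1)\<^sup>2 + 4 * \<tau> * (wt 6 1)\<^sup>2"
    by (simp add: if_distrib if_distribR cong: if_cong)
  then show False using assms by (simp add: wt_sq)
qed

text \<open>For \<open>d \<ge> 2\<close> the quadratic form on the modes \<open>d - 2\<close> and \<open>d + 2\<close> is indefinite for every
  \<open>\<tau> > 0\<close>: its determinant is a quadratic in \<open>X = \<tau> (2 d choose d) / 4^d\<close> with negative
  discriminant.\<close>

lemma phi_ge2_unstable:
  assumes "\<tau> > 0" "cmod \<gamma> = 1" "d \<ge> 2"
  shows "\<not> lmin \<tau> (single d \<gamma>)"
proof
  assume min: "lmin \<tau> (single d \<gamma>)"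
  obtain k where d: "d = k + 2" using assms(3) by (metis add.commute le_Suc_ex)
  define n where "n = real d"
  define q where "q = (wt (2 * d) d)\<^sup>2"
  define X where "X = \<tau> * q"
  \<comment> \<open>With \<open>aY\<close> and \<open>b\<close>, the entries of the form on modes
    \<open>d - 2\<close> and \<open>d + 2\<close>, which couple to each other because they sum to
    \<open>2 * d\<close>.\<close>
  define aX where "aX = - 2 - 2 * \<tau> * q + 4 * \<tau> * (wt (2 * d - 2) d)\<^sup>2"
  define aY where "aY = 2 - 2 * \<tau> * q + 4 * \<tau> * (wt (2 * d + 2) d)\<^sup>2"
  define b where "b = 2 * \<tau> * wt (2 * d) d * wt (2 * d) (d - 2)"
  have form: "0 \<le> aX * x\<^sup>2 + 2 * b * x * y + aY * y\<^sup>2" for x y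
  proof -
    define w where "w m = (if m = k then x else if m = k + 4 then y else 0)" for m
    have "(\<Sum>m\<le>d + 2. u m * (w m)\<^sup>2) = u k * x\<^sup>2 + u (k + 4) * y\<^sup>2" for u
    proof -
      have "(\<Sum>m\<le>d + 2. u m * (w m)\<^sup>2) = (\<Sum>m\<in>{k, k + 4}. u m * (w m)\<^sup>2)"
        by (rule sum.mono_neutral_right) (auto simp: w_def d)
      then show ?thesis by (simp add: w_def)
    qed
    moreover have "(\<Sum>m\<le>2 * d. wt (2 * d) m * w m * w (2 * d - m)) = 2 * wt (2 * d) k * x * y"
    proof -
      have "(\<Sum>m\<le>2 * d. wt (2 * d) m * w m * w (2 * d - m)) = (\<Sum>m\<in>{k, k + 4}. wt (2 * d) m * w m * w (2 * d - m))"
        by (rule sum.mono_neutral_right) (auto simp: w_def d)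
      also have "\<dots> = wt (2 * d) k * x * y + wt (2 * d) (k + 4) * y * x"
        by (simp add: w_def d)
      also have "wt (2 * d) (k + 4) = wt (2 * d) k" using wt_sym[of k "2 * d"] by (simp add: d)
      finally show ?thesis by simp
    qed
    moreover have "real k - real d = - 2" "real (k + 4) - real d = 2" "k + d = 2 * d - 2" "k + 4 + d = 2 * d + 2" "d - 2 = k"
      by (simp_all add: d)
    ultimately have "0 \<le> aX * x\<^sup>2 + aY * y\<^sup>2 + 2 * \<tau> * wt (2 * d) d * (2 * wt (2 * d) k * x * y)"
      using second_variation_monomial[OF min assms(2), of w "d + 2"] unfolding aX_def aY_def q_def
      by (simp only:) (simp add: w_def d)
    then show ?thesis unfolding b_def by (simp add: d mult_ac)
  qed
  have e: "2 * (k + 2) = 2 * k + 4" "2 * k + 4 - 2 = 2 * k + 2" "2 * k + 4 + 2 = 2 * k + 6" "k + 2 - 2 = k" by simp_all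
  have C0: "real (2 * d choose d) = fact (2 * k + 4) / (fact (k + 2))\<^sup>2"
  proof -
    have "real ((2 * k + 4) choose (k + 2)) = fact (2 * k + 4) / (fact (k + 2) * fact (2 * k + 4 - (k + 2)))" by (rule binomial_fact) simp
    moreover have "2 * k + 4 - (k + 2) = k + 2" by simp
    ultimately show ?thesis by (simp only: d e power2_eq_square)
  qed
  have C1: "real (2 * d - 2 choose d) = fact (2 * k + 2) / (fact (k + 2) * fact k)"
  proof -
    have "real ((2 * k + 2) choose (k + 2)) = fact (2 * k + 2) / (fact (k + 2) * fact (2 * k + 2 - (k + 2)))" by (rule binomial_fact) simp
    moreover have "2 * k + 2 - (k + 2) = k" by simp
    ultimately show ?thesis by (simp only: d e power2_eq_square)
  qed
  have C2: "real (2 * d + 2 choose d) = fact (2 * k + 6) / (fact (k + 2) * fact (k + 4))"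
  proof -
    have "real ((2 * k + 6) choose (k + 2)) = fact (2 * k + 6) / (fact (k + 2) * fact (2 * k + 6 - (k + 2)))" by (rule binomial_fact) simp
    moreover have "2 * k + 6 - (k + 2) = k + 4" by simp
    ultimately show ?thesis by (simp only: d e power2_eq_square)
  qed
  have C3: "real (2 * d choose (d - 2)) = fact (2 * k + 4) / (fact k * fact (k + 4))"
  proof -
    have "real ((2 * k + 4) choose (k)) = fact (2 * k + 4) / (fact (k) * fact (2 * k + 4 - (k)))" by (rule binomial_fact) simp
    moreover have "2 * k + 4 - (k) = k + 4" by simp
    ultimately show ?thesis by (simp only: d e power2_eq_square)
  qed
  have fk: "fact (k + 2) = (real k + 2) * (real k + 1) * (fact k :: real)"
    "fact (k + 4) = (real k + 4) * (real k + 3) * (real k + 2) * (real k + 1) * (fact k :: real)"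
    "fact (2 * k + 4) = (2 * real k + 4) * (2 * real k + 3) * (fact (2 * k + 2) :: real)"
    "fact (2 * k + 6) = (2 * real k + 6) * (2 * real k + 5) * (2 * real k + 4) * (2 * real k + 3) * (fact (2 * k + 2) :: real)"
    by (simp_all add: eval_nat_numeral algebra_simps)
  have p: "fact k > (0::real)" "fact (2 * k + 2) > (0::real)" "real k \<ge> 0" by simp_all
  \<comment> \<open>The other three squared weights as rational multiples of \<open>q\<close>.
    Reading \<open>r\<close> as \<open>k\<close>, \<open>G\<close> as \<open>fact k\<close>,
    \<open>F\<close> as \<open>fact (2 * k + 2)\<close> and \<open>T\<close> as a power of 2 turns
    them into identities of rational functions.\<close>
  have gen: "F / ((r + 2) * (r + 1) * G * G) / T = (2 * r + 4) * (2 * r + 3) * F / ((r + 2) * (r + 1) * G)\<^sup>2 / (4 * T) * (2 * (r + 2 - 1) / (2 * (r + 2) - 1))"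
    "(2 * r + 6) * (2 * r + 5) * (2 * r + 4) * (2 * r + 3) * F / ((r + 2) * (r + 1) * G * ((r + 4) * (r + 3) * (r + 2) * (r + 1) * G)) / (4 * T)
      = (2 * r + 4) * (2 * r + 3) * F / ((r + 2) * (r + 1) * G)\<^sup>2 / T * ((2 * (r + 2) + 1) / (2 * (r + 2 + 2)))"
    "(2 * r + 4) * (2 * r + 3) * F / (G * ((r + 4) * (r + 3) * (r + 2) * (r + 1) * G)) / T
      = (2 * r + 4) * (2 * r + 3) * F / ((r + 2) * (r + 1) * G)\<^sup>2 / T * ((r + 2) * (r + 2 - 1) / ((r + 2 + 1) * (r + 2 + 2)))"
    if "r \<ge> 0" "F > 0" "G > 0" "T > 0" for r F G T :: real
    using that by (simp_all add: divide_simps) (simp_all add: algebra_simps power2_eq_square)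
  have nk: "n = real k + 2" by (simp add: n_def d)
  have T: "(2::real) ^ (2 * d) = 4 * 2 ^ (2 * d - 2)" "(2::real) ^ (2 * d + 2) = 4 * 2 ^ (2 * d)" by (simp_all add: d)
  have w1: "(wt (2 * d - 2) d)\<^sup>2 = q * (2 * (n - 1) / (2 * n - 1))"
    unfolding q_def wt_sq C0 C1 T(1) unfolding fk nk by (rule gen(1)) (use p in simp_all)
  have w2: "(wt (2 * d + 2) d)\<^sup>2 = q * ((2 * n + 1) / (2 * (n + 2)))"
    unfolding q_def wt_sq C0 C2 T(2) unfolding fk nk by (rule gen(2)) (use p in simp_all)
  have w3: "(wt (2 * d) (d - 2))\<^sup>2 = q * (n * (n - 1) / ((n + 1) * (n + 2)))"
    unfolding q_def wt_sq C0 C3 unfolding fk nk by (rule gen(3)) (use p in simp_all)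
  have n2: "n = real k + 2" "n \<ge> 2" by (simp_all add: n_def d)
  have "2 * d choose d > 0" by (rule zero_less_binomial) simp
  then have q0: "q > 0" unfolding q_def wt_sq by (intro divide_pos_pos) auto
  then have X0: "X > 0" using assms(1) by (simp add: X_def)
  have aX: "aX * (2 * n - 1) = - 2 * (2 * n - 1) + X * (4 * n - 6)"
    unfolding aX_def w1 X_def using n2(2) by (simp add: field_simps)
  have aY: "aY * (n + 2) = 2 * (n + 2) + X * (2 * n - 2)"
    unfolding aY_def w2 X_def using n2(2) by (simp add: field_simps)
  have b2: "b\<^sup>2 * ((n + 1) * (n + 2)) = 4 * X\<^sup>2 * (n * (n - 1))"
  proof -
    have e1: "b\<^sup>2 = 4 * X\<^sup>2 * (n * (n - 1)) / ((n + 1) * (n + 2))"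
      unfolding b_def power_mult_distrib w3 q_def[symmetric] X_def by (simp add: power2_eq_square)
    have D: "(n + 1) * (n + 2) \<noteq> 0" using n2(2) by auto
    show ?thesis using iffD1[OF nonzero_eq_divide_eq[OF D] e1] .
  qed
  have "aY * (n + 2) > 0" unfolding aY using X0 n2(2) by (intro add_pos_nonneg mult_nonneg_nonneg) auto
  then have aYp: "aY > 0" using n2(2) by (simp add: zero_less_mult_iff)
  \<comment> \<open>At the vector \<open>(aY, - b)\<close> the form takes the value
    \<open>aY\<close> times its determinant.\<close>
  have "0 \<le> aY * (aX * aY - b\<^sup>2)" using form[of aY "- b"] by (simp add: power2_eq_square algebra_simps)
  then have "0 \<le> aX * aY - b\<^sup>2" using aYp by (simp add: zero_le_mult_iff)
  then have "0 \<le> (aX * aY - b\<^sup>2) * ((2 * n - 1) * (n + 2) * (n + 1))" using n2(2) by simp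
  also have "\<dots> = (aX * (2 * n - 1)) * (aY * (n + 2)) * (n + 1) - b\<^sup>2 * ((n + 1) * (n + 2)) * (2 * n - 1)"
    by (simp add: algebra_simps)
  also have "\<dots> = 4 * (- (n + 2) * (2 * n - 1) * (n + 1) + X * (4 * n - 7) * (n + 1) - 3 * X\<^sup>2 * (n - 1))"
    unfolding aX aY b2 by (simp add: power2_eq_square algebra_simps)
  \<comment> \<open>The factor \<open>12 * (n - 1)\<close> lets the quadratic in \<open>X\<close> be
    completed to a perfect square; the cubic in \<open>n\<close> that remains has positive
    coefficients in \<open>k\<close>, where \<open>n = k + 2\<close>.\<close>
  finally have "0 \<le> 12 * (n - 1) * (- (n + 2) * (2 * n - 1) * (n + 1) + X * (4 * n - 7) * (n + 1) - 3 * X\<^sup>2 * (n - 1))"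
    using n2(2) by (simp add: zero_le_mult_iff)
  also have "\<dots> = - (6 * (n - 1) * X - (4 * n - 7) * (n + 1))\<^sup>2 - (n + 1) * (8 * n ^ 3 + 52 * n\<^sup>2 - 53 * n - 25)"
    by (simp add: power2_eq_square power3_eq_cube algebra_simps)
  also have "\<dots> < 0"
  proof -
    have "8 * n ^ 3 + 52 * n\<^sup>2 - 53 * n - 25 = 8 * real k ^ 3 + 100 * (real k)\<^sup>2 + 251 * real k + 141"
      unfolding n2(1) by (simp add: power2_eq_square power3_eq_cube algebra_simps)
    also have "\<dots> > 0" by (intro add_nonneg_pos) auto
    finally have "0 < (n + 1) * (8 * n ^ 3 + 52 * n\<^sup>2 - 53 * n - 25)" using n2(2) by simp
    moreover have "0 \<le> (6 * (n - 1) * X - (4 * n - 7) * (n + 1))\<^sup>2" by simp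
    ultimately show ?thesis by linarith
  qed
  finally show False by simp
qed

lemma single_unstable:
  assumes "\<tau> > 32 / 5" "cmod \<gamma> = 1"
  shows "\<not> lmin \<tau> (single d \<gamma>)"
proof -
  consider "d = 0" | "d = 1" | "d \<ge> 2" by linarith
  then show ?thesis using assms phi0_unstable phi1_unstable phi_ge2_unstable by cases auto
qed

section \<open>States with finitely many zeros\<close>

text \<open>Induction on the number of distinct zeros: each step divides out one zero with its full
  multiplicity.\<close>

lemma entire_finite_zeros_factor:
  fixes f :: "complex \<Rightarrow> complex"
  assumes "f holomorphic_on UNIV" "finite {z. f z = 0}"
  shows "\<exists>p g. p \<noteq> 0 \<and> g holomorphic_on UNIV \<and> (\<forall>z. g z \<noteq> 0) \<and> (\<forall>z. f z = poly p z * g z)"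
  using assms
proof (induction "card {z. f z = 0}" arbitrary: f)
  case 0
  then have "{z. f z = 0} = {}" by simp
  then show ?case using 0 by (intro exI[of _ 1] exI[of _ f]) auto
next
  case (Suc k)
  have "{z. f z = 0} \<noteq> {}"
  proof
    assume "{z. f z = 0} = {}"
    then show False using Suc.hyps(2) by simp
  qed
  then obtain w where w: "f w = 0" by blast
  have nc: "\<not> f constant_on UNIV"
  proof
    assume "f constant_on UNIV"
    then have "{z. f z = 0} = UNIV" using w by (auto simp: constant_on_def)
    then show False using Suc.prems(2) by (simp add: infinite_UNIV_char_0)
  qed
  obtain g r n where g: "0 < n" "0 < r" "g holomorphic_on ball w r"
    "\<And>z. z \<in> ball w r \<Longrightarrow> f z = (z - w) ^ n * g z" "\<And>z. z \<in> ball w r \<Longrightarrow> g z \<noteq> 0"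
    by (rule holomorphic_factor_zero_nonconstant[OF Suc.prems(1) open_UNIV connected_UNIV UNIV_I w nc]) blast
  define h where "h z = (if z \<in> ball w r then g z else f z / (z - w) ^ n)" for z
  have h1: "h z = f z / (z - w) ^ n" if "z \<noteq> w" for z
    using that g(4)[of z] by (auto simp: h_def)
  have hw: "h w \<noteq> 0" using g(2,5) by (simp add: h_def)
  have "h holomorphic_on ball w r \<union> (UNIV - {w})"
  proof (rule holomorphic_on_Un)
    show "h holomorphic_on ball w r" by (rule holomorphic_transform[OF g(3)]) (simp add: h_def)
    have "(\<lambda>z. f z / (z - w) ^ n) holomorphic_on UNIV - {w}"
      by (intro holomorphic_intros holomorphic_on_subset[OF Suc.prems(1)]) auto
    then show "h holomorphic_on UNIV - {w}" by (rule holomorphic_transform) (simp add: h1)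
  qed auto
  moreover have "ball w r \<union> (UNIV - {w}) = UNIV" using g(2) by auto
  ultimately have hh: "h holomorphic_on UNIV" by simp
  have fh: "f z = (z - w) ^ n * h z" for z
    using h1[of z] w g(1) by (cases "z = w") auto
  have Z: "{z. f z = 0} = insert w {z. h z = 0}" using fh hw w g(1) by auto
  have "w \<notin> {z. h z = 0}" using hw by simp
  moreover have fin: "finite {z. h z = 0}" using Suc.prems(2) unfolding Z by simp
  ultimately have "k = card {z. h z = 0}" using Suc.hyps(2) unfolding Z by simp
  from Suc.hyps(1)[OF this hh fin] obtain p G where p: "p \<noteq> 0" "G holomorphic_on UNIV" "\<forall>z. G z \<noteq> 0" "\<forall>z. h z = poly p z * G z"
    by blast
  show ?case
    by (rule exI[of _ "[:- w, 1:] ^ n * p"], rule exI[of _ G]) (use p fh in \<open>auto simp: poly_power\<close>)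
qed

lemma poly_eventually_ge:
  fixes p :: "complex poly"
  assumes "p \<noteq> 0"
  obtains d R where "d > 0" "\<And>z. R \<le> cmod z \<Longrightarrow> d \<le> cmod (poly p z)"
proof -
  obtain a q where p: "p = pCons a q" by (cases p) auto
  show ?thesis
  proof (cases "q = 0")
    case True
    then show ?thesis using that[of "cmod a" 0] assms p by auto
  next
    case False
    from poly_infinity[OF this, of 1 a] show ?thesis using that[of 1] p by auto
  qed
qed

text \<open>Borel--Caratheodory on the disc of radius \<open>2 |z|\<close>, by the Schwarz lemma for
  \<open>q / (2 A - q)\<close>.\<close>

lemma entire_real_part_quadratic:
  fixes q :: "complex \<Rightarrow> complex"
  assumes hol: "q holomorphic_on UNIV" and q0: "q 0 = 0" and re: "\<And>z. Re (q z) \<le> K + (cmod z)\<^sup>2" and K: "K \<ge> 0"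
  obtains \<alpha> \<beta> where "\<And>z. q z = \<alpha> * z\<^sup>2 / 2 + \<beta> * z"
proof -
  have bound: "cmod (q z) \<le> (2 * K + 10) * cmod z ^ 2" if z: "1 \<le> cmod z" for z
  proof -
    define R where "R = 2 * cmod z"
    define A where "A = K + R\<^sup>2 + 1"
    have A: "A > 0" using K by (simp add: A_def add_nonneg_pos)
    have lt: "Re (q (of_real R * \<zeta>)) < A" if "cmod \<zeta> < 1" for \<zeta>
    proof -
      have "R\<^sup>2 * (cmod \<zeta>)\<^sup>2 \<le> R\<^sup>2 * 1" using that by (intro mult_left_mono) (auto simp: power_le_one)
      moreover have "(cmod (of_real R * \<zeta>))\<^sup>2 = R\<^sup>2 * (cmod \<zeta>)\<^sup>2" by (simp add: norm_mult power_mult_distrib)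
      ultimately show ?thesis using re[of "of_real R * \<zeta>"] unfolding A_def by linarith
    qed
    define \<phi> where "\<phi> \<zeta> = q (of_real R * \<zeta>) / (2 * of_real A - q (of_real R * \<zeta>))" for \<zeta>
    have nz: "2 * of_real A - q (of_real R * \<zeta>) \<noteq> 0" if "cmod \<zeta> < 1" for \<zeta>
    proof
      assume "2 * of_real A - q (of_real R * \<zeta>) = 0"
      then have "Re (q (of_real R * \<zeta>)) = 2 * A" by (metis Re_complex_of_real eq_iff_diff_eq_0 of_real_mult of_real_numeral)
      then show False using lt[OF that] A by simp
    qed
    have "cmod (\<phi> (z / of_real R)) \<le> cmod (z / of_real R)"
    proof (rule Schwarz_Lemma(1))
      have "(\<lambda>\<zeta>. q (of_real R * \<zeta>)) holomorphic_on ball 0 1"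
      proof -
        have "(\<lambda>\<zeta>. of_real R * \<zeta>) holomorphic_on ball 0 1" by (intro holomorphic_intros)
        from holomorphic_on_compose[OF this holomorphic_on_subset[OF hol subset_UNIV]] show ?thesis by (simp only: o_def)
      qed
      then show "\<phi> holomorphic_on ball 0 1" unfolding \<phi>_def using nz by (intro holomorphic_intros) auto
      show "\<phi> 0 = 0" by (simp add: \<phi>_def q0)
      show "cmod (\<phi> \<zeta>) < 1" if "cmod \<zeta> < 1" for \<zeta>
      proof -
        let ?q = "q (of_real R * \<zeta>)"
        have "(cmod (2 * of_real A - ?q))\<^sup>2 - (cmod ?q)\<^sup>2 = 4 * A * (A - Re ?q)"
          unfolding cmod_power2 by (simp add: power2_eq_square algebra_simps)
        also have "\<dots> > 0" using A lt[OF that] by simp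
        finally have "cmod ?q < cmod (2 * of_real A - ?q)" by (simp add: power2_less_imp_less)
        then show ?thesis using nz[OF that] by (simp add: \<phi>_def norm_divide)
      qed
      show "cmod (z / of_real R) < 1" using z by (simp add: R_def norm_divide)
    qed
    moreover have e: "cmod (z / of_real R) = 1 / 2" "of_real R * (z / of_real R) = z" using z by (auto simp: R_def norm_divide)
    ultimately have "cmod (q z) / cmod (2 * of_real A - q z) \<le> 1 / 2" unfolding \<phi>_def e norm_divide[of "q z"] by simp
    moreover have "2 * of_real A - q z \<noteq> 0" using nz[of "z / of_real R"] unfolding e by simp
    ultimately have "cmod (q z) \<le> 1 / 2 * cmod (2 * of_real A - q z)" by (simp add: pos_divide_le_eq)
    also have "\<dots> \<le> 1 / 2 * (2 * A + cmod (q z))"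
      using norm_triangle_ineq4[of "2 * of_real A" "q z"] A by simp
    finally have "cmod (q z) \<le> 2 * A" by simp
    also have "\<dots> = (2 * K + 2) * 1 + 8 * cmod z ^ 2" by (simp add: A_def R_def power_mult_distrib)
    also have "\<dots> \<le> (2 * K + 2) * cmod z ^ 2 + 8 * cmod z ^ 2"
      using z K by (intro add_right_mono mult_left_mono) (auto simp: one_le_power)
    finally show ?thesis by (simp add: algebra_simps)
  qed
  have "q z = (\<Sum>k\<le>2. (deriv ^^ k) q 0 / fact k * z ^ k)" for z
    by (rule Liouville_polynomial[OF hol bound])
  then have "q z = (deriv ^^ 2) q 0 * z\<^sup>2 / 2 + (deriv ^^ 1) q 0 * z" for z
    by (simp add: q0 numeral_2_eq_2)
  then show ?thesis by (rule that)
qed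

text \<open>The zero-free factor is \<open>exp (Q z)\<close>. Outside a disc the polynomial is
  bounded below, so the growth of \<open>f\<close> bounds the real part of \<open>Q\<close> from
  above; inside the disc compactness does. A quadratic bound on the real part leaves only degree
  two.\<close>

lemma entire_finite_zeros_gaussian:
  fixes f :: "complex \<Rightarrow> complex"
  assumes hol: "f holomorphic_on UNIV" and fin: "finite {z. f z = 0}"
    and gr: "\<And>z. cmod (f z) \<le> C * exp ((cmod z)\<^sup>2 / 2)"
  obtains p \<alpha> \<beta> where "p \<noteq> 0" "\<And>z. f z = poly p z * exp (\<alpha> * z\<^sup>2 / 2 + \<beta> * z)"
proof -
  obtain p g where p: "p \<noteq> 0" "g holomorphic_on UNIV" "\<And>z. g z \<noteq> 0" "\<And>z. f z = poly p z * g z"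
    using entire_finite_zeros_factor[OF hol fin] by blast
  obtain Q where Q: "Q holomorphic_on UNIV" "\<And>z. exp (Q z) = g z"
    using holomorphic_logarithm_exists[OF convex_UNIV open_UNIV p(2)] p(3) by (metis UNIV_I)
  obtain d R where d: "d > 0" "\<And>z. R \<le> cmod z \<Longrightarrow> d \<le> cmod (poly p z)" using poly_eventually_ge[OF p(1)] by blast
  have "bounded (Q ` cball 0 R)"
    using Q(1) holomorphic_on_imp_continuous_on holomorphic_on_subset
    by (intro compact_imp_bounded compact_continuous_image) auto
  then obtain B where "\<forall>x\<in>cball 0 R. cmod (Q x) \<le> B" unfolding bounded_iff by blast
  then have B: "\<And>z. cmod z \<le> R \<Longrightarrow> cmod (Q z) \<le> B" by simp
  have C: "C / d > 0"
  proof -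
    obtain z :: complex where z: "R \<le> cmod z" by (rule that[of "of_real R"]) simp
    then have "0 < cmod (f z)" using d p(3,4) by (metis norm_mult order_less_le_trans zero_less_mult_iff zero_less_norm_iff)
    then have "0 < C * exp ((cmod z)\<^sup>2 / 2)" using gr[of z] by linarith
    then have "C > 0" by (simp add: zero_less_mult_iff)
    then show ?thesis using d by simp
  qed
  define K where "K = \<bar>ln (C / d)\<bar> + \<bar>B\<bar> + cmod (Q 0)"
  have re: "Re (Q z - Q 0) \<le> K + (cmod z)\<^sup>2" for z
  proof -
    have r0: "Re (Q z - Q 0) \<le> Re (Q z) + cmod (Q 0)" using abs_Re_le_cmod[of "Q 0"] by simp
    show ?thesis
    proof (cases "cmod z \<le> R")
      case True
      have "Re (Q z) \<le> \<bar>B\<bar>" using B[OF True] abs_Re_le_cmod[of "Q z"] by linarith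
      then show ?thesis using r0 unfolding K_def by (smt (verit) abs_ge_zero zero_le_power2)
    next
      case False
      have "d * cmod (g z) \<le> cmod (poly p z) * cmod (g z)" using d(2)[of z] False by (intro mult_right_mono) auto
      also have "\<dots> \<le> C * exp ((cmod z)\<^sup>2 / 2)" using gr[of z] p(4)[of z] by (simp add: norm_mult)
      finally have "exp (Re (Q z)) \<le> C / d * exp ((cmod z)\<^sup>2 / 2)"
        unfolding Q(2)[symmetric] using d(1) by (simp add: field_simps)
      also have "C / d = exp (ln (C / d))" using C by simp
      finally have "exp (Re (Q z)) \<le> exp (ln (C / d) + (cmod z)\<^sup>2 / 2)" by (simp add: exp_add)
      then have "Re (Q z) \<le> ln (C / d) + (cmod z)\<^sup>2 / 2" by simp
      then show ?thesis using r0 unfolding K_def by (smt (verit) abs_ge_self abs_ge_zero zero_le_power2 field_sum_of_halves)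
    qed
  qed
  have "(\<lambda>z. Q z - Q 0) holomorphic_on UNIV" using Q(1) by (intro holomorphic_intros)
  then obtain \<alpha> \<beta> where ab: "\<And>z. Q z - Q 0 = \<alpha> * z\<^sup>2 / 2 + \<beta> * z"
    using entire_real_part_quadratic[of "\<lambda>z. Q z - Q 0" K] re by (auto simp: K_def)
  have fz: "f z = poly (smult (exp (Q 0)) p) z * exp (\<alpha> * z\<^sup>2 / 2 + \<beta> * z)" for z
    unfolding p(4)[of z] Q(2)[symmetric] ab[symmetric] by (simp add: exp_diff)
  show ?thesis by (rule that[OF _ fz]) (use p(1) in simp)
qed

text \<open>Along a direction \<open>u\<close> for which \<open>\<alpha> * u^2\<close> equals the
  modulus of \<open>\<alpha>\<close> the quadratic term grows fastest. The sign of \<open>u\<close>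
  is still free and is chosen so that the term with \<open>\<beta>\<close> has nonnegative real
  part.\<close>

lemma poly_gaussian_growth:
  fixes p :: "complex poly"
  assumes "p \<noteq> 0"
  obtains d R where "d > 0" "\<And>r. r \<ge> R \<Longrightarrow> r \<ge> 0 \<Longrightarrow> \<exists>z. cmod z = r \<and> d * exp (cmod \<alpha> * r\<^sup>2 / 2) \<le> cmod (poly p z * exp (\<alpha> * z\<^sup>2 / 2 + \<beta> * z))"
proof -
  obtain d R where d: "d > 0" "\<And>z. R \<le> cmod z \<Longrightarrow> d \<le> cmod (poly p z)" using poly_eventually_ge[OF assms] by blast
  obtain u0 where u0: "cmod u0 = 1" "\<alpha> * u0\<^sup>2 = of_real (cmod \<alpha>)"
  proof (cases "\<alpha> = 0")
    case True then show ?thesis using that[of 1] by simp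
  next
    case False
    have s1: "(csqrt (of_real (cmod \<alpha>) / \<alpha>))\<^sup>2 = of_real (cmod \<alpha>) / \<alpha>" by simp
    have s2: "cmod (csqrt (of_real (cmod \<alpha>) / \<alpha>)) = 1"
    proof -
      have "(cmod (csqrt (of_real (cmod \<alpha>) / \<alpha>)))\<^sup>2 = 1"
        unfolding norm_power[symmetric] power2_csqrt using False by (simp add: norm_divide)
      then show ?thesis unfolding power2_eq_1_iff using norm_ge_zero[of "csqrt (of_real (cmod \<alpha>) / \<alpha>)"] by linarith
    qed
    show ?thesis by (rule that[OF s2]) (unfold s1, use False in simp)
  qed
  define u where "u = (if Re (\<beta> * u0) \<ge> 0 then u0 else - u0)"
  have u: "cmod u = 1" "\<alpha> * u\<^sup>2 = of_real (cmod \<alpha>)" "Re (\<beta> * u) \<ge> 0" using u0 by (auto simp: u_def)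
  show ?thesis
  proof (rule that[OF d(1), of R])
    fix r :: real assume r: "r \<ge> R" "r \<ge> 0"
    let ?z = "of_real r * u"
    have z: "cmod ?z = r" using r u by (simp add: norm_mult)
    have "\<alpha> * ?z\<^sup>2 / 2 = of_real r ^ 2 * (\<alpha> * u\<^sup>2) / 2" by (simp add: power_mult_distrib)
    then have "\<alpha> * ?z\<^sup>2 / 2 = of_real (cmod \<alpha> * r\<^sup>2 / 2)" unfolding u(2) by simp
    moreover have "\<beta> * ?z = of_real r * (\<beta> * u)" by simp
    ultimately have "Re (\<alpha> * ?z\<^sup>2 / 2 + \<beta> * ?z) = cmod \<alpha> * r\<^sup>2 / 2 + r * Re (\<beta> * u)"
      by (simp only: plus_complex.sel Re_of_real_mult Re_complex_of_real)
    then have "cmod (exp (\<alpha> * ?z\<^sup>2 / 2 + \<beta> * ?z)) \<ge> exp (cmod \<alpha> * r\<^sup>2 / 2)"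
      unfolding norm_exp_eq_Re using r u(3) by simp
    moreover have "d \<le> cmod (poly p ?z)" using d(2) z r by simp
    ultimately have "d * exp (cmod \<alpha> * r\<^sup>2 / 2) \<le> cmod (poly p ?z) * cmod (exp (\<alpha> * ?z\<^sup>2 / 2 + \<beta> * ?z))"
      using d(1) by (intro mult_mono) auto
    then show "\<exists>z. cmod z = r \<and> d * exp (cmod \<alpha> * r\<^sup>2 / 2) \<le> cmod (poly p z * exp (\<alpha> * z\<^sup>2 / 2 + \<beta> * z))"
      unfolding norm_mult[of "poly p _"] using z by blast
  qed
qed

text \<open>The holomorphic factor at scale 1, without the \<open>1 / sqrt pi\<close> of
  \<open>fock_state\<close>. A state at scale \<open>h\<close> differs from it by a dilation and
  nonvanishing factors, so zeros can be studied here.\<close>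

definition fockf :: "(nat \<Rightarrow> complex) \<Rightarrow> complex \<Rightarrow> complex" where
  "fockf c z = (\<Sum>n. c n / of_real (sqrt (fact n)) * z ^ n)"

lemma fockf_sums:
  assumes "l2 c"
  shows "(\<lambda>n. c n / of_real (sqrt (fact n)) * z ^ n) sums fockf c z"
  unfolding fockf_def
proof (rule l2_power_series[where c = "\<lambda>n. of_real (sqrt pi) * c n" and h = 1])
  show "l2 (\<lambda>n. of_real (sqrt pi) * c n)" using assms by (rule l2_cmult)
qed (auto simp: real_sqrt_mult)

lemma fockf_bound:
  assumes "l2 c"
  shows "cmod (fockf c z) \<le> sqrt (msum c) * exp ((cmod z)\<^sup>2 / 2)"
proof (rule Lim_norm_ubound)
  show "(\<lambda>N. \<Sum>n<N. c n / of_real (sqrt (fact n)) * z ^ n) \<longlonglongrightarrow> fockf c z"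
    using fockf_sums[OF assms] by (simp add: sums_def)
  show "\<forall>\<^sub>F N in sequentially. cmod (\<Sum>n<N. c n / of_real (sqrt (fact n)) * z ^ n) \<le> sqrt (msum c) * exp ((cmod z)\<^sup>2 / 2)"
  proof (intro always_eventually allI)
    fix N
    have "cmod (\<Sum>n<N. c n / of_real (sqrt (fact n)) * z ^ n) \<le> (\<Sum>n<N. cmod (c n) * (cmod z ^ n / sqrt (fact n)))"
      by (rule sum_norm_le) (simp add: norm_mult norm_divide norm_power)
    also have "\<dots> \<le> sqrt (\<Sum>n<N. (cmod (c n))\<^sup>2) * sqrt (\<Sum>n<N. (cmod z ^ n / sqrt (fact n))\<^sup>2)"
      using Cauchy_Schwarz_ineq_sum[of "\<lambda>n. cmod (c n)" "\<lambda>n. cmod z ^ n / sqrt (fact n)" "{..<N}"]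
      unfolding real_sqrt_mult[symmetric] by (rule real_le_rsqrt)
    also have "\<dots> \<le> sqrt (msum c) * sqrt (exp ((cmod z)\<^sup>2))"
    proof (intro mult_mono real_sqrt_le_mono)
      show "(\<Sum>n<N. (cmod (c n))\<^sup>2) \<le> msum c" unfolding msum_def using assms unfolding l2_def by (intro sum_le_suminf) auto
      have s: "(\<lambda>n. ((cmod z)\<^sup>2) ^ n / fact n) sums exp ((cmod z)\<^sup>2)"
        using exp_converges[of "(cmod z)\<^sup>2"] by (simp add: divide_inverse_commute)
      have "(\<Sum>n<N. ((cmod z)\<^sup>2) ^ n / fact n) \<le> exp ((cmod z)\<^sup>2)"
        unfolding sums_unique[OF s] using sums_summable[OF s] by (intro sum_le_suminf) auto
      then show "(\<Sum>n<N. (cmod z ^ n / sqrt (fact n))\<^sup>2) \<le> exp ((cmod z)\<^sup>2)"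
        by (simp add: power_divide power_mult[symmetric] mult.commute)
    qed (auto intro: sum_nonneg msum_nonneg assms)
    also have "sqrt (exp ((cmod z)\<^sup>2)) = exp ((cmod z)\<^sup>2 / 2)"
      by (rule real_sqrt_unique) (simp_all add: exp_double[symmetric])
    finally show "cmod (\<Sum>n<N. c n / of_real (sqrt (fact n)) * z ^ n) \<le> sqrt (msum c) * exp ((cmod z)\<^sup>2 / 2)" .
  qed
qed simp

text \<open>Dividing the coefficients by \<open>(sqrt 2 * \<rho>) ^ n\<close> leaves a sequence in
  \<open>l2\<close> and corresponds to a dilation, so \<open>fockf_bound\<close> at the dilated
  point gives the claim.\<close>

lemma fockf_geometric_bound:
  assumes "\<rho> > 0" "\<And>n. cmod (c n) \<le> C * \<rho> ^ n" "l2 c"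
  obtains C' where "\<And>z. cmod (fockf c z) \<le> C' * exp (\<rho>\<^sup>2 * (cmod z)\<^sup>2)"
proof -
  define s where "s = sqrt 2 * \<rho>"
  define d where "d n = c n / of_real (s ^ n)" for n
  have s0: "s > 0" using assms(1) by (simp add: s_def)
  have "l2 d" unfolding l2_def
  proof (rule summable_comparison_test')
    show "summable (\<lambda>n. C\<^sup>2 * (1 / 2) ^ n)" by (intro summable_mult summable_geometric) simp
    fix n
    have "cmod (d n) \<le> C * \<rho> ^ n / s ^ n" unfolding d_def norm_divide using assms(2) s0 by (simp add: norm_power divide_right_mono)
    then have "(cmod (d n))\<^sup>2 \<le> (C * \<rho> ^ n / s ^ n)\<^sup>2" by (rule power_mono) simp
    also have "\<dots> = C\<^sup>2 * (\<rho>\<^sup>2 / s\<^sup>2) ^ n"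
      by (simp add: power_mult_distrib power_divide power_mult[symmetric] mult.commute)
    also have "\<rho>\<^sup>2 / s\<^sup>2 = 1 / 2" using assms(1) by (simp add: s_def power_mult_distrib)
    finally show "norm ((cmod (d n))\<^sup>2) \<le> C\<^sup>2 * (1 / 2) ^ n" by simp
  qed
  have "fockf c z = fockf d (of_real s * z)" for z
    unfolding fockf_def d_def using s0 by (simp add: power_mult_distrib field_simps)
  moreover have "(cmod (of_real s * z))\<^sup>2 / 2 = \<rho>\<^sup>2 * (cmod z)\<^sup>2" for z
    by (simp add: s_def norm_mult power_mult_distrib)
  ultimately have "cmod (fockf c z) \<le> sqrt (msum d) * exp (\<rho>\<^sup>2 * (cmod z)\<^sup>2)" for z
    using fockf_bound[OF \<open>l2 d\<close>, of "of_real s * z"] by simp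
  then show ?thesis by (rule that)
qed

text \<open>An \<open>l2\<close> coefficient sequence forces \<open>o(exp (|z|^2 / 2))\<close>, hence \<open>|\<alpha>| < 1\<close>.\<close>

lemma fockf_gaussian_exponent:
  assumes c: "l2 c" and p: "p \<noteq> 0" and f: "\<And>z. fockf c z = poly p z * exp (\<alpha> * z\<^sup>2 / 2 + \<beta> * z)"
  shows "cmod \<alpha> < 1"
proof (rule ccontr)
  assume "\<not> cmod \<alpha> < 1"
  then have a: "cmod \<alpha> \<ge> 1" by simp
  obtain d R where d: "d > 0" "\<And>r. r \<ge> R \<Longrightarrow> r \<ge> 0 \<Longrightarrow> \<exists>z. cmod z = r \<and> d * exp (cmod \<alpha> * r\<^sup>2 / 2) \<le> cmod (poly p z * exp (\<alpha> * z\<^sup>2 / 2 + \<beta> * z))"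
    by (rule poly_gaussian_growth[OF p]) blast
  have "(\<lambda>N. \<Sum>n. (cmod (c (n + N)))\<^sup>2) \<longlonglongrightarrow> 0"
    using c unfolding l2_def by (rule suminf_exist_split2)
  then have "\<forall>\<^sub>F N in sequentially. (\<Sum>n. (cmod (c (n + N)))\<^sup>2) < (d / 2)\<^sup>2"
    using d(1) by (intro order_tendstoD) auto
  then obtain N where N: "(\<Sum>n. (cmod (c (n + N)))\<^sup>2) < (d / 2)\<^sup>2" by (auto simp: eventually_sequentially)
  \<comment> \<open>The tail beyond \<open>N\<close> contributes less than \<open>d / 2\<close>
    times the critical Gaussian, while the head is a polynomial and negligible against it; together
    they stay below the lower bound with constant \<open>d\<close>.\<close>
  define t where "t n = (if n < N then 0 else c n)" for n
  have ts: "(\<lambda>n. (cmod (t n))\<^sup>2) sums (\<Sum>n. (cmod (c (n + N)))\<^sup>2)"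
  proof -
    have "(\<lambda>n. (cmod (t (n + N)))\<^sup>2) sums (\<Sum>n. (cmod (c (n + N)))\<^sup>2)"
      unfolding t_def using summable_ignore_initial_segment[OF c[unfolded l2_def], of N] by (simp add: summable_sums)
    then show ?thesis by (subst (asm) sums_iff_shift) (simp add: t_def)
  qed
  have lt: "l2 t" unfolding l2_def using sums_summable[OF ts] .
  have mt: "sqrt (msum t) < d / 2" unfolding msum_def sums_unique[OF ts, symmetric]
    using N d(1) by (metis half_gt_zero less_imp_le real_sqrt_less_mono real_sqrt_abs abs_of_nonneg)
  define P where "P r = (\<Sum>n<N. cmod (c n) / sqrt (fact n) * r ^ n)" for r
  have split: "cmod (fockf c z) \<le> P (cmod z) + d / 2 * exp ((cmod z)\<^sup>2 / 2)" for z
  proof -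
    have "(\<lambda>n. c n / of_real (sqrt (fact n)) * z ^ n - t n / of_real (sqrt (fact n)) * z ^ n) sums (fockf c z - fockf t z)"
      by (intro sums_diff fockf_sums c lt)
    moreover have "(\<lambda>n. c n / of_real (sqrt (fact n)) * z ^ n - t n / of_real (sqrt (fact n)) * z ^ n) sums (\<Sum>n<N. c n / of_real (sqrt (fact n)) * z ^ n - t n / of_real (sqrt (fact n)) * z ^ n)"
      by (rule sums_finite) (auto simp: t_def)
    ultimately have e: "fockf c z - fockf t z = (\<Sum>n<N. c n / of_real (sqrt (fact n)) * z ^ n)"
      using sums_unique2 by (fastforce simp: t_def)
    have "cmod (fockf c z - fockf t z) \<le> P (cmod z)"
      unfolding e P_def by (rule sum_norm_le) (simp add: norm_mult norm_divide norm_power)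
    moreover have "cmod (fockf t z) \<le> d / 2 * exp ((cmod z)\<^sup>2 / 2)"
      using fockf_bound[OF lt, of z] mt by (smt (verit) exp_gt_zero mult_right_mono)
    moreover have "cmod (fockf c z) \<le> cmod (fockf c z - fockf t z) + cmod (fockf t z)"
      by (metis diff_add_cancel norm_triangle_ineq)
    ultimately show ?thesis by linarith
  qed
  have "((\<lambda>r. \<Sum>n<N. cmod (c n) / sqrt (fact n) * (r ^ n * exp (- r\<^sup>2 / 2))) \<longlongrightarrow> (\<Sum>n<N. cmod (c n) / sqrt (fact n) * 0)) at_top"
  proof (intro tendsto_intros)
    fix n show "((\<lambda>r::real. r ^ n * exp (- r\<^sup>2 / 2)) \<longlongrightarrow> 0) at_top" by real_asymp
  qed
  then have "\<forall>\<^sub>F r in at_top. (\<Sum>n<N. cmod (c n) / sqrt (fact n) * (r ^ n * exp (- r\<^sup>2 / 2))) < d / 2"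
    using d(1) by (intro order_tendstoD) auto
  then have "\<forall>\<^sub>F r in at_top. r \<ge> R \<and> r \<ge> 0 \<and> P r * exp (- r\<^sup>2 / 2) < d / 2"
    using eventually_ge_at_top[of R] eventually_ge_at_top[of "0::real"]
    by eventually_elim (simp add: P_def sum_distrib_right mult.assoc)
  then obtain r where r: "r \<ge> R" "r \<ge> 0" "P r * exp (- r\<^sup>2 / 2) < d / 2"
    using eventually_happens by force
  obtain z where z: "cmod z = r" "d * exp (cmod \<alpha> * r\<^sup>2 / 2) \<le> cmod (fockf c z)" using d(2)[OF r(1,2)] f by auto
  have "P r < d / 2 * exp (r\<^sup>2 / 2)" using r(3) by (simp add: exp_minus field_simps)
  then have "d * exp (cmod \<alpha> * r\<^sup>2 / 2) < d * exp (r\<^sup>2 / 2)" using split[of z] z by simp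
  then have "cmod \<alpha> * r\<^sup>2 < 1 * r\<^sup>2" using d(1) by simp
  then show False using a mult_right_mono[OF a, of "r\<^sup>2"] by simp
qed

text \<open>A single binomial probability is at most 1; the parameter
  \<open>1 - r\<^sup>2 / 2\<close> is tuned so that a geometric gain in \<open>n\<close> is bought
  at the price of \<open>inverse (r ^ m)\<close>. A sequence decaying like \<open>r ^ m\<close> can
  afford that price.\<close>

lemma wt_le_geometric:
  assumes "0 < r" "r < 1"
  shows "wt (n + m) n \<le> inverse (r ^ m) * (1 / sqrt (2 - r\<^sup>2)) ^ n"
proof -
  define y where "y = r\<^sup>2 / 2"
  have r2: "0 < r\<^sup>2" "r\<^sup>2 < 1" using assms by (auto simp: power_less_one_iff)
  have y: "0 < y" "y < 1" using r2 by (auto simp: y_def)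
  have "real (n + m choose n) * (1 - y) ^ n * y ^ (n + m - n) \<le> (\<Sum>k\<le>n + m. real (n + m choose k) * (1 - y) ^ k * y ^ (n + m - k))"
    using y by (intro member_le_sum) auto
  also have "\<dots> = ((1 - y) + y) ^ (n + m)" by (rule binomial_ring[symmetric])
  finally have "real (n + m choose n) * ((1 - y) ^ n * y ^ m) \<le> 1" by (simp add: mult.assoc)
  then have le: "real (n + m choose n) \<le> 1 / ((1 - y) ^ n * y ^ m)"
    using y by (simp add: pos_le_divide_eq)
  have "(wt (n + m) n)\<^sup>2 \<le> 1 / ((1 - y) ^ n * y ^ m) / 2 ^ (n + m)"
    unfolding wt_sq by (intro divide_right_mono le) simp
  also have "\<dots> = 1 / ((2 * (1 - y)) ^ n * (2 * y) ^ m)"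
    unfolding power_mult_distrib power_add by simp
  also have "\<dots> = 1 / ((2 - r\<^sup>2) ^ n * (r\<^sup>2) ^ m)" by (simp add: y_def)
  also have "\<dots> = (inverse (r ^ m) * (1 / sqrt (2 - r\<^sup>2)) ^ n)\<^sup>2"
  proof -
    have "(1 / sqrt (2 - r\<^sup>2))\<^sup>2 = 1 / (2 - r\<^sup>2)" using r2 by (simp add: power_divide)
    then have e1: "((1 / sqrt (2 - r\<^sup>2)) ^ n)\<^sup>2 = (1 / (2 - r\<^sup>2)) ^ n" by (metis mult.commute power_mult)
    have e2: "(inverse (r ^ m))\<^sup>2 = 1 / (r\<^sup>2) ^ m" by (simp add: power_inverse divide_inverse power_mult[symmetric] mult.commute)
    show ?thesis unfolding power_mult_distrib[of "inverse (r ^ m)"] e1 e2 by (simp add: power_one_over)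
  qed
  finally have "(wt (n + m) n)\<^sup>2 \<le> (inverse (r ^ m) * (1 / sqrt (2 - r\<^sup>2)) ^ n)\<^sup>2" .
  then show ?thesis by (rule power2_le_imp_le) (use assms r2 in auto)
qed

lemma bil_geometric_bound:
  assumes "\<And>n. cmod (c n) \<le> C * \<rho> ^ n"
  shows "cmod (bil c c k) \<le> real (k + 1) * (C\<^sup>2 * \<rho> ^ k)"
proof -
  have C: "C \<ge> 0" using order_trans[OF norm_ge_zero assms[of 0]] by simp
  have b: "cmod (of_real (wt k m) * c m * c (k - m)) \<le> C\<^sup>2 * \<rho> ^ k" if "m \<le> k" for m
  proof -
    have "cmod (of_real (wt k m) * c m * c (k - m)) = wt k m * (cmod (c m) * cmod (c (k - m)))"
      by (simp add: norm_mult)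
    also have "\<dots> \<le> 1 * ((C * \<rho> ^ m) * (C * \<rho> ^ (k - m)))"
    proof (intro mult_mono assms wt_le_1)
      show "0 \<le> C * \<rho> ^ m" using order_trans[OF norm_ge_zero assms[of m]] .
    qed auto
    also have "\<dots> = C\<^sup>2 * \<rho> ^ k" using that by (simp add: power2_eq_square power_add[symmetric] mult_ac)
    finally show ?thesis .
  qed
  have "cmod (bil c c k) \<le> (\<Sum>m\<le>k. C\<^sup>2 * \<rho> ^ k)" unfolding bil_def by (rule sum_norm_le) (use b in auto)
  then show ?thesis by simp
qed

lemma summable_linear_geometric:
  fixes r :: real
  assumes "0 \<le> r" "r < 1"
  shows "summable (\<lambda>m. real (m + 1) * r ^ m)"
  using geometric_deriv_sums[of r] assms by (simp add: sums_iff)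

text \<open>In the Euler-Lagrange sum the \<open>m\<close>-th term carries
  \<open>\<rho> ^ (2 * m)\<close>, at most \<open>r ^ (2 * m)\<close>. One factor
  \<open>r ^ m\<close> pays the price in \<open>wt_le_geometric\<close>, the other gives
  convergence, and the gain in \<open>n\<close> improves the rate by
  \<open>1 / sqrt (2 - r\<^sup>2)\<close>, which is less than 1.\<close>

lemma decay_improve:
  assumes min: "lmin \<tau> c" and \<tau>: "\<tau> \<ge> 0" and r: "0 < r" "r < 1" and \<rho>: "0 < \<rho>" "\<rho> \<le> r"
    and C: "\<And>n. cmod (c n) \<le> C * \<rho> ^ n"
  obtains C' where "\<And>n. cmod (c n) \<le> C' * (1 / sqrt (2 - r\<^sup>2) * \<rho>) ^ n"
proof -
  define \<theta> where "\<theta> = 1 / sqrt (2 - r\<^sup>2)"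
  have r2: "r\<^sup>2 < 1" using r by (auto simp: power_less_one_iff)
  have th: "\<theta> > 0" using r2 by (simp add: \<theta>_def)
  have C0: "C \<ge> 0" using order_trans[OF norm_ge_zero C[of 0]] by simp
  define S where "S = (\<Sum>m. real (m + 1) * r ^ m)"
  have Ss: "summable (\<lambda>m. real (m + 1) * r ^ m)" using r by (intro summable_linear_geometric) auto
  define \<mu> where "\<mu> = psum c + 2 * \<tau> * qsum c"
  have l: "l2 c" using min h1_imp_l2 by (auto simp: lmin_def)
  have el: "\<bar>\<mu> - real n\<bar> * cmod (c n) \<le> 2 * \<tau> * (C ^ 3 * S) * (real (n + 1) * (\<theta> * \<rho>) ^ n)" for n
  proof -
    let ?t = "\<lambda>m. of_real (wt (n + m) n) * cnj (c m) * bil c c (n + m)"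
    have b: "cmod (?t m) \<le> (C ^ 3 * (real (n + 1) * (\<theta> * \<rho>) ^ n)) * (real (m + 1) * r ^ m)" for m
    proof -
      have "cmod (?t m) = wt (n + m) n * (cmod (c m) * cmod (bil c c (n + m)))" by (simp add: norm_mult)
      also have "\<dots> \<le> (inverse (r ^ m) * \<theta> ^ n) * ((C * \<rho> ^ m) * (real (n + m + 1) * (C\<^sup>2 * \<rho> ^ (n + m))))"
        using C0 \<rho>(1) r th wt_le_geometric[OF r] unfolding \<theta>_def
        by (intro mult_mono C bil_geometric_bound[OF C]) auto
      also have "\<dots> = C ^ 3 * (real (n + m + 1) * (\<theta> * \<rho>) ^ n) * (inverse (r ^ m) * \<rho> ^ m * \<rho> ^ m)"
        by (simp add: power_add power_mult_distrib power2_eq_square power3_eq_cube algebra_simps)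
      also have "\<dots> \<le> C ^ 3 * ((real (n + 1) * real (m + 1)) * (\<theta> * \<rho>) ^ n) * r ^ m"
      proof (intro mult_mono)
        have "\<rho> ^ m * \<rho> ^ m \<le> r ^ m * r ^ m" using \<rho> by (intro mult_mono power_mono) auto
        then have "inverse (r ^ m) * (\<rho> ^ m * \<rho> ^ m) \<le> inverse (r ^ m) * (r ^ m * r ^ m)" using r by (intro mult_left_mono) auto
        also have "\<dots> = r ^ m" using r by simp
        finally show "inverse (r ^ m) * \<rho> ^ m * \<rho> ^ m \<le> r ^ m" by (simp add: mult.assoc)
        have "real (n + m + 1) \<le> real ((n + 1) * (m + 1))" unfolding of_nat_le_iff by simp
        then show "real (n + m + 1) \<le> real (n + 1) * real (m + 1)" by (simp only: of_nat_mult)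
      qed (use C0 th \<rho> r in \<open>auto intro!: mult_nonneg_nonneg\<close>)
      finally show ?thesis by (simp add: mult_ac)
    qed
    have "cmod (\<Sum>m. ?t m) \<le> (\<Sum>m. (C ^ 3 * (real (n + 1) * (\<theta> * \<rho>) ^ n)) * (real (m + 1) * r ^ m))"
      by (rule norm_suminf_le[OF b summable_mult[OF Ss]])
    also have "\<dots> = (C ^ 3 * (real (n + 1) * (\<theta> * \<rho>) ^ n)) * S"
      unfolding S_def by (rule suminf_mult[OF Ss])
    finally have "cmod (\<Sum>m. ?t m) \<le> (C ^ 3 * (real (n + 1) * (\<theta> * \<rho>) ^ n)) * S" .
    moreover have "\<bar>\<mu> - real n\<bar> * cmod (c n) = 2 * \<tau> * cmod (\<Sum>m. ?t m)"
      using arg_cong[OF euler_lagrange[OF min, of n], of cmod] \<tau> unfolding \<mu>_def[symmetric] norm_mult norm_of_real by simp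
    ultimately show ?thesis using \<tau> mult_left_mono[of "cmod (\<Sum>m. ?t m)" "(C ^ 3 * (real (n + 1) * (\<theta> * \<rho>) ^ n)) * S" "2 * \<tau>"]
      by (simp add: mult_ac)
  qed
  \<comment> \<open>Beyond \<open>N\<close> the distance of \<open>\<mu>\<close> to \<open>n\<close>
    is at least \<open>(n + 1) / 2\<close>, which cancels the factor \<open>n + 1\<close> coming
    from \<open>bil\<close>.\<close>
  obtain N :: nat where N: "2 * \<bar>\<mu>\<bar> + 1 \<le> real N" using real_arch_simple by blast
  define K where "K = 2 * \<tau> * (C ^ 3 * S)"
  define C' where "C' = max (2 * K) (Max ((\<lambda>n. cmod (c n) / (\<theta> * \<rho>) ^ n) ` {..N}))"
  have tr: "\<theta> * \<rho> > 0" using th \<rho> by simp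
  have "cmod (c n) \<le> C' * (\<theta> * \<rho>) ^ n" for n
  proof (cases "n \<le> N")
    case True
    then have "cmod (c n) / (\<theta> * \<rho>) ^ n \<le> Max ((\<lambda>n. cmod (c n) / (\<theta> * \<rho>) ^ n) ` {..N})" by (intro Max_ge) auto
    then have "cmod (c n) / (\<theta> * \<rho>) ^ n \<le> C'" unfolding C'_def by simp
    then show ?thesis using tr by (simp add: pos_divide_le_eq)
  next
    case False
    then have "real (n + 1) / 2 \<le> \<bar>\<mu> - real n\<bar>" using N by (simp add: abs_if field_simps split: if_splits)
    then have "real (n + 1) / 2 * cmod (c n) \<le> \<bar>\<mu> - real n\<bar> * cmod (c n)" by (rule mult_right_mono) simp
    also have "\<dots> \<le> K * (real (n + 1) * (\<theta> * \<rho>) ^ n)" using el[of n] by (simp add: K_def)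
    finally have "real (n + 1) * cmod (c n) \<le> real (n + 1) * (2 * K * (\<theta> * \<rho>) ^ n)" by (simp add: mult_ac)
    then have "cmod (c n) \<le> 2 * K * (\<theta> * \<rho>) ^ n" by (rule mult_left_le_imp_le) simp
    also have "\<dots> \<le> C' * (\<theta> * \<rho>) ^ n" using tr by (intro mult_right_mono) (auto simp: C'_def)
    finally show ?thesis .
  qed
  then show ?thesis using that unfolding \<theta>_def by blast
qed

text \<open>Keeping \<open>r\<close> fixed while the rate shrinks makes the improvement factor of
  \<open>decay_improve\<close> the same in every round, so finitely many rounds get below any given
  \<open>\<rho>\<close>.\<close>

lemma decay_superexponential:
  assumes min: "lmin \<tau> c" and \<tau>: "\<tau> \<ge> 0" and r: "0 < r" "r < 1" and C: "\<And>n. cmod (c n) \<le> C * r ^ n" and \<rho>: "\<rho> > 0"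
  obtains C' where "\<And>n. cmod (c n) \<le> C' * \<rho> ^ n"
proof -
  define \<theta> where "\<theta> = 1 / sqrt (2 - r\<^sup>2)"
  have r2: "r\<^sup>2 < 1" using r by (auto simp: power_less_one_iff)
  have th: "0 < \<theta>" "\<theta> < 1" using r2 by (auto simp: \<theta>_def)
  have it: "\<exists>C'. \<forall>n. cmod (c n) \<le> C' * (\<theta> ^ j * r) ^ n" for j
  proof (induction j)
    case 0 then show ?case using C by auto
  next
    case (Suc j)
    then obtain D where D: "\<And>n. cmod (c n) \<le> D * (\<theta> ^ j * r) ^ n" by blast
    have "0 < \<theta> ^ j * r" "\<theta> ^ j * r \<le> r" using th r by (auto simp: mult_left_le_one_le power_le_one)
    from decay_improve[OF min \<tau> r this D] obtain C' where "\<And>n. cmod (c n) \<le> C' * (1 / sqrt (2 - r\<^sup>2) * (\<theta> ^ j * r)) ^ n" by blast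
    then show ?case unfolding \<theta>_def[symmetric] by (auto simp: mult.assoc)
  qed
  have "(\<lambda>j. \<theta> ^ j * r) \<longlonglongrightarrow> 0 * r" using th by (intro tendsto_intros LIMSEQ_power_zero) auto
  then have "\<forall>\<^sub>F j in sequentially. \<theta> ^ j * r < \<rho>" using \<rho> by (intro order_tendstoD) auto
  then obtain j where j: "\<theta> ^ j * r < \<rho>" by (auto simp: eventually_sequentially)
  obtain D where D: "\<And>n. cmod (c n) \<le> D * (\<theta> ^ j * r) ^ n" using it[of j] by blast
  have D0: "D \<ge> 0" using order_trans[OF norm_ge_zero D[of 0]] by simp
  have "cmod (c n) \<le> D * \<rho> ^ n" for n
    using D[of n] mult_left_mono[OF power_mono[of "\<theta> ^ j * r" \<rho> n] D0] j th r by simp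
  then show ?thesis by (rule that)
qed

lemma poly_gaussian_bound:
  fixes p :: "complex poly"
  assumes "\<delta> > 0"
  shows "\<exists>C. \<forall>z. cmod (poly p z) \<le> C * exp (\<delta> * (cmod z)\<^sup>2)"
  using assms
proof (induction p arbitrary: \<delta>)
  case 0
  then show ?case by (intro exI[of _ 0]) simp
next
  case (pCons a p)
  obtain C where C: "\<And>z. cmod (poly p z) \<le> C * exp (\<delta> / 2 * (cmod z)\<^sup>2)" using pCons.IH[of "\<delta> / 2"] pCons.prems by auto
  have C0: "C \<ge> 0" using order_trans[OF norm_ge_zero C[of 0]] by simp
  have "cmod (poly (pCons a p) z) \<le> (cmod a + (1 + 2 / \<delta>) * C) * exp (\<delta> * (cmod z)\<^sup>2)" for z
  proof -
    let ?E = "exp (\<delta> / 2 * (cmod z)\<^sup>2)"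
    have E1: "1 \<le> ?E" using pCons.prems by simp
    have EE: "exp (\<delta> * (cmod z)\<^sup>2) = ?E * ?E" by (simp add: exp_add[symmetric])
    have "cmod z \<le> 1 + (cmod z)\<^sup>2" using sum_squares_bound[of "cmod z" 1] by (simp add: power2_eq_square) (smt (verit) norm_ge_zero)
    also have "(cmod z)\<^sup>2 \<le> 2 / \<delta> * ?E"
      using exp_ge_add_one_self[of "\<delta> / 2 * (cmod z)\<^sup>2"] pCons.prems by (simp add: field_simps)
    also have "1 + 2 / \<delta> * ?E \<le> (1 + 2 / \<delta>) * ?E" using E1 by (simp add: distrib_right)
    finally have z: "cmod z \<le> (1 + 2 / \<delta>) * ?E" by simp
    have "cmod (poly (pCons a p) z) \<le> cmod a + cmod z * cmod (poly p z)"
      using norm_triangle_ineq[of a "z * poly p z"] by (simp add: norm_mult)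
    also have "\<dots> \<le> cmod a * (?E * ?E) + ((1 + 2 / \<delta>) * ?E) * (C * ?E)"
    proof (intro add_mono mult_mono z C)
      have "cmod a * (1 * 1) \<le> cmod a * (?E * ?E)" using E1 by (intro mult_left_mono mult_mono) auto
      then show "cmod a \<le> cmod a * (?E * ?E)" by simp
    qed (use pCons.prems in auto)
    finally show ?thesis unfolding EE by (simp add: algebra_simps)
  qed
  then show ?case by blast
qed

text \<open>Growth \<open>exp (s |z|^2 / 2)\<close> with \<open>s < 1\<close> gives geometric decay of the coefficients, by Parseval
  with a Gaussian weight slightly wider than the natural one.\<close>

lemma gaussian_coefficients_decay:
  assumes c: "l2 c" and a: "cmod \<alpha> < 1" and f: "\<And>z. fockf c z = poly p z * exp (\<alpha> * z\<^sup>2 / 2 + \<beta> * z)"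
  obtains C r where "0 < r" "r < 1" "\<And>n. cmod (c n) \<le> C * r ^ n"
proof -
  \<comment> \<open>The slack \<open>1 - |\<alpha>|\<close> is split into eighths: the polynomial
    and the linear exponent cost \<open>4 * \<delta>\<close> in the squared modulus,
    \<open>2 * \<delta>\<close> keep the integral convergent, and \<open>2 * \<delta>\<close> keep
    \<open>t\<close> below 1.\<close>
  define \<delta> where "\<delta> = (1 - cmod \<alpha>) / 8"
  have d: "\<delta> > 0" using a by (simp add: \<delta>_def)
  define t where "t = cmod \<alpha> + 6 * \<delta>"
  have t: "0 < t" unfolding t_def using d by (intro add_nonneg_pos) auto
  have "t = 1 - 2 * \<delta>" by (simp add: t_def \<delta>_def field_simps)
  with d have t: "0 < t" "t < 1" using t by auto
  obtain C where C: "\<And>z. cmod (poly p z) \<le> C * exp (\<delta> * (cmod z)\<^sup>2)" using poly_gaussian_bound[OF d] by blast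
  have C0: "C \<ge> 0" using order_trans[OF norm_ge_zero C[of 0]] by simp
  define D where "D = C * exp ((cmod \<beta>)\<^sup>2 / (4 * \<delta>))"
  have fb: "(cmod (fockf c z))\<^sup>2 \<le> D\<^sup>2 * exp ((t - 2 * \<delta>) * (cmod z)\<^sup>2)" for z
  proof -
    have "Re (\<alpha> * z\<^sup>2 / 2) \<le> cmod \<alpha> * (cmod z)\<^sup>2 / 2"
      using complex_Re_le_cmod[of "\<alpha> * z\<^sup>2 / 2"] by (simp add: norm_mult norm_divide norm_power)
    moreover have "Re (\<beta> * z) \<le> cmod \<beta> * cmod z" using complex_Re_le_cmod[of "\<beta> * z"] by (simp add: norm_mult)
    moreover have "cmod \<beta> * cmod z \<le> (cmod \<beta>)\<^sup>2 / (4 * \<delta>) + \<delta> * (cmod z)\<^sup>2"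
    proof -
      have "0 \<le> (cmod \<beta> - 2 * \<delta> * cmod z)\<^sup>2 / (4 * \<delta>)" using d by simp
      also have "\<dots> = (cmod \<beta>)\<^sup>2 / (4 * \<delta>) + \<delta> * (cmod z)\<^sup>2 - cmod \<beta> * cmod z"
        using d by (simp add: power2_eq_square field_simps)
      finally show ?thesis by simp
    qed
    ultimately have "Re (\<alpha> * z\<^sup>2 / 2 + \<beta> * z) \<le> (cmod \<beta>)\<^sup>2 / (4 * \<delta>) + (cmod \<alpha> / 2 + \<delta>) * (cmod z)\<^sup>2"
      unfolding plus_complex.sel(1) distrib_right by linarith
    then have "cmod (exp (\<alpha> * z\<^sup>2 / 2 + \<beta> * z)) \<le> exp ((cmod \<beta>)\<^sup>2 / (4 * \<delta>)) * exp ((cmod \<alpha> / 2 + \<delta>) * (cmod z)\<^sup>2)"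
      unfolding norm_exp_eq_Re exp_add[symmetric] by simp
    then have "cmod (fockf c z) \<le> (C * exp (\<delta> * (cmod z)\<^sup>2)) * (exp ((cmod \<beta>)\<^sup>2 / (4 * \<delta>)) * exp ((cmod \<alpha> / 2 + \<delta>) * (cmod z)\<^sup>2))"
      unfolding f norm_mult using C C0 by (intro mult_mono) auto
    also have "\<dots> = D * (exp (\<delta> * (cmod z)\<^sup>2) * exp ((cmod \<alpha> / 2 + \<delta>) * (cmod z)\<^sup>2))" by (simp add: D_def)
    also have "exp (\<delta> * (cmod z)\<^sup>2) * exp ((cmod \<alpha> / 2 + \<delta>) * (cmod z)\<^sup>2) = exp ((t - 2 * \<delta>) * (cmod z)\<^sup>2 / 2)"
      unfolding exp_add[symmetric] t_def by (simp add: algebra_simps)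
    finally have "(cmod (fockf c z))\<^sup>2 \<le> (D * exp ((t - 2 * \<delta>) * (cmod z)\<^sup>2 / 2))\<^sup>2" by (rule power_mono) simp
    then show ?thesis by (simp add: power_mult_distrib exp_double[symmetric])
  qed
  let ?I = "\<integral>\<^sup>+ z. ennreal (cmod z ^ (2 * 0) * (cmod (fockf c z))\<^sup>2 * exp (- t * (cmod z)\<^sup>2)) \<partial>lborel"
  have "?I \<le> (\<integral>\<^sup>+ z. ennreal (D\<^sup>2) * ennreal (cmod z ^ (2 * 0) * exp (- (2 * \<delta>) * (cmod z)\<^sup>2)) \<partial>lborel)"
  proof (rule nn_integral_mono)
    fix z
    have "(cmod (fockf c z))\<^sup>2 * exp (- t * (cmod z)\<^sup>2) \<le> D\<^sup>2 * exp ((t - 2 * \<delta>) * (cmod z)\<^sup>2) * exp (- t * (cmod z)\<^sup>2)"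
      using fb by (rule mult_right_mono) simp
    also have "\<dots> = D\<^sup>2 * exp (- (2 * \<delta>) * (cmod z)\<^sup>2)" by (simp add: mult.assoc exp_add[symmetric] algebra_simps)
    finally show "ennreal (cmod z ^ (2 * 0) * (cmod (fockf c z))\<^sup>2 * exp (- t * (cmod z)\<^sup>2)) \<le> ennreal (D\<^sup>2) * ennreal (cmod z ^ (2 * 0) * exp (- (2 * \<delta>) * (cmod z)\<^sup>2))"
      by (simp add: ennreal_mult[symmetric] ennreal_leI)
  qed
  also have "\<dots> = ennreal (D\<^sup>2) * ennreal (pi * fact 0 / (2 * \<delta>) ^ (0 + 1))"
  proof (subst nn_integral_cmult)
    show "ennreal (D\<^sup>2) * (\<integral>\<^sup>+ z. ennreal (cmod z ^ (2 * 0) * exp (- (2 * \<delta>) * (cmod z)\<^sup>2)) \<partial>lborel) = ennreal (D\<^sup>2) * ennreal (pi * fact 0 / (2 * \<delta>) ^ (0 + 1))"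
      by (subst nn_integral_gaussian_moment) (use d in auto)
  qed simp
  also have "\<dots> = ennreal (D\<^sup>2 * (pi * fact 0 / (2 * \<delta>) ^ (0 + 1)))" by (rule ennreal_mult[symmetric]) (use d in auto)
  finally have I: "?I \<le> ennreal (D\<^sup>2 * (pi * fact 0 / (2 * \<delta>) ^ (0 + 1)))" .
  define B where "B = D\<^sup>2 * (pi * fact 0 / (2 * \<delta>) ^ (0 + 1))"
  have B0: "B \<ge> 0" unfolding B_def using d by simp
  have cb: "(cmod (c n))\<^sup>2 \<le> B / pi * t ^ (n + 1)" for n
  proof -
    have "ennreal (pi * fact (n + 0) / t ^ (n + 0 + 1) * (cmod (c n / of_real (sqrt (fact n))))\<^sup>2) \<le> ?I"
      unfolding nn_integral_parseval[OF fockf_sums[OF c] t(1)]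
      using sum_le_suminf[of "\<lambda>n. ennreal (pi * fact (n + 0) / t ^ (n + 0 + 1) * (cmod (c n / of_real (sqrt (fact n))))\<^sup>2)" "{n}"] by simp
    also have "\<dots> \<le> ennreal B" using I unfolding B_def .
    finally have "pi * fact (n + 0) / t ^ (n + 0 + 1) * (cmod (c n / of_real (sqrt (fact n))))\<^sup>2 \<le> B"
      using B0 by (simp add: ennreal_le_iff)
    moreover have "pi * fact (n + 0) / t ^ (n + 0 + 1) * (cmod (c n / of_real (sqrt (fact n))))\<^sup>2 = pi * (cmod (c n))\<^sup>2 / t ^ (n + 1)"
      by (simp add: norm_divide power_divide)
    ultimately have "pi * (cmod (c n))\<^sup>2 / t ^ (n + 1) \<le> B" by (simp only:)
    then have "pi * (cmod (c n))\<^sup>2 \<le> B * t ^ (n + 1)" using t by (simp only: pos_divide_le_eq zero_less_power)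
    then show ?thesis by (simp add: pos_le_divide_eq mult.commute)
  qed
  show ?thesis
  proof (rule that[of "sqrt t" "sqrt (B / pi * t)"])
    show "0 < sqrt t" "sqrt t < 1" using t by auto
    fix n
    have "(cmod (c n))\<^sup>2 \<le> (sqrt (B / pi * t) * sqrt t ^ n)\<^sup>2"
    proof -
      have "(sqrt t ^ n)\<^sup>2 = ((sqrt t)\<^sup>2) ^ n" by (metis mult.commute power_mult)
      then have "(sqrt t ^ n)\<^sup>2 = t ^ n" using t by simp
      moreover have "(sqrt (B / pi * t))\<^sup>2 = B / pi * t" using B0 t by (intro real_sqrt_pow2) auto
      ultimately show ?thesis using cb[of n] unfolding power_mult_distrib by simp
    qed
    then show "cmod (c n) \<le> sqrt (B / pi * t) * sqrt t ^ n"
      by (rule power2_le_imp_le) (use B0 t in auto)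
  qed
qed

lemma lmin_finite_zeros_exponential:
  assumes min: "lmin \<tau> c" and \<tau>: "\<tau> \<ge> 0" and fin: "finite {z. fockf c z = 0}"
  obtains p \<beta> where "p \<noteq> 0" "\<And>z. fockf c z = poly p z * exp (\<beta> * z)"
proof -
  have l: "l2 c" using min h1_imp_l2 by (auto simp: lmin_def)
  have hol: "fockf c holomorphic_on UNIV" by (rule power_series_entire[OF fockf_sums[OF l]])
  obtain p \<alpha> \<beta> where p: "p \<noteq> 0" and f: "\<And>z. fockf c z = poly p z * exp (\<alpha> * z\<^sup>2 / 2 + \<beta> * z)"
    using entire_finite_zeros_gaussian[OF hol fin fockf_bound[OF l]] by blast
  have a: "cmod \<alpha> < 1" by (rule fockf_gaussian_exponent[OF l p f])
  obtain C r where r: "0 < r" "r < 1" "\<And>n. cmod (c n) \<le> C * r ^ n"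
    using gaussian_coefficients_decay[OF l a f] by blast
  have "\<alpha> = 0"
  proof (rule ccontr)
    assume "\<alpha> \<noteq> 0"
    \<comment> \<open>With this rate the growth of \<open>fockf c\<close> has exponent at most
      \<open>|\<alpha>| * |z|^2 / 4\<close>, half of what \<open>poly_gaussian_growth\<close>
      exhibits.\<close>
    define \<rho> where "\<rho> = sqrt (cmod \<alpha>) / 2"
    have \<rho>: "\<rho> > 0" "\<rho>\<^sup>2 = cmod \<alpha> / 4" using \<open>\<alpha> \<noteq> 0\<close> by (auto simp: \<rho>_def power_divide)
    obtain C' where "\<And>n. cmod (c n) \<le> C' * \<rho> ^ n"
      using decay_superexponential[OF min \<tau> r \<rho>(1)] by blast
    from fockf_geometric_bound[OF \<rho>(1) this l] obtain D where D: "\<And>z. cmod (fockf c z) \<le> D * exp (\<rho>\<^sup>2 * (cmod z)\<^sup>2)" by blast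
    obtain d R where d: "d > 0" "\<And>r. r \<ge> R \<Longrightarrow> r \<ge> 0 \<Longrightarrow> \<exists>z. cmod z = r \<and> d * exp (cmod \<alpha> * r\<^sup>2 / 2) \<le> cmod (poly p z * exp (\<alpha> * z\<^sup>2 / 2 + \<beta> * z))"
      by (rule poly_gaussian_growth[OF p]) blast
    have le: "d * exp (cmod \<alpha> * s\<^sup>2 / 4) \<le> D" if s: "s \<ge> R" "s \<ge> 0" for s
    proof -
      obtain z where z: "cmod z = s" "d * exp (cmod \<alpha> * s\<^sup>2 / 2) \<le> cmod (fockf c z)" using d(2)[OF s] f by auto
      have "d * exp (cmod \<alpha> * s\<^sup>2 / 2) \<le> D * exp (cmod \<alpha> * s\<^sup>2 / 4)" using z D[of z] \<rho>(2) by simp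
      moreover have "exp (cmod \<alpha> * s\<^sup>2 / 2) = exp (cmod \<alpha> * s\<^sup>2 / 4) * exp (cmod \<alpha> * s\<^sup>2 / 4)" by (simp add: exp_add[symmetric])
      ultimately have "(d * exp (cmod \<alpha> * s\<^sup>2 / 4)) * exp (cmod \<alpha> * s\<^sup>2 / 4) \<le> D * exp (cmod \<alpha> * s\<^sup>2 / 4)" by simp
      then show ?thesis by (rule mult_right_le_imp_le) simp
    qed
    have "filterlim (\<lambda>s::real. d * exp (cmod \<alpha> * s\<^sup>2 / 4)) at_top at_top"
    proof -
      have "cmod \<alpha> / 4 > 0" using \<open>\<alpha> \<noteq> 0\<close> by simp
      then have "filterlim (\<lambda>s::real. d * exp ((cmod \<alpha> / 4) * s\<^sup>2)) at_top at_top" using d(1) by real_asymp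
      then show ?thesis by simp
    qed
    then have "\<forall>\<^sub>F s in at_top. D < d * exp (cmod \<alpha> * s\<^sup>2 / 4)" by (auto simp: filterlim_at_top_dense)
    then have "\<forall>\<^sub>F s::real in at_top. False"
      using eventually_ge_at_top[of R] eventually_ge_at_top[of "0::real"]
      by eventually_elim (use le in force)
    then show False by simp
  qed
  then have "\<And>z. fockf c z = poly p z * exp (\<beta> * z)" using f by simp
  then show ?thesis using that p by blast
qed

section \<open>The Euler-Lagrange equation for exponential polynomials\<close>

text \<open>With \<open>F\<close> and \<open>G\<close> the Taylor series of entire functions, \<open>H\<close> below is the Taylor series of
  the projection of \<open>cnj F * G\<close>: it is \<open>F\<^sup>* (d/dw)\<close> applied to \<open>G (w / 2)\<close>.\<close>

definition hasS :: "complex fps \<Rightarrow> complex fps \<Rightarrow> complex fps \<Rightarrow> bool" where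
  "hasS F G H \<longleftrightarrow> (\<forall>n. (\<lambda>m. cnj (fps_nth F m) * (fact (n + m) / (fact n * 2 ^ (n + m))) * fps_nth G (n + m)) sums fps_nth H n)"

lemma hasS_add_right:
  assumes "hasS F G H" "hasS F G' H'"
  shows "hasS F (G + G') (H + H')"
  unfolding hasS_def
proof
  fix n
  from sums_add[OF assms(1)[unfolded hasS_def, rule_format, of n] assms(2)[unfolded hasS_def, rule_format, of n]]
  show "(\<lambda>m. cnj (fps_nth F m) * (fact (n + m) / (fact n * 2 ^ (n + m))) * fps_nth (G + G') (n + m)) sums fps_nth (H + H') n"
    by (simp add: distrib_left add_divide_distrib)
qed

lemma hasS_add_left:
  assumes "hasS F G H" "hasS F' G H'"
  shows "hasS (F + F') G (H + H')"
  unfolding hasS_def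
proof
  fix n
  from sums_add[OF assms(1)[unfolded hasS_def, rule_format, of n] assms(2)[unfolded hasS_def, rule_format, of n]]
  show "(\<lambda>m. cnj (fps_nth (F + F') m) * (fact (n + m) / (fact n * 2 ^ (n + m))) * fps_nth G (n + m)) sums fps_nth (H + H') n"
    by (simp add: distrib_right add_divide_distrib)
qed

lemma hasS_cmult_right:
  assumes "hasS F G H"
  shows "hasS F (fps_const c * G) (fps_const c * H)"
  unfolding hasS_def
proof
  fix n
  from sums_mult[OF assms(1)[unfolded hasS_def, rule_format, of n], of "c"]
  show "(\<lambda>m. cnj (fps_nth F m) * (fact (n + m) / (fact n * 2 ^ (n + m))) * fps_nth (fps_const c * G) (n + m)) sums fps_nth (fps_const c * H) n"
    by (simp add: mult_ac)
qed

lemma hasS_cmult_left: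
  assumes "hasS F G H"
  shows "hasS (fps_const c * F) G (fps_const (cnj c) * H)"
  unfolding hasS_def
proof
  fix n
  from sums_mult[OF assms(1)[unfolded hasS_def, rule_format, of n], of "cnj c"]
  show "(\<lambda>m. cnj (fps_nth (fps_const c * F) m) * (fact (n + m) / (fact n * 2 ^ (n + m))) * fps_nth G (n + m)) sums fps_nth (fps_const (cnj c) * H) n"
    by (simp add: mult_ac)
qed

lemma hasS_0_left: "hasS 0 G 0" by (simp add: hasS_def)

lemma hasS_sum_left:
  "finite A \<Longrightarrow> (\<And>i. i \<in> A \<Longrightarrow> hasS (F i) G (H i)) \<Longrightarrow> hasS (\<Sum>i\<in>A. F i) G (\<Sum>i\<in>A. H i)"
  by (induction A rule: finite_induct) (auto simp: hasS_0_left hasS_add_left)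

text \<open>A factor \<open>X\<close> on the left becomes a derivative acting on
  \<open>G (w / 2)\<close>; the chain rule gives the factor 1/2.\<close>

lemma hasS_X_left:
  assumes "hasS F (fps_deriv G) H"
  shows "hasS (fps_X * F) G (fps_const (1 / 2) * H)"
  unfolding hasS_def
proof
  fix n
  let ?u = "\<lambda>m. cnj (fps_nth (fps_X * F) m) * (fact (n + m) / (fact n * 2 ^ (n + m))) * fps_nth G (n + m)"
  have "(\<lambda>m. 1 / 2 * (cnj (fps_nth F m) * (fact (n + m) / (fact n * 2 ^ (n + m))) * fps_nth (fps_deriv G) (n + m))) sums (1 / 2 * fps_nth H n)"
    using assms unfolding hasS_def by (intro sums_mult) blast
  moreover have "1 / 2 * (cnj (fps_nth F m) * (fact (n + m) / (fact n * 2 ^ (n + m))) * fps_nth (fps_deriv G) (n + m)) = ?u (Suc m)" for m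
  proof -
    have "fact (n + Suc m) = (of_nat (n + m + 1) * fact (n + m) :: complex)" by simp
    then show ?thesis by (simp add: mult_ac del: of_nat_Suc of_nat_add fact_Suc)
  qed
  ultimately have "(\<lambda>m. ?u (Suc m)) sums (1 / 2 * fps_nth H n)" by simp
  then show "?u sums fps_nth (fps_const (1 / 2) * H) n" by (subst (asm) sums_Suc_iff) simp
qed

text \<open>Commutation rule: moving the differential operator past multiplication by
  \<open>w\<close> leaves an extra term in which \<open>F\<close> is replaced by its derivative. On
  coefficients, the factor \<open>n + m\<close> of \<open>fact (n + m)\<close> is split into the
  parts \<open>A\<close> and \<open>B\<close>.\<close>

lemma hasS_X_right:
  assumes "hasS F G H" "hasS (fps_deriv F) G H'"
  shows "hasS F (fps_X * G) (fps_const (1 / 2) * (fps_X * H + H'))"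
  unfolding hasS_def
proof
  fix n
  let ?u = "\<lambda>m. cnj (fps_nth F m) * (fact (n + m) / (fact n * 2 ^ (n + m))) * fps_nth (fps_X * G) (n + m)"
  define A where "A m = (if n = 0 then 0 else 1 / 2 * (cnj (fps_nth F m) * (fact (n - 1 + m) / (fact (n - 1) * 2 ^ (n - 1 + m))) * fps_nth G (n - 1 + m)))" for m
  define B where "B m = (if m = 0 then 0 else 1 / 2 * (cnj (fps_nth (fps_deriv F) (m - 1)) * (fact (n + (m - 1)) / (fact n * 2 ^ (n + (m - 1)))) * fps_nth G (n + (m - 1))))" for m
  have sA: "A sums (1 / 2 * fps_nth (fps_X * H) n)"
  proof (cases "n = 0")
    case True then show ?thesis by (simp add: A_def[abs_def])
  next
    case False
    have "(\<lambda>m. 1 / 2 * (cnj (fps_nth F m) * (fact (n - 1 + m) / (fact (n - 1) * 2 ^ (n - 1 + m))) * fps_nth G (n - 1 + m))) sums (1 / 2 * fps_nth H (n - 1))"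
      using assms(1) unfolding hasS_def by (intro sums_mult) blast
    then show ?thesis using False by (simp add: A_def[abs_def])
  qed
  have sB: "B sums (1 / 2 * fps_nth H' n)"
  proof -
    have "(\<lambda>m. 1 / 2 * (cnj (fps_nth (fps_deriv F) m) * (fact (n + m) / (fact n * 2 ^ (n + m))) * fps_nth G (n + m))) sums (1 / 2 * fps_nth H' n)"
      using assms(2) unfolding hasS_def by (intro sums_mult) blast
    then have "(\<lambda>m. B (Suc m)) sums (1 / 2 * fps_nth H' n)" by (simp add: B_def)
    then show ?thesis by (subst (asm) sums_Suc_iff) (simp add: B_def)
  qed
  have "?u m = A m + B m" for m
  proof (cases "n + m = 0")
    case True then show ?thesis by (simp add: A_def B_def)
  next
    case False
    then obtain k where k: "n + m = Suc k" by (metis not0_implies_Suc)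
    have "?u m = cnj (fps_nth F m) * (fact (Suc k) / (fact n * 2 ^ Suc k)) * fps_nth G k" unfolding k by simp
    also have "fact (Suc k) = ((of_nat n + of_nat m) * fact k :: complex)"
      using k by (metis fact_Suc of_nat_add)
    finally have u: "?u m = of_nat n * (cnj (fps_nth F m) * (fact k / (fact n * 2 ^ Suc k)) * fps_nth G k) + of_nat m * (cnj (fps_nth F m) * (fact k / (fact n * 2 ^ Suc k)) * fps_nth G k)"
      by (simp add: add_divide_distrib distrib_left distrib_right mult_ac)
    have "A m = of_nat n * (cnj (fps_nth F m) * (fact k / (fact n * 2 ^ Suc k)) * fps_nth G k)"
    proof (cases n)
      case 0 then show ?thesis by (simp add: A_def)
    next
      case (Suc j)
      then have e: "j + m = k" using k by simp
      have "fact (Suc j) = (of_nat (Suc j) * fact j :: complex)" by (rule fact_Suc)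
      then show ?thesis unfolding A_def Suc using e by (simp add: mult_ac del: of_nat_Suc fact_Suc)
    qed
    moreover have "B m = of_nat m * (cnj (fps_nth F m) * (fact k / (fact n * 2 ^ Suc k)) * fps_nth G k)"
    proof (cases m)
      case 0 then show ?thesis by (simp add: B_def)
    next
      case (Suc j)
      then have e: "n + j = k" using k by simp
      then show ?thesis unfolding B_def Suc by (simp add: mult_ac del: of_nat_Suc fact_Suc)
    qed
    ultimately show ?thesis using u by simp
  qed
  then show "?u sums fps_nth (fps_const (1 / 2) * (fps_X * H + H')) n"
    using sums_add[OF sA sB] by (simp add: distrib_left)
qed

context
  fixes \<beta> :: complex
begin

text \<open>For \<open>F = exp (\<beta> w)\<close> the operator is translation by
  \<open>cnj \<beta>\<close>, so the argument \<open>w / 2\<close> becomes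
  \<open>(w + cnj \<beta>) / 2\<close>. \<open>KE\<close> is what
  \<open>exp (2 * \<beta> * w)\<close> turns into under this substitution.\<close>

definition lin :: "complex poly" where "lin = [:cnj \<beta> / 2, 1 / 2:]"

definition KE :: "complex fps" where "KE = fps_const (of_real (exp ((cmod \<beta>)\<^sup>2))) * fps_exp \<beta>"

lemma hasS_exp: "hasS (fps_exp \<beta>) (fps_exp (2 * \<beta>)) KE"
  unfolding hasS_def
proof
  fix n
  have "(\<lambda>m. ((cmod \<beta>)\<^sup>2) ^ m / fact m) sums exp ((cmod \<beta>)\<^sup>2)"
    using exp_converges[of "(cmod \<beta>)\<^sup>2"] by (simp add: divide_inverse_commute)
  then have "(\<lambda>m. complex_of_real (((cmod \<beta>)\<^sup>2) ^ m / fact m)) sums of_real (exp ((cmod \<beta>)\<^sup>2))"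
    by (simp only: sums_of_real_iff)
  then have "(\<lambda>m. complex_of_real (((cmod \<beta>)\<^sup>2) ^ m / fact m) * (\<beta> ^ n / fact n)) sums (of_real (exp ((cmod \<beta>)\<^sup>2)) * (\<beta> ^ n / fact n))"
    by (rule sums_mult2)
  moreover have "complex_of_real (((cmod \<beta>)\<^sup>2) ^ m / fact m) * (\<beta> ^ n / fact n)
    = cnj (fps_nth (fps_exp \<beta>) m) * (fact (n + m) / (fact n * 2 ^ (n + m))) * fps_nth (fps_exp (2 * \<beta>)) (n + m)" for m
  proof -
    have "complex_of_real (((cmod \<beta>)\<^sup>2) ^ m / fact m) = (complex_of_real ((cmod \<beta>)\<^sup>2)) ^ m / fact m" by simp
    also have "\<dots> = \<beta> ^ m * cnj \<beta> ^ m / fact m" unfolding complex_norm_square by (simp add: power_mult_distrib)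
    finally show ?thesis by (simp add: power_mult_distrib power_add field_simps)
  qed
  ultimately show "(\<lambda>m. cnj (fps_nth (fps_exp \<beta>) m) * (fact (n + m) / (fact n * 2 ^ (n + m))) * fps_nth (fps_exp (2 * \<beta>)) (n + m)) sums fps_nth KE n"
    by (simp add: KE_def)
qed

lemma hasS_exp_poly: "hasS (fps_exp \<beta>) (fps_of_poly s * fps_exp (2 * \<beta>)) (fps_of_poly (pcompose s lin) * KE)"
proof (induction s)
  case 0
  show ?case by (simp add: hasS_def)
next
  case (pCons a s)
  let ?G = "fps_of_poly s * fps_exp (2 * \<beta>)" and ?H = "fps_of_poly (pcompose s lin) * KE"
  have "hasS (fps_deriv (fps_exp \<beta>)) ?G (fps_const (cnj \<beta>) * ?H)"
    using hasS_cmult_left[OF pCons.IH, of \<beta>] by simp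
  from hasS_add_right[OF hasS_cmult_right[OF hasS_exp, of a] hasS_X_right[OF pCons.IH this]]
  have "hasS (fps_exp \<beta>) (fps_const a * fps_exp (2 * \<beta>) + fps_X * ?G)
    (fps_const a * KE + fps_const (1 / 2) * (fps_X * ?H + fps_const (cnj \<beta>) * ?H))" .
  moreover have "fps_const a * fps_exp (2 * \<beta>) + fps_X * ?G = fps_of_poly (pCons a s) * fps_exp (2 * \<beta>)"
    by (simp add: fps_of_poly_pCons algebra_simps)
  moreover have "fps_const a * KE + fps_const (1 / 2) * (fps_X * ?H + fps_const (cnj \<beta>) * ?H) = fps_of_poly (pcompose (pCons a s) lin) * KE"
  proof -
    have "fps_of_poly lin = fps_const (1 / 2) * (fps_X + fps_const (cnj \<beta>))"
      unfolding lin_def by (simp add: fps_of_poly_pCons distrib_left fps_const_mult[symmetric] mult.commute del: fps_const_mult)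
    then show ?thesis unfolding pcompose_pCons fps_of_poly_add fps_of_poly_mult
      by (simp only: fps_of_poly_const distrib_left distrib_right mult_ac)
  qed
  ultimately show ?case by simp
qed

text \<open>Half the derivative of \<open>exp (2 * \<beta> * w)\<close> contributes a term with
  \<open>\<beta>\<close>, and the shift by \<open>- cnj \<beta>\<close> on the left, which enters
  conjugated, cancels it. Hence only \<open>s\<close> is differentiated; this is why
  \<open>p\<close> is expanded about \<open>cnj \<beta>\<close>.\<close>

lemma hasS_shifted_power:
  "hasS (fps_of_poly ([:- cnj \<beta>, 1:] ^ i) * fps_exp \<beta>) (fps_of_poly s * fps_exp (2 * \<beta>))
     (fps_const (1 / 2 ^ i) * (fps_of_poly (pcompose ((pderiv ^^ i) s) lin) * KE))"
proof (induction i arbitrary: s)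
  case 0
  show ?case using hasS_exp_poly[of s] by simp
next
  case (Suc i)
  let ?F = "fps_of_poly ([:- cnj \<beta>, 1:] ^ i) * fps_exp \<beta>"
  let ?H = "\<lambda>s. fps_const (1 / 2 ^ i) * (fps_of_poly (pcompose ((pderiv ^^ i) s) lin) * KE)"
  have d: "fps_deriv (fps_of_poly s * fps_exp (2 * \<beta>)) = fps_of_poly (pderiv s) * fps_exp (2 * \<beta>) + fps_const (2 * \<beta>) * (fps_of_poly s * fps_exp (2 * \<beta>))"
    by (simp add: fps_of_poly_pderiv algebra_simps)
  have "hasS ?F (fps_deriv (fps_of_poly s * fps_exp (2 * \<beta>))) (?H (pderiv s) + fps_const (2 * \<beta>) * ?H s)"
    unfolding d by (intro hasS_add_right hasS_cmult_right Suc.IH)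
  from hasS_add_left[OF hasS_X_left[OF this] hasS_cmult_left[OF Suc.IH[of s], of "- cnj \<beta>"]]
  have "hasS (fps_X * ?F + fps_const (- cnj \<beta>) * ?F) (fps_of_poly s * fps_exp (2 * \<beta>))
     (fps_const (1 / 2) * (?H (pderiv s) + fps_const (2 * \<beta>) * ?H s) + fps_const (cnj (- cnj \<beta>)) * ?H s)" .
  moreover have "fps_X * ?F + fps_const (- cnj \<beta>) * ?F = fps_of_poly ([:- cnj \<beta>, 1:] ^ Suc i) * fps_exp \<beta>"
  proof -
    have "fps_of_poly [:- cnj \<beta>, 1:] = fps_X + fps_const (- cnj \<beta>)" by (simp add: fps_of_poly_pCons)
    then show ?thesis unfolding power_Suc fps_of_poly_mult by (simp only: distrib_right mult.assoc)
  qed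
  moreover have "fps_const (1 / 2) * (?H (pderiv s) + fps_const (2 * \<beta>) * ?H s) + fps_const (cnj (- cnj \<beta>)) * ?H s
     = fps_const (1 / 2 ^ Suc i) * (fps_of_poly (pcompose ((pderiv ^^ Suc i) s) lin) * KE)"
  proof -
    have c1: "fps_const (1 / 2) * (fps_const (2 * \<beta>) * Z) + fps_const (cnj (- cnj \<beta>)) * Z = 0" for Z
    proof -
      have "fps_const (1 / 2) * (fps_const (2 * \<beta>) * Z) = fps_const \<beta> * Z"
        unfolding mult.assoc[symmetric] fps_const_mult by simp
      moreover have "fps_const (cnj (- cnj \<beta>)) * Z = - (fps_const \<beta> * Z)"
        by (simp add: fps_const_neg[symmetric] del: fps_const_neg)
      ultimately show ?thesis by simp
    qed
    have "fps_const (1 / 2) * (?H (pderiv s) + fps_const (2 * \<beta>) * ?H s) + fps_const (cnj (- cnj \<beta>)) * ?H s = fps_const (1 / 2) * ?H (pderiv s)"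
      unfolding distrib_left add.assoc c1 by simp
    also have "\<dots> = fps_const (1 / 2 ^ Suc i) * (fps_of_poly (pcompose ((pderiv ^^ i) (pderiv s)) lin) * KE)"
      unfolding mult.assoc[symmetric] fps_const_mult by simp
    finally show ?thesis unfolding funpow_Suc_right o_apply .
  qed
  ultimately show ?case by simp
qed

lemma pcompose_monom': "pcompose (monom a i) q = smult a (q ^ i)" for q :: "complex poly"
  by (induction i) (simp_all add: monom_0 monom_Suc pcompose_pCons)

lemma poly_expand_at:
  fixes p :: "complex poly"
  defines "pt \<equiv> pcompose p [:cnj \<beta>, 1:]"
  shows "p = (\<Sum>i\<le>degree pt. smult (coeff pt i) ([:- cnj \<beta>, 1:] ^ i))"
proof -
  have "p = pcompose pt [:- cnj \<beta>, 1:]"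
    unfolding pt_def pcompose_assoc[symmetric] by (simp add: pcompose_pCons)
  also have "pt = (\<Sum>i\<le>degree pt. monom (coeff pt i) i)" by (rule poly_as_sum_of_monoms[symmetric])
  finally show ?thesis by (simp add: pcompose_sum pcompose_monom')
qed

lemma hasS_poly_exp:
  fixes p s :: "complex poly"
  defines "pt \<equiv> pcompose p [:cnj \<beta>, 1:]"
  shows "hasS (fps_of_poly p * fps_exp \<beta>) (fps_of_poly s * fps_exp (2 * \<beta>))
    (fps_of_poly (\<Sum>i\<le>degree pt. smult (cnj (coeff pt i) / 2 ^ i) (pcompose ((pderiv ^^ i) s) lin)) * KE)"
proof -
  have "hasS (\<Sum>i\<le>degree pt. fps_const (coeff pt i) * (fps_of_poly ([:- cnj \<beta>, 1:] ^ i) * fps_exp \<beta>)) (fps_of_poly s * fps_exp (2 * \<beta>))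
    (\<Sum>i\<le>degree pt. fps_const (cnj (coeff pt i)) * (fps_const (1 / 2 ^ i) * (fps_of_poly (pcompose ((pderiv ^^ i) s) lin) * KE)))"
    by (intro hasS_sum_left hasS_cmult_left hasS_shifted_power) simp
  moreover have "(\<Sum>i\<le>degree pt. fps_const (coeff pt i) * (fps_of_poly ([:- cnj \<beta>, 1:] ^ i) * fps_exp \<beta>)) = fps_of_poly p * fps_exp \<beta>"
    by (subst (3) poly_expand_at) (simp add: fps_of_poly_sum fps_of_poly_smult sum_distrib_right mult.assoc pt_def)
  moreover have "(\<Sum>i\<le>degree pt. fps_const (cnj (coeff pt i)) * (fps_const (1 / 2 ^ i) * (fps_of_poly (pcompose ((pderiv ^^ i) s) lin) * KE)))
    = fps_of_poly (\<Sum>i\<le>degree pt. smult (cnj (coeff pt i) / 2 ^ i) (pcompose ((pderiv ^^ i) s) lin)) * KE"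
    unfolding fps_of_poly_sum fps_of_poly_smult sum_distrib_right
    by (intro sum.cong refl) (simp only: mult.assoc[symmetric] fps_const_mult, simp)
  ultimately show ?thesis by simp
qed

end

section \<open>The Euler-Lagrange equation as a polynomial identity\<close>

lemma pochhammer_times_fact: "pochhammer (of_nat (Suc n)) m * fact n = (fact (n + m) :: 'a :: {comm_semiring_1, semiring_char_0})"
proof (induction m)
  case (Suc m)
  have "pochhammer (of_nat (Suc n)) (Suc m) * fact n = (pochhammer (of_nat (Suc n)) m * fact n) * (of_nat (Suc n) + of_nat m :: 'a)"
    by (simp only: pochhammer_Suc mult_ac)
  also have "\<dots> = fact (n + Suc m)" unfolding Suc.IH by (simp add: algebra_simps)
  finally show ?case .
qed simp

lemma higher_pderiv_pcompose_shift:
  "(pderiv ^^ i) (pcompose s [:b, 1:]) = pcompose ((pderiv ^^ i) s) [:b, 1:]" for s :: "complex poly"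
  by (induction i) (simp_all add: pderiv_pcompose pderiv_pCons)

lemma fockf_fps:
  assumes c: "l2 c" and f: "\<And>z. fockf c z = poly p z * exp (\<beta> * z)"
  shows "Abs_fps (\<lambda>n. c n / of_real (sqrt (fact n))) = fps_of_poly p * fps_exp \<beta>"
proof (rule fps_expansion_unique_complex)
  show "fockf c has_fps_expansion Abs_fps (\<lambda>n. c n / of_real (sqrt (fact n)))"
    by (rule power_series_has_fps_expansion[OF fockf_sums[OF c]])
  have "(\<lambda>z. poly p z * exp (\<beta> * z)) has_fps_expansion fps_of_poly p * fps_exp \<beta>"
  proof (intro has_fps_expansion_mult has_fps_expansion_exp)
    have "eval_fps (fps_of_poly p) has_fps_expansion fps_of_poly p" by (rule eval_fps_has_fps_expansion) simp
    then show "poly p has_fps_expansion fps_of_poly p" by (simp add: eval_fps_of_poly[abs_def])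
  qed
  moreover have "fockf c = (\<lambda>z. poly p z * exp (\<beta> * z))" by (rule ext) (rule f)
  ultimately show "fockf c has_fps_expansion fps_of_poly p * fps_exp \<beta>" by (simp only:)
qed

text \<open>With \<open>c n = sqrt (fact n) * fps_nth F n\<close> the square roots in
  \<open>wt\<close> and \<open>bil\<close> combine into the factorials of \<open>hasS\<close>, and
  the number operator becomes \<open>fps_X * fps_deriv F\<close>.\<close>

lemma euler_lagrange_hasS:
  assumes min: "lmin \<tau> c"
  defines "F \<equiv> Abs_fps (\<lambda>n. c n / of_real (sqrt (fact n)))" and "\<mu> \<equiv> psum c + 2 * \<tau> * qsum c"
  assumes H: "hasS F (F * F) H"
  shows "fps_const (of_real (2 * \<tau>)) * H = fps_const (of_real \<mu>) * F - fps_X * fps_deriv F"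
proof (rule fps_ext)
  fix n
  have c: "c k = of_real (sqrt (fact k)) * fps_nth F k" for k by (simp add: F_def)
  have B: "bil c c k = of_real (sqrt (fact k / 2 ^ k)) * fps_nth (F * F) k" for k
  proof -
    have "complex_of_real (sqrt pi * sqrt pi) = of_real pi" by simp
    then have ss: "complex_of_real (sqrt pi) * of_real (sqrt pi) = of_real pi" by (simp only: of_real_mult)
    have "bil c c k = of_real (pi * 1 * sqrt (fact k * (1 / 2) ^ k)) * (\<Sum>m\<le>k. (fps_nth F m / of_real (sqrt pi)) * (fps_nth F (k - m) / of_real (sqrt pi)))"
      by (rule bil_eq_cauchy) (auto simp: c real_sqrt_mult)
    also have "(\<Sum>m\<le>k. (fps_nth F m / of_real (sqrt pi)) * (fps_nth F (k - m) / of_real (sqrt pi))) = fps_nth (F * F) k / of_real pi"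
      unfolding fps_mult_nth sum_divide_distrib atLeast0AtMost
      by (intro sum.cong refl) (simp only: times_divide_times_eq ss)
    also have "complex_of_real (pi * 1 * r) * (z / of_real pi) = of_real r * z" for r z by simp
    also have "fact k * (1 / 2) ^ k = (fact k / 2 ^ k :: real)" by (simp add: power_one_over)
    finally show ?thesis .
  qed
  have t: "of_real (wt (n + m) n) * cnj (c m) * bil c c (n + m) = of_real (sqrt (fact n)) * (cnj (fps_nth F m) * (fact (n + m) / (fact n * 2 ^ (n + m))) * fps_nth (F * F) (n + m))" for m
  proof -
    have "wt (n + m) n * sqrt (fact m) * sqrt (fact (n + m) / 2 ^ (n + m)) = sqrt (fact n) * (fact (n + m) / (fact n * 2 ^ (n + m)))"
    proof -
      have gen: "A / (u * v) * v * A = u * (A * A / (u * u))" if "u > 0" "v > 0" for A u v :: real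
        using that by (simp add: field_simps)
      have w: "wt (n + m) n = sqrt (fact (n + m) / 2 ^ (n + m)) / (sqrt (fact n) * sqrt (fact m))"
      proof -
        have "real (n + m choose n) / 2 ^ (n + m) = fact (n + m) / 2 ^ (n + m) / (fact n * fact m)"
          using binomial_fact[of n "n + m", where ?'a = real] by simp
        then show ?thesis unfolding wt_def by (simp only: real_sqrt_divide real_sqrt_mult)
      qed
      have "sqrt (fact (n + m) / 2 ^ (n + m)) * sqrt (fact (n + m) / 2 ^ (n + m)) = fact (n + m) / 2 ^ (n + m)"
        "sqrt (fact n) * sqrt (fact n) = (fact n :: real)" by (simp_all only: real_sqrt_mult_self) simp_all
      then show ?thesis unfolding w using gen[of "sqrt (fact n)" "sqrt (fact m)" "sqrt (fact (n + m) / 2 ^ (n + m))"] by simp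
    qed
    then have "complex_of_real (wt (n + m) n * sqrt (fact m) * sqrt (fact (n + m) / 2 ^ (n + m))) = complex_of_real (sqrt (fact n) * (fact (n + m) / (fact n * 2 ^ (n + m))))"
      by (rule arg_cong)
    then have w: "of_real (wt (n + m) n) * of_real (sqrt (fact m)) * of_real (sqrt (fact (n + m) / 2 ^ (n + m))) = complex_of_real (sqrt (fact n)) * (fact (n + m) / (fact n * 2 ^ (n + m)))"
      unfolding of_real_mult of_real_divide of_real_fact of_real_power of_real_numeral .
    have "x * (s * y) * (v * z) = x * s * v * (y * z)" for x s y v z :: complex by (simp only: mult_ac)
    then show ?thesis unfolding B c complex_cnj_mult complex_cnj_complex_of_real by (simp only: w) (simp only: mult_ac)
  qed
  have "(\<lambda>m. of_real (wt (n + m) n) * cnj (c m) * bil c c (n + m)) sums (of_real (sqrt (fact n)) * fps_nth H n)"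
    unfolding t using H unfolding hasS_def by (intro sums_mult) blast
  then have "of_real (\<mu> - real n) * c n = of_real (2 * \<tau>) * (of_real (sqrt (fact n)) * fps_nth H n)"
    using euler_lagrange[OF min, of n] unfolding \<mu>_def by (simp add: sums_iff)
  then have "of_real (sqrt (fact n)) * (of_real (\<mu> - real n) * fps_nth F n) = of_real (sqrt (fact n)) * (of_real (2 * \<tau>) * fps_nth H n)"
    unfolding c by (simp only: mult_ac)
  then have "of_real (\<mu> - real n) * fps_nth F n = of_real (2 * \<tau>) * fps_nth H n" by simp
  then show "fps_nth (fps_const (of_real (2 * \<tau>)) * H) n = fps_nth (fps_const (of_real \<mu>) * F - fps_X * fps_deriv F) n"
    by (cases n) (simp_all add: algebra_simps)
qed

text \<open>The common factor \<open>exp (\<beta> w)\<close> cancels and leaves a polynomial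
  identity with argument \<open>(w + cnj \<beta>) / 2\<close> on one side and \<open>w\<close> on
  the other. Substituting \<open>cnj \<beta> + 2 * w\<close> expresses both through the shifted
  polynomial, at \<open>w\<close> and at \<open>2 * w\<close>; hence the powers of 2.\<close>

lemma exponential_coefficients:
  assumes min: "lmin \<tau> c" and f: "\<And>z. fockf c z = poly p z * exp (\<beta> * z)"
  defines "a \<equiv> coeff (pcompose p [:cnj \<beta>, 1:])" and "d \<equiv> degree (pcompose p [:cnj \<beta>, 1:])"
    and "\<mu> \<equiv> psum c + 2 * \<tau> * qsum c" and "\<kappa> \<equiv> 2 * \<tau> * exp ((cmod \<beta>)\<^sup>2)"
  shows "of_real \<kappa> * (\<Sum>i\<le>d. cnj (a i) / 2 ^ i * (pochhammer (of_nat (Suc n)) i * coeff (pcompose p [:cnj \<beta>, 1:] * pcompose p [:cnj \<beta>, 1:]) (n + i)))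
    = 2 ^ n * (of_real \<mu> * a n - cnj \<beta> * (of_nat (Suc n) * a (Suc n) + \<beta> * a n))
      - (if n = 0 then 0 else 2 ^ n * (of_nat n * a n + \<beta> * a (n - 1)))"
proof -
  define pt where "pt = pcompose p [:cnj \<beta>, 1:]"
  define F where "F = fps_of_poly p * fps_exp \<beta>"
  define Sg where "Sg = (\<Sum>i\<le>degree pt. smult (cnj (coeff pt i) / 2 ^ i) (pcompose ((pderiv ^^ i) (p * p)) (lin \<beta>)))"
  have l: "l2 c" using min h1_imp_l2 by (auto simp: lmin_def)
  have F: "Abs_fps (\<lambda>n. c n / of_real (sqrt (fact n))) = F" unfolding F_def by (rule fockf_fps[OF l f])
  have FF: "F * F = fps_of_poly (p * p) * fps_exp (2 * \<beta>)"
  proof -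
    have "fps_exp \<beta> * fps_exp \<beta> = fps_exp (2 * \<beta>)" by (simp add: fps_exp_add_mult[symmetric])
    then show ?thesis unfolding F_def fps_of_poly_mult by (simp add: mult_ac)
  qed
  have "hasS F (F * F) (fps_of_poly Sg * KE \<beta>)"
    unfolding FF unfolding F_def Sg_def pt_def by (rule hasS_poly_exp)
  from euler_lagrange_hasS[OF min, unfolded F, OF this]
  have "fps_const (of_real (2 * \<tau>)) * (fps_of_poly Sg * KE \<beta>) = fps_const (of_real \<mu>) * F - fps_X * fps_deriv F"
    unfolding \<mu>_def .
  moreover have "fps_const (of_real (2 * \<tau>)) * (fps_of_poly Sg * KE \<beta>) = fps_of_poly (smult (of_real \<kappa>) Sg) * fps_exp \<beta>"
  proof -
    have "fps_const (of_real \<kappa>) = fps_const (of_real (2 * \<tau>)) * fps_const (complex_of_real (exp ((cmod \<beta>)\<^sup>2)))"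
      unfolding \<kappa>_def fps_const_mult by (simp add: exp_of_real[symmetric])
    then show ?thesis unfolding KE_def fps_of_poly_smult by (simp only: mult_ac)
  qed
  moreover have "fps_const (of_real \<mu>) * F - fps_X * fps_deriv F = fps_of_poly (smult (of_real \<mu>) p - [:0, 1:] * (pderiv p + smult \<beta> p)) * fps_exp \<beta>"
    unfolding F_def by (simp add: fps_of_poly_diff fps_of_poly_smult fps_of_poly_add fps_of_poly_pCons fps_of_poly_pderiv algebra_simps)
  ultimately have "fps_of_poly (smult (of_real \<kappa>) Sg) = fps_of_poly (smult (of_real \<mu>) p - [:0, 1:] * (pderiv p + smult \<beta> p))"
    by (metis fps_exp_neq_0 mult_right_cancel)
  then have id: "smult (of_real \<kappa>) Sg = smult (of_real \<mu>) p - [:0, 1:] * (pderiv p + smult \<beta> p)"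
    by (simp only: fps_of_poly_eq_iff)
  let ?q = "[:cnj \<beta>, 2:]" and ?b = "[:cnj \<beta>, 1:]" and ?t = "[:0, 2:] :: complex poly"
  have q1: "pcompose (lin \<beta>) ?q = ?b" by (simp add: lin_def pcompose_pCons)
  have q2: "pcompose ?b ?t = ?q" by (simp add: pcompose_pCons)
  have s1: "pcompose Sg ?q = (\<Sum>i\<le>degree pt. smult (cnj (coeff pt i) / 2 ^ i) ((pderiv ^^ i) (pt * pt)))"
    unfolding Sg_def pcompose_sum pcompose_smult pcompose_assoc[symmetric] q1 higher_pderiv_pcompose_shift[symmetric] pcompose_mult pt_def ..
  have p1: "pcompose p ?q = pcompose pt ?t" unfolding pt_def pcompose_assoc[symmetric] q2 ..
  have p2: "pcompose (pderiv p) ?q = pcompose (pderiv pt) ?t"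
    unfolding pt_def pderiv_pcompose pcompose_mult pcompose_assoc[symmetric] q2 by (simp add: pderiv_pCons pcompose_1)
  have "pcompose (smult (of_real \<kappa>) Sg) ?q = pcompose (smult (of_real \<mu>) p - [:0, 1:] * (pderiv p + smult \<beta> p)) ?q"
    unfolding id ..
  then have "smult (of_real \<kappa>) (\<Sum>i\<le>degree pt. smult (cnj (coeff pt i) / 2 ^ i) ((pderiv ^^ i) (pt * pt)))
    = smult (of_real \<mu>) (pcompose pt ?t) - ?q * (pcompose (pderiv pt) ?t + smult \<beta> (pcompose pt ?t))"
    unfolding pcompose_smult pcompose_diff pcompose_mult pcompose_add s1 p1 p2 by (simp add: pcompose_pCons)
  then have "coeff (smult (of_real \<kappa>) (\<Sum>i\<le>degree pt. smult (cnj (coeff pt i) / 2 ^ i) ((pderiv ^^ i) (pt * pt)))) n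
    = coeff (smult (of_real \<mu>) (pcompose pt ?t) - ?q * (pcompose (pderiv pt) ?t + smult \<beta> (pcompose pt ?t))) n"
    by (rule arg_cong)
  also have "coeff (smult (of_real \<kappa>) (\<Sum>i\<le>degree pt. smult (cnj (coeff pt i) / 2 ^ i) ((pderiv ^^ i) (pt * pt)))) n
    = of_real \<kappa> * (\<Sum>i\<le>degree pt. cnj (coeff pt i) / 2 ^ i * (pochhammer (of_nat (Suc n)) i * coeff (pt * pt) (n + i)))"
    by (simp add: coeff_sum coeff_higher_pderiv del: of_nat_Suc)
  also have "coeff (smult (of_real \<mu>) (pcompose pt ?t) - ?q * (pcompose (pderiv pt) ?t + smult \<beta> (pcompose pt ?t))) n
    = 2 ^ n * (of_real \<mu> * coeff pt n - cnj \<beta> * (of_nat (Suc n) * coeff pt (Suc n) + \<beta> * coeff pt n))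
      - (if n = 0 then 0 else 2 ^ n * (of_nat n * coeff pt n + \<beta> * coeff pt (n - 1)))"
  proof (cases n)
    case 0
    then show ?thesis by (simp add: coeff_pcompose_linear coeff_pderiv poly_0_coeff_0 algebra_simps)
  next
    case (Suc k)
    then show ?thesis by (simp add: coeff_pcompose_linear coeff_pderiv algebra_simps del: of_nat_Suc)
  qed
  finally show ?thesis unfolding a_def d_def pt_def .
qed

lemma fock_state_fockf:
  assumes h1: "h1 c" and m: "msum c = 1"
  shows "fock_state (\<lambda>n. c n / of_real (sqrt (pi * fact n))) c (\<lambda>z. fockf c z / of_real (sqrt pi))
    (\<lambda>z. (cmod (fockf c z / of_real (sqrt pi)))\<^sup>2 * exp (- (cmod z)\<^sup>2))"
proof
  fix z
  show "(\<lambda>n. c n / of_real (sqrt (pi * fact n)) * z ^ n) sums (fockf c z / of_real (sqrt pi))"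
    using sums_divide[OF fockf_sums[OF h1_imp_l2[OF h1], of z], of "of_real (sqrt pi)"]
    by (simp add: real_sqrt_mult mult_ac)
qed (use assms in simp_all)

lemma linear_exp_normalized:
  assumes h1: "h1 c" and m: "msum c = 1"
    and cf: "\<And>z. fockf c z = (A + B * (z - cnj \<beta>)) * exp (\<beta> * z)" and B: "B \<noteq> 0"
  shows "exp ((cmod \<beta>)\<^sup>2) * ((cmod A)\<^sup>2 + (cmod B)\<^sup>2) = 1"
proof -
  interpret fock_state "\<lambda>n. c n / of_real (sqrt (pi * fact n))" c "\<lambda>z. fockf c z / of_real (sqrt pi)"
    "\<lambda>z. (cmod (fockf c z / of_real (sqrt pi)))\<^sup>2 * exp (- (cmod z)\<^sup>2)" by (rule fock_state_fockf[OF h1 m])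
  \<comment> \<open>The zero is placed at \<open>cnj \<beta> - A / B\<close>, so that the
    \<open>e\<close> of \<open>linear_exp_state\<close> is \<open>A / B\<close>.\<close>
  have "fockf c z / of_real (sqrt pi) = B / of_real (sqrt pi) * (z - (cnj \<beta> - A / B)) * exp (\<beta> * z)" for z
  proof -
    have "A + B * (z - cnj \<beta>) = B * (z - (cnj \<beta> - A / B))" using B by (simp add: algebra_simps)
    then show ?thesis unfolding cf by simp
  qed
  from linear_exp_mass[OF this]
  have "pi * (cmod (B / of_real (sqrt pi)))\<^sup>2 * exp ((cmod \<beta>)\<^sup>2) * (1 + (cmod (A / B))\<^sup>2) = 1" by simp
  moreover have "pi * (cmod (B / of_real (sqrt pi)))\<^sup>2 = (cmod B)\<^sup>2" by (simp add: norm_divide power_divide)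
  moreover have "(cmod B)\<^sup>2 * E * (1 + (cmod (A / B))\<^sup>2) = E * ((cmod A)\<^sup>2 + (cmod B)\<^sup>2)" for E
    using B by (simp add: norm_divide power_divide field_simps)
  ultimately show ?thesis by simp
qed

text \<open>After cancelling factorials, equality would read
  \<open>4 * k + 6 = 4 * k + 12\<close>.\<close>

lemma pochhammer_ratio_distinct:
  "pochhammer (of_nat (k + 4)) (k + 1) * of_nat (k + 1) \<noteq> (4 * pochhammer (of_nat (k + 1)) (k + 2) :: complex)"
proof
  let ?P = "pochhammer (of_nat (k + 4)) (k + 1) :: complex" and ?Q = "pochhammer (of_nat (k + 1)) (k + 2) :: complex"
  assume eq: "?P * of_nat (k + 1) = 4 * ?Q"
  have P: "?P * fact (k + 3) = fact (2 * k + 4)"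
  proof -
    have s: "Suc (k + 3) = k + 4" "k + 3 + (k + 1) = 2 * k + 4" by simp_all
    show ?thesis using pochhammer_times_fact[of "k + 3" "k + 1", where ?'a = complex] by (simp only: s)
  qed
  have Q: "?Q * fact k = fact (2 * k + 2)"
  proof -
    have s: "Suc k = k + 1" "k + (k + 2) = 2 * k + 2" by simp_all
    show ?thesis using pochhammer_times_fact[of k "k + 2", where ?'a = complex] by (simp only: s)
  qed
  have f3: "fact (k + 3) = of_nat ((k + 3) * (k + 2) * (k + 1)) * (fact k :: complex)"
  proof -
    have s: "k + 3 = Suc (Suc (Suc k))" "k + 2 = Suc (Suc k)" "k + 1 = Suc k" by simp_all
    show ?thesis unfolding s by (simp only: fact_Suc of_nat_mult mult.assoc)
  qed
  have f4: "fact (2 * k + 4) = of_nat ((2 * k + 4) * (2 * k + 3)) * (fact (2 * k + 2) :: complex)"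
  proof -
    have s: "2 * k + 4 = Suc (Suc (2 * k + 2))" "2 * k + 3 = Suc (2 * k + 2)" by simp_all
    show ?thesis unfolding s by (simp only: fact_Suc of_nat_mult mult.assoc)
  qed
  have "of_nat ((2 * k + 4) * (2 * k + 3) * (k + 1)) * fact (2 * k + 2) = (?P * of_nat (k + 1)) * fact (k + 3)"
    using P unfolding f4 by (simp only: of_nat_mult mult_ac)
  also have "\<dots> = 4 * (of_nat ((k + 3) * (k + 2) * (k + 1)) * (?Q * fact k))"
    unfolding eq f3 by (simp only: mult_ac)
  also have "\<dots> = of_nat (4 * ((k + 3) * (k + 2) * (k + 1))) * fact (2 * k + 2)"
    unfolding Q by (simp only: of_nat_mult of_nat_numeral mult.assoc)
  finally have "complex_of_nat ((2 * k + 4) * (2 * k + 3) * (k + 1)) = of_nat (4 * ((k + 3) * (k + 2) * (k + 1)))"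
    by (simp only: mult_cancel_right fact_nonzero simp_thms)
  then have "(2 * k + 4) * (2 * k + 3) * (k + 1) = 4 * ((k + 3) * (k + 2) * (k + 1))" by (simp only: of_nat_eq_iff)
  moreover have "(2 * k + 4) * (2 * k + 3) * (k + 1) = (k + 1) * ((k + 2) * (2 * (2 * k + 3)))"
    "4 * ((k + 3) * (k + 2) * (k + 1)) = (k + 1) * ((k + 2) * (4 * (k + 3)))" by (simp_all only: algebra_simps)
  ultimately have "(k + 1) * ((k + 2) * (2 * (2 * k + 3))) = (k + 1) * ((k + 2) * (4 * (k + 3)))" by (simp only:)
  then have "2 * (2 * k + 3) = 4 * (k + 3)" by (simp only: mult_cancel1) simp
  then show False by simp
qed

text \<open>Shift \<open>p\<close> by \<open>cnj \<beta>\<close> and let \<open>\<nu>\<close> be its order at \<open>0\<close>.  The cubic side of the equation is nonzero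
  at index \<open>2 d - \<nu>\<close> while the linear side vanishes beyond \<open>d + 1\<close>, so \<open>\<nu> \<ge> d - 1\<close>.  The case
  \<open>\<nu> = d - 1\<close> survives only for \<open>d = 1\<close> and \<open>\<tau> = 2\<close>.\<close>

lemma lmin_exponential_single:
  assumes min: "lmin \<tau> c" and \<tau>: "\<tau> > 0" "\<tau> \<noteq> 2" and p0: "p \<noteq> 0"
    and f: "\<And>z. fockf c z = poly p z * exp (\<beta> * z)"
  obtains d \<gamma> where "c = single d \<gamma>"
proof -
  define pt where "pt = pcompose p [:cnj \<beta>, 1:]"
  define a where "a = coeff pt"
  define d where "d = degree pt"
  define \<mu> where "\<mu> = psum c + 2 * \<tau> * qsum c"
  define \<kappa> where "\<kappa> = 2 * \<tau> * exp ((cmod \<beta>)\<^sup>2)"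
  define T where "T n = (\<Sum>i\<le>d. cnj (a i) / 2 ^ i * (pochhammer (of_nat (Suc n)) i * coeff (pt * pt) (n + i)))" for n
  have h: "h1 c" and m: "msum c = 1" using min by (auto simp: lmin_def)
  have \<kappa>: "\<kappa> > 0" using \<tau> by (simp add: \<kappa>_def)
  have E: "of_real \<kappa> * T n = 2 ^ n * (of_real \<mu> * a n - cnj \<beta> * (of_nat (Suc n) * a (Suc n) + \<beta> * a n))
      - (if n = 0 then 0 else 2 ^ n * (of_nat n * a n + \<beta> * a (n - 1)))" for n
    unfolding T_def using exponential_coefficients[OF min f, of n]
    unfolding a_def pt_def d_def \<mu>_def \<kappa>_def by blast
  have "pt \<noteq> 0" using p0 pcompose_eq_0[of p "[:cnj \<beta>, 1:]"] unfolding pt_def by auto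
  then have ad: "a d \<noteq> 0" unfolding a_def d_def by simp
  have ahi: "a n = 0" if "n > d" for n using that unfolding a_def d_def by (simp add: coeff_eq_0)
  have sqhi: "coeff (pt * pt) n = 0" if "n > 2 * d" for n
    using that degree_mult_le[of pt pt] unfolding d_def by (intro coeff_eq_0) linarith
  have sqd: "coeff (pt * pt) (2 * d) = a d * a d"
    using coeff_mult_degree_sum[of pt pt] unfolding d_def a_def by (simp add: mult_2)
  have poch: "pochhammer (of_nat (Suc n)) i \<noteq> (0 :: complex)" for n i
    using pochhammer_times_fact[of n i, where ?'a = complex] by (metis fact_nonzero mult_zero_left)
  define \<nu> where "\<nu> = (LEAST i. a i \<noteq> 0)"
  have a\<nu>: "a \<nu> \<noteq> 0" unfolding \<nu>_def by (rule LeastI[of "\<lambda>i. a i \<noteq> 0", OF ad])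
  have alo: "a i = 0" if "i < \<nu>" for i using not_less_Least that unfolding \<nu>_def by blast
  have \<nu>d: "\<nu> \<le> d" using ahi a\<nu> by (metis not_le)
  have T\<nu>: "T (2 * d - \<nu>) = cnj (a \<nu>) / 2 ^ \<nu> * (pochhammer (of_nat (Suc (2 * d - \<nu>))) \<nu> * (a d * a d))"
  proof -
    have "T (2 * d - \<nu>) = (\<Sum>i\<in>{\<nu>}. cnj (a i) / 2 ^ i * (pochhammer (of_nat (Suc (2 * d - \<nu>))) i * coeff (pt * pt) (2 * d - \<nu> + i)))"
      unfolding T_def
    proof (intro sum.mono_neutral_right ballI)
      fix i assume "i \<in> {..d} - {\<nu>}"
      then consider "i < \<nu>" | "i > \<nu>" by fastforce
      then show "cnj (a i) / 2 ^ i * (pochhammer (of_nat (Suc (2 * d - \<nu>))) i * coeff (pt * pt) (2 * d - \<nu> + i)) = 0"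
        using alo sqhi[of "2 * d - \<nu> + i"] \<nu>d by cases auto
    qed (use \<nu>d in auto)
    also have "2 * d - \<nu> + \<nu> = 2 * d" using \<nu>d by simp
    ultimately show ?thesis using sqd by simp
  qed
  have "2 * d - \<nu> \<le> d + 1"
  proof (rule ccontr)
    assume "\<not> 2 * d - \<nu> \<le> d + 1"
    then have "of_real \<kappa> * T (2 * d - \<nu>) = 0" unfolding E by (simp add: ahi)
    then show False using \<kappa> a\<nu> ad poch[of "2 * d - \<nu>" \<nu>] unfolding T\<nu> by (simp del: of_nat_Suc)
  qed
  then consider "\<nu> = d" | "\<nu> + 1 = d" using \<nu>d by linarith
  then show ?thesis
  proof cases
    case 1
    \<comment> \<open>The linear side at index \<open>d + 1\<close> consists of the single term with
      \<open>\<beta> * a d\<close>, so this forces \<open>\<beta> = 0\<close>, and \<open>p\<close>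
      is a monomial.\<close>
    have "T (d + 1) = 0" unfolding T_def
    proof (intro sum.neutral ballI)
      fix i assume "i \<in> {..d}"
      then show "cnj (a i) / 2 ^ i * (pochhammer (of_nat (Suc (d + 1))) i * coeff (pt * pt) (d + 1 + i)) = 0"
        using alo[of i] sqhi[of "d + 1 + i"] 1 by (cases "i = d") auto
    qed
    then have \<beta>: "\<beta> = 0" using E[of "d + 1"] ad by (simp add: ahi)
    then have pt: "pt = p" unfolding pt_def by (simp add: pcompose_idR)
    have "c n = single d (of_real (sqrt (fact d)) * a d) n" for n
    proof -
      have "fps_nth (Abs_fps (\<lambda>n. c n / of_real (sqrt (fact n)))) n = fps_nth (fps_of_poly p * fps_exp \<beta>) n"
        unfolding fockf_fps[OF h1_imp_l2[OF h] f] ..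
      then have cn: "c n / of_real (sqrt (fact n)) = a n" unfolding \<beta> a_def pt by simp
      have "a n = 0" if "n \<noteq> d" using that alo ahi 1 by (metis linorder_neqE_nat)
      then show ?thesis using cn unfolding single_def by (auto simp: field_simps)
    qed
    then have "c = single d (of_real (sqrt (fact d)) * a d)" by (rule ext)
    then show ?thesis by (rule that)
  next
    case 2
    define A where "A = a \<nu>"
    define B where "B = a d"
    have A0: "A \<noteq> 0" and B0: "B \<noteq> 0" using ad a\<nu> by (auto simp: A_def B_def)
    have pt: "pt = monom 1 \<nu> * [:A, B:]"
    proof (rule poly_eqI)
      fix n
      consider "n < \<nu>" | "n = \<nu>" | "n = d" | "n > d" using 2 by linarith
      then show "coeff pt n = coeff (monom 1 \<nu> * [:A, B:]) n"
        unfolding a_def[symmetric] using alo[of n] ahi[of n] 2[symmetric]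
        by cases (auto simp: coeff_monom_mult coeff_pCons A_def B_def split: nat.splits)
    qed
    have sq: "pt * pt = monom 1 (2 * \<nu>) * [:A * A, 2 * A * B, B * B:]"
    proof -
      have "pt * pt = (monom 1 \<nu> * monom 1 \<nu>) * ([:A, B:] * [:A, B:])" unfolding pt by (simp only: mult_ac)
      moreover have "monom 1 \<nu> * monom 1 \<nu> = monom (1 :: complex) (2 * \<nu>)" by (simp add: mult_monom mult_2)
      moreover have "[:A, B:] * [:A, B:] = [:A * A, 2 * A * B, B * B:]" by simp
      ultimately show ?thesis by (simp only:)
    qed
    have csq: "coeff (pt * pt) n = (if n < 2 * \<nu> then 0 else coeff [:A * A, 2 * A * B, B * B:] (n - 2 * \<nu>))" for n
      unfolding sq coeff_monom_mult by simp
    have T: "T n = cnj A / 2 ^ \<nu> * (pochhammer (of_nat (Suc n)) \<nu> * coeff (pt * pt) (n + \<nu>))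
      + cnj B / 2 ^ d * (pochhammer (of_nat (Suc n)) d * coeff (pt * pt) (n + d))" for n
    proof -
      have "T n = (\<Sum>i\<in>{\<nu>, d}. cnj (a i) / 2 ^ i * (pochhammer (of_nat (Suc n)) i * coeff (pt * pt) (n + i)))"
        unfolding T_def by (rule sum.mono_neutral_right) (use \<nu>d 2 alo in auto)
      then show ?thesis using 2 unfolding A_def B_def by simp
    qed
    show ?thesis
    proof (cases \<nu>)
      case (Suc k)
      then have d: "d = k + 2" using 2 by simp
      \<comment> \<open>The equations at the extreme indices \<open>k + 3 = d + 1\<close> and
        \<open>k = \<nu> - 1\<close> both express \<open>\<beta>\<close> through \<open>A\<close>
        and \<open>B\<close>. After conjugating the first they read \<open>X * ?P = 4 * Y\<close>
        and \<open>X * ?Q = Y * (k + 1)\<close>; eliminating \<open>Y\<close> contradicts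
        \<open>pochhammer_ratio_distinct\<close>.\<close>
      define X where "X = of_real \<kappa> * (A * cnj B)"
      define Y where "Y = - (4 * 4 ^ k * cnj \<beta>)"
      have X0: "X \<noteq> 0" using A0 B0 \<kappa> by (simp add: X_def)
      let ?P = "pochhammer (of_nat (k + 4)) (k + 1) :: complex" and ?Q = "pochhammer (of_nat (k + 1)) (k + 2) :: complex"
      have s: "Suc (k + 3) = k + 4" "Suc k = k + 1" by simp_all
      have e1: "of_real \<kappa> * (cnj A / 2 ^ (k + 1) * (?P * (B * B))) = - (2 ^ (k + 3) * (\<beta> * B))"
      proof -
        have "T (k + 3) = cnj A / 2 ^ (k + 1) * (?P * (B * B))"
          unfolding T s csq d Suc by (simp add: eval_nat_numeral)
        then show ?thesis using E[of "k + 3"] d ahi[of "k + 3"] ahi[of "k + 4"] by (simp add: B_def eval_nat_numeral)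
      qed
      have e2: "of_real \<kappa> * (cnj B / 2 ^ (k + 2) * (?Q * (A * A))) = - (2 ^ k * (cnj \<beta> * (of_nat (k + 1) * A)))"
      proof -
        have n: "k + \<nu> < 2 * \<nu>" "k + d - 2 * \<nu> = 0" "\<not> k + d < 2 * \<nu>" using d Suc by auto
        have "T k = cnj B / 2 ^ d * (pochhammer (of_nat (Suc k)) d * (A * A))"
          unfolding T csq using n by (simp del: of_nat_Suc)
        then have "T k = cnj B / 2 ^ (k + 2) * (?Q * (A * A))" by (simp only: d Suc_eq_plus1)
        moreover have "of_real \<kappa> * T k = - (2 ^ k * (cnj \<beta> * (of_nat (k + 1) * A)))"
          unfolding E using d Suc alo[of k] alo[of "k - 1"] by (cases k) (simp_all add: A_def)
        ultimately show ?thesis by (simp only:)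
      qed
      have cP: "cnj ?P = ?P"
      proof -
        show ?thesis by (simp only: pochhammer_prod cnj_prod complex_cnj_add complex_cnj_of_nat)
      qed
      have gen: "K * (cA * B) * P = - (r * s * s * b)"
        if "K * (cA / (q * s) * (P * (B * B))) = - (r / q * s * (b * B))" "B \<noteq> 0" "s \<noteq> 0" "q \<noteq> 0" for K cA P b B r q s :: complex
      proof -
        have "K * (cA * B) * P * B = K * (cA / (q * s) * (P * (B * B))) * (q * s)" using that(3,4) by simp
        also have "\<dots> = - (r * s * s * b) * B" unfolding that(1) using that(4) by simp
        finally show ?thesis using mult_right_cancel[OF that(2)] by blast
      qed
      have s4: "16 * 2 ^ k * 2 ^ k * x = 4 * (4 * (4 ^ k * x))" "4 * 2 ^ k * 2 ^ k * x = 4 * (4 ^ k * x)" for x :: complex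
      proof -
        have "(4::complex) ^ k = 2 ^ k * 2 ^ k" by (simp flip: power_mult_distrib)
        moreover have "16 * s * s * x = 4 * (4 * ((s * s) * x))" "4 * s * s * x = 4 * ((s * s) * x)" for s :: complex by simp_all
        ultimately show "16 * 2 ^ k * 2 ^ k * x = 4 * (4 * (4 ^ k * x))" "4 * 2 ^ k * 2 ^ k * x = 4 * (4 ^ k * x)" by (simp_all only:)
      qed
      have g1: "of_real \<kappa> * (cnj A * B) * ?P = - (16 * 2 ^ k * 2 ^ k * \<beta>)"
      proof (rule gen[where q = 2])
        have p: "(2::complex) ^ (k + 1) = 2 * 2 ^ k" "(2::complex) ^ (k + 3) = 16 / 2 * 2 ^ k" by (simp_all add: power_add)
        show "of_real \<kappa> * (cnj A / (2 * 2 ^ k) * (?P * (B * B))) = - (16 / 2 * 2 ^ k * (\<beta> * B))" using e1 unfolding p .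
      qed (use B0 in simp_all)
      have g2: "of_real \<kappa> * (cnj B * A) * ?Q = - (4 * 2 ^ k * 2 ^ k * (cnj \<beta> * of_nat (k + 1)))"
      proof (rule gen[where q = 4])
        have p: "(2::complex) ^ (k + 2) = 4 * 2 ^ k" by (simp add: power_add)
        have one: "4 / 4 = (1 :: complex)" by simp
        show "of_real \<kappa> * (cnj B / (4 * 2 ^ k) * (?Q * (A * A))) = - (4 / 4 * 2 ^ k * (cnj \<beta> * of_nat (k + 1) * A))"
          unfolding one mult_1_left using e2 unfolding p mult.assoc .
      qed (use A0 in simp_all)
      have "cnj (of_real \<kappa> * (cnj A * B) * ?P) = cnj (- (4 * (4 * (4 ^ k * \<beta>))))" unfolding g1 s4 ..
      moreover have "cnj (of_real \<kappa> * (cnj A * B) * ?P) = X * ?P"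
        unfolding X_def complex_cnj_mult cP by simp
      moreover have "cnj (- (4 * (4 * (4 ^ k * \<beta>)))) = 4 * Y" unfolding Y_def by simp
      ultimately have P: "X * ?P = 4 * Y" by (simp only:)
      have "X * ?Q = of_real \<kappa> * (cnj B * A) * ?Q" unfolding X_def by (simp only: mult.commute)
      also have "\<dots> = Y * of_nat (k + 1)" unfolding g2 s4 Y_def by (simp only: mult.assoc mult_minus_left)
      finally have Q: "X * ?Q = Y * of_nat (k + 1)" .
      have "X * (?P * of_nat (k + 1)) = X * (4 * ?Q)"
      proof -
        have "X * (?P * of_nat (k + 1)) = 4 * (Y * of_nat (k + 1))" unfolding mult.assoc[symmetric] P ..
        also have "\<dots> = X * (4 * ?Q)" unfolding Q[symmetric] by (simp only: mult_ac)
        finally show ?thesis .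
      qed
      then have "?P * of_nat (k + 1) = 4 * ?Q" using X0 by simp
      with pochhammer_ratio_distinct show ?thesis by blast
    next
      case 0
      \<comment> \<open>The equations at 0, 1 and 2 determine \<open>\<beta>\<close> and give
        \<open>\<kappa> * (|A|^2 + |B|^2) = 4\<close>. Normalization makes the left side
        \<open>2 * \<tau>\<close>, so only \<open>\<tau> = 2\<close> would remain, where the
        equality family of the central inequality lives.\<close>
      then have d: "d = 1" using 2 by simp
      have a01: "a 0 = A" "a (Suc 0) = B" using 0 d by (simp_all add: A_def B_def)
      define K where "K = complex_of_real \<kappa>"
      have e2: "K * (cnj A * (B * B)) = - (4 * (\<beta> * B))"
        using E[of 2] ahi[of 2] ahi[of 3] a01 unfolding T csq d 0 K_def by (simp add: eval_nat_numeral)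
      have e1: "K * (cnj A * (2 * A * B) + cnj B * (B * B)) = 2 * (of_real \<mu> * B - cnj \<beta> * (\<beta> * B)) - 2 * (B + \<beta> * A)"
        using E[of 1] ahi[of 2] a01 unfolding T csq d 0 K_def by (simp add: eval_nat_numeral)
      have e0: "K * (cnj A * (A * A) + cnj B * (A * B)) = of_real \<mu> * A - cnj \<beta> * (B + \<beta> * A)"
        using E[of 0] a01 unfolding T csq d 0 K_def by (simp add: eval_nat_numeral)
      have b: "\<beta> = - (K * cnj A * B) / 4"
      proof -
        have "B * (K * cnj A * B + 4 * \<beta>) = 0" using e2 by (simp add: algebra_simps)
        then have "K * cnj A * B + 4 * \<beta> = 0" using B0 by simp
        moreover have "y = - x / 4" if "x + 4 * y = 0" for x y :: complex
          using that by (metis add.commute eq_neg_iff_add_eq_0 nonzero_mult_div_cancel_left zero_neq_numeral)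
        ultimately show ?thesis by blast
      qed
      have "cnj K = K" by (simp add: K_def)
      then have b': "cnj \<beta> = - (K * A * cnj B) / 4" by (subst b) simp
      have f1: "K * (2 * (A * cnj A) + B * cnj B) = 2 * of_real \<mu> - 2 * (cnj \<beta> * \<beta>) - 2 + K / 2 * (A * cnj A)"
      proof -
        have "B * (K * (2 * (A * cnj A) + B * cnj B)) = K * (cnj A * (2 * A * B) + cnj B * (B * B))"
          by (simp only: distrib_left mult_ac)
        also have "\<dots> = 2 * (of_real \<mu> * B - cnj \<beta> * (\<beta> * B)) - 2 * (B + \<beta> * A)" by (rule e1)
        also have "\<dots> = B * (2 * of_real \<mu> - 2 * (cnj \<beta> * \<beta>) - 2) - 2 * (\<beta> * A)"
          by (simp only: right_diff_distrib distrib_left mult_ac diff_diff_eq add_ac)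
        also have "2 * (\<beta> * A) = - B * (K / 2 * (A * cnj A))"
        proof -
          have "2 * (- (K * x * B) / 4 * A) = - B * (K / 2 * (A * x))" for x by (simp add: field_simps)
          from this[of "cnj A"] show ?thesis unfolding b[symmetric] .
        qed
        finally have "B * (K * (2 * (A * cnj A) + B * cnj B)) = B * (2 * of_real \<mu> - 2 * (cnj \<beta> * \<beta>) - 2 + K / 2 * (A * cnj A))"
          by (simp only: distrib_left mult_minus_left diff_minus_eq_add)
        then show ?thesis using B0 mult_left_cancel by blast
      qed
      have f0: "K * (A * cnj A + B * cnj B) = of_real \<mu> - cnj \<beta> * \<beta> + K / 4 * (B * cnj B)"
      proof -
        have "A * (K * (A * cnj A + B * cnj B)) = K * (cnj A * (A * A) + cnj B * (A * B))"
          by (simp only: distrib_left mult_ac)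
        also have "\<dots> = of_real \<mu> * A - cnj \<beta> * (B + \<beta> * A)" by (rule e0)
        also have "\<dots> = A * (of_real \<mu> - cnj \<beta> * \<beta>) - cnj \<beta> * B"
          by (simp only: right_diff_distrib distrib_left mult_ac diff_diff_eq add_ac)
        also have "cnj \<beta> * B = - A * (K / 4 * (B * cnj B))"
        proof -
          have "- (K * A * x) / 4 * B = - A * (K / 4 * (B * x))" for x by (simp add: field_simps)
          from this[of "cnj B"] show ?thesis unfolding b'[symmetric] .
        qed
        finally have "A * (K * (A * cnj A + B * cnj B)) = A * (of_real \<mu> - cnj \<beta> * \<beta> + K / 4 * (B * cnj B))"
          by (simp only: distrib_left mult_minus_left diff_minus_eq_add)
        then show ?thesis using A0 mult_left_cancel by blast
      qed
      have gen: "K * (x + y) = 4" if "K * (2 * x + y) = 2 * M - 2 * b - 2 + K / 2 * x" "K * (x + y) = M - b + K / 4 * y" for x y M b :: complex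
      proof -
        have "2 * (K * (x + y)) - K * (2 * x + y) = 2 * (M - b + K / 4 * y) - (2 * M - 2 * b - 2 + K / 2 * x)" unfolding that ..
        then have "K * y = 2 + K / 2 * y - K / 2 * x" by (simp add: algebra_simps)
        then have "2 * (K * y) = 2 * (2 + K / 2 * y - K / 2 * x)" by (rule arg_cong)
        then show ?thesis by (simp add: algebra_simps)
      qed
      have "K * (A * cnj A + B * cnj B) = 4" by (rule gen[OF f1 f0])
      then have "complex_of_real (\<kappa> * ((cmod A)\<^sup>2 + (cmod B)\<^sup>2)) = of_real 4"
        by (simp only: K_def complex_norm_square[symmetric] of_real_mult of_real_add) simp
      then have \<kappa>4: "\<kappa> * ((cmod A)\<^sup>2 + (cmod B)\<^sup>2) = 4" by (simp only: of_real_eq_iff)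
      have "p = pcompose pt [:- cnj \<beta>, 1:]"
        unfolding pt_def pcompose_assoc[symmetric] by (simp add: pcompose_pCons)
      then have "poly p z = A + B * (z - cnj \<beta>)" for z
        unfolding pt 0 by (simp add: poly_pcompose poly_monom algebra_simps)
      with f have "fockf c z = (A + B * (z - cnj \<beta>)) * exp (\<beta> * z)" for z by simp
      from linear_exp_normalized[OF h m this B0]
      have "exp ((cmod \<beta>)\<^sup>2) * ((cmod A)\<^sup>2 + (cmod B)\<^sup>2) = 1" .
      then have "\<kappa> * ((cmod A)\<^sup>2 + (cmod B)\<^sup>2) = 2 * \<tau>" unfolding \<kappa>_def mult.assoc by simp
      with \<kappa>4 \<tau> show ?thesis by simp
    qed
  qed
qed

lemma msum_single: "msum (single d \<gamma>) = (cmod \<gamma>)\<^sup>2"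
proof -
  have "(\<lambda>n. (cmod (single d \<gamma> n))\<^sup>2) = (\<lambda>n. if n = d then (cmod \<gamma>)\<^sup>2 else 0)" by (auto simp: single_def)
  then show ?thesis unfolding msum_def using sums_at[of d "\<lambda>_. (cmod \<gamma>)\<^sup>2"] by (simp add: sums_iff)
qed

lemma lmin_infinite_zeros:
  assumes min: "lmin \<tau> c" and \<tau>: "\<tau> > 32 / 5"
  shows "infinite {z. fockf c z = 0}"
proof
  assume fin: "finite {z. fockf c z = 0}"
  have t0: "\<tau> \<ge> 0" using \<tau> by simp
  obtain p \<beta> where p: "p \<noteq> 0" "\<And>z. fockf c z = poly p z * exp (\<beta> * z)"
    by (rule lmin_finite_zeros_exponential[OF min t0 fin]) blast
  have t: "\<tau> > 0" "\<tau> \<noteq> 2" using \<tau> by auto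
  obtain d \<gamma> where c: "c = single d \<gamma>" by (rule lmin_exponential_single[OF min t p])
  have "(cmod \<gamma>)\<^sup>2 = 1" using min unfolding c by (simp add: lmin_def msum_single)
  then have "cmod \<gamma> = 1" using norm_ge_zero[of \<gamma>] unfolding power2_eq_1_iff by linarith
  with min \<tau> single_unstable show False unfolding c by blast
qed

section \<open>States and coefficient sequences\<close>

definition state :: "real \<Rightarrow> (nat \<Rightarrow> complex) \<Rightarrow> complex \<Rightarrow> complex" where
  "state h c z = of_real (exp (- (cmod z)\<^sup>2 / (2 * h))) * (fockf c (z / of_real (sqrt h)) / of_real (sqrt (pi * h)))"

context
  fixes h :: real
  assumes h: "h > 0"
begin

lemma state_taylor:
  assumes "l2 c"
  shows "(\<lambda>n. c n / of_real (sqrt (pi * fact n * h ^ (n + 1))) * z ^ n) sums (fockf c (z / of_real (sqrt h)) / of_real (sqrt (pi * h)))"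
proof -
  have "c n / of_real (sqrt (fact n)) * (z / of_real (sqrt h)) ^ n / of_real (sqrt (pi * h)) = c n / of_real (sqrt (pi * fact n * h ^ (n + 1))) * z ^ n" for n
  proof -
    have "sqrt (pi * fact n * h ^ (n + 1)) = sqrt (fact n) * sqrt h ^ n * sqrt (pi * h)"
      by (simp add: real_sqrt_mult real_sqrt_power)
    then show ?thesis by (simp add: power_divide)
  qed
  with sums_divide[OF fockf_sums[OF assms, of "z / of_real (sqrt h)"], of "of_real (sqrt (pi * h))"]
  show ?thesis by simp
qed

lemma cmod_state_sq:
  "(cmod (state h c z))\<^sup>2 = (cmod (fockf c (z / of_real (sqrt h)) / of_real (sqrt (pi * h))))\<^sup>2 * exp (- (cmod z)\<^sup>2 / h)"
proof -
  have "(exp (- (cmod z)\<^sup>2 / (2 * h)))\<^sup>2 = exp (- (cmod z)\<^sup>2 / h)"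
    using h by (simp add: power2_eq_square exp_add[symmetric])
  then show ?thesis unfolding state_def norm_mult power_mult_distrib by simp
qed

lemma cmod_state_quartic:
  "(cmod (state h c z)) ^ 4 = (cmod (fockf c (z / of_real (sqrt h)) / of_real (sqrt (pi * h)))) ^ 4 * exp (- 2 * (cmod z)\<^sup>2 / h)"
proof -
  have e: "x ^ 4 = (x\<^sup>2)\<^sup>2" for x :: real by simp
  have "(exp (- (cmod z)\<^sup>2 / h))\<^sup>2 = exp (- 2 * (cmod z)\<^sup>2 / h)"
    by (simp add: power2_eq_square exp_add[symmetric])
  then show ?thesis unfolding e cmod_state_sq power_mult_distrib by simp
qed

lemma
  assumes l: "l2 c"
  shows state_mass_integral: "(\<integral>\<^sup>+ z. ennreal ((cmod (state h c z))\<^sup>2) \<partial>lborel) = (\<Sum>n. ennreal ((cmod (c n))\<^sup>2))"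
    and moment_state: "(\<integral>\<^sup>+ z. ennreal ((cmod z)\<^sup>2 * (cmod (state h c z))\<^sup>2) \<partial>lborel) = (\<Sum>n. ennreal (h * (real (n + 1) * (cmod (c n))\<^sup>2)))"
    and quartic_state_suminf: "(\<integral>\<^sup>+ z. ennreal ((cmod (state h c z)) ^ 4) \<partial>lborel) = (\<Sum>k. ennreal (1 / (2 * pi * h) * (cmod (bil c c k))\<^sup>2))"
proof -
  have c: "c n = complex_of_real (sqrt (pi * fact n * h ^ (n + 1))) * (c n / of_real (sqrt (pi * fact n * h ^ (n + 1))))" for n
    using h by simp
  show "(\<integral>\<^sup>+ z. ennreal ((cmod (state h c z))\<^sup>2) \<partial>lborel) = (\<Sum>n. ennreal ((cmod (c n))\<^sup>2))"
    unfolding cmod_state_sq by (rule fock_mass[OF state_taylor[OF l] h c])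
  show "(\<integral>\<^sup>+ z. ennreal ((cmod z)\<^sup>2 * (cmod (state h c z))\<^sup>2) \<partial>lborel) = (\<Sum>n. ennreal (h * (real (n + 1) * (cmod (c n))\<^sup>2)))"
    unfolding cmod_state_sq using fock_moment[OF state_taylor[OF l] h c] by (simp only: mult.assoc)
  show "(\<integral>\<^sup>+ z. ennreal ((cmod (state h c z)) ^ 4) \<partial>lborel) = (\<Sum>k. ennreal (1 / (2 * pi * h) * (cmod (bil c c k))\<^sup>2))"
    unfolding cmod_state_quartic by (rule fock_quartic[OF state_taylor[OF l] h c])
qed

lemma continuous_state:
  assumes "l2 c"
  shows "continuous_on UNIV (state h c)"
proof -
  have "continuous_on UNIV (\<lambda>z. fockf c (z / of_real (sqrt h)) / of_real (sqrt (pi * h)))"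
    by (intro holomorphic_on_imp_continuous_on power_series_entire[OF state_taylor[OF assms]])
  moreover have "continuous_on UNIV (\<lambda>z. complex_of_real (exp (- (cmod z)\<^sup>2 / (2 * h))))"
    using h by (intro continuous_intros) auto
  ultimately show ?thesis unfolding state_def[abs_def] by (intro continuous_on_mult)
qed

lemma state_measurable:
  assumes "l2 c"
  shows "state h c \<in> borel_measurable borel"
  by (rule borel_measurable_continuous_onI[OF continuous_state[OF assms]])

lemma suminf_ennreal_infinite:
  assumes "\<And>n. 0 \<le> r n" "(\<Sum>n. ennreal (r n)) < \<infinity>"
  shows "summable r"
  by (rule summable_suminf_not_top) (use assms in auto)

lemma mass_state:
  assumes "l2 c"
  shows "mass (state h c) = ennreal (msum c)"
  unfolding mass_def state_mass_integral[OF assms] msum_def using assms unfolding l2_def by (intro suminf_ennreal2) auto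

lemma quartic_state:
  assumes "l2 c"
  shows "(\<integral>\<^sup>+ z. ennreal ((cmod (state h c z)) ^ 4) \<partial>lborel) = ennreal (1 / (2 * pi * h) * qsum c)"
proof -
  have "(\<integral>\<^sup>+ z. ennreal ((cmod (state h c z)) ^ 4) \<partial>lborel) = (\<Sum>k. ennreal (1 / (2 * pi * h) * (cmod (bil c c k))\<^sup>2))"
    by (rule quartic_state_suminf[OF assms])
  also have "\<dots> = ennreal (\<Sum>k. 1 / (2 * pi * h) * (cmod (bil c c k))\<^sup>2)"
    using h by (intro suminf_ennreal2 summable_mult summable_bil assms) auto
  also have "(\<Sum>k. 1 / (2 * pi * h) * (cmod (bil c c k))\<^sup>2) = 1 / (2 * pi * h) * qsum c"
    unfolding qsum_def by (intro suminf_mult summable_bil assms)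
  finally show ?thesis .
qed

lemma moment_state_h1:
  assumes "h1 c"
  shows "(\<integral>\<^sup>+ z. ennreal ((cmod z)\<^sup>2 * (cmod (state h c z))\<^sup>2) \<partial>lborel) = ennreal (h * (psum c + msum c))"
proof -
  note l = h1_imp_l2[OF assms]
  have s: "(\<lambda>n. h * (real (n + 1) * (cmod (c n))\<^sup>2)) sums (h * (psum c + msum c))"
  proof (rule sums_mult)
    have "(\<lambda>n. real n * (cmod (c n))\<^sup>2 + (cmod (c n))\<^sup>2) sums (psum c + msum c)"
      unfolding psum_def msum_def using l h1_summable_n[OF assms] unfolding l2_def by (intro sums_add summable_sums)
    then show "(\<lambda>n. real (n + 1) * (cmod (c n))\<^sup>2) sums (psum c + msum c)" by (simp add: distrib_right add.commute)
  qed
  show ?thesis unfolding moment_state[OF l] sums_unique[OF s]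
    using h s by (intro suminf_ennreal2) (auto simp: sums_iff)
qed

lemma moment_state_finite:
  assumes "l2 c" "(\<integral>\<^sup>+ z. ennreal ((cmod z)\<^sup>2 * (cmod (state h c z))\<^sup>2) \<partial>lborel) < \<infinity>"
  shows "h1 c"
proof -
  have "summable (\<lambda>n. h * (real (n + 1) * (cmod (c n))\<^sup>2))"
    using assms(2) h unfolding moment_state[OF assms(1)] by (intro suminf_ennreal_infinite) auto
  then show ?thesis using h unfolding h1_def by (subst (asm) summable_cmult_iff) auto
qed

lemma state_in_LLL:
  assumes "l2 c"
  shows "state h c \<in> LLL_space h"
proof -
  have "(\<lambda>z. fockf c (z / of_real (sqrt h)) / of_real (sqrt (pi * h))) holomorphic_on UNIV"
    by (rule power_series_entire[OF state_taylor[OF assms]])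
  moreover have "state h c \<in> L2"
  proof -
    have "integrable lborel (\<lambda>z. (cmod (state h c z))\<^sup>2)"
    proof (rule integrableI_nonneg)
      show "(\<lambda>z. (cmod (state h c z))\<^sup>2) \<in> borel_measurable lborel" using state_measurable[OF assms] by simp
      show "(\<integral>\<^sup>+ z. ennreal ((cmod (state h c z))\<^sup>2) \<partial>lborel) < \<infinity>"
        using mass_state[OF assms] unfolding mass_def by simp
    qed simp
    then show ?thesis unfolding L2_def using state_measurable[OF assms] by simp
  qed
  ultimately show ?thesis unfolding LLL_space_def state_def[abs_def] by blast
qed

text \<open>The normalized Taylor coefficients are square summable because \<open>fock_mass\<close>
  holds in \<open>ennreal\<close> without any summability assumption.\<close>

lemma LLL_eq_state:
  assumes "u \<in> LLL_space h"
  obtains c where "l2 c" "u = state h c"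
proof -
  obtain f where f: "f holomorphic_on UNIV" and u: "u = (\<lambda>z. of_real (exp (- (cmod z)\<^sup>2 / (2 * h))) * f z)" and L: "u \<in> L2"
    using assms unfolding LLL_space_def by blast
  define a where "a n = (deriv ^^ n) f 0 / fact n" for n
  define c where "c n = of_real (sqrt (pi * fact n * h ^ (n + 1))) * a n" for n
  have fs: "(\<lambda>n. a n * z ^ n) sums f z" for z
    using holomorphic_power_series[of f 0 "cmod z + 1" z] holomorphic_on_subset[OF f]
    unfolding a_def by (simp add: dist_norm)
  have "(\<integral>\<^sup>+ z. ennreal ((cmod (u z))\<^sup>2) \<partial>lborel) < \<infinity>"
    using L unfolding L2_def by (auto simp: integrable_iff_bounded)
  moreover have "(cmod (u z))\<^sup>2 = (cmod (f z))\<^sup>2 * exp (- (cmod z)\<^sup>2 / h)" for z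
  proof -
    have "(exp (- (cmod z)\<^sup>2 / (2 * h)))\<^sup>2 = exp (- (cmod z)\<^sup>2 / h)"
      using h by (simp add: power2_eq_square exp_add[symmetric])
    then show ?thesis unfolding u norm_mult power_mult_distrib by simp
  qed
  ultimately have "(\<Sum>n. ennreal ((cmod (c n))\<^sup>2)) < \<infinity>" using fock_mass[OF fs h c_def] by simp
  then have l: "l2 c" unfolding l2_def by (intro suminf_ennreal_infinite) auto
  have "a n = c n / of_real (sqrt (pi * fact n * h ^ (n + 1)))" for n using h by (simp add: c_def)
  then have "f z = fockf c (z / of_real (sqrt h)) / of_real (sqrt (pi * h))" for z
    using state_taylor[OF l, of z] fs[of z] by (simp add: sums_iff)
  then have "u = state h c" unfolding u state_def[abs_def] by simp
  with l show ?thesis by (rule that)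
qed

lemma weighted_norm_state:
  assumes "l2 c"
  shows "weighted_norm_sq (state h c) = mass (state h c) + (\<integral>\<^sup>+ z. ennreal ((cmod z)\<^sup>2 * (cmod (state h c z))\<^sup>2) \<partial>lborel)"
proof -
  note [measurable] = state_measurable[OF assms]
  show ?thesis unfolding weighted_norm_sq_def mass_def
    by (subst nn_integral_add[symmetric]) (auto simp: distrib_right simp flip: ennreal_plus)
qed

lemma energy_state_eq:
  assumes "l2 c" and g: "0 \<le> N * a"
  shows "energy N a h (state h c) = (\<integral>\<^sup>+ z. ennreal ((cmod z)\<^sup>2 * (cmod (state h c z))\<^sup>2) \<partial>lborel)
    + ennreal (N * a * (Omega h)\<^sup>2 / 2 * (1 / (2 * pi * h) * qsum c))"
proof -
  note [measurable] = state_measurable[OF assms(1)]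
  have g': "0 \<le> N * a * (Omega h)\<^sup>2 / 2" using g by simp
  have "energy N a h (state h c) = (\<integral>\<^sup>+ z. ennreal ((cmod z)\<^sup>2 * (cmod (state h c z))\<^sup>2) + ennreal (N * a * (Omega h)\<^sup>2 / 2) * ennreal ((cmod (state h c z)) ^ 4) \<partial>lborel)"
    unfolding energy_def using g' by (intro nn_integral_cong) (simp only: ennreal_mult'[symmetric] ennreal_plus[symmetric] mult_nonneg_nonneg zero_le_power2 zero_le_power norm_ge_zero)
  also have "\<dots> = (\<integral>\<^sup>+ z. ennreal ((cmod z)\<^sup>2 * (cmod (state h c z))\<^sup>2) \<partial>lborel)
      + ennreal (N * a * (Omega h)\<^sup>2 / 2) * (\<integral>\<^sup>+ z. ennreal ((cmod (state h c z)) ^ 4) \<partial>lborel)"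
    by (subst nn_integral_add) (auto intro!: nn_integral_cmult)
  also have "\<dots> = (\<integral>\<^sup>+ z. ennreal ((cmod z)\<^sup>2 * (cmod (state h c z))\<^sup>2) \<partial>lborel)
    + ennreal (N * a * (Omega h)\<^sup>2 / 2 * (1 / (2 * pi * h) * qsum c))"
    unfolding quartic_state[OF assms(1)] by (subst ennreal_mult'[OF g', symmetric]) rule
  finally show ?thesis .
qed

lemma energy_state:
  assumes "h1 c" "msum c = 1" and g: "0 \<le> N * a"
  defines "\<tau> \<equiv> N * a * (Omega h)\<^sup>2 / (4 * pi * h\<^sup>2)"
  shows "energy N a h (state h c) = ennreal (h * (1 + (psum c + \<tau> * qsum c)))"
proof -
  have l: "l2 c" by (rule h1_imp_l2[OF assms(1)])
  have q: "N * a * (Omega h)\<^sup>2 / 2 * (1 / (2 * pi * h) * qsum c) = h * (\<tau> * qsum c)"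
    using h unfolding \<tau>_def by (simp add: power2_eq_square)
  have "\<tau> \<ge> 0" using g by (simp add: \<tau>_def)
  then have "0 \<le> h * (psum c + msum c)" "0 \<le> h * (\<tau> * qsum c)"
    using h psum_nonneg[OF assms(1)] assms(2) qsum_nonneg[OF l] by auto
  then show ?thesis unfolding energy_state_eq[OF l g] moment_state_h1[OF assms(1)] q
    using assms(2) by (simp add: ennreal_plus[symmetric] algebra_simps del: ennreal_plus)
qed

lemma energy_finite:
  assumes "l2 c" "0 \<le> N * a" "energy N a h (state h c) < \<infinity>"
  shows "h1 c"
  using assms(3) unfolding energy_state_eq[OF assms(1,2)] by (intro moment_state_finite assms(1)) (simp add: less_top)

lemma energy_le_iff:
  assumes "h1 c" "msum c = 1" "h1 d" "msum d = 1" "0 \<le> N * a"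
  defines "\<tau> \<equiv> N * a * (Omega h)\<^sup>2 / (4 * pi * h\<^sup>2)"
  shows "energy N a h (state h c) \<le> energy N a h (state h d) \<longleftrightarrow> psum c + \<tau> * qsum c \<le> psum d + \<tau> * qsum d"
proof -
  have "\<tau> \<ge> 0" using assms(5) by (simp add: \<tau>_def)
  then have "0 \<le> h * (1 + (psum d + \<tau> * qsum d))"
    using h psum_nonneg[OF assms(3)] qsum_nonneg[OF h1_imp_l2[OF assms(3)]] by auto
  then show ?thesis
    unfolding energy_state[OF assms(1,2,5), folded \<tau>_def] energy_state[OF assms(3,4,5), folded \<tau>_def]
    using h by (simp add: ennreal_le_iff)
qed

lemma global_minimizer_state:
  assumes "l2 c" "0 \<le> N * a"
  defines "\<tau> \<equiv> N * a * (Omega h)\<^sup>2 / (4 * pi * h\<^sup>2)"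
  shows "global_minimizer N a h (state h c) \<longleftrightarrow>
    h1 c \<and> msum c = 1 \<and> (\<forall>d. h1 d \<and> msum d = 1 \<longrightarrow> psum c + \<tau> * qsum c \<le> psum d + \<tau> * qsum d)"
proof
  assume G: "global_minimizer N a h (state h c)"
  then have m: "msum c = 1" using mass_state[OF assms(1)] unfolding global_minimizer_def by (metis ennreal_eq_1)
  have le: "energy N a h (state h c) \<le> energy N a h (state h d)" if "h1 d" "msum d = 1" for d
    using G state_in_LLL[OF h1_imp_l2[OF that(1)]] mass_state[OF h1_imp_l2[OF that(1)]] that(2)
    unfolding global_minimizer_def by simp
  \<comment> \<open>The ground state has finite energy, hence so has a minimizer; this puts it into
    \<open>h1\<close>, where \<open>energy_le_iff\<close> applies.\<close>
  have s: "h1 (single 0 1)" "msum (single 0 1) = 1" by (simp_all add: h1_single msum_single)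
  have "energy N a h (state h c) < \<infinity>"
    using le[OF s] unfolding energy_state[OF s assms(2)] by (simp add: le_less_trans)
  then have "h1 c" by (rule energy_finite[OF assms(1,2)])
  then show "h1 c \<and> msum c = 1 \<and> (\<forall>d. h1 d \<and> msum d = 1 \<longrightarrow> psum c + \<tau> * qsum c \<le> psum d + \<tau> * qsum d)"
    using m le energy_le_iff[OF _ m _ _ assms(2), folded \<tau>_def] by blast
next
  assume H: "h1 c \<and> msum c = 1 \<and> (\<forall>d. h1 d \<and> msum d = 1 \<longrightarrow> psum c + \<tau> * qsum c \<le> psum d + \<tau> * qsum d)"
  have "energy N a h (state h c) \<le> energy N a h v" if v: "v \<in> LLL_space h" "mass v = 1" for v
  proof (cases "energy N a h v = \<infinity>")
    case False
    obtain d where d: "l2 d" "v = state h d" by (rule LLL_eq_state[OF v(1)])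
    have "h1 d" by (rule energy_finite[OF d(1) assms(2)]) (use False d in \<open>simp add: less_top\<close>)
    moreover have "msum d = 1" using v(2) mass_state[OF d(1)] unfolding d(2) by (metis ennreal_eq_1)
    ultimately show ?thesis unfolding d(2) using H energy_le_iff[of c d, OF _ _ _ _ assms(2), folded \<tau>_def] by blast
  qed simp
  then show "global_minimizer N a h (state h c)"
    unfolding global_minimizer_def using state_in_LLL[OF assms(1)] mass_state[OF assms(1)] H by simp
qed

lemma state_diff:
  assumes "l2 c" "l2 d"
  shows "state h c z - state h d z = state h (\<lambda>n. c n + (- 1) * d n) z"
proof -
  have l: "l2 (\<lambda>n. c n + (- 1) * d n)" using assms by (intro l2_add l2_cmult)
  have "fockf (\<lambda>n. c n + (- 1) * d n) w = fockf c w - fockf d w" for w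
    using sums_unique2[OF fockf_sums[OF l] sums_cong[THEN iffD1, OF _ sums_diff[OF fockf_sums[OF assms(1)] fockf_sums[OF assms(2)]]]]
    by (simp add: diff_divide_distrib left_diff_distrib)
  then show ?thesis unfolding state_def by (simp add: diff_divide_distrib right_diff_distrib)
qed

text \<open>The squared weighted norm of \<open>state h e\<close> is
  \<open>msum e + h * (psum e + msum e)\<close>, at most \<open>1 + h\<close> times the squared norm
  in \<open>lmin\<close>; the radius is scaled accordingly.\<close>

lemma local_minimizer_state:
  assumes "l2 c" "0 \<le> N * a" "local_minimizer N a h (state h c)"
  shows "lmin (N * a * (Omega h)\<^sup>2 / (4 * pi * h\<^sup>2)) c"
proof -
  from assms(3) obtain \<delta> where w: "weighted_norm_sq (state h c) < \<infinity>" and M: "mass (state h c) = 1" and \<delta>: "\<delta> > 0"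
    and min: "\<And>v. v \<in> LLL_space h \<Longrightarrow> mass v = 1 \<Longrightarrow> weighted_norm_sq (\<lambda>z. state h c z - v z) < ennreal (\<delta>\<^sup>2) \<Longrightarrow>
      energy N a h (state h c) \<le> energy N a h v"
    unfolding local_minimizer_def by blast
  have m: "msum c = 1" using M mass_state[OF assms(1)] by (metis ennreal_eq_1)
  have h1: "h1 c" by (rule moment_state_finite[OF assms(1)]) (use w in \<open>simp add: weighted_norm_state[OF assms(1)] less_top\<close>)
  have le: "psum c + N * a * (Omega h)\<^sup>2 / (4 * pi * h\<^sup>2) * qsum c \<le> psum d + N * a * (Omega h)\<^sup>2 / (4 * pi * h\<^sup>2) * qsum d"
    if d: "h1 d" "msum d = 1" "(\<Sum>n. real (n + 1) * (cmod (c n - d n))\<^sup>2) < \<delta>\<^sup>2 / (1 + h)" for d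
  proof -
    define e where "e n = c n + (- 1) * d n" for n
    have e: "h1 e" unfolding e_def by (rule h1_add_cmult[OF h1 d(1)])
    note le = h1_imp_l2[OF e]
    have S: "(\<Sum>n. real (n + 1) * (cmod (c n - d n))\<^sup>2) = psum e + msum e"
    proof -
      have "(\<lambda>n. real n * (cmod (e n))\<^sup>2 + (cmod (e n))\<^sup>2) sums (psum e + msum e)"
        unfolding psum_def msum_def using le h1_summable_n[OF e] unfolding l2_def by (intro sums_add summable_sums)
      then show ?thesis by (simp add: e_def sums_iff distrib_right add.commute)
    qed
    have p: "0 \<le> psum e" "0 \<le> msum e" using psum_nonneg[OF e] msum_nonneg[OF le] .
    have "weighted_norm_sq (\<lambda>z. state h c z - state h d z) = weighted_norm_sq (state h e)"
      unfolding state_diff[OF assms(1) h1_imp_l2[OF d(1)]] e_def[abs_def] ..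
    also have "\<dots> = ennreal (msum e + h * (psum e + msum e))"
      unfolding weighted_norm_state[OF le] mass_state[OF le] moment_state_h1[OF e]
      using p h by (simp add: ennreal_plus[symmetric] del: ennreal_plus)
    also have "\<dots> < ennreal (\<delta>\<^sup>2)"
    proof (rule ennreal_lessI)
      have "(1 + h) * (psum e + msum e) < \<delta>\<^sup>2" using d(3) h unfolding S by (simp add: field_simps)
      then show "msum e + h * (psum e + msum e) < \<delta>\<^sup>2" using p by (simp add: distrib_right)
    qed (use \<delta> in simp)
    finally have "energy N a h (state h c) \<le> energy N a h (state h d)"
      using d(2) mass_state[OF h1_imp_l2[OF d(1)]] by (intro min state_in_LLL[OF h1_imp_l2[OF d(1)]]) auto
    then show ?thesis using energy_le_iff[OF h1 m d(1,2) assms(2)] by blast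
  qed
  show ?thesis unfolding lmin_def
    by (intro conjI h1 m exI[of _ "\<delta>\<^sup>2 / (1 + h)"]) (use le \<delta> h in auto)
qed

lemma infinite_zeros_state:
  assumes "infinite {z. fockf c z = 0}"
  shows "infinite {z. state h c z = 0}"
proof -
  have "{z. fockf c z = 0} \<subseteq> (\<lambda>z. z / of_real (sqrt h)) ` {z. state h c z = 0}"
  proof
    fix z assume "z \<in> {z. fockf c z = 0}"
    then show "z \<in> (\<lambda>z. z / of_real (sqrt h)) ` {z. state h c z = 0}"
      using h by (intro image_eqI[where x = "z * of_real (sqrt h)"]) (auto simp: state_def)
  qed
  then show ?thesis using assms finite_surj by blast
qed

lemma fockf_single: "fockf (single d \<gamma>) w = \<gamma> / of_real (sqrt (fact d)) * w ^ d"
proof -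
  have "(\<lambda>n. single d \<gamma> n / of_real (sqrt (fact n)) * w ^ n) = (\<lambda>n. if n = d then \<gamma> / of_real (sqrt (fact d)) * w ^ d else 0)"
    by (auto simp: single_def)
  then show ?thesis unfolding fockf_def using sums_at[of d "\<lambda>_. \<gamma> / of_real (sqrt (fact d)) * w ^ d"] by (simp add: sums_iff)
qed

lemma state_single: "state h (single d \<gamma>) z = \<gamma> * state h (single d 1) z"
  unfolding state_def fockf_single by simp

lemma phi0_eq_state: "phi0 h = state h (single 0 1)"
  by (rule ext) (simp add: phi0_def state_def fockf_single)

lemma phi1_eq_state: "phi1 h = state h (single 1 1)"
  by (rule ext) (simp add: phi1_def state_def fockf_single mult_ac)

lemma rotation_equivalent_single:
  assumes "cmod \<gamma> = 1"
  shows "rotation_equivalent (state h (single d \<gamma>)) (state h (single d 1))"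
proof -
  have "\<gamma> = exp (\<i> * of_real (Arg \<gamma>))" using Arg_eq[of \<gamma>] assms by (cases "\<gamma> = 0") auto
  then show ?thesis unfolding rotation_equivalent_def
    by (intro exI[of _ "Arg \<gamma>"] exI[of _ 0] allI) (simp add: state_single[of d \<gamma>])
qed

text \<open>A unit vector with one coefficient of modulus 1 has no other nonzero coefficient, so
  \<open>cmod (c d) = 1\<close> already gives uniqueness up to a phase.\<close>

lemma unique_global_minimizer_single:
  assumes g: "0 \<le> N * a"
  defines "\<tau> \<equiv> N * a * (Omega h)\<^sup>2 / (4 * pi * h\<^sup>2)"
  assumes le: "\<And>c. h1 c \<Longrightarrow> msum c = 1 \<Longrightarrow> psum (single d 1) + \<tau> * qsum (single d 1) \<le> psum c + \<tau> * qsum c"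
    and eq: "\<And>c. h1 c \<Longrightarrow> msum c = 1 \<Longrightarrow> psum c + \<tau> * qsum c \<le> psum (single d 1) + \<tau> * qsum (single d 1) \<Longrightarrow> cmod (c d) = 1"
  shows "unique_global_minimizer N a h (state h (single d 1))"
  unfolding unique_global_minimizer_def
proof (intro conjI allI impI)
  have s: "h1 (single d 1)" "msum (single d 1) = 1" by (simp_all add: h1_single msum_single)
  show "global_minimizer N a h (state h (single d 1))"
    unfolding global_minimizer_state[OF h1_imp_l2[OF s(1)] g, folded \<tau>_def] using s le by blast
  fix u assume G: "global_minimizer N a h u"
  then obtain c where c: "l2 c" "u = state h c" using LLL_eq_state unfolding global_minimizer_def by blast
  have c1: "h1 c" "msum c = 1" and "psum c + \<tau> * qsum c \<le> psum (single d 1) + \<tau> * qsum (single d 1)"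
    using G s unfolding c(2) global_minimizer_state[OF c(1) g, folded \<tau>_def] by blast+
  then have cd: "cmod (c d) = 1" by (intro eq)
  have "c n = single d (c d) n" for n
  proof (cases "n = d")
    case False
    have "(\<Sum>k\<in>{n, d}. (cmod (c k))\<^sup>2) \<le> msum c"
      unfolding msum_def using c(1) unfolding l2_def by (intro sum_le_suminf) auto
    then show ?thesis using False cd c1(2) by (simp add: single_def)
  qed (simp add: single_def)
  then have "c = single d (c d)" by (rule ext)
  then show "rotation_equivalent u (state h (single d 1))"
    unfolding c(2) using rotation_equivalent_single[OF cd] by metis
qed

end

section \<open>Energies of the two lowest states and the thresholds\<close>

lemma psum_single: "psum (single d 1) = real d"
proof -
  have "(\<lambda>n. real n * (cmod (single d 1 n))\<^sup>2) = (\<lambda>n. if n = d then real d else 0)" by (auto simp: single_def)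
  then show ?thesis unfolding psum_def using sums_at[of d "\<lambda>_. real d"] by (simp add: sums_iff)
qed

lemma qsum_single: "qsum (single d 1) = (wt (2 * d) d)\<^sup>2"
proof -
  have "(\<lambda>k. (cmod (bil (single d 1) (single d 1) k))\<^sup>2) = (\<lambda>k. if k = 2 * d then (wt (2 * d) d)\<^sup>2 else 0)"
    unfolding bil_single by (rule ext) (auto simp: single_def)
  then show ?thesis unfolding qsum_def using sums_at[of "2 * d" "\<lambda>_. (wt (2 * d) d)\<^sup>2"] by (simp add: sums_iff)
qed

lemma qsum_single_0: "qsum (single 0 1) = 1" and qsum_single_1: "qsum (single 1 1) = 1 / 2"
  unfolding qsum_single wt_sq by simp_all

lemma psum_zero_imp:
  assumes "h1 c" "msum c = 1" "psum c \<le> 0"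
  shows "cmod (c 0) = 1"
proof -
  have "c n = 0" if "n \<noteq> 0" for n
  proof -
    have "(\<Sum>k\<in>{n}. real k * (cmod (c k))\<^sup>2) \<le> psum c"
      unfolding psum_def using h1_summable_n[OF assms(1)] by (intro sum_le_suminf) auto
    then have "real n * (cmod (c n))\<^sup>2 \<le> 0" using assms(3) by simp
    then show ?thesis using that by (simp add: mult_le_0_iff)
  qed
  then have "c = single 0 (c 0)" by (auto simp: single_def)
  then have "(cmod (c 0))\<^sup>2 = 1" using assms(2) msum_single by metis
  then show ?thesis using norm_ge_zero[of "c 0"] unfolding power2_eq_1_iff by linarith
qed

text \<open>In terms of the scale-free coupling \<open>\<tau>\<close> each bound on \<open>h\<close>
  becomes a bound on \<open>\<kappa> * \<tau>\<close>; the constants \<open>kappa_0\<close> and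
  \<open>kappa_inf\<close> are the reciprocals of the critical values 2 and 32 / 5.\<close>

lemma sqrt_threshold:
  assumes "h > (0 :: real)"
  shows "sqrt (\<kappa> * (\<tau> * h\<^sup>2)) < h \<longleftrightarrow> \<kappa> * \<tau> < 1" "h < sqrt (\<kappa> * (\<tau> * h\<^sup>2)) \<longleftrightarrow> 1 < \<kappa> * \<tau>"
proof -
  have "sqrt (\<kappa> * (\<tau> * h\<^sup>2)) = sqrt (\<kappa> * \<tau>) * h"
    using assms by (simp add: real_sqrt_mult)
  then show "sqrt (\<kappa> * (\<tau> * h\<^sup>2)) < h \<longleftrightarrow> \<kappa> * \<tau> < 1" "h < sqrt (\<kappa> * (\<tau> * h\<^sup>2)) \<longleftrightarrow> 1 < \<kappa> * \<tau>"
    using assms by simp_all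
qed

theorem theorem1p9:
  fixes N a :: real
  assumes "N > 0" and "a > 0"
  shows
    "(\<forall>h\<in>{0<..<1}.
        (h > sqrt (kappa_0 * (N * a * (Omega h)\<^sup>2 / (4 * pi))) \<longrightarrow>
           unique_global_minimizer N a h (phi0 h)) \<and>
        (h < sqrt (kappa_0 * (N * a * (Omega h)\<^sup>2 / (4 * pi))) \<longrightarrow>
           \<not> local_minimizer N a h (phi0 h)) \<and>
        energy N a h (phi0 h) = ennreal (N * a * (Omega h)\<^sup>2 / (4 * pi * h) + h))
   \<and> (\<forall>h\<in>{0<..<1}.
        h < sqrt (kappa_inf * (N * a * (Omega h)\<^sup>2 / (4 * pi))) \<longrightarrow>
        (\<forall>u. local_minimizer N a h u \<or> global_minimizer N a h u \<longrightarrow>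
           infinite {z. u z = 0}))
   \<and> (\<exists>\<kappa>1\<in>{kappa_inf<..<kappa_0}. \<forall>h\<in>{0<..<1}.
        sqrt (\<kappa>1 * (N * a * (Omega h)\<^sup>2 / (4 * pi))) < h \<and>
        h < sqrt (kappa_0 * (N * a * (Omega h)\<^sup>2 / (4 * pi))) \<longrightarrow>
        unique_global_minimizer N a h (phi1 h))
   \<and> (\<forall>h\<in>{0<..<1}.
        energy N a h (phi1 h) = ennreal (N * a * (Omega h)\<^sup>2 / (8 * pi * h) + 2 * h))"
proof -
  define T where "T h = N * a * (Omega h)\<^sup>2 / (4 * pi * h\<^sup>2)" for h
  have g: "0 \<le> N * a" using assms by simp
  have T0: "T h \<ge> 0" for h using g by (simp add: T_def)
  have X: "N * a * (Omega h)\<^sup>2 / (4 * pi) = T h * h\<^sup>2" if "h > 0" for h using that by (simp add: T_def)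
  have h0: "h1 (single d 1)" "msum (single d 1) = 1" "l2 (single d 1)" for d
    using h1_imp_l2[OF h1_single] by (simp_all add: h1_single msum_single)
  have s01: "psum (single 0 1) = 0" "psum (single 1 1) = 1" by (simp_all add: psum_single)
  note q01 = qsum_single_0 qsum_single_1
  have "unique_global_minimizer N a h (phi0 h)" if h: "h > 0" and t: "T h < 2" for h
    unfolding phi0_eq_state[OF h]
  proof (rule unique_global_minimizer_single[OF h g, folded T_def])
    fix c assume c: "h1 c" "msum c = 1"
    \<comment> \<open>For \<open>T h < 2\<close> the coefficient \<open>1 - T h / 2\<close> of
      \<open>psum c\<close> that results is positive, so a minimizer must have
      \<open>psum c = 0\<close>.\<close>
    have "T h * defect c \<ge> 0" using defect_nonneg[OF c] T0 by simp
    then have *: "T h * qsum c \<ge> T h - T h / 2 * psum c" unfolding defect_def by (simp add: algebra_simps)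
    have P: "psum c \<ge> 0" by (rule psum_nonneg[OF c(1)])
    then have "(1 - T h / 2) * psum c \<ge> 0" using t by simp
    then show "psum (single 0 1) + T h * qsum (single 0 1) \<le> psum c + T h * qsum c"
      using * unfolding s01 q01 by (simp add: algebra_simps)
    assume "psum c + T h * qsum c \<le> psum (single 0 1) + T h * qsum (single 0 1)"
    then have "(1 - T h / 2) * psum c \<le> 0" using * unfolding s01 q01 by (simp add: algebra_simps)
    then have "psum c \<le> 0" using t by (simp add: mult_le_0_iff)
    then show "cmod (c 0) = 1" by (rule psum_zero_imp[OF c])
  qed
  moreover have "\<not> local_minimizer N a h (phi0 h)" if h: "h > 0" and t: "T h > 2" for h
    using local_minimizer_state[OF h h0(3) g, folded T_def, of 0] phi0_unstable[OF t, of 1]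
    unfolding phi0_eq_state[OF h] by auto
  moreover have "energy N a h (phi0 h) = ennreal (N * a * (Omega h)\<^sup>2 / (4 * pi * h) + h)" if h: "h > 0" for h
  proof -
    have "h * (1 + (0 + T h * 1)) = N * a * (Omega h)\<^sup>2 / (4 * pi * h) + h"
      using h unfolding T_def by (simp add: distrib_left power2_eq_square)
    then show ?thesis unfolding phi0_eq_state[OF h] energy_state[OF h h0(1,2) g, folded T_def] s01 q01 by simp
  qed
  moreover have "infinite {z. u z = 0}" if h: "h > 0" and t: "T h > 32 / 5" and u: "local_minimizer N a h u \<or> global_minimizer N a h u" for h u
  proof -
    have "u \<in> LLL_space h" using u unfolding local_minimizer_def global_minimizer_def by blast
    then obtain c where c: "l2 c" "u = state h c" by (rule LLL_eq_state[OF h])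
    have "lmin (T h) c"
    proof (cases "local_minimizer N a h u")
      case True
      then show ?thesis unfolding c(2) T_def by (rule local_minimizer_state[OF h c(1) g])
    next
      case False
      then have "global_minimizer N a h (state h c)" using u c(2) by simp
      then show ?thesis unfolding global_minimizer_state[OF h c(1) g, folded T_def] lmin_def
        by (intro conjI exI[of _ 1]) auto
    qed
    then show ?thesis unfolding c(2) using infinite_zeros_state[OF h lmin_infinite_zeros[OF _ t]] by blast
  qed
  moreover have "energy N a h (phi1 h) = ennreal (N * a * (Omega h)\<^sup>2 / (8 * pi * h) + 2 * h)" if h: "h > 0" for h
  proof -
    have "h * (1 + (1 + T h * (1 / 2))) = N * a * (Omega h)\<^sup>2 / (8 * pi * h) + 2 * h"
      using h unfolding T_def by (simp add: distrib_left power2_eq_square)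
    then show ?thesis unfolding phi1_eq_state[OF h] energy_state[OF h h0(1,2) g, folded T_def] s01 q01 by simp
  qed
  moreover obtain K where K: "K > 0" "\<And>c. h1 c \<Longrightarrow> msum c = 1 \<Longrightarrow> psum c - 1 \<le> K * defect c"
    by (rule defect_controls_psum) blast
  \<comment> \<open>The bound \<open>T h < 2 + 4 / K\<close> gives
    \<open>(T h / 2 - 1) * K < 2 < T h\<close>, which lets the \<open>defect\<close> term dominate
    below. The maximum with 1/4 keeps the constant above \<open>kappa_inf\<close> even when
    \<open>K\<close> is small.\<close>
  define \<kappa>1 where "\<kappa>1 = max (1 / (2 + 4 / K)) (1 / 4)"
  have "4 / K > 0" using K by simp
  have "1 / (2 + E) < 1 / 2" if "E > 0" for E :: real using that by (simp add: field_simps)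
  with \<open>4 / K > 0\<close> have "1 / (2 + 4 / K) < 1 / 2" by blast
  then have \<kappa>1: "\<kappa>1 \<in> {kappa_inf<..<kappa_0}" by (auto simp: \<kappa>1_def kappa_inf_def kappa_0_def)
  have "unique_global_minimizer N a h (phi1 h)" if h: "h > 0" and t2: "T h > 2" and t: "\<kappa>1 * T h < 1" for h
    unfolding phi1_eq_state[OF h]
  proof (rule unique_global_minimizer_single[OF h g, folded T_def])
    have "1 / (2 + 4 / K) * T h \<le> \<kappa>1 * T h" unfolding \<kappa>1_def using T0 by (intro mult_right_mono) auto
    then have "1 / (2 + 4 / K) * T h < 1" using t by simp
    then have "T h < 2 + 4 / K" using \<open>4 / K > 0\<close> by (simp add: divide_less_eq)
    then have "(T h - 2) * K < 4" using K(1) by (simp add: field_simps)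
    then have tK: "(T h / 2 - 1) * K < T h" using t2 by (simp add: algebra_simps)
    fix c assume c: "h1 c" "msum c = 1"
    have D: "defect c \<ge> 0" by (rule defect_nonneg[OF c])
    \<comment> \<open>The excess energy over the first excited state; by the choice of
      \<open>K\<close> the subtracted term is a smaller multiple of \<open>defect c\<close> than the
      first.\<close>
    have e: "psum c + T h * qsum c - (1 + T h * (1 / 2)) = T h * defect c - (T h / 2 - 1) * (psum c - 1)"
      unfolding defect_def by (simp add: field_simps)
    have "(T h / 2 - 1) * (psum c - 1) \<le> (T h / 2 - 1) * (K * defect c)"
      using K(2)[OF c] t2 by (intro mult_left_mono) auto
    then have *: "(T h - (T h / 2 - 1) * K) * defect c \<le> psum c + T h * qsum c - (1 + T h * (1 / 2))"
      unfolding e by (simp add: left_diff_distrib mult.assoc)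
    have "0 \<le> (T h - (T h / 2 - 1) * K) * defect c" using D tK by simp
    then show "psum (single 1 1) + T h * qsum (single 1 1) \<le> psum c + T h * qsum c"
      using * unfolding s01 q01 by linarith
    assume le: "psum c + T h * qsum c \<le> psum (single 1 1) + T h * qsum (single 1 1)"
    then have "(T h - (T h / 2 - 1) * K) * defect c \<le> 0" using * unfolding s01 q01 by linarith
    then have D0: "defect c = 0" using D tK by (simp add: mult_le_0_iff)
    then have "(T h / 2 - 1) * (psum c - 1) \<ge> 0" using e le unfolding s01 q01 by simp
    then have "psum c \<ge> 1" using t2 by (simp add: zero_le_mult_iff)
    then show "cmod (c 1) = 1" by (rule defect_zero_phi1[OF c D0])
  qed
  ultimately show ?thesis
    using \<kappa>1 by (intro conjI bexI[OF _ \<kappa>1] ballI impI allI; simp only: X sqrt_threshold greaterThanLessThan_iff)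
      (auto simp: kappa_0_def kappa_inf_def)
qed

end
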